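(* Let $T$ be a Banach theory with infinite-dimensional models. Then some model of $T$ contains an infinite-dimensional indiscernible subspace (over $\varnothing$). In particular, $T$ has an infinite indiscernible set in some model, namely any orthonormal basis of an infinite-dimensional indiscernible subspace.
   Context: We work in continuous first-order logic. Let $K\in\{\mathbb{R},\mathbb{C}\}$. A $K$-Banach space $X$ is regarded as a metric structure whose universe is the closed unit ball $B(X)$, with metric $d(x,y)=\|x-y\|$, a predicate $\left\|\sum_i a_ix_i\right\|$ for each finite tuple $\bar a$ from $K$ (evaluated in $X$), a constant $\mathbf{0}$, and functions $\sigma_{\bar a}(\bar x)$ equal to $\sum_i a_ix_i$ if this lies in $B(X)$ and to $\sum_i a_ix_i/\|\sum_i a_ix_i\|$ otherwise. The space $X$ and the structure are conflated. A Banach structure is an expansion of such a structure; a Banach theory is the (complete) theory of a Banach structure. A real subspace of a Banach structure is a closed real linear subspace of the underlying Banach space; tuples from it to which types are applied are tuples from its unit ball. Two $n$-tuples $\bar b,\bar c$ are congruent, $\bar b\cong\bar c$, if $\|b_i-b_j\|=\|c_i-c_j\|$ for all $i,j\le n$, where $b_n=c_n=\mathbf{0}$. A real subspace $V$ of a model $\mathfrak{M}$ is an indiscernible subspace over $A\subseteq\mathfrak{M}$ if for every $n<\omega$ and all $n$-tuples $\bar b,\bar c\in V$, $\bar b\equiv_A\bar c$ (same type over $A$) if and only if $\bar b\cong\bar c$. Indiscernible subspaces are isometric to real Hilbert spaces, and "orthonormal basis" refers to this structure. An indiscernible set is a set $I$ such that for each $n$ any two $n$-tuples of pairwise distinct elements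 of $I$ have the same type. *)

theory Defs
  imports "HOL-Analysis.Analysis" "HOL-Algebra.Module"
begin

section \<open>Continuous first-order logic\<close>

subsection \<open>Languages and metric structures\<close>

text \<open>
  A language specifies, for each symbol, its arity and a modulus of uniform continuity, and for each
  predicate symbol also a compact interval containing its values. The symbols of the language are
  the elements of \<open>fsyms\<close> and \<open>psyms\<close> (so that a language may have no symbols at all).
\<close>

record ('g, 'q) language =
  fsyms :: "'g set"
  farity :: "'g \<Rightarrow> nat"
  fmodulus :: "'g \<Rightarrow> real \<Rightarrow> real"
  psyms :: "'q set"
  parity :: "'q \<Rightarrow> nat"
  pmodulus :: "'q \<Rightarrow> real \<Rightarrow> real"
  plower :: "'q \<Rightarrow> real"
  pupper :: "'q \<Rightarrow> real"

definition is_language :: "('g, 'q) language \<Rightarrow> bool" where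
  "is_language L \<longleftrightarrow>
     (\<forall>g\<in>fsyms L. \<forall>\<epsilon>>0. fmodulus L g \<epsilon> > 0) \<and>
     (\<forall>q\<in>psyms L. (\<forall>\<epsilon>>0. pmodulus L q \<epsilon> > 0) \<and> plower L q \<le> pupper L q)"

record ('x, 'g, 'q) mstructure =
  universe :: "'x set"
  distance :: "'x \<Rightarrow> 'x \<Rightarrow> real"
  finterp :: "'g \<Rightarrow> 'x list \<Rightarrow> 'x"
  pinterp :: "'q \<Rightarrow> 'x list \<Rightarrow> real"

definition tuples :: "nat \<Rightarrow> 'x set \<Rightarrow> 'x list set" where
  "tuples n U = {xs. length xs = n \<and> set xs \<subseteq> U}"

definition is_mstructure :: "('g, 'q) language \<Rightarrow> ('x, 'g, 'q) mstructure \<Rightarrow> bool" where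
  "is_mstructure L M \<longleftrightarrow>
     universe M \<noteq> {} \<and>
     Metric_space (universe M) (distance M) \<and>
     Metric_space.mcomplete (universe M) (distance M) \<and>
     (\<forall>g\<in>fsyms L.
        (\<forall>xs\<in>tuples (farity L g) (universe M). finterp M g xs \<in> universe M) \<and>
        (\<forall>\<epsilon>>0. \<forall>xs\<in>tuples (farity L g) (universe M). \<forall>ys\<in>tuples (farity L g) (universe M).
           (\<forall>i<farity L g. distance M (xs ! i) (ys ! i) < fmodulus L g \<epsilon>) \<longrightarrow>
           distance M (finterp M g xs) (finterp M g ys) \<le> \<epsilon>)) \<and>
     (\<forall>q\<in>psyms L.
        (\<forall>xs\<in>tuples (parity L q) (universe M). pinterp M q xs \<in> {plower L q..pupper L q}) \<and>
        (\<forall>\<epsilon>>0. \<forall>xs\<in>tuples (parity L q) (universe M). \<forall>ys\<in>tuples (parity L q) (universe M).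
           (\<forall>i<parity L q. distance M (xs ! i) (ys ! i) < pmodulus L q \<epsilon>) \<longrightarrow>
           \<bar>pinterp M q xs - pinterp M q ys\<bar> \<le> \<epsilon>))"


subsection \<open>Formulas\<close>

datatype 'g trm = Var nat | Fn 'g "'g trm list"

text \<open>
  In \<open>FConn u \<phi>s\<close> the connective is a continuous function \<open>\<real>\<^sup>n \<rightarrow> \<real>\<close>, where \<open>n\<close> is the length
  of \<open>\<phi>s\<close>. It is represented by a function \<open>u\<close> on sequences, continuous for the product topology
  (which is required in \<open>wf_fm\<close>) and evaluated at sequences that vanish from \<open>n\<close> on: the
  continuous functions on \<open>\<real>\<^sup>n\<close> are exactly the restrictions of such \<open>u\<close>.
\<close>

datatype ('g, 'q) fm =
    FDist "'g trm" "'g trm"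
  | FPred 'q "'g trm list"
  | FConn "(nat \<Rightarrow> real) \<Rightarrow> real" "('g, 'q) fm list"
  | FSup nat "('g, 'q) fm"
  | FInf nat "('g, 'q) fm"

fun wf_trm :: "('g, 'q) language \<Rightarrow> 'g trm \<Rightarrow> bool" where
  "wf_trm L (Var i) = True"
| "wf_trm L (Fn g ts) = (g \<in> fsyms L \<and> length ts = farity L g \<and> (\<forall>t\<in>set ts. wf_trm L t))"

fun wf_fm :: "('g, 'q) language \<Rightarrow> ('g, 'q) fm \<Rightarrow> bool" where
  "wf_fm L (FDist s t) = (wf_trm L s \<and> wf_trm L t)"
| "wf_fm L (FPred q ts) = (q \<in> psyms L \<and> length ts = parity L q \<and> (\<forall>t\<in>set ts. wf_trm L t))"
| "wf_fm L (FConn u \<phi>s) = (continuous_on UNIV u \<and> (\<forall>\<phi>\<in>set \<phi>s. wf_fm L \<phi>))"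
| "wf_fm L (FSup i \<phi>) = wf_fm L \<phi>"
| "wf_fm L (FInf i \<phi>) = wf_fm L \<phi>"

fun vars_trm :: "'g trm \<Rightarrow> nat set" where
  "vars_trm (Var i) = {i}"
| "vars_trm (Fn g ts) = (\<Union>t\<in>set ts. vars_trm t)"

fun free_vars :: "('g, 'q) fm \<Rightarrow> nat set" where
  "free_vars (FDist s t) = vars_trm s \<union> vars_trm t"
| "free_vars (FPred q ts) = (\<Union>t\<in>set ts. vars_trm t)"
| "free_vars (FConn u \<phi>s) = (\<Union>\<phi>\<in>set \<phi>s. free_vars \<phi>)"
| "free_vars (FSup i \<phi>) = free_vars \<phi> - {i}"
| "free_vars (FInf i \<phi>) = free_vars \<phi> - {i}"

fun eval_trm :: "('x, 'g, 'q) mstructure \<Rightarrow> (nat \<Rightarrow> 'x) \<Rightarrow> 'g trm \<Rightarrow> 'x" where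
  "eval_trm M e (Var i) = e i"
| "eval_trm M e (Fn g ts) = finterp M g (map (eval_trm M e) ts)"

fun eval_fm :: "('x, 'g, 'q) mstructure \<Rightarrow> (nat \<Rightarrow> 'x) \<Rightarrow> ('g, 'q) fm \<Rightarrow> real" where
  "eval_fm M e (FDist s t) = distance M (eval_trm M e s) (eval_trm M e t)"
| "eval_fm M e (FPred q ts) = pinterp M q (map (eval_trm M e) ts)"
| "eval_fm M e (FConn u \<phi>s) =
     (let vs = map (eval_fm M e) \<phi>s in u (\<lambda>i. if i < length vs then vs ! i else 0))"
| "eval_fm M e (FSup i \<phi>) = (SUP x\<in>universe M. eval_fm M (e(i := x)) \<phi>)"
| "eval_fm M e (FInf i \<phi>) = (INF x\<in>universe M. eval_fm M (e(i := x)) \<phi>)"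


subsection \<open>Theories and types\<close>

definition sentence :: "('g, 'q) language \<Rightarrow> ('g, 'q) fm \<Rightarrow> bool" where
  "sentence L \<phi> \<longleftrightarrow> wf_fm L \<phi> \<and> free_vars \<phi> = {}"

definition value_in :: "('x, 'g, 'q) mstructure \<Rightarrow> ('g, 'q) fm \<Rightarrow> real" where
  "value_in M \<phi> = eval_fm M (\<lambda>_. undefined) \<phi>"

text \<open>
  A theory is a set of sentences \<open>\<phi>\<close>, each standing for the condition \<open>\<phi> = 0\<close>. As the connectives
  include \<open>t \<mapsto> t - r\<close>, the complete theory of a structure determines the values of all sentences.
\<close>

definition complete_theory :: "('g, 'q) language \<Rightarrow> ('x, 'g, 'q) mstructure \<Rightarrow> ('g, 'q) fm set" where
  "complete_theory L M = {\<phi>. sentence L \<phi> \<and> value_in M \<phi> = 0}"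

definition satisfies :: "('x, 'g, 'q) mstructure \<Rightarrow> ('g, 'q) fm set \<Rightarrow> bool" where
  "satisfies M T \<longleftrightarrow> (\<forall>\<phi>\<in>T. value_in M \<phi> = 0)"

text \<open>
  Equality of the types of \<open>bs\<close> and \<open>cs\<close> over \<open>A\<close>: the variables with index below \<open>length bs\<close> stand
  for the tuple, the following ones for parameters \<open>as\<close> from \<open>A\<close>. The values of \<open>nth\<close> beyond
  the length of its argument are irrelevant.
\<close>

definition same_type ::
  "('g, 'q) language \<Rightarrow> ('x, 'g, 'q) mstructure \<Rightarrow> 'x set \<Rightarrow> 'x list \<Rightarrow> 'x list \<Rightarrow> bool" where
  "same_type L M A bs cs \<longleftrightarrow>
     length bs = length cs \<and>
     (\<forall>as\<in>lists A. \<forall>\<phi>. wf_fm L \<phi> \<longrightarrow> free_vars \<phi> \<subseteq> {..<length bs + length as} \<longrightarrow>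
        eval_fm M (nth (bs @ as)) \<phi> = eval_fm M (nth (cs @ as)) \<phi>)"

definition indiscernible_set ::
  "('g, 'q) language \<Rightarrow> ('x, 'g, 'q) mstructure \<Rightarrow> 'x set \<Rightarrow> bool" where
  "indiscernible_set L M I \<longleftrightarrow>
     I \<subseteq> universe M \<and>
     (\<forall>n. \<forall>bs\<in>tuples n I. \<forall>cs\<in>tuples n I. distinct bs \<longrightarrow> distinct cs \<longrightarrow> same_type L M {} bs cs)"


section \<open>Banach spaces over a subfield of the complex numbers\<close>

text \<open>
  The scalar field \<open>K\<close> is either \<open>\<real>\<close> or \<open>UNIV\<close> (all of \<open>\<complex>\<close>), as a set of complex numbers. Banach
  spaces have an explicit carrier, since the space underlying a model cannot be
  a type; of the module record, the fields \<open>mult\<close> and \<open>one\<close> are not used.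
\<close>

definition is_scalar_field :: "complex set \<Rightarrow> bool" where
  "is_scalar_field K \<longleftrightarrow> K = \<real> \<or> K = UNIV"

definition scalars :: "complex set \<Rightarrow> complex ring" where
  "scalars K = \<lparr>carrier = K, mult = (*), one = 1, zero = 0, add = (+)\<rparr>"

record 'x normed_space = "(complex, 'x) module" +
  nrm :: "'x \<Rightarrow> real"

text \<open>The value outside the carrier is chosen so as to fit \<^locale>\<open>Metric_space\<close>.\<close>

definition ndist :: "('x, 'm) normed_space_scheme \<Rightarrow> 'x \<Rightarrow> 'x \<Rightarrow> real" where
  "ndist X x y = (if x \<in> carrier X \<and> y \<in> carrier X then nrm X (x \<ominus>\<^bsub>X\<^esub> y) else 0)"

locale banach_space = module "scalars K" X
  for K :: "complex set" and X :: "('x, 'm) normed_space_scheme" (structure) +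
  assumes scalar_field: "is_scalar_field K"
    and nrm_nonneg: "x \<in> carrier X \<Longrightarrow> 0 \<le> nrm X x"
    and nrm_eq_0_iff: "x \<in> carrier X \<Longrightarrow> nrm X x = 0 \<longleftrightarrow> x = \<zero>"
    and nrm_triangle: "x \<in> carrier X \<Longrightarrow> y \<in> carrier X \<Longrightarrow> nrm X (x \<oplus> y) \<le> nrm X x + nrm X y"
    and nrm_smult: "a \<in> K \<Longrightarrow> x \<in> carrier X \<Longrightarrow> nrm X (a \<odot> x) = cmod a * nrm X x"
    and complete: "Metric_space.mcomplete (carrier X) (ndist X)"

definition unit_ball :: "('x, 'm) normed_space_scheme \<Rightarrow> 'x set" where
  "unit_ball X = {x \<in> carrier X. nrm X x \<le> 1}"

definition norm_topology :: "('x, 'm) normed_space_scheme \<Rightarrow> 'x topology" where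
  "norm_topology X = Metric_space.mtopology (carrier X) (ndist X)"

text \<open>Linear span and dimension with respect to the scalars \<open>F\<close>.\<close>

definition lin_span :: "complex set \<Rightarrow> ('x, 'm) normed_space_scheme \<Rightarrow> 'x set \<Rightarrow> 'x set" where
  "lin_span F X S = \<Inter> {W. submodule W (scalars F) X \<and> S \<subseteq> W}"

definition infinite_dimensional ::
  "complex set \<Rightarrow> ('x, 'm) normed_space_scheme \<Rightarrow> 'x set \<Rightarrow> bool" where
  "infinite_dimensional F X V \<longleftrightarrow> \<not> (\<exists>S. finite S \<and> S \<subseteq> V \<and> V \<subseteq> lin_span F X S)"

definition real_subspace :: "('x, 'm) normed_space_scheme \<Rightarrow> 'x set \<Rightarrow> bool" where
  "real_subspace X V \<longleftrightarrow> submodule V (scalars \<real>) X \<and> closedin (norm_topology X) V"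

text \<open>
  If \<open>V\<close> is isometric to a real Hilbert space, its inner product is recovered by polarization.
\<close>

definition real_ip :: "('x, 'm) normed_space_scheme \<Rightarrow> 'x \<Rightarrow> 'x \<Rightarrow> real" where
  "real_ip X x y = ((nrm X (x \<oplus>\<^bsub>X\<^esub> y))\<^sup>2 - (nrm X (x \<ominus>\<^bsub>X\<^esub> y))\<^sup>2) / 4"

definition orthonormal_basis :: "('x, 'm) normed_space_scheme \<Rightarrow> 'x set \<Rightarrow> 'x set \<Rightarrow> bool" where
  "orthonormal_basis X V B \<longleftrightarrow>
     B \<subseteq> V \<and>
     (\<forall>e\<in>B. nrm X e = 1) \<and>
     (\<forall>e\<in>B. \<forall>f\<in>B. e \<noteq> f \<longrightarrow> real_ip X e f = 0) \<and>
     norm_topology X closure_of lin_span \<real> X B = V"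

definition lin_comb :: "('x, 'm) normed_space_scheme \<Rightarrow> complex list \<Rightarrow> 'x list \<Rightarrow> 'x" where
  "lin_comb X as xs = (\<Oplus>\<^bsub>X\<^esub>i\<in>{..<length as}. (as ! i) \<odot>\<^bsub>X\<^esub> (xs ! i))"

definition ball_comb :: "('x, 'm) normed_space_scheme \<Rightarrow> complex list \<Rightarrow> 'x list \<Rightarrow> 'x" where
  "ball_comb X as xs =
     (let y = lin_comb X as xs
      in if nrm X y \<le> 1 then y else complex_of_real (1 / nrm X y) \<odot>\<^bsub>X\<^esub> y)"


section \<open>Banach structures\<close>

text \<open>
  Symbols of the language of Banach spaces, together with those of an expansion: the constant
  \<open>\<^bold>0\<close>, the functions \<open>\<sigma>\<^sub>a\<close> and the predicates \<open>\<parallel>\<Sum>\<^sub>i a\<^sub>i x\<^sub>i\<parallel>\<close>.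
\<close>

datatype 'f bfun = ZeroC | SigmaF "complex list" | ExtF 'f
datatype 'p bpred = NormP "complex list" | ExtP 'p

text \<open>
  The language of Banach spaces over \<open>K\<close> expanded by the symbols of \<open>E\<close>. The map normalizing the
  vectors outside the unit ball is 2-Lipschitz, whence the modulus for \<open>SigmaF\<close>.
\<close>

definition banach_language ::
  "complex set \<Rightarrow> ('f, 'p) language \<Rightarrow> ('f bfun, 'p bpred) language" where
  "banach_language K E =
     \<lparr>fsyms = {ZeroC} \<union> SigmaF ` lists K \<union> ExtF ` fsyms E,
      farity = (\<lambda>g. case g of ZeroC \<Rightarrow> 0 | SigmaF as \<Rightarrow> length as | ExtF f \<Rightarrow> farity E f),
      fmodulus = (\<lambda>g \<epsilon>. case g of ZeroC \<Rightarrow> \<epsilon>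
                              | SigmaF as \<Rightarrow> \<epsilon> / (2 * (1 + (\<Sum>a\<leftarrow>as. cmod a)))
                              | ExtF f \<Rightarrow> fmodulus E f \<epsilon>),
      psyms = NormP ` lists K \<union> ExtP ` psyms E,
      parity = (\<lambda>q. case q of NormP as \<Rightarrow> length as | ExtP p \<Rightarrow> parity E p),
      pmodulus = (\<lambda>q \<epsilon>. case q of NormP as \<Rightarrow> \<epsilon> / (1 + (\<Sum>a\<leftarrow>as. cmod a))
                              | ExtP p \<Rightarrow> pmodulus E p \<epsilon>),
      plower = (\<lambda>q. case q of NormP as \<Rightarrow> 0 | ExtP p \<Rightarrow> plower E p),
      pupper = (\<lambda>q. case q of NormP as \<Rightarrow> (\<Sum>a\<leftarrow>as. cmod a) | ExtP p \<Rightarrow> pupper E p)\<rparr>"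

text \<open>
  A Banach structure is given by its underlying Banach space and the interpretations of the
  additional symbols; \<open>metric_structure\<close> is the resulting metric structure on the unit ball.
\<close>

record ('x, 'f, 'p) banach_data = "'x normed_space" +
  ext_fun :: "'f \<Rightarrow> 'x list \<Rightarrow> 'x"
  ext_pred :: "'p \<Rightarrow> 'x list \<Rightarrow> real"

definition metric_structure ::
  "('x, 'f, 'p) banach_data \<Rightarrow> ('x, 'f bfun, 'p bpred) mstructure" where
  "metric_structure X =
     \<lparr>universe = unit_ball X,
      distance = ndist X,
      finterp = (\<lambda>g xs. case g of ZeroC \<Rightarrow> \<zero>\<^bsub>X\<^esub>
                               | SigmaF as \<Rightarrow> ball_comb X as xs
                               | ExtF f \<Rightarrow> ext_fun X f xs),
      pinterp = (\<lambda>q xs. case q of NormP as \<Rightarrow> nrm X (lin_comb X as xs)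
                               | ExtP p \<Rightarrow> ext_pred X p xs)\<rparr>"

definition banach_structure ::
  "complex set \<Rightarrow> ('f, 'p) language \<Rightarrow> ('x, 'f, 'p) banach_data \<Rightarrow> bool" where
  "banach_structure K E X \<longleftrightarrow>
     is_language E \<and> banach_space K X \<and> is_mstructure (banach_language K E) (metric_structure X)"

definition theory_of ::
  "complex set \<Rightarrow> ('f, 'p) language \<Rightarrow> ('x, 'f, 'p) banach_data \<Rightarrow> ('f bfun, 'p bpred) fm set" where
  "theory_of K E X = complete_theory (banach_language K E) (metric_structure X)"

definition is_model ::
  "complex set \<Rightarrow> ('f, 'p) language \<Rightarrow> ('f bfun, 'p bpred) fm set \<Rightarrow>
   ('x, 'f, 'p) banach_data \<Rightarrow> bool" where
  "is_model K E T X \<longleftrightarrow> banach_structure K E X \<and> satisfies (metric_structure X) T"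

text \<open>
  The norms \<open>\<parallel>b\<^sub>i\<parallel>\<close> are the distances to the additional entry \<open>b\<^sub>n = \<^bold>0\<close>.
\<close>

definition congruent_tuples ::
  "('x, 'm) normed_space_scheme \<Rightarrow> 'x list \<Rightarrow> 'x list \<Rightarrow> bool" where
  "congruent_tuples X bs cs \<longleftrightarrow>
     length bs = length cs \<and>
     (let bs' = bs @ [\<zero>\<^bsub>X\<^esub>]; cs' = cs @ [\<zero>\<^bsub>X\<^esub>] in
      \<forall>i\<le>length bs. \<forall>j\<le>length bs.
        nrm X (bs' ! i \<ominus>\<^bsub>X\<^esub> bs' ! j) = nrm X (cs' ! i \<ominus>\<^bsub>X\<^esub> cs' ! j))"

definition indiscernible_subspace ::
  "complex set \<Rightarrow> ('f, 'p) language \<Rightarrow> ('x, 'f, 'p) banach_data \<Rightarrow> 'x set \<Rightarrow> 'x set \<Rightarrow> bool" where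
  "indiscernible_subspace K E X A V \<longleftrightarrow>
     A \<subseteq> unit_ball X \<and> real_subspace X V \<and>
     (\<forall>n. \<forall>bs\<in>tuples n (V \<inter> unit_ball X). \<forall>cs\<in>tuples n (V \<inter> unit_ball X).
        same_type (banach_language K E) (metric_structure X) A bs cs \<longleftrightarrow> congruent_tuples X bs cs)"

text \<open>
  HOL cannot quantify existentially over the type in which a model lives, so this has to be a
  fixed type. Given an infinite-dimensional model \<open>M\<close> over \<open>'x\<close>, the type below is large enough for
  the purpose: by the downward Loewenheim-Skolem theorem, a model of the theory with a separable
  subspace \<open>V\<close> has an elementary substructure around \<open>V\<close> whose cardinality is at most that of the
  type; likewise an ultrapower of \<open>M\<close> indexed by finite sets of formulas has its
  elements represented by functions in this type.
\<close>

type_synonym ('x, 'f, 'p) large = "('f bfun, 'p bpred) fm set \<Rightarrow> 'x"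

end

theory Submission
  imports Defs "HOL-Library.Ramsey"
begin

text \<open>
  The indiscernible subspace is the closure of the image of an isometric embedding into an
  ultrapower of \<open>M\<close> of the space of finitely supported sequences. It suffices that the values of all
  formulas on the image are invariant under reflections of that space: tuples with almost
  equal Gram matrices are almost moved onto each other by products of reflections, so that
  congruent tuples have the same type. Saturation reduces this to finding, for finitely many formulas,
  tuples and reflections, a linear map to \<open>M\<close> under which the formulas are almost invariant.

  Such a map is built from vectors \<open>e\<^sub>i\<close> of \<open>M\<close> that satisfy an upper \<open>\<ell>\<^sub>2\<close>-estimate while the norm of
  \<open>\<Sum>\<^sub>i \<plusminus> e\<^sub>i\<close> is large; by Ramsey's theorem, an infinite-dimensional space contains them. The
  map is \<open>x \<mapsto> \<Sum>\<^sub>i \<langle>x, z\<^sub>i\<rangle> e\<^sub>i\<close>, where \<open>z\<^sub>i\<close> is a normalized sum of independent random unit vectors whose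
  common law is almost invariant under the reflections. By the upper estimate and the Efron--Stein
  inequality, the values of formulas at it are concentrated near their means. These are almost
  invariant, and the norm is nontrivial, since the random combinations of the \<open>e\<^sub>i\<close> are large.

  That orthonormal bases are indiscernible follows from Ficken's argument: in an indiscernible
  subspace vectors of equal norm can be exchanged, hence the norm of \<open>e - f\<close> is \<open>\<surd>2\<close> whenever \<open>e\<close> and \<open>f\<close>
  are orthonormal.
\<close>

section \<open>Finitely supported sequences\<close>

text \<open>The obstacle is that formulas are neither convex nor homogeneous: all that is known of
  their values is boundedness and uniform continuity in the norm. The upper l2-estimate makes
  \<open>W z y\<close> Lipschitz in \<open>z\<close> with constant \<open>norm y\<close>, whereas
  its typical norm can be made as large as desired. Division by the mean \<open>A'\<close> of the
  norm leaves vectors of norm about 1 that hardly move when \<open>z\<close> moves by a bounded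
  amount, and this turns uniform continuity into almost constancy. Lipschitz functions of
  independent vectors need not concentrate independently of the number of vectors unless they are
  convex; for this reason each \<open>z\<^sub>i\<close> is a sum of many small terms, a single one
  of which has little influence. Only finitely many reflections matter at a time, hence laws with
  finite support suffice and every expectation is a finite average. The law must be chosen without
  knowledge of the functions to which it will be applied, since the normalization \<open>A'\<close>
  depends on the law; the bound on the length of the words is therefore uniform in the
  function.\<close>

typedef fseq = "{f::nat \<Rightarrow> real. finite {i. f i \<noteq> 0}}"
  morphisms coord Abs_fseq
  by (rule exI[of _ "\<lambda>_. 0"]) simp

setup_lifting type_definition_fseq

lemma finite_coord [simp]: "finite {i. coord x i \<noteq> 0}"
  using coord[of x] by simp

instantiation fseq :: real_vector
begin

lift_definition zero_fseq :: fseq is "\<lambda>_. 0" by simp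

lift_definition plus_fseq :: "fseq \<Rightarrow> fseq \<Rightarrow> fseq" is "\<lambda>f g i. f i + g i"
proof -
  fix f g :: "nat \<Rightarrow> real" assume "finite {i. f i \<noteq> 0}" "finite {i. g i \<noteq> 0}"
  then have "finite ({i. f i \<noteq> 0} \<union> {i. g i \<noteq> 0})" by simp
  then show "finite {i. f i + g i \<noteq> 0}" by (rule finite_subset[rotated]) auto
qed

lift_definition minus_fseq :: "fseq \<Rightarrow> fseq \<Rightarrow> fseq" is "\<lambda>f g i. f i - g i"
proof -
  fix f g :: "nat \<Rightarrow> real" assume "finite {i. f i \<noteq> 0}" "finite {i. g i \<noteq> 0}"
  then have "finite ({i. f i \<noteq> 0} \<union> {i. g i \<noteq> 0})" by simp
  then show "finite {i. f i - g i \<noteq> 0}" by (rule finite_subset[rotated]) auto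
qed

lift_definition uminus_fseq :: "fseq \<Rightarrow> fseq" is "\<lambda>f i. - f i" by simp

lift_definition scaleR_fseq :: "real \<Rightarrow> fseq \<Rightarrow> fseq" is "\<lambda>c f i. c * f i"
  by (erule finite_subset[rotated]) auto

instance
  by standard (transfer; simp add: fun_eq_iff algebra_simps)+

end

lemma coord_simps [simp]:
  "coord 0 i = 0" "coord (x + y) i = coord x i + coord y i"
  "coord (x - y) i = coord x i - coord y i" "coord (- x) i = - coord x i"
  "coord (c *\<^sub>R x) i = c * coord x i"
  by (transfer; simp)+

lemma coord_sum [simp]: "coord (sum f A) i = (\<Sum>a\<in>A. coord (f a) i)"
  by (induction A rule: infinite_finite_induct) auto

lemma fseq_eqI: "(\<And>i. coord x i = coord y i) \<Longrightarrow> x = y"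
  using coord_inject by blast

instantiation fseq :: real_inner
begin

definition "inner_fseq x y = (\<Sum>i | coord x i \<noteq> 0. coord x i * coord y i)"
definition "norm_fseq (x::fseq) = sqrt (inner x x)"
definition "sgn_fseq (x::fseq) = x /\<^sub>R norm x"
definition "dist_fseq (x::fseq) y = norm (x - y)"
definition "uniformity_fseq = (INF e\<in>{0<..}. principal {(x::fseq, y). dist x y < e})"
definition "open_fseq (U::fseq set) \<longleftrightarrow> (\<forall>x\<in>U. eventually (\<lambda>(x', y). x' = x \<longrightarrow> y \<in> U) uniformity)"

lemma inner_fseq_superset:
  assumes "finite A" "{i. coord x i \<noteq> 0} \<subseteq> A"
  shows "inner x y = (\<Sum>i\<in>A. coord x i * coord y i)"
  unfolding inner_fseq_def by (rule sum.mono_neutral_left) (use assms in auto)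

instance
proof
  fix x y z :: fseq and r :: real
  let ?A = "{i. coord x i \<noteq> 0} \<union> {i. coord y i \<noteq> 0}"
  have A: "finite ?A" by simp
  have xy: "inner x w = (\<Sum>i\<in>?A. coord x i * coord w i)" "inner y w = (\<Sum>i\<in>?A. coord y i * coord w i)" for w
    by (rule inner_fseq_superset[OF A]; auto)+
  show "inner x y = inner y x"
    unfolding xy by (simp add: mult.commute)
  have "inner (x + y) z = (\<Sum>i\<in>?A. coord (x + y) i * coord z i)"
    by (rule inner_fseq_superset[OF A]) auto
  then show "inner (x + y) z = inner x z + inner y z"
    unfolding xy by (simp add: algebra_simps sum.distrib)
  have "inner (r *\<^sub>R x) y = (\<Sum>i\<in>?A. coord (r *\<^sub>R x) i * coord y i)"
    by (rule inner_fseq_superset[OF A]) auto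
  then show "inner (r *\<^sub>R x) y = r * inner x y"
    unfolding xy by (simp add: sum_distrib_left mult.assoc)
  show "0 \<le> inner x x"
    by (simp add: inner_fseq_def sum_nonneg)
  show "inner x x = 0 \<longleftrightarrow> x = 0"
  proof
    assume "inner x x = 0"
    then have "\<forall>i\<in>{i. coord x i \<noteq> 0}. coord x i * coord x i = 0"
      unfolding inner_fseq_def by (subst (asm) sum_nonneg_eq_0_iff) auto
    then show "x = 0" by (intro fseq_eqI) auto
  qed (simp add: inner_fseq_def)
qed (simp_all add: dist_fseq_def norm_fseq_def sgn_fseq_def uniformity_fseq_def open_fseq_def)

end

lift_definition unit_seq :: "nat \<Rightarrow> fseq" is "\<lambda>c i. if i = c then 1 else 0" by simp

lemma coord_unit_seq [simp]: "coord (unit_seq c) i = (if i = c then 1 else 0)"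
  by transfer simp

lemma inner_unit_seq [simp]: "inner (unit_seq c) x = coord x c" "inner x (unit_seq c) = coord x c"
proof -
  show "inner (unit_seq c) x = coord x c"
    by (subst inner_fseq_superset[of "{c}"]) auto
  then show "inner x (unit_seq c) = coord x c"
    by (simp add: inner_commute)
qed

lemma norm_unit_seq [simp]: "norm (unit_seq c) = 1"
  by (simp add: norm_eq_sqrt_inner)

lemma fseq_expansion:
  assumes "finite A" "{i. coord x i \<noteq> 0} \<subseteq> A"
  shows "x = (\<Sum>i\<in>A. coord x i *\<^sub>R unit_seq i)"
proof (rule fseq_eqI)
  fix j
  have "coord (\<Sum>i\<in>A. coord x i *\<^sub>R unit_seq i) j = (\<Sum>i\<in>A. if i = j then coord x i else 0)"
    by (simp, rule sum.cong) auto
  then show "coord x j = coord (\<Sum>i\<in>A. coord x i *\<^sub>R unit_seq i) j"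
    using assms by (auto simp: sum.delta)
qed

section \<open>Reflections\<close>

text \<open>Since \<open>x / 0 = 0\<close>, \<open>reflect 0\<close> is the identity.\<close>

definition reflect :: "'h \<Rightarrow> 'h \<Rightarrow> 'h::real_inner" where
  "reflect v x = x - (2 * inner x v / inner v v) *\<^sub>R v"

lemma reflect_0 [simp]: "reflect 0 = id"
  by (simp add: reflect_def fun_eq_iff)

lemma linear_reflect: "linear (reflect v)"
  by (rule linearI) (simp_all add: reflect_def inner_add_left algebra_simps add_divide_distrib)

lemma inner_reflect [simp]: "inner (reflect v x) (reflect v y) = inner x y"
proof (cases "v = 0")
  case False
  define a b where "a = 2 * inner x v / inner v v" and "b = 2 * inner y v / inner v v"
  have ab: "a * inner v v = 2 * inner x v" "b * inner v v = 2 * inner y v"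
    using False by (simp_all add: a_def b_def)
  have "inner (reflect v x) (reflect v y) = inner x y - b * inner x v - a * inner y v + a * (b * inner v v)"
    unfolding reflect_def a_def[symmetric] b_def[symmetric] inner_diff_left inner_diff_right
      inner_scaleR_left inner_scaleR_right inner_commute[of v y]
    by (simp add: right_diff_distrib mult.left_commute)
  moreover have "b * inner x v = a * inner y v"
    by (simp add: a_def b_def)
  ultimately show ?thesis by (simp add: ab)
qed simp

lemma norm_reflect [simp]: "norm (reflect v x) = norm x"
  by (simp add: norm_eq_sqrt_inner)

lemma reflect_reflect [simp]: "reflect v (reflect v x) = x"
proof (cases "v = 0")
  case False
  define a where "a = 2 * inner x v / inner v v"
  have "2 * inner (x - a *\<^sub>R v) v / inner v v = - a"
    using False by (simp add: a_def inner_diff_left diff_divide_distrib)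
  then show ?thesis by (simp add: reflect_def a_def[symmetric])
qed simp

text \<open>Since the norms agree, \<open>2 * inner x (x - y)\<close> is the squared norm of
  \<open>x - y\<close>. Reflections thus act transitively on spheres, which is used whenever two
  vectors of equal norm have to be exchanged.\<close>

lemma reflect_diff_swap:
  assumes "norm x = norm y" shows "reflect (x - y) x = y"
proof (cases "x = y")
  case False
  then have "inner (x - y) (x - y) \<noteq> 0" by simp
  moreover have "2 * inner x (x - y) = inner (x - y) (x - y)"
    using assms by (simp add: norm_eq inner_diff_left inner_diff_right inner_commute)
  ultimately show ?thesis by (simp add: reflect_def)
qed simp

definition reflects :: "'h list \<Rightarrow> 'h \<Rightarrow> 'h::real_inner" where
  "reflects w x = foldr reflect w x"

lemma reflects_simps [simp]:
  "reflects [] x = x" "reflects (v # w) x = reflect v (reflects w x)"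
  by (simp_all add: reflects_def)

lemma reflects_append [simp]: "reflects (u @ w) x = reflects u (reflects w x)"
  by (simp add: reflects_def)

lemma linear_reflects: "linear (reflects w)"
proof -
  have "reflects w (x + y) = reflects w x + reflects w y" "reflects w (c *\<^sub>R x) = c *\<^sub>R reflects w x" for x y c
    by (induction w) (auto simp: linear_add[OF linear_reflect] linear_scale[OF linear_reflect])
  then show ?thesis by (rule linearI)
qed

lemma inner_reflects [simp]: "inner (reflects w x) (reflects w y) = inner x y"
  by (induction w) auto

lemma norm_reflects [simp]: "norm (reflects w x) = norm x"
  by (induction w) auto

lemma reflects_rev [simp]: "reflects (rev w) (reflects w x) = x"
  by (induction w arbitrary: x) auto

text \<open>
  Tuples with almost equal Gram matrices are moved onto each other entry by entry: the
  reflection taking the next entry of the first tuple to that of the second almost fixes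
  the entries already treated, unless the two are close, in which case it is omitted.
\<close>

lemma close_gram_reflects:
  fixes n :: nat and \<epsilon> :: real
  assumes "\<epsilon> > 0"
  shows "\<exists>\<delta>>0. \<forall>x y :: nat \<Rightarrow> 'h::real_inner.
    (\<forall>t<n. norm (x t) \<le> 1 \<and> norm (y t) \<le> 1) \<longrightarrow>
    (\<forall>s<n. \<forall>t<n. \<bar>inner (x s) (x t) - inner (y s) (y t)\<bar> \<le> \<delta>) \<longrightarrow>
    (\<exists>w. \<forall>t<n. norm (reflects w (x t) - y t) \<le> \<epsilon>)"
  using assms
proof (induction n arbitrary: \<epsilon>)
  case 0
  then show ?case by (auto intro: exI[of _ 1])
next
  case (Suc n)
  define e where "e = min 1 \<epsilon>"
  have e: "0 < e" "e \<le> 1" "e \<le> \<epsilon>" using Suc.prems by (auto simp: e_def)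
  \<comment> \<open>When the new reflection is along a vector \<open>v\<close> of norm above
    \<open>e\<close>, an entry already treated moves by at most
    \<open>2 * (\<delta> + e') / e\<close>. The quadratic choice of \<open>e'\<close> makes this,
    with \<open>\<delta> \<le> e'\<close>, at most \<open>4 / 10 * e\<close>.\<close>
  define e' where "e' = e^2 / 10"
  have e': "e' > 0" using e by (simp add: e'_def)
  obtain \<delta>0 where d0: "\<delta>0 > 0" and IH: "\<forall>x y :: nat \<Rightarrow> 'h.
      (\<forall>t<n. norm (x t) \<le> 1 \<and> norm (y t) \<le> 1) \<longrightarrow>
      (\<forall>s<n. \<forall>t<n. \<bar>inner (x s) (x t) - inner (y s) (y t)\<bar> \<le> \<delta>0) \<longrightarrow>
      (\<exists>w. \<forall>t<n. norm (reflects w (x t) - y t) \<le> e')"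
    using Suc.IH[OF e'] by (elim exE conjE) (rule that)
  define \<delta> where "\<delta> = min \<delta>0 e'"
  have dpos: "\<delta> > 0" using d0 e' by (simp add: \<delta>_def)
  have main: "\<exists>w. \<forall>t<Suc n. norm (reflects w (x t) - y t) \<le> \<epsilon>"
    if nrm: "\<forall>t<Suc n. norm (x t) \<le> 1 \<and> norm (y t) \<le> 1"
      and gram: "\<forall>s<Suc n. \<forall>t<Suc n. \<bar>inner (x s) (x t) - inner (y s) (y t)\<bar> \<le> \<delta>"
    for x y :: "nat \<Rightarrow> 'h"
  proof -
    have "\<exists>w. \<forall>t<n. norm (reflects w (x t) - y t) \<le> e'"
      by (rule IH[THEN spec, THEN spec, THEN mp, THEN mp])
         (use nrm gram in \<open>auto simp: \<delta>_def\<close>)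
    then obtain w where w: "\<And>t. t < n \<Longrightarrow> norm (reflects w (x t) - y t) \<le> e'" by blast
    define x' where "x' t = reflects w (x t)" for t
    define v where "v = x' n - y n"
    have "e^2 \<le> e" using e by (simp add: power2_eq_square mult_left_le)
    then have e'e: "e' \<le> e" using e by (simp add: e'_def)
    show ?thesis
    proof (cases "norm v \<le> e")
      case True
      have "norm (reflects w (x t) - y t) \<le> \<epsilon>" if "t < Suc n" for t
        using that w[of t] True e'e e by (cases "t = n") (auto simp: v_def x'_def)
      then show ?thesis by blast
    next
      case False
      then have vpos: "norm v > e" by simp
      then have v0: "norm v > 0" using e by linarith
      have ivv: "inner v v = (norm v)^2" by (simp add: power2_norm_eq_inner)
      have "norm (reflect v (x' t) - y t) \<le> \<epsilon>" if "t < Suc n" for t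
      proof (cases "t = n")
        case True
        \<comment> \<open>The norms of \<open>x' n\<close> and \<open>y n\<close> agree only
          approximately, so the reflection misses \<open>y n\<close> by the difference of the
          squared norms divided by the norm of \<open>v\<close>.\<close>
        have eq: "2 * inner (x' n) v = inner v v + (inner (x' n) (x' n) - inner (y n) (y n))"
          by (simp add: v_def inner_diff_left inner_diff_right inner_commute)
        have "reflect v (x' n) - y n = - ((inner (x' n) (x' n) - inner (y n) (y n)) / inner v v) *\<^sub>R v"
          unfolding reflect_def eq using v0 by (simp add: add_divide_distrib scaleR_add_left v_def)
        then have "norm (reflect v (x' n) - y n) = \<bar>inner (x' n) (x' n) - inner (y n) (y n)\<bar> / norm v"
          using v0 by (simp add: ivv power2_eq_square)
        also have "\<dots> \<le> \<delta> / e"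
          using gram[rule_format, of n n] vpos e by (intro frac_le) (auto simp: x'_def)
        also have "\<dots> \<le> e' / e" using e by (simp add: \<delta>_def divide_right_mono)
        also have "\<dots> \<le> e" using e by (simp add: e'_def power2_eq_square)
        finally show ?thesis using True e by simp
      next
        case False
        then have t: "t < n" using that by simp
        have "inner (x' t) v = (inner (x t) (x n) - inner (y t) (y n)) + inner (y t - x' t) (y n)"
          by (simp add: v_def inner_diff_left inner_diff_right x'_def)
        also have "\<bar>\<dots>\<bar> \<le> \<delta> + e'"
        proof -
          have "\<bar>inner (y t - x' t) (y n)\<bar> \<le> norm (y t - x' t) * norm (y n)"
            by (rule Cauchy_Schwarz_ineq2)
          also have "\<dots> \<le> e' * 1"
            using w[OF t] nrm e' by (intro mult_mono) (auto simp: x'_def norm_minus_commute)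
          finally show ?thesis using gram[rule_format, of t n] t by simp
        qed
        finally have iv: "\<bar>inner (x' t) v\<bar> \<le> \<delta> + e'" .
        have "norm (reflect v (x' t) - y t) \<le> norm (x' t - y t) + norm ((2 * inner (x' t) v / inner v v) *\<^sub>R v)"
          using norm_triangle_ineq4[of "x' t - y t" "(2 * inner (x' t) v / inner v v) *\<^sub>R v"]
          by (simp add: reflect_def algebra_simps)
        also have "norm ((2 * inner (x' t) v / inner v v) *\<^sub>R v) = 2 * \<bar>inner (x' t) v\<bar> / norm v"
          using v0 by (simp add: ivv power2_eq_square abs_mult)
        also have "\<dots> \<le> 2 * (\<delta> + e') / e"
          using iv vpos e by (intro frac_le) auto
        also have "\<dots> \<le> 4 * e' / e" using e by (simp add: \<delta>_def divide_right_mono)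
        also have "\<dots> = 4 / 10 * e" using e by (simp add: e'_def power2_eq_square)
        also have "norm (x' t - y t) \<le> e / 10"
          using w[OF t] \<open>e^2 \<le> e\<close> by (simp add: x'_def e'_def)
        finally show ?thesis using e by simp
      qed
      then show ?thesis by (intro exI[of _ "v # w"]) (auto simp: x'_def)
    qed
  qed
  show ?case
    by (rule exI[of _ \<delta>], intro conjI allI impI dpos) (rule main; assumption)
qed

section \<open>Averages over finite product spaces\<close>

definition avg :: "'o set \<Rightarrow> ('o \<Rightarrow> real) \<Rightarrow> real" where
  "avg \<Omega> f = (\<Sum>x\<in>\<Omega>. f x) / real (card \<Omega>)"

definition coord_avg :: "'o set \<Rightarrow> nat \<Rightarrow> ((nat \<Rightarrow> 'o) \<Rightarrow> real) \<Rightarrow> (nat \<Rightarrow> 'o) \<Rightarrow> real" where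
  "coord_avg \<Omega> q F \<xi> = avg \<Omega> (\<lambda>x. F (\<xi>(q := x)))"

text \<open>Expectation over the coordinates below \<open>P\<close>, taken to be independent. The
  others stay fixed at their values in \<open>\<xi>\<close>, so that the result is again a function
  of sequences and averages over different coordinates can be composed and commuted.\<close>

primrec prod_avg :: "'o set \<Rightarrow> nat \<Rightarrow> ((nat \<Rightarrow> 'o) \<Rightarrow> real) \<Rightarrow> (nat \<Rightarrow> 'o) \<Rightarrow> real" where
  "prod_avg \<Omega> 0 F = F"
| "prod_avg \<Omega> (Suc P) F = coord_avg \<Omega> P (prod_avg \<Omega> P F)"

locale finite_law =
  fixes \<Omega> :: "'o set"
  assumes fin: "finite \<Omega>" and ne: "\<Omega> \<noteq> {}"
begin

lemma card_pos: "real (card \<Omega>) > 0"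
  using fin ne by (simp add: card_gt_0_iff)

lemma avg_const [simp]: "avg \<Omega> (\<lambda>_. c) = c"
  using card_pos by (simp add: avg_def)

lemma avg_add: "avg \<Omega> (\<lambda>x. f x + g x) = avg \<Omega> f + avg \<Omega> g"
  by (simp add: avg_def sum.distrib add_divide_distrib)

lemma avg_diff: "avg \<Omega> (\<lambda>x. f x - g x) = avg \<Omega> f - avg \<Omega> g"
  by (simp add: avg_def sum_subtractf diff_divide_distrib)

lemma avg_cmult: "avg \<Omega> (\<lambda>x. c * f x) = c * avg \<Omega> f"
  by (simp add: avg_def sum_distrib_left)

lemma avg_sum: "avg \<Omega> (\<lambda>x. \<Sum>i\<in>A. f i x) = (\<Sum>i\<in>A. avg \<Omega> (f i))"
  by (simp add: avg_def sum_divide_distrib[symmetric]) (subst sum.swap, simp)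

lemma avg_mono: "(\<And>x. x \<in> \<Omega> \<Longrightarrow> f x \<le> g x) \<Longrightarrow> avg \<Omega> f \<le> avg \<Omega> g"
  unfolding avg_def by (intro divide_right_mono sum_mono) auto

lemma avg_swap: "avg \<Omega> (\<lambda>x. avg \<Omega>' (\<lambda>y. f x y)) = avg \<Omega>' (\<lambda>y. avg \<Omega> (\<lambda>x. f x y))"
  by (simp add: avg_def sum_divide_distrib[symmetric]) (subst sum.swap, simp add: ac_simps)

lemma avg_exists_le: "\<exists>x\<in>\<Omega>. f x \<le> avg \<Omega> f"
proof (rule ccontr)
  assume "\<not> ?thesis"
  then have "\<And>x. x \<in> \<Omega> \<Longrightarrow> avg \<Omega> f < f x" by force
  then have "(\<Sum>x\<in>\<Omega>. avg \<Omega> f) < (\<Sum>x\<in>\<Omega>. f x)"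
    using fin ne by (intro sum_strict_mono) auto
  then show False using card_pos by (simp add: avg_def)
qed

lemma avg_var:
  "avg \<Omega> (\<lambda>x. (f x)^2) - (avg \<Omega> f)^2 = avg \<Omega> (\<lambda>x. avg \<Omega> (\<lambda>y. (f x - f y)^2)) / 2"
proof -
  have "avg \<Omega> (\<lambda>x. avg \<Omega> (\<lambda>y. (f x - f y)^2))
      = avg \<Omega> (\<lambda>x. (f x)^2 + (avg \<Omega> (\<lambda>y. (f y)^2) - 2 * f x * avg \<Omega> f))"
  proof -
    have "avg \<Omega> (\<lambda>y. (f x - f y)^2) = (f x)^2 + (avg \<Omega> (\<lambda>y. (f y)^2) - 2 * f x * avg \<Omega> f)" for x
    proof -
      have "avg \<Omega> (\<lambda>y. (f x - f y)^2) = avg \<Omega> (\<lambda>y. (f x)^2 + ((f y)^2 - (2 * f x) * f y))"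
        by (simp add: power2_diff algebra_simps)
      then show ?thesis by (simp only: avg_add avg_diff avg_cmult avg_const)
    qed
    then show ?thesis by simp
  qed
  also have "\<dots> = 2 * (avg \<Omega> (\<lambda>x. (f x)^2) - (avg \<Omega> f)^2)"
    using avg_cmult[of "2 * avg \<Omega> f" f]
    by (simp add: avg_add avg_diff power2_eq_square mult.commute mult.left_commute)
  finally show ?thesis by simp
qed

text \<open>By symmetry, the two independent copies contribute equally according to which has the
  larger value. Keeping only the upward increments matters later: for an infimal convolution, only
  upper bounds on the increments at a given point are at hand.\<close>

lemma avg_var_pos:
  "avg \<Omega> (\<lambda>x. (f x)^2) - (avg \<Omega> f)^2 = avg \<Omega> (\<lambda>x. avg \<Omega> (\<lambda>y. (max 0 (f y - f x))^2))"
proof -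
  have eq: "(f x - f y)^2 = (max 0 (f y - f x))^2 + (max 0 (f x - f y))^2" for x y
    by (auto simp: max_def power2_commute)
  have "avg \<Omega> (\<lambda>x. avg \<Omega> (\<lambda>y. (max 0 (f x - f y))^2)) = avg \<Omega> (\<lambda>x. avg \<Omega> (\<lambda>y. (max 0 (f y - f x))^2))"
    by (rule avg_swap)
  then show ?thesis unfolding avg_var eq avg_add by simp
qed

lemma avg_square_le: "(avg \<Omega> f)^2 \<le> avg \<Omega> (\<lambda>x. (f x)^2)"
proof -
  have "0 \<le> avg \<Omega> (\<lambda>x. avg \<Omega> (\<lambda>y. (f x - f y)^2))"
    unfolding avg_def by (auto intro!: divide_nonneg_nonneg sum_nonneg)
  then show ?thesis using avg_var[of f] by linarith
qed

lemma coord_avg_commute: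
  "coord_avg \<Omega> q (coord_avg \<Omega> r F) = coord_avg \<Omega> r (coord_avg \<Omega> q F)"
proof (cases "q = r")
  case False
  show ?thesis
    unfolding coord_avg_def fun_eq_iff
    by (subst avg_swap) (simp add: fun_upd_twist[OF False])
qed simp

lemma coord_avg_idem: "coord_avg \<Omega> q (coord_avg \<Omega> q F) = coord_avg \<Omega> q F"
  by (simp add: coord_avg_def fun_eq_iff)

lemma coord_avg_mono: "(\<And>\<xi>. F \<xi> \<le> G \<xi>) \<Longrightarrow> coord_avg \<Omega> q F \<xi> \<le> coord_avg \<Omega> q G \<xi>"
  unfolding coord_avg_def by (rule avg_mono)

lemma prod_avg_add: "prod_avg \<Omega> P (\<lambda>\<xi>. F \<xi> + G \<xi>) \<xi> = prod_avg \<Omega> P F \<xi> + prod_avg \<Omega> P G \<xi>"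
  by (induction P arbitrary: \<xi>) (simp_all add: coord_avg_def avg_add)

lemma prod_avg_diff: "prod_avg \<Omega> P (\<lambda>\<xi>. F \<xi> - G \<xi>) \<xi> = prod_avg \<Omega> P F \<xi> - prod_avg \<Omega> P G \<xi>"
  by (induction P arbitrary: \<xi>) (simp_all add: coord_avg_def avg_diff)

lemma prod_avg_cmult: "prod_avg \<Omega> P (\<lambda>\<xi>. c * F \<xi>) \<xi> = c * prod_avg \<Omega> P F \<xi>"
  by (induction P arbitrary: \<xi>) (simp_all add: coord_avg_def avg_cmult)

lemma prod_avg_const [simp]: "prod_avg \<Omega> P (\<lambda>\<xi>. c) \<xi> = c"
  by (induction P arbitrary: \<xi>) (simp_all add: coord_avg_def)

lemma prod_avg_mono: "(\<And>\<xi>. F \<xi> \<le> G \<xi>) \<Longrightarrow> prod_avg \<Omega> P F \<xi> \<le> prod_avg \<Omega> P G \<xi>"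
  by (induction P arbitrary: \<xi>) (simp_all add: coord_avg_mono)

lemma prod_avg_sum:
  "prod_avg \<Omega> P (\<lambda>\<xi>. \<Sum>i\<in>A. F i \<xi>) \<xi> = (\<Sum>i\<in>A. prod_avg \<Omega> P (F i) \<xi>)"
  by (induction A rule: infinite_finite_induct) (simp_all add: prod_avg_add)

lemma prod_avg_exists_le: "\<exists>\<xi>'. F \<xi>' \<le> prod_avg \<Omega> P F \<xi>"
proof (induction P arbitrary: \<xi>)
  case (Suc P)
  obtain x where "prod_avg \<Omega> P F (\<xi>(P := x)) \<le> prod_avg \<Omega> (Suc P) F \<xi>"
    using avg_exists_le[of "\<lambda>x. prod_avg \<Omega> P F (\<xi>(P := x))"] by (auto simp: coord_avg_def)
  then show ?case using Suc[of "\<xi>(P := x)"] order_trans by blast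
qed auto

lemma prod_avg_coord_avg_commute:
  "prod_avg \<Omega> P (coord_avg \<Omega> q F) = coord_avg \<Omega> q (prod_avg \<Omega> P F)"
  by (induction P) (simp_all add: coord_avg_commute)

lemma prod_avg_coord_avg: "q < P \<Longrightarrow> prod_avg \<Omega> P (coord_avg \<Omega> q F) = prod_avg \<Omega> P F"
proof (induction P)
  case (Suc P)
  then show ?case
    by (cases "q = P") (simp_all add: prod_avg_coord_avg_commute coord_avg_idem)
qed simp

lemma prod_avg_fun_upd:
  "q \<ge> P \<Longrightarrow> prod_avg \<Omega> P F (\<xi>(q := x)) = prod_avg \<Omega> P (\<lambda>\<zeta>. F (\<zeta>(q := x))) \<xi>"
proof (induction P arbitrary: \<xi>)
  case (Suc P)
  have "(\<xi>(q := x))(P := y) = (\<xi>(P := y))(q := x)" for y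
    using Suc.prems by (intro fun_upd_twist) auto
  then show ?case using Suc by (simp add: coord_avg_def del: fun_upd_apply)
qed simp

lemma prod_avg_square_le: "(prod_avg \<Omega> P F \<xi>)^2 \<le> prod_avg \<Omega> P (\<lambda>\<xi>. (F \<xi>)^2) \<xi>"
proof (induction P arbitrary: \<xi>)
  case (Suc P)
  have "(prod_avg \<Omega> (Suc P) F \<xi>)^2 \<le> avg \<Omega> (\<lambda>x. (prod_avg \<Omega> P F (\<xi>(P := x)))^2)"
    unfolding prod_avg.simps coord_avg_def by (rule avg_square_le)
  also have "\<dots> \<le> avg \<Omega> (\<lambda>x. prod_avg \<Omega> P (\<lambda>\<xi>. (F \<xi>)^2) (\<xi>(P := x)))"
    by (rule avg_mono) (rule Suc)
  finally show ?case by (simp add: coord_avg_def)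
qed simp

text \<open>Induction on the number of coordinates by the law of total variance: the new coordinate
  adds the variance of a conditional mean, and Jensen's inequality moves the square inside the
  average over the earlier coordinates. Each one-coordinate variance is then written with upward
  increments only, the current value \<open>\<xi> q\<close> serving as one of the two independent
  copies.\<close>

lemma efron_stein:
  "prod_avg \<Omega> P (\<lambda>\<xi>. (F \<xi>)^2) \<xi> - (prod_avg \<Omega> P F \<xi>)^2
    \<le> prod_avg \<Omega> P (\<lambda>\<xi>. \<Sum>q<P. avg \<Omega> (\<lambda>x. (max 0 (F (\<xi>(q := x)) - F \<xi>))^2)) \<xi>"
proof -
  define V where "V q = (\<lambda>\<xi>. avg \<Omega> (\<lambda>x. (max 0 (F (\<xi>(q := x)) - F \<xi>))^2))" for q
  have V: "coord_avg \<Omega> q (V q) \<xi>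
      = avg \<Omega> (\<lambda>x. avg \<Omega> (\<lambda>y. (F (\<xi>(q := x)) - F (\<xi>(q := y)))^2)) / 2" for q \<xi>
    using avg_var_pos[of "\<lambda>x. F (\<xi>(q := x))"] avg_var[of "\<lambda>x. F (\<xi>(q := x))"]
    by (simp add: coord_avg_def V_def)
  have "prod_avg \<Omega> P (\<lambda>\<xi>. (F \<xi>)^2) \<xi> - (prod_avg \<Omega> P F \<xi>)^2 \<le> (\<Sum>q<P. prod_avg \<Omega> P (V q) \<xi>)"
  proof (induction P arbitrary: \<xi>)
    case (Suc P)
    let ?E = "prod_avg \<Omega> P"
    have "prod_avg \<Omega> (Suc P) (\<lambda>\<xi>. (F \<xi>)^2) \<xi> - (prod_avg \<Omega> (Suc P) F \<xi>)^2
      = avg \<Omega> (\<lambda>x. ?E (\<lambda>\<xi>. (F \<xi>)^2) (\<xi>(P := x)) - (?E F (\<xi>(P := x)))^2)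
        + (avg \<Omega> (\<lambda>x. (?E F (\<xi>(P := x)))^2) - (avg \<Omega> (\<lambda>x. ?E F (\<xi>(P := x))))^2)"
      by (simp add: coord_avg_def avg_diff)
    also have "avg \<Omega> (\<lambda>x. ?E (\<lambda>\<xi>. (F \<xi>)^2) (\<xi>(P := x)) - (?E F (\<xi>(P := x)))^2)
        \<le> avg \<Omega> (\<lambda>x. \<Sum>q<P. ?E (V q) (\<xi>(P := x)))"
      by (rule avg_mono) (rule Suc)
    also have "\<dots> = (\<Sum>q<P. prod_avg \<Omega> (Suc P) (V q) \<xi>)"
      by (simp add: avg_sum coord_avg_def)
    also have "avg \<Omega> (\<lambda>x. (?E F (\<xi>(P := x)))^2) - (avg \<Omega> (\<lambda>x. ?E F (\<xi>(P := x))))^2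
       = avg \<Omega> (\<lambda>x. avg \<Omega> (\<lambda>y. (?E F (\<xi>(P := x)) - ?E F (\<xi>(P := y)))^2)) / 2"
      by (rule avg_var)
    also have "\<dots> \<le> avg \<Omega> (\<lambda>x. avg \<Omega> (\<lambda>y. ?E (\<lambda>\<xi>. (F (\<xi>(P := x)) - F (\<xi>(P := y)))^2) \<xi>)) / 2"
      by (intro divide_right_mono avg_mono)
         (simp_all add: prod_avg_fun_upd prod_avg_diff[symmetric] prod_avg_square_le)
    also have "\<dots> = ?E (coord_avg \<Omega> P (V P)) \<xi>"
    proof -
      have av: "?E (\<lambda>\<xi>. avg \<Omega> (\<lambda>x. G x \<xi>)) \<xi> = avg \<Omega> (\<lambda>x. ?E (G x) \<xi>)" for G :: "'o \<Rightarrow> (nat \<Rightarrow> 'o) \<Rightarrow> real"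
        using prod_avg_cmult[of P "1 / real (card \<Omega>)" "\<lambda>\<xi>. \<Sum>x\<in>\<Omega>. G x \<xi>" \<xi>]
        by (simp add: avg_def prod_avg_sum)
      have "?E (\<lambda>\<xi>. 1/2 * avg \<Omega> (\<lambda>x. avg \<Omega> (\<lambda>y. (F (\<xi>(P := x)) - F (\<xi>(P := y)))^2))) \<xi>
        = 1/2 * avg \<Omega> (\<lambda>x. avg \<Omega> (\<lambda>y. ?E (\<lambda>\<xi>. (F (\<xi>(P := x)) - F (\<xi>(P := y)))^2) \<xi>))"
        by (simp only: prod_avg_cmult av)
      moreover have "coord_avg \<Omega> P (V P) = (\<lambda>\<xi>. 1/2 * avg \<Omega> (\<lambda>x. avg \<Omega> (\<lambda>y. (F (\<xi>(P := x)) - F (\<xi>(P := y)))^2)))"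
        by (simp add: V fun_eq_iff)
      ultimately show ?thesis by simp
    qed
    also have "\<dots> = prod_avg \<Omega> (Suc P) (V P) \<xi>"
      by (simp add: prod_avg_coord_avg_commute)
    finally show ?case by simp
  qed simp
  then show ?thesis by (simp add: V_def prod_avg_sum)
qed

lemma prod_avg_variance_le:
  assumes "\<And>\<xi>. (\<Sum>q<P. avg \<Omega> (\<lambda>x. (max 0 (F (\<xi>(q := x)) - F \<xi>))^2)) \<le> S"
  shows "prod_avg \<Omega> P (\<lambda>\<xi>'. (F \<xi>' - prod_avg \<Omega> P F \<xi>)^2) \<xi> \<le> S"
proof -
  define c where "c = prod_avg \<Omega> P F \<xi>"
  have "prod_avg \<Omega> P (\<lambda>\<xi>'. (F \<xi>' - c)^2) \<xi> = prod_avg \<Omega> P (\<lambda>\<xi>'. (F \<xi>')^2 + (c^2 - (2 * c) * F \<xi>')) \<xi>"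
    by (simp add: power2_diff algebra_simps)
  also have "\<dots> = prod_avg \<Omega> P (\<lambda>\<xi>'. (F \<xi>')^2) \<xi> - c^2"
    by (simp only: prod_avg_add prod_avg_diff prod_avg_cmult prod_avg_const)
       (simp add: c_def power2_eq_square)
  also have "\<dots> \<le> prod_avg \<Omega> P (\<lambda>_. S) \<xi>"
    unfolding c_def
    by (rule order_trans[OF efron_stein]) (rule prod_avg_mono, rule assms)
  finally show ?thesis by (simp add: c_def)
qed

text \<open>The coordinates are exchanged one at a time.\<close>

lemma prod_avg_replace:
  fixes F :: "(nat \<Rightarrow> 'h) \<Rightarrow> real" and pt pt' :: "'o \<Rightarrow> 'h"
  assumes "\<And>q h. \<bar>avg \<Omega> (\<lambda>x. F (h(q := pt' x))) - avg \<Omega> (\<lambda>x. F (h(q := pt x)))\<bar> \<le> \<epsilon>"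
    and supp: "\<And>h h'. (\<And>q. q < P \<Longrightarrow> h q = h' q) \<Longrightarrow> F h = F h'"
  shows "\<bar>prod_avg \<Omega> P (\<lambda>\<xi>. F (pt' \<circ> \<xi>)) \<xi> - prod_avg \<Omega> P (\<lambda>\<xi>. F (pt \<circ> \<xi>)) \<xi>\<bar> \<le> P * \<epsilon>"
proof -
  define G where "G q \<xi> = F (\<lambda>j. if j < q then pt' (\<xi> j) else pt (\<xi> j))" for q \<xi>
  have G0: "G 0 = (\<lambda>\<xi>. F (pt \<circ> \<xi>))" by (simp add: G_def o_def fun_eq_iff)
  have GP: "G P = (\<lambda>\<xi>. F (pt' \<circ> \<xi>))"
    unfolding G_def fun_eq_iff by (auto intro: supp)
  have step: "\<bar>prod_avg \<Omega> P (G (Suc q)) \<xi> - prod_avg \<Omega> P (G q) \<xi>\<bar> \<le> \<epsilon>" if "q < P" for q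
  proof -
    have 1: "(\<lambda>j. if j < q' then pt' ((\<zeta>(q := x)) j) else pt ((\<zeta>(q := x)) j))
        = (\<lambda>j. if j < q then pt' (\<zeta> j) else pt (\<zeta> j))(q := (if q < q' then pt' x else pt x))"
      if "q' \<in> {q, Suc q}" for q' \<zeta> x
      using that by (auto simp: fun_eq_iff)
    have pw: "\<bar>coord_avg \<Omega> q (\<lambda>\<zeta>. G (Suc q) \<zeta> - G q \<zeta>) \<zeta>\<bar> \<le> \<epsilon>" for \<zeta>
      using assms(1)[of "\<lambda>j. if j < q then pt' (\<zeta> j) else pt (\<zeta> j)" q]
      by (simp add: coord_avg_def G_def 1 avg_diff)
    \<comment> \<open>Averaging over coordinate \<open>q\<close> in advance is harmless, since
      \<open>prod_avg\<close> averages over it again; it makes the pointwise bound \<open>pw\<close>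
      applicable.\<close>
    have "prod_avg \<Omega> P (G (Suc q)) \<xi> - prod_avg \<Omega> P (G q) \<xi>
        = prod_avg \<Omega> P (coord_avg \<Omega> q (\<lambda>\<zeta>. G (Suc q) \<zeta> - G q \<zeta>)) \<xi>"
      by (simp add: prod_avg_coord_avg[OF that] prod_avg_diff)
    moreover have "prod_avg \<Omega> P (coord_avg \<Omega> q (\<lambda>\<zeta>. G (Suc q) \<zeta> - G q \<zeta>)) \<xi> \<le> prod_avg \<Omega> P (\<lambda>_. \<epsilon>) \<xi>"
      by (rule prod_avg_mono) (use pw in \<open>simp add: abs_le_iff\<close>)
    moreover have "prod_avg \<Omega> P (\<lambda>_. - \<epsilon>) \<xi> \<le> prod_avg \<Omega> P (coord_avg \<Omega> q (\<lambda>\<zeta>. G (Suc q) \<zeta> - G q \<zeta>)) \<xi>"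
      by (rule prod_avg_mono) (smt (verit) pw)
    ultimately show ?thesis by simp
  qed
  have "\<bar>prod_avg \<Omega> P (G q) \<xi> - prod_avg \<Omega> P (G 0) \<xi>\<bar> \<le> q * \<epsilon>" if "q \<le> P" for q
    using that
  proof (induction q)
    case (Suc q)
    then show ?case using step[of q] by (simp add: algebra_simps)
  qed simp
  from this[of P] show ?thesis by (simp add: G0 GP)
qed

end

section \<open>Concentration for sums of small independent vectors\<close>

definition sqdist :: "nat \<Rightarrow> (nat \<Rightarrow> 'h) \<Rightarrow> (nat \<Rightarrow> 'h::real_inner) \<Rightarrow> real" where
  "sqdist N z y = (\<Sum>i<N. (norm (z i - y i))^2)"

text \<open>
  Replacing \<open>\<Phi>\<close> by its infimal convolution with a multiple of the squared distance makes it
  semiconcave, so that its increments under small changes of the argument are bounded by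
  those of a linear function. This is what makes the Efron--Stein inequality effective
  without any differentiability of \<open>\<Phi>\<close>.
\<close>

definition inf_conv :: "nat \<Rightarrow> real \<Rightarrow> ((nat \<Rightarrow> 'h) \<Rightarrow> real) \<Rightarrow> (nat \<Rightarrow> 'h::real_inner) \<Rightarrow> real" where
  "inf_conv N s \<Phi> z = (INF y. \<Phi> y + sqdist N z y / (2 * s))"

lemma sqdist_nonneg [simp]: "0 \<le> sqdist N z y"
  by (simp add: sqdist_def sum_nonneg)

lemma sqdist_self [simp]: "sqdist N z z = 0"
  by (simp add: sqdist_def)

lemma inf_conv_le:
  assumes "s > 0" "\<And>y. 0 \<le> \<Phi> y"
  shows "inf_conv N s \<Phi> z \<le> \<Phi> y + sqdist N z y / (2 * s)"
  unfolding inf_conv_def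
proof (rule cINF_lower)
  show "bdd_below (range (\<lambda>y. \<Phi> y + sqdist N z y / (2 * s)))"
    by (rule bdd_belowI[of _ 0]) (use assms in auto)
qed simp

lemma inf_conv_nonneg:
  assumes "s > 0" "\<And>y. 0 \<le> \<Phi> y"
  shows "0 \<le> inf_conv N s \<Phi> z"
  unfolding inf_conv_def by (rule cINF_greatest) (use assms in auto)

lemma inf_conv_near:
  assumes "s > 0" "\<And>y. 0 \<le> \<Phi> y" "\<eta> > 0"
  obtains y where "\<Phi> y + sqdist N z y / (2 * s) \<le> inf_conv N s \<Phi> z + \<eta>"
proof -
  have bdd: "bdd_below (range (\<lambda>y. \<Phi> y + sqdist N z y / (2 * s)))"
    by (rule bdd_belowI[of _ 0]) (use assms in auto)
  have "Inf (range (\<lambda>y. \<Phi> y + sqdist N z y / (2 * s))) < inf_conv N s \<Phi> z + \<eta>"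
    using assms by (simp add: inf_conv_def)
  from cInf_lessD[OF _ this] obtain y where "\<Phi> y + sqdist N z y / (2 * s) < inf_conv N s \<Phi> z + \<eta>"
    by auto
  then show ?thesis using that[of y] by simp
qed

lemma inf_conv_cong:
  assumes "\<And>i. i < N \<Longrightarrow> z i = z' i"
  shows "inf_conv N s \<Phi> z = inf_conv N s \<Phi> z'"
  using assms by (simp add: inf_conv_def sqdist_def)

text \<open>The squared distance is invariant under simultaneous translation, so a near-minimizer
  \<open>y\<close> for \<open>z\<close> gives the competitor \<open>y + d\<close> for
  \<open>z + d\<close>. The opposite inequality is the same statement for the translation by
  \<open>- d\<close>.\<close>

lemma inf_conv_translate:
  fixes z d :: "nat \<Rightarrow> 'h::real_inner"
  assumes s: "s > 0" and nn: "\<And>y. 0 \<le> \<Phi> y"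
    and d: "\<And>y. \<bar>\<Phi> (\<lambda>i. y i + d i) - \<Phi> y\<bar> \<le> \<epsilon>"
  shows "\<bar>inf_conv N s \<Phi> (\<lambda>i. z i + d i) - inf_conv N s \<Phi> z\<bar> \<le> \<epsilon>"
proof -
  have 1: "inf_conv N s \<Phi> (\<lambda>i. z i + d i) \<le> inf_conv N s \<Phi> z + \<epsilon>" 
    if d: "\<And>y. \<bar>\<Phi> (\<lambda>i. y i + d i) - \<Phi> y\<bar> \<le> \<epsilon>" for z d :: "nat \<Rightarrow> 'h"
  proof (rule field_le_epsilon)
    fix \<eta> :: real assume "\<eta> > 0"
    obtain y where y: "\<Phi> y + sqdist N z y / (2 * s) \<le> inf_conv N s \<Phi> z + \<eta>"
      by (rule inf_conv_near[of s \<Phi> \<eta> N z]) (use s nn \<open>\<eta> > 0\<close> in auto)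
    have "inf_conv N s \<Phi> (\<lambda>i. z i + d i) \<le> \<Phi> (\<lambda>i. y i + d i) + sqdist N (\<lambda>i. z i + d i) (\<lambda>i. y i + d i) / (2 * s)"
      by (rule inf_conv_le) (use s nn in auto)
    then show "inf_conv N s \<Phi> (\<lambda>i. z i + d i) \<le> inf_conv N s \<Phi> z + \<epsilon> + \<eta>"
      using y d[of y] by (simp add: sqdist_def abs_le_iff)
  qed
  have "\<bar>\<Phi> (\<lambda>i. y i + - d i) - \<Phi> y\<bar> \<le> \<epsilon>" for y
    using d[of "\<lambda>i. y i + - d i"] by simp
  from 1[OF this, of "\<lambda>i. z i + d i"] 1[OF d, of z] show ?thesis by simp
qed

text \<open>The scaling of the central limit theorem: for independent centred unit vectors the
  second moments stay bounded, while a change of one of the \<open>m\<close> vectors moves the block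
  sum by at most \<open>2 / sqrt m\<close>.\<close>

definition block_sum :: "nat \<Rightarrow> (nat \<Rightarrow> 'h) \<Rightarrow> nat \<Rightarrow> 'h::real_inner" where
  "block_sum m h i = (1 / sqrt m) *\<^sub>R (\<Sum>j<m. h (i * m + j))"

lemma block_sum_upd:
  assumes "i < N" "j < m"
  shows "block_sum m (h(i * m + j := x)) =
    (block_sum m h)(i := block_sum m h i + (1 / sqrt m) *\<^sub>R (x - h (i * m + j)))"
proof
  fix i'
  show "block_sum m (h(i * m + j := x)) i' =
    ((block_sum m h)(i := block_sum m h i + (1 / sqrt m) *\<^sub>R (x - h (i * m + j)))) i'"
  proof (cases "i' = i")
    case True
    have "(\<Sum>j'<m. (h(i * m + j := x)) (i * m + j'))
        = (\<Sum>j'<m. h (i * m + j') + (if j' = j then x - h (i * m + j) else 0))"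
      by (rule sum.cong) auto
    then show ?thesis
      using True assms by (simp add: block_sum_def sum.distrib scaleR_add_right)
  next
    case False
    have "i' * m + j' \<noteq> i * m + j" if "j' < m" for j'
    proof
      assume "i' * m + j' = i * m + j"
      then have "(i' * m + j') div m = (i * m + j) div m" by simp
      then show False using False that assms by simp
    qed
    then show ?thesis using False by (simp add: block_sum_def)
  qed
qed

lemma block_sum_cong:
  assumes "i < N" "\<And>q. q < N * m \<Longrightarrow> h q = h' q"
  shows "block_sum m h i = block_sum m h' i"
proof -
  have "i * m + j < N * m" if "j < m" for j
  proof -
    have "i * m + j < Suc i * m" using that by simp
    also have "\<dots> \<le> N * m" using assms(1) by (intro mult_right_mono) auto
    finally show ?thesis .
  qed
  then show ?thesis unfolding block_sum_def using assms(2) by simp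
qed

lemma block_sum_linear:
  "linear R \<Longrightarrow> block_sum m (R \<circ> h) i = R (block_sum m h i)"
  by (simp add: block_sum_def linear_scale linear_sum)

text \<open>A near-minimizer \<open>y\<close> at \<open>z\<close> remains a competitor after one
  summand is exchanged. The squared distance then changes by a term linear in
  \<open>z i - y i\<close> and a small quadratic one, so the squared upward increments over all
  coordinates add up to a multiple of \<open>sqdist N z y\<close>, which \<open>D\<close> controls,
  plus an error that vanishes as \<open>m\<close> grows.\<close>

lemma (in finite_law) inf_conv_variance:
  fixes pt :: "'o \<Rightarrow> 'h::real_inner" and \<Phi> :: "(nat \<Rightarrow> 'h) \<Rightarrow> real" and m N :: nat and s :: real
  assumes pt: "\<And>x. norm (pt x) \<le> 1" and m: "m > 0" and s: "s > 0"
    and nn: "\<And>y. 0 \<le> \<Phi> y"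
    and near: "\<And>z y. \<Phi> y + sqdist N z y / (2 * s) \<le> inf_conv N s \<Phi> z + 1 / (m * s) \<Longrightarrow> sqdist N z y \<le> D"
  defines "F \<equiv> (\<lambda>\<xi>. inf_conv N s \<Phi> (block_sum m (pt \<circ> \<xi>)))"
  shows "prod_avg \<Omega> (N * m) (\<lambda>\<xi>'. (F \<xi>' - prod_avg \<Omega> (N * m) F \<xi>)^2) \<xi> \<le> 8 * D / s^2 + 18 * N / (m * s^2)"
proof (rule prod_avg_variance_le)
  fix \<xi>
  define z where "z = block_sum m (pt \<circ> \<xi>)"
  \<comment> \<open>The tolerance is of the order of the quadratic term, which is at most
    \<open>2 * \<eta>\<close>; together they give \<open>3 * \<eta>\<close>, whence the constant
    18.\<close>
  define \<eta> where "\<eta> = 1 / (m * s)"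
  have "\<eta> > 0" using m s by (simp add: \<eta>_def)
  obtain y where y: "\<Phi> y + sqdist N z y / (2 * s) \<le> inf_conv N s \<Phi> z + \<eta>"
    by (rule inf_conv_near[of s \<Phi> \<eta> N z]) (use s nn \<open>\<eta> > 0\<close> in auto)
  have D: "sqdist N z y \<le> D" using near y by (simp add: \<eta>_def)
  have step: "(max 0 (F (\<xi>(i * m + j := x)) - F \<xi>))^2 \<le> 8 * (norm (z i - y i))^2 / (m * s^2) + 18 / (m^2 * s^2)"
    if ij: "i < N" "j < m" for i j x
  proof -
    define d where "d = (1 / sqrt m) *\<^sub>R (pt x - pt (\<xi> (i * m + j)))"
    have "norm (pt x - pt (\<xi> (i * m + j))) \<le> 2"
      using norm_triangle_ineq4[of "pt x" "pt (\<xi> (i * m + j))"] pt[of x] pt[of "\<xi> (i * m + j)"] by linarith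
    then have nd: "norm d \<le> 2 / sqrt m"
      using m by (simp add: d_def divide_right_mono)
    have upd: "pt \<circ> \<xi>(i * m + j := x) = (pt \<circ> \<xi>)(i * m + j := pt x)" by auto
    have z': "block_sum m (pt \<circ> \<xi>(i * m + j := x)) = z(i := z i + d)"
      unfolding upd block_sum_upd[OF ij] by (simp add: z_def d_def)
    have sq: "sqdist N (z(i := z i + d)) y = sqdist N z y + (2 * inner d (z i - y i) + (norm d)^2)"
    proof -
      have "(norm ((z(i := z i + d)) i' - y i'))^2
        = (norm (z i' - y i'))^2 + (if i' = i then 2 * inner d (z i - y i) + (norm d)^2 else 0)" for i'
        by (simp add: power2_norm_eq_inner inner_diff_left inner_diff_right inner_add_left inner_add_right
            inner_commute algebra_simps)
      then have "sqdist N (z(i := z i + d)) y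
          = (\<Sum>i'<N. (norm (z i' - y i'))^2 + (if i' = i then 2 * inner d (z i - y i) + (norm d)^2 else 0))"
        by (simp add: sqdist_def)
      then show ?thesis using ij by (simp add: sum.distrib sqdist_def)
    qed
    have "F (\<xi>(i * m + j := x)) - F \<xi> \<le> (2 * inner d (z i - y i) + (norm d)^2) / (2 * s) + \<eta>"
    proof -
      have "F (\<xi>(i * m + j := x)) \<le> \<Phi> y + sqdist N (z(i := z i + d)) y / (2 * s)"
        unfolding F_def z' by (rule inf_conv_le) (use s nn in auto)
      then show ?thesis using y unfolding sq F_def z_def[symmetric]
        by (simp add: add_divide_distrib)
    qed
    also have "\<dots> \<le> (2 / sqrt m) * norm (z i - y i) / s + 3 * \<eta>"
    proof -
      have "inner d (z i - y i) \<le> norm d * norm (z i - y i)" by (rule norm_cauchy_schwarz)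
      also have "\<dots> \<le> (2 / sqrt m) * norm (z i - y i)" using nd by (intro mult_right_mono) auto
      finally have "inner d (z i - y i) / s \<le> (2 / sqrt m) * norm (z i - y i) / s"
        using s by (intro divide_right_mono) auto
      then have 1: "2 * inner d (z i - y i) / (2 * s) \<le> (2 / sqrt m) * norm (z i - y i) / s"
        by simp
      have "(norm d)^2 \<le> (2 / sqrt m)^2" using nd by (intro power_mono) auto
      also have "\<dots> = 4 / m" by (simp add: power_divide)
      finally have 2: "(norm d)^2 / (2 * s) \<le> 2 * \<eta>"
        using s m by (simp add: \<eta>_def field_simps)
      show ?thesis using 1 2 by (simp add: add_divide_distrib)
    qed
    finally have "max 0 (F (\<xi>(i * m + j := x)) - F \<xi>) \<le> (2 / sqrt m) * norm (z i - y i) / s + 3 * \<eta>"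
      using s \<open>\<eta> > 0\<close> by simp
    then have "(max 0 (F (\<xi>(i * m + j := x)) - F \<xi>))^2 \<le> ((2 / sqrt m) * norm (z i - y i) / s + 3 * \<eta>)^2"
      by (intro power_mono) auto
    also have "\<dots> \<le> 2 * ((2 / sqrt m) * norm (z i - y i) / s)^2 + 2 * (3 * \<eta>)^2"
    proof -
      have "(a + b)^2 \<le> 2 * a^2 + 2 * b^2" for a b :: real
        using zero_le_power2[of "a - b"] by (simp add: power2_diff power2_sum)
      then show ?thesis .
    qed
    also have "\<dots> = 8 * (norm (z i - y i))^2 / (m * s^2) + 18 / (m^2 * s^2)"
      by (simp add: \<eta>_def power_divide power_mult_distrib)
    finally show ?thesis .
  qed
  have "(\<Sum>q<N * m. avg \<Omega> (\<lambda>x. (max 0 (F (\<xi>(q := x)) - F \<xi>))^2))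
     = (\<Sum>i<N. \<Sum>j<m. avg \<Omega> (\<lambda>x. (max 0 (F (\<xi>(i * m + j := x)) - F \<xi>))^2))"
  proof -
    have "(\<Sum>q<N * m. g q) = (\<Sum>i<N. \<Sum>j<m. g (i * m + j))" for g :: "nat \<Rightarrow> real"
    proof -
      have "(\<Sum>q\<in>{i * m..<i * m + m}. g q) = (\<Sum>j<m. g (i * m + j))" for i
        by (rule sum.reindex_bij_witness[of _ "\<lambda>j. i * m + j" "\<lambda>j. j - i * m"]) auto
      then show ?thesis by (simp add: sum.nat_group[symmetric])
    qed
    then show ?thesis .
  qed
  also have "\<dots> \<le> (\<Sum>i<N. \<Sum>j<m. 8 * (norm (z i - y i))^2 / (m * s^2) + 18 / (m^2 * s^2))"
  proof (intro sum_mono)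
    fix i j assume "i \<in> {..<N}" "j \<in> {..<m}"
    then have "avg \<Omega> (\<lambda>x. (max 0 (F (\<xi>(i * m + j := x)) - F \<xi>))^2)
        \<le> avg \<Omega> (\<lambda>x. 8 * (norm (z i - y i))^2 / (m * s^2) + 18 / (m^2 * s^2))"
      by (intro avg_mono step) auto
    then show "avg \<Omega> (\<lambda>x. (max 0 (F (\<xi>(i * m + j := x)) - F \<xi>))^2)
        \<le> 8 * (norm (z i - y i))^2 / (m * s^2) + 18 / (m^2 * s^2)" by simp
  qed
  also have "\<dots> = 8 * sqdist N z y / s^2 + 18 * N / (m * s^2)"
    using m by (simp add: sum.distrib sqdist_def sum_distrib_left sum_divide_distrib
        power2_eq_square distrib_left)
  also have "\<dots> \<le> 8 * D / s^2 + 18 * N / (m * s^2)"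
    using D by (simp add: divide_right_mono)
  finally show "(\<Sum>q<N * m. avg \<Omega> (\<lambda>x. (max 0 (F (\<xi>(q := x)) - F \<xi>))^2)) \<le> 8 * D / s^2 + 18 * N / (m * s^2)" .
qed

section \<open>Almost invariant laws\<close>

text \<open>
  Random words of reflections are asymptotically distributed according to the Haar measure of the
  group they generate. The oscillation of an average over words of length \<open>n\<close>, as a function of
  the starting element, decreases geometrically in \<open>n\<close>, since any element of the
  group is approximated by words of a fixed length.
\<close>

definition words :: "'v set \<Rightarrow> nat \<Rightarrow> 'v list set" where
  "words V n = {w. set w \<subseteq> V \<and> length w = n}"

lemma finite_words: "finite V \<Longrightarrow> finite (words V n)"
  by (simp add: words_def finite_lists_length_eq)

lemma words_ne: "v \<in> V \<Longrightarrow> words V n \<noteq> {}"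
  unfolding words_def by (auto intro!: exI[of _ "replicate n v"])

lemma avg_words_add:
  assumes "finite V" "V \<noteq> {}"
  shows "avg (words V (a + b)) f = avg (words V a) (\<lambda>u. avg (words V b) (\<lambda>w. f (u @ w)))"
proof -
  have card: "card (words V n) = card V ^ n" for n
    unfolding words_def by (rule card_lists_length_eq[OF assms(1)])
  have "(\<Sum>w\<in>words V (a + b). f w) = (\<Sum>(u, w)\<in>words V a \<times> words V b. f (u @ w))"
    by (rule sum.reindex_bij_witness[of _ "\<lambda>(u, w). u @ w" "\<lambda>w. (take a w, drop a w)"])
       (auto simp: words_def dest: in_set_takeD in_set_dropD)
  also have "\<dots> = (\<Sum>u\<in>words V a. \<Sum>w\<in>words V b. f (u @ w))"
    by (rule sum.cartesian_product[symmetric])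
  finally show ?thesis
    by (simp add: avg_def card power_add sum_divide_distrib[symmetric] mult.commute)
qed

lemma reflects_replicate_0 [simp]: "reflects (replicate n 0) x = x"
  by (induction n) auto

lemma reflects_supported:
  assumes "\<And>v i. v \<in> set w \<Longrightarrow> k \<le> i \<Longrightarrow> coord v i = 0" "\<And>i. k \<le> i \<Longrightarrow> coord x i = 0" "k \<le> i"
  shows "coord (reflects w x) i = 0"
  using assms by (induction w) (auto simp: reflect_def)

lemma norm_le_sum_coord:
  assumes "\<And>i. k \<le> i \<Longrightarrow> coord x i = 0"
  shows "norm x \<le> (\<Sum>i<k. \<bar>coord x i\<bar>)"
proof -
  have "x = (\<Sum>i<k. coord x i *\<^sub>R unit_seq i)"
    by (rule fseq_expansion) (use assms in \<open>force simp: not_less[symmetric]\<close>)+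
  then have "norm x = norm (\<Sum>i<k. coord x i *\<^sub>R unit_seq i)" by simp
  also have "\<dots> \<le> (\<Sum>i<k. norm (coord x i *\<^sub>R unit_seq i))" by (rule norm_sum)
  finally show ?thesis by simp
qed

lemma abs_coord_le_norm: "\<bar>coord x i\<bar> \<le> norm x"
  using Cauchy_Schwarz_ineq2[of "unit_seq i" x] by simp

text \<open>Compactness by rounding: a word acts on the first \<open>k\<close> coordinates through a
  matrix with entries between -1 and 1, and there are only finitely many rounded matrices. One
  representative word for each is enough, and the zero vector, whose reflection is the identity,
  brings the representatives to a common length.\<close>

lemma words_dense:
  fixes V :: "fseq set"
  assumes V: "finite V" "0 \<in> V" and supp: "\<And>v i. v \<in> V \<Longrightarrow> k \<le> i \<Longrightarrow> coord v i = 0"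
    and "\<delta> > 0"
  shows "\<exists>n. \<forall>u\<in>lists V. \<exists>w\<in>words V n. \<forall>y. norm y \<le> 1 \<longrightarrow> (\<forall>i\<ge>k. coord y i = 0) \<longrightarrow>
    norm (reflects w y - reflects u y) \<le> \<delta>"
proof -
  \<comment> \<open>Entries with the same rounding differ by at most \<open>1 / Suc D\<close>;
    columns then differ by at most \<open>k / Suc D\<close>, and the images of a vector in the unit
    ball by at most \<open>k\<close> times as much.\<close>
  obtain D :: nat where "real k * real k / \<delta> < real D" using reals_Archimedean2 by blast
  then have D: "real k * real k / real (Suc D) \<le> \<delta>" using \<open>\<delta> > 0\<close> by (simp add: field_simps)
  define code where "code u = (\<lambda>cd\<in>{..<k} \<times> {..<k}. \<lfloor>real (Suc D) * coord (reflects u (unit_seq (fst cd))) (snd cd)\<rfloor>)"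
    for u
  have "code ` lists V \<subseteq> ({..<k} \<times> {..<k}) \<rightarrow>\<^sub>E {- int (Suc D)..int (Suc D)}"
  proof -
    have "\<lfloor>real (Suc D) * coord (reflects u (unit_seq c)) d\<rfloor> \<in> {- int (Suc D)..int (Suc D)}" for u c d
    proof -
      have "\<bar>coord (reflects u (unit_seq c)) d\<bar> \<le> 1"
        using abs_coord_le_norm[of "reflects u (unit_seq c)" d] by simp
      then have "\<bar>real (Suc D) * coord (reflects u (unit_seq c)) d\<bar> \<le> real (Suc D)"
        by (simp add: abs_mult mult_left_le del: of_nat_Suc)
      moreover have "\<lfloor>t\<rfloor> \<in> {- int n..int n}" if "\<bar>t\<bar> \<le> real n" for t n
        using that by (auto simp: le_floor_iff floor_le_iff)
      ultimately show ?thesis by blast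
    qed
    then show ?thesis unfolding code_def image_subset_iff restrict_PiE_iff by blast
  qed
  then have finC: "finite (code ` lists V)"
    by (rule finite_subset) (intro finite_PiE; simp)
  define rep where "rep c = (SOME u. u \<in> lists V \<and> code u = c)" for c
  have rep: "rep (code u) \<in> lists V \<and> code (rep (code u)) = code u" if "u \<in> lists V" for u
    unfolding rep_def by (rule someI[of _ u]) (use that in simp)
  define n where "n = Max ((length \<circ> rep) ` (code ` lists V))"
  have "\<exists>w\<in>words V n. \<forall>y. norm y \<le> 1 \<longrightarrow> (\<forall>i\<ge>k. coord y i = 0) \<longrightarrow> norm (reflects w y - reflects u y) \<le> \<delta>"
    if u: "u \<in> lists V" for u
  proof -
    define r where "r = rep (code u)"
    have r: "r \<in> lists V" "code r = code u" using rep[OF u] by (auto simp: r_def)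
    have "length r \<le> n" unfolding n_def r_def using finC u by (intro Max_ge) auto
    define w where "w = r @ replicate (n - length r) 0"
    have w: "w \<in> words V n" using r V \<open>length r \<le> n\<close> by (auto simp: w_def words_def)
    have wr: "reflects w y = reflects r y" for y by (simp add: w_def)
    have "norm (reflects w y - reflects u y) \<le> \<delta>" if y: "norm y \<le> 1" "\<forall>i\<ge>k. coord y i = 0" for y
    proof -
      have e: "norm (reflects r (unit_seq c) - reflects u (unit_seq c)) \<le> k / Suc D" if c: "c < k" for c
      proof -
        have "norm (reflects r (unit_seq c) - reflects u (unit_seq c))
            \<le> (\<Sum>d<k. \<bar>coord (reflects r (unit_seq c) - reflects u (unit_seq c)) d\<bar>)"
        proof (rule norm_le_sum_coord)
          fix i assume "k \<le> i"
          then have "coord (reflects r (unit_seq c)) i = 0" "coord (reflects u (unit_seq c)) i = 0"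
            by (intro reflects_supported[of _ k]; use r u supp c in auto)+
          then show "coord (reflects r (unit_seq c) - reflects u (unit_seq c)) i = 0" by simp
        qed
        also have "\<dots> \<le> (\<Sum>d<k. 1 / Suc D)"
        proof (rule sum_mono)
          fix d assume "d \<in> {..<k}"
          then have "\<lfloor>real (Suc D) * coord (reflects r (unit_seq c)) d\<rfloor> = \<lfloor>real (Suc D) * coord (reflects u (unit_seq c)) d\<rfloor>"
            using c fun_cong[OF r(2), of "(c, d)"] by (simp add: code_def)
          then have "\<bar>real (Suc D) * coord (reflects r (unit_seq c)) d - real (Suc D) * coord (reflects u (unit_seq c)) d\<bar> \<le> 1"
            by linarith
          then have "real (Suc D) * \<bar>coord (reflects r (unit_seq c)) d - coord (reflects u (unit_seq c)) d\<bar> \<le> 1"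
            by (simp add: right_diff_distrib[symmetric] abs_mult del: of_nat_Suc)
          then show "\<bar>coord (reflects r (unit_seq c) - reflects u (unit_seq c)) d\<bar> \<le> 1 / Suc D"
            by (simp add: pos_le_divide_eq mult.commute del: of_nat_Suc)
        qed
        finally show ?thesis by simp
      qed
      have ye: "y = (\<Sum>c<k. coord y c *\<^sub>R unit_seq c)"
        by (rule fseq_expansion) (use y in \<open>force simp: not_less[symmetric]\<close>)+
      have "reflects r y - reflects u y = (\<Sum>c<k. coord y c *\<^sub>R (reflects r (unit_seq c) - reflects u (unit_seq c)))"
        by (subst (1 2) ye)
           (simp add: linear_sum[OF linear_reflects] linear_scale[OF linear_reflects]
             scaleR_diff_right sum_subtractf)
      also have "norm \<dots> \<le> (\<Sum>c<k. norm (coord y c *\<^sub>R (reflects r (unit_seq c) - reflects u (unit_seq c))))"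
        by (rule norm_sum)
      also have "\<dots> \<le> (\<Sum>c<k. 1 * (k / Suc D))"
      proof (rule sum_mono)
        fix c assume "c \<in> {..<k}"
        then show "norm (coord y c *\<^sub>R (reflects r (unit_seq c) - reflects u (unit_seq c))) \<le> 1 * (k / Suc D)"
          unfolding norm_scaleR using e[of c] y abs_coord_le_norm[of y c]
          by (intro mult_mono) auto
      qed
      also have "\<dots> = real k * real k / real (Suc D)" by simp
      finally show ?thesis using D wr by simp
    qed
    then show ?thesis using w by blast
  qed
  then show ?thesis by blast
qed

text \<open>Doeblin's coupling argument. For starting elements \<open>g\<close> and
  \<open>h\<close>, one continuation of \<open>g\<close> by a word of length \<open>n0\<close> is
  close to \<open>h\<close> continued by the identity word. When these two are matched and the other
  words paired arbitrarily, a step of length \<open>n0\<close> multiplies the oscillation by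
  \<open>1 - 1 / K\<close> up to an error \<open>\<epsilon> / K\<close>. The length \<open>n\<close>
  is found before \<open>\<Psi>\<close>, which enters only through \<open>B\<close>,
  \<open>\<delta>\<close> and \<open>\<epsilon>\<close>.\<close>

lemma words_oscillation:
  fixes V :: "fseq set"
  assumes V: "finite V" "0 \<in> V" and supp: "\<And>v i. v \<in> V \<Longrightarrow> k \<le> i \<Longrightarrow> coord v i = 0"
    and x0: "norm x0 \<le> 1" "\<And>i. k \<le> i \<Longrightarrow> coord x0 i = 0"
    and "\<delta> > 0" "\<epsilon> > 0"
  shows "\<exists>n. \<forall>\<Psi>. (\<forall>x. \<bar>\<Psi> x\<bar> \<le> B) \<longrightarrow> (\<forall>x y. norm (x - y) \<le> \<delta> \<longrightarrow> \<bar>\<Psi> x - \<Psi> y\<bar> \<le> \<epsilon>) \<longrightarrow>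
    (\<forall>g\<in>lists V. \<forall>h\<in>lists V. \<bar>avg (words V n) (\<lambda>w. \<Psi> (reflects (g @ w) x0)) -
       avg (words V n) (\<lambda>w. \<Psi> (reflects (h @ w) x0))\<bar> \<le> 2 * \<epsilon>)"
proof -
  obtain n0 where n0: "\<And>u. u \<in> lists V \<Longrightarrow> \<exists>w\<in>words V n0. \<forall>y. norm y \<le> 1 \<longrightarrow> (\<forall>i\<ge>k. coord y i = 0) \<longrightarrow>
      norm (reflects w y - reflects u y) \<le> \<delta>"
  proof -
    have "\<exists>n. \<forall>u\<in>lists V. \<exists>w\<in>words V n. \<forall>y. norm y \<le> 1 \<longrightarrow> (\<forall>i\<ge>k. coord y i = 0) \<longrightarrow>
      norm (reflects w y - reflects u y) \<le> \<delta>"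
      by (rule words_dense) (fact V supp \<open>\<delta> > 0\<close>)+
    then show ?thesis by (elim exE) (rule that, blast)
  qed
  let ?W = "words V n0"
  interpret W: finite_law ?W
    using finite_words[OF V(1)] words_ne[OF V(2)] by unfold_locales auto
  define K where "K = real (card ?W)"
  have K: "K \<ge> 1" using W.card_pos by (simp add: K_def Suc_leI)
  define r where "r = 1 - 1 / K"
  have r: "0 \<le> r" "r < 1" using K by (auto simp: r_def)
  obtain j where j: "r ^ j * (2 * \<bar>B\<bar>) \<le> \<epsilon>"
  proof -
    have "(\<lambda>j. r ^ j * (2 * \<bar>B\<bar>)) \<longlonglongrightarrow> 0 * (2 * \<bar>B\<bar>)"
      by (intro tendsto_mult LIMSEQ_realpow_zero tendsto_const) (use r in auto)
    then have "\<forall>\<^sub>F j in sequentially. r ^ j * (2 * \<bar>B\<bar>) < \<epsilon>"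
      using \<open>\<epsilon> > 0\<close> by (intro order_tendstoD(2)) auto
    then show ?thesis using that by (auto simp: eventually_sequentially intro: less_imp_le)
  qed
  have main: "\<bar>avg (words V (j * n0)) (\<lambda>w. \<Psi> (reflects (g @ w) x0)) -
       avg (words V (j * n0)) (\<lambda>w. \<Psi> (reflects (h @ w) x0))\<bar> \<le> 2 * \<epsilon>"
    if B: "\<forall>x. \<bar>\<Psi> x\<bar> \<le> B" and \<Psi>: "\<forall>x y. norm (x - y) \<le> \<delta> \<longrightarrow> \<bar>\<Psi> x - \<Psi> y\<bar> \<le> \<epsilon>"
      and gh: "g \<in> lists V" "h \<in> lists V" for \<Psi> g h
  proof -
    define \<phi> where "\<phi> j g = avg (words V (j * n0)) (\<lambda>w. \<Psi> (reflects (g @ w) x0))" for j g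
    have law: "finite_law (words V n)" for n
      using finite_words[OF V(1)] words_ne[OF V(2)] by unfold_locales auto
    have \<phi>_Suc: "\<phi> (Suc j) g = avg ?W (\<lambda>u. \<phi> j (g @ u))" for j g
    proof -
      have "V \<noteq> {}" using V by blast
      from avg_words_add[OF V(1) this, of n0 "j * n0" "\<lambda>w. \<Psi> (reflects (g @ w) x0)"]
      show ?thesis by (simp add: \<phi>_def)
    qed
    have close: "\<exists>w\<in>?W. \<forall>j. \<bar>\<phi> j (g @ w) - \<phi> j h\<bar> \<le> \<epsilon>" if gh: "g \<in> lists V" "h \<in> lists V" for g h
    proof -
      \<comment> \<open>\<open>rev g @ h\<close> acts as \<open>h\<close> followed by the inverse of
        \<open>g\<close>; a word \<open>w\<close> close to it makes \<open>g @ w\<close> close to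
        \<open>h\<close>, because \<open>g\<close> acts isometrically.\<close>
      have "rev g @ h \<in> lists V" using gh by auto
      then obtain w where w: "w \<in> ?W" and near: "\<And>y. norm y \<le> 1 \<Longrightarrow> (\<And>i. i \<ge> k \<Longrightarrow> coord y i = 0) \<Longrightarrow>
          norm (reflects w y - reflects (rev g @ h) y) \<le> \<delta>"
        using n0 by meson
      have pw: "\<bar>\<Psi> (reflects ((g @ w) @ t) x0) - \<Psi> (reflects (h @ t) x0)\<bar> \<le> \<epsilon>" if t: "t \<in> lists V" for t
      proof -
        define y where "y = reflects t x0"
        have y: "norm y \<le> 1" using x0 by (simp add: y_def)
        have y': "coord y i = 0" if "i \<ge> k" for i
          unfolding y_def by (rule reflects_supported[of _ k]) (use t supp x0 that in auto)
        have "norm (reflects g (reflects w y) - reflects h y)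
            = norm (reflects (rev g) (reflects g (reflects w y) - reflects h y))" by simp
        also have "\<dots> = norm (reflects w y - reflects (rev g @ h) y)"
          by (simp only: linear_diff[OF linear_reflects] reflects_rev reflects_append)
        also have "\<dots> \<le> \<delta>" by (rule near[OF y y'])
        finally show ?thesis using \<Psi> by (simp add: y_def)
      qed
      have "\<bar>\<phi> j (g @ w) - \<phi> j h\<bar> \<le> \<epsilon>" for j
      proof -
        interpret L: finite_law "words V (j * n0)" by (rule law)
        have "\<phi> j (g @ w) - \<phi> j h = avg (words V (j * n0)) (\<lambda>t. \<Psi> (reflects ((g @ w) @ t) x0) - \<Psi> (reflects (h @ t) x0))"
          by (simp only: \<phi>_def L.avg_diff)
        moreover have "\<dots> \<le> avg (words V (j * n0)) (\<lambda>t. \<epsilon>)"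
          by (rule L.avg_mono) (use pw in \<open>force simp: words_def abs_le_iff\<close>)
        moreover have "avg (words V (j * n0)) (\<lambda>t. - \<epsilon>) \<le> avg (words V (j * n0)) (\<lambda>t. \<Psi> (reflects ((g @ w) @ t) x0) - \<Psi> (reflects (h @ t) x0))"
          by (rule L.avg_mono) (smt (verit) pw words_def mem_Collect_eq in_lists_conv_set subsetD)
        ultimately show ?thesis by (simp only: L.avg_const)
      qed
      then show ?thesis using w by blast
    qed
    have osc: "\<phi> j g - \<phi> j h \<le> r ^ j * (2 * \<bar>B\<bar>) + \<epsilon>" if "g \<in> lists V" "h \<in> lists V" for j g h
      using that
    proof (induction j arbitrary: g h)
      case 0
      have "\<phi> 0 g = \<Psi> (reflects g x0)" for g
      proof -
        have "words V 0 = {[]}" by (auto simp: words_def)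
        then show ?thesis by (simp add: \<phi>_def avg_def)
      qed
      then show ?case using B[rule_format, of "reflects g x0"] B[rule_format, of "reflects h x0"] \<open>\<epsilon> > 0\<close>
        by simp
    next
      case (Suc j)
      define b where "b = r ^ j * (2 * \<bar>B\<bar>) + \<epsilon>"
      define i0 :: "fseq list" where "i0 = replicate n0 0"
      have i0: "i0 \<in> ?W" using V by (auto simp: i0_def words_def)
      have Wl: "u \<in> lists V" if "u \<in> ?W" for u using that by (auto simp: words_def)
      obtain w0 where w0: "w0 \<in> ?W" "\<And>j. \<bar>\<phi> j (g @ w0) - \<phi> j (h @ i0)\<bar> \<le> \<epsilon>"
        using close[of g "h @ i0"] Suc.prems Wl[OF i0] by auto
      \<comment> \<open>An arbitrary bijection between the remaining words will do: for each pair
        the induction hypothesis bounds the difference.\<close>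
      have "card (?W - {w0}) = card (?W - {i0})" using w0 i0 W.fin by simp
      with W.fin have "\<exists>f. bij_betw f (?W - {w0}) (?W - {i0})"
        by (intro finite_same_card_bij) simp_all
      then obtain f where f: "bij_betw f (?W - {w0}) (?W - {i0})" ..
      have "(\<Sum>u\<in>?W. \<phi> j (g @ u)) - (\<Sum>u\<in>?W. \<phi> j (h @ u))
         = (\<phi> j (g @ w0) - \<phi> j (h @ i0)) + ((\<Sum>u\<in>?W - {w0}. \<phi> j (g @ u)) - (\<Sum>u\<in>?W - {i0}. \<phi> j (h @ u)))"
        using sum.remove[OF W.fin w0(1), of "\<lambda>u. \<phi> j (g @ u)"] sum.remove[OF W.fin i0, of "\<lambda>u. \<phi> j (h @ u)"]
        by simp
      also have "(\<Sum>u\<in>?W - {i0}. \<phi> j (h @ u)) = (\<Sum>u\<in>?W - {w0}. \<phi> j (h @ f u))"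
        by (rule sum.reindex_bij_betw[OF f, symmetric])
      also have "(\<Sum>u\<in>?W - {w0}. \<phi> j (g @ u)) - (\<Sum>u\<in>?W - {w0}. \<phi> j (h @ f u))
         = (\<Sum>u\<in>?W - {w0}. \<phi> j (g @ u) - \<phi> j (h @ f u))" by (simp add: sum_subtractf)
      also have "\<dots> \<le> (\<Sum>u\<in>?W - {w0}. b)"
      proof (rule sum_mono)
        fix u assume u: "u \<in> ?W - {w0}"
        then have "f u \<in> ?W" using f by (auto simp: bij_betw_def)
        then show "\<phi> j (g @ u) - \<phi> j (h @ f u) \<le> b"
          unfolding b_def using u Wl Suc.prems by (intro Suc.IH) auto
      qed
      also have "\<dots> = (K - 1) * b"
        using w0(1) W.fin K by (simp add: K_def of_nat_diff)
      also have "\<phi> j (g @ w0) - \<phi> j (h @ i0) \<le> \<epsilon>" using w0(2)[of j] by linarith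
      finally have "(\<Sum>u\<in>?W. \<phi> j (g @ u)) - (\<Sum>u\<in>?W. \<phi> j (h @ u)) \<le> \<epsilon> + (K - 1) * b" by simp
      then have "((\<Sum>u\<in>?W. \<phi> j (g @ u)) - (\<Sum>u\<in>?W. \<phi> j (h @ u))) / K \<le> (\<epsilon> + (K - 1) * b) / K"
        using K by (intro divide_right_mono) auto
      moreover have "\<phi> (Suc j) g - \<phi> (Suc j) h = ((\<Sum>u\<in>?W. \<phi> j (g @ u)) - (\<Sum>u\<in>?W. \<phi> j (h @ u))) / K"
        unfolding \<phi>_Suc by (simp add: avg_def K_def diff_divide_distrib)
      \<comment> \<open>\<open>\<epsilon>\<close> is the fixed point of the map taking
        \<open>b\<close> to \<open>\<epsilon> / K + r * b\<close>, so the additive error does not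
        accumulate.\<close>
      moreover have "(\<epsilon> + (K - 1) * b) / K = \<epsilon> / K + r * b"
        using K by (simp add: r_def field_simps)
      moreover have "\<epsilon> / K + r * b = r ^ Suc j * (2 * \<bar>B\<bar>) + \<epsilon>"
        using K by (simp add: r_def b_def field_simps)
      ultimately show ?case by linarith
    qed
    show ?thesis
      using osc[OF gh, of j] osc[OF gh(2) gh(1), of j] j by (simp add: \<phi>_def abs_le_iff)
  qed
  show ?thesis
    by (rule exI[of _ "j * n0"]) (use main in blast)
qed

section \<open>Sums of independent symmetric variables\<close>

text \<open>Expectation of \<open>f\<close> at a sum of \<open>m\<close> independent copies of
  \<open>X\<close>, unfolded one summand at a time so that moments follow by induction on
  \<open>m\<close>.\<close>

primrec (in finite_law) sum_avg :: "('o \<Rightarrow> real) \<Rightarrow> nat \<Rightarrow> (real \<Rightarrow> real) \<Rightarrow> real" where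
  "sum_avg X 0 f = f 0"
| "sum_avg X (Suc m) f = sum_avg X m (\<lambda>s. avg \<Omega> (\<lambda>x. f (s + X x)))"

context finite_law
begin

text \<open>The coordinates outside the range of \<open>\<sigma>\<close> average out; injectivity of
  \<open>\<sigma>\<close> is what makes the summands independent.\<close>

lemma prod_avg_sum_avg:
  assumes "inj_on \<sigma> {..<m}" "\<And>j. j < m \<Longrightarrow> \<sigma> j < P"
  shows "prod_avg \<Omega> P (\<lambda>\<xi>. f (\<Sum>j<m. X (\<xi> (\<sigma> j)))) \<xi> = sum_avg X m f"
  using assms
proof (induction m arbitrary: f)
  case (Suc m)
  have "prod_avg \<Omega> P (\<lambda>\<xi>. f (\<Sum>j<Suc m. X (\<xi> (\<sigma> j)))) \<xi>
      = prod_avg \<Omega> P (coord_avg \<Omega> (\<sigma> m) (\<lambda>\<xi>. f (\<Sum>j<Suc m. X (\<xi> (\<sigma> j))))) \<xi>"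
    by (subst prod_avg_coord_avg) (use Suc.prems in auto)
  also have "coord_avg \<Omega> (\<sigma> m) (\<lambda>\<xi>. f (\<Sum>j<Suc m. X (\<xi> (\<sigma> j))))
      = (\<lambda>\<xi>. avg \<Omega> (\<lambda>x. f ((\<Sum>j<m. X (\<xi> (\<sigma> j))) + X x)))"
  proof
    fix \<xi>
    have "(\<Sum>j<m. X ((\<xi>(\<sigma> m := x)) (\<sigma> j))) = (\<Sum>j<m. X (\<xi> (\<sigma> j)))" for x
    proof (rule sum.cong[OF refl])
      fix j assume "j \<in> {..<m}"
      then have "\<sigma> j \<noteq> \<sigma> m" using Suc.prems(1) by (auto simp: inj_on_def)
      then show "X ((\<xi>(\<sigma> m := x)) (\<sigma> j)) = X (\<xi> (\<sigma> j))" by simp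
    qed
    then show "coord_avg \<Omega> (\<sigma> m) (\<lambda>\<xi>. f (\<Sum>j<Suc m. X (\<xi> (\<sigma> j)))) \<xi>
      = avg \<Omega> (\<lambda>x. f ((\<Sum>j<m. X (\<xi> (\<sigma> j))) + X x))"
      by (simp add: coord_avg_def)
  qed
  also have "prod_avg \<Omega> P (\<lambda>\<xi>. avg \<Omega> (\<lambda>x. f ((\<Sum>j<m. X (\<xi> (\<sigma> j))) + X x))) \<xi>
      = sum_avg X m (\<lambda>s. avg \<Omega> (\<lambda>x. f (s + X x)))"
    by (rule Suc.IH) (use Suc.prems in \<open>auto simp: inj_on_def\<close>)
  finally show ?case by simp
qed simp

lemma sum_avg_add: "sum_avg X m (\<lambda>s. f s + g s) = sum_avg X m f + sum_avg X m g"
  by (induction m arbitrary: f g) (simp_all add: avg_add)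

lemma sum_avg_cmult: "sum_avg X m (\<lambda>s. c * f s) = c * sum_avg X m f"
  by (induction m arbitrary: f) (simp_all add: avg_cmult)

lemma sum_avg_const [simp]: "sum_avg X m (\<lambda>s. c) = c"
  by (induction m) simp_all

lemma sum_avg_mono: "(\<And>s. f s \<le> g s) \<Longrightarrow> sum_avg X m f \<le> sum_avg X m g"
  by (induction m arbitrary: f g) (simp_all add: avg_mono)

text \<open>In the expansion of the fourth power of \<open>s + X x\<close>, the term linear in
  \<open>X x\<close> has mean zero and the cubic one is multiplied by \<open>s\<close>, whose mean
  is zero. What remains is governed by the second moment, whence quadratic growth in
  \<open>m\<close>.\<close>

lemma sum_avg_moments:
  assumes X0: "avg \<Omega> X = 0" and X1: "\<And>x. \<bar>X x\<bar> \<le> 1"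
  shows "sum_avg X m (\<lambda>s. s) = 0"
    and "sum_avg X m (\<lambda>s. s^2) = m * avg \<Omega> (\<lambda>x. (X x)^2)"
    and "sum_avg X m (\<lambda>s. s^4) \<le> 3 * (real m)^2 + real m"
proof -
  define v where "v = avg \<Omega> (\<lambda>x. (X x)^2)"
  have a1: "avg \<Omega> (\<lambda>x. s + X x) = s" for s
    by (simp add: avg_add X0)
  have a2: "avg \<Omega> (\<lambda>x. (s + X x)^2) = s^2 + v" for s
  proof -
    have "avg \<Omega> (\<lambda>x. (s + X x)^2) = avg \<Omega> (\<lambda>x. s^2 + ((X x)^2 + (2 * s) * X x))"
      by (simp add: power2_sum algebra_simps)
    then show ?thesis by (simp only: avg_add avg_cmult avg_const X0 v_def mult_zero_right add_0_right)
  qed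
  have a4: "avg \<Omega> (\<lambda>x. (s + X x)^4)
      = s^4 + ((6 * v) * s^2 + ((4 * avg \<Omega> (\<lambda>x. (X x)^3)) * s + avg \<Omega> (\<lambda>x. (X x)^4)))" for s
  proof -
    have "avg \<Omega> (\<lambda>x. (s + X x)^4)
        = avg \<Omega> (\<lambda>x. s^4 + ((4 * s^3) * X x + ((6 * s^2) * (X x)^2 + ((4 * s) * (X x)^3 + (X x)^4))))"
      by (simp add: power2_eq_square power3_eq_cube power4_eq_xxxx algebra_simps)
    then show ?thesis
      by (simp only: avg_add avg_cmult avg_const X0 v_def) (simp add: algebra_simps)
  qed
  have v1: "v \<le> 1"
  proof -
    have "v \<le> avg \<Omega> (\<lambda>x. 1)" unfolding v_def
      by (rule avg_mono) (use X1 in \<open>simp add: abs_square_le_1\<close>)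
    then show ?thesis by simp
  qed
  have k4: "avg \<Omega> (\<lambda>x. (X x)^4) \<le> 1"
  proof -
    have "avg \<Omega> (\<lambda>x. (X x)^4) \<le> avg \<Omega> (\<lambda>x. 1)"
    proof (rule avg_mono)
      fix x
      have "\<bar>X x\<bar> ^ 4 \<le> 1" using X1[of x] by (intro power_le_one) auto
      then show "(X x)^4 \<le> 1" by (simp add: power_even_abs)
    qed
    then show ?thesis by simp
  qed
  have m1: "sum_avg X m (\<lambda>s. s) = 0" for m
    by (induction m) (simp_all add: a1)
  have m2: "sum_avg X m (\<lambda>s. s^2) = m * avg \<Omega> (\<lambda>x. (X x)^2)" for m
    unfolding v_def[symmetric]
    by (induction m) (simp_all add: a2 sum_avg_add algebra_simps)
  show "sum_avg X m (\<lambda>s. s) = 0" by (rule m1)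
  show "sum_avg X m (\<lambda>s. s^2) = m * avg \<Omega> (\<lambda>x. (X x)^2)" by (rule m2)
  show "sum_avg X m (\<lambda>s. s^4) \<le> 3 * (real m)^2 + real m"
  proof (induction m)
    case (Suc m)
    have "sum_avg X (Suc m) (\<lambda>s. s^4)
        = sum_avg X m (\<lambda>s. s^4) + (6 * v * (m * v) + avg \<Omega> (\<lambda>x. (X x)^4))"
      by (simp only: sum_avg.simps a4 sum_avg_add sum_avg_cmult sum_avg_const m1 m2 v_def)
    moreover have "6 * v * (m * v) \<le> 6 * m"
    proof -
      have "0 \<le> v" using sum_avg_mono[of "\<lambda>_. 0" "\<lambda>s. s^2" X 1] m2[of 1] by (simp add: v_def)
      then have "v * v \<le> 1" using v1 by (simp add: mult_le_one)
      then have "6 * real m * (v * v) \<le> 6 * real m * 1" by (intro mult_left_mono) auto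
      then show ?thesis by (simp add: algebra_simps)
    qed
    ultimately show ?case using Suc k4 by (simp add: power2_eq_square algebra_simps)
  qed simp
qed

text \<open>From \<open>t\<^sup>2 \<le> M |t| + t\<^sup>4 / M\<^sup>2\<close>.\<close>

lemma sum_avg_abs_ge:
  fixes m :: nat and k :: nat
  assumes X0: "avg \<Omega> X = 0" and X1: "\<And>x. \<bar>X x\<bar> \<le> 1" and k: "k > 0"
    and v: "avg \<Omega> (\<lambda>x. (X x)^2) \<ge> 1 / k" and m: "m > 0"
  shows "sum_avg X m (\<lambda>s. \<bar>s\<bar>) / sqrt m \<ge> 1 / (2 * k * sqrt (8 * k))"
proof -
  \<comment> \<open>With this \<open>M\<close> the fourth moment, at most \<open>4 * m^2\<close>,
    divided by \<open>M^2\<close> gives \<open>m / (2 * k)\<close>, half of the lower bound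
    \<open>m / k\<close> for the second moment.\<close>
  define M where "M = sqrt (8 * k * m)"
  have M: "M > 0" "M^2 = 8 * k * m" using k m by (auto simp: M_def)
  have pw: "s^2 \<le> M * \<bar>s\<bar> + (1 / M^2) * s^4" for s
  proof (cases "\<bar>s\<bar> \<le> M")
    case True
    then have "\<bar>s\<bar> * \<bar>s\<bar> \<le> M * \<bar>s\<bar>" by (intro mult_right_mono) auto
    moreover have "0 \<le> (1 / M^2) * s^4" by simp
    moreover have "s^2 = \<bar>s\<bar> * \<bar>s\<bar>" by (simp add: power2_eq_square)
    ultimately show ?thesis by linarith
  next
    case False
    then have "M^2 \<le> \<bar>s\<bar>^2" using M by (intro power_mono) auto
    then have "s^2 * M^2 \<le> s^2 * s^2" by (intro mult_left_mono) auto
    then have "s^2 \<le> (s^2 * s^2) / M^2" using M(1) by (subst pos_le_divide_eq) simp_all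
    then have "s^2 \<le> (1 / M^2) * s^4" by (simp add: power4_eq_xxxx power2_eq_square mult.assoc)
    moreover have "0 \<le> M * \<bar>s\<bar>" using M by simp
    ultimately show ?thesis by linarith
  qed
  have "sum_avg X m (\<lambda>s. s^2) \<le> sum_avg X m (\<lambda>s. M * \<bar>s\<bar> + (1 / M^2) * s^4)"
    by (rule sum_avg_mono) (rule pw)
  also have "\<dots> = M * sum_avg X m (\<lambda>s. \<bar>s\<bar>) + (1 / M^2) * sum_avg X m (\<lambda>s. s^4)"
    by (simp only: sum_avg_add sum_avg_cmult)
  also have "(1 / M^2) * sum_avg X m (\<lambda>s. s^4) \<le> (1 / M^2) * (4 * (real m)^2)"
  proof (rule mult_left_mono)
    have "1 * real m \<le> real m * real m" using m by (intro mult_right_mono) auto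
    then have "real m \<le> (real m)^2" by (simp add: power2_eq_square)
    then show "sum_avg X m (\<lambda>s. s^4) \<le> 4 * (real m)^2"
      using sum_avg_moments(3)[of X m, OF X0 X1] by linarith
  qed simp
  also have "(1 / M^2) * (4 * (real m)^2) = m / (2 * k)"
    unfolding M(2) using m k by (simp add: power2_eq_square)
  finally have "m * (1 / k) \<le> M * sum_avg X m (\<lambda>s. \<bar>s\<bar>) + m / (2 * k)"
    using sum_avg_moments(2)[of X m, OF X0 X1] mult_left_mono[OF v, of "real m"] by simp
  then have "m / (2 * k) \<le> M * sum_avg X m (\<lambda>s. \<bar>s\<bar>)"
    using k by (simp add: field_simps)
  moreover have "M = sqrt (8 * k) * sqrt m" by (simp add: M_def real_sqrt_mult)
  moreover have "real m = sqrt m * sqrt m" by simp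
  ultimately have "sqrt m * (sqrt m / (2 * k)) \<le> sqrt m * (sqrt (8 * k) * sum_avg X m (\<lambda>s. \<bar>s\<bar>))"
    by (metis mult.assoc mult.commute times_divide_eq_right)
  then have "sqrt m / (2 * k) \<le> sqrt (8 * k) * sum_avg X m (\<lambda>s. \<bar>s\<bar>)"
    by (rule mult_left_le_imp_le) (use m in simp)
  then show ?thesis using m k by (simp add: field_simps)
qed

end

section \<open>Almost invariant linear maps from finitely supported sequences\<close>

locale seminorm =
  fixes p :: "'b::real_vector \<Rightarrow> real"
  assumes triangle: "p (x + y) \<le> p x + p y"
    and scale: "p (c *\<^sub>R x) = \<bar>c\<bar> * p x"
begin

lemma p_0 [simp]: "p 0 = 0"
  using scale[of 0 0] by simp

lemma p_minus [simp]: "p (- x) = p x"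
  using scale[of "-1" x] by simp

lemma p_nonneg [simp]: "0 \<le> p x"
  using triangle[of x "- x"] by simp

lemma p_sum: "p (sum f A) \<le> (\<Sum>a\<in>A. p (f a))"
  by (induction A rule: infinite_finite_induct) (auto intro: order_trans[OF triangle])

lemma p_diff_commute: "p (x - y) = p (y - x)"
  using p_minus[of "x - y"] by simp

lemma p_diff_le: "p x - p y \<le> p (x - y)"
  using triangle[of "x - y" y] by simp

lemma abs_p_diff_le: "\<bar>p x - p y\<bar> \<le> p (x - y)"
  using p_diff_le[of x y] p_diff_le[of y x] p_diff_commute[of x y] by linarith

text \<open>
  The function \<open>q\<close> of the moduli of the coefficients is sublinear, so that Jensen's inequality applies
  to random coefficients.
\<close>

definition spread :: "real \<Rightarrow> nat \<Rightarrow> (nat \<Rightarrow> 'b) \<Rightarrow> bool" where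
  "spread A N e \<longleftrightarrow>
     (\<forall>a. p (\<Sum>i<N. a i *\<^sub>R e i) \<le> sqrt (\<Sum>i<N. (a i)^2)) \<and>
     (\<exists>q. (\<forall>a. q (\<lambda>i. \<bar>a i\<bar>) \<le> p (\<Sum>i<N. a i *\<^sub>R e i)) \<and>
        (\<forall>a b. q (\<lambda>i. a i + b i) \<le> q a + q b) \<and> (\<forall>c\<ge>0. \<forall>a. q (\<lambda>i. c * a i) = c * q a) \<and>
        A \<le> q (\<lambda>_. 1))"

text \<open>Jensen's inequality for the sublinear \<open>q\<close>: its mean at the random moduli is
  at least its value at their means, which all equal \<open>t\<close>. This is why a lower bound at
  the single vector of ones is enough in \<open>spread\<close>.\<close>

lemma spread_mean:
  assumes "finite_law \<Omega>" and e: "spread A N e"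
    and t: "\<And>i. i < N \<Longrightarrow> prod_avg \<Omega> P (\<lambda>\<xi>. \<bar>a \<xi> i\<bar>) \<xi> = t" and t0: "t \<ge> 0"
  shows "t * A \<le> prod_avg \<Omega> P (\<lambda>\<xi>. p (\<Sum>i<N. a \<xi> i *\<^sub>R e i)) \<xi>"
proof -
  interpret finite_law \<Omega> by fact
  obtain q where q: "\<And>a. q (\<lambda>i. \<bar>a i\<bar>) \<le> p (\<Sum>i<N. a i *\<^sub>R e i)"
    "\<And>a b. q (\<lambda>i. a i + b i) \<le> q a + q b" "\<And>c a. c \<ge> 0 \<Longrightarrow> q (\<lambda>i. c * a i) = c * q a"
    "A \<le> q (\<lambda>_. 1)"
    using e unfolding spread_def by meson
  \<comment> \<open>From \<open>N\<close> on, the coefficients do not affect the linear combination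
    but may affect \<open>q\<close>; the value \<open>t\<close> there makes the vector of means
    constant.\<close>
  define b where "b \<xi> i = (if i < N then \<bar>a \<xi> i\<bar> else t)" for \<xi> i
  have q0: "q (\<lambda>_. 0) = 0" using q(3)[of 0 "\<lambda>_. 0"] by simp
  have jensen: "q (\<lambda>i. prod_avg \<Omega> P' (\<lambda>\<xi>. b \<xi> i) \<xi>) \<le> prod_avg \<Omega> P' (\<lambda>\<xi>. q (b \<xi>)) \<xi>" for P' \<xi>
  proof (induction P' arbitrary: \<xi>)
    case (Suc P')
    have qs: "q (\<lambda>i. \<Sum>x\<in>S. g x i) \<le> (\<Sum>x\<in>S. q (g x))" for g :: "'o \<Rightarrow> nat \<Rightarrow> real" and S
      by (induction S rule: infinite_finite_induct) (auto simp: q0 intro: order_trans[OF q(2)])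
    let ?g = "\<lambda>x i. prod_avg \<Omega> P' (\<lambda>\<xi>. b \<xi> i) (\<xi>(P' := x))"
    have "q (\<lambda>i. prod_avg \<Omega> (Suc P') (\<lambda>\<xi>. b \<xi> i) \<xi>) = (1 / card \<Omega>) * q (\<lambda>i. \<Sum>x\<in>\<Omega>. ?g x i)"
      by (subst q(3)[symmetric]) (auto simp: coord_avg_def avg_def)
    also have "\<dots> \<le> (1 / card \<Omega>) * (\<Sum>x\<in>\<Omega>. q (?g x))"
      by (intro mult_left_mono qs) auto
    also have "\<dots> = avg \<Omega> (\<lambda>x. q (?g x))" by (simp add: avg_def)
    also have "\<dots> \<le> avg \<Omega> (\<lambda>x. prod_avg \<Omega> P' (\<lambda>\<xi>. q (b \<xi>)) (\<xi>(P' := x)))"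
      by (rule avg_mono) (rule Suc)
    finally show ?case by (simp add: coord_avg_def)
  qed simp
  have "(\<lambda>i. prod_avg \<Omega> P (\<lambda>\<xi>. b \<xi> i) \<xi>) = (\<lambda>i. t * 1)"
  proof
    fix i
    show "prod_avg \<Omega> P (\<lambda>\<xi>. b \<xi> i) \<xi> = t * 1"
      by (cases "i < N") (simp_all add: b_def t)
  qed
  then have "t * A \<le> q (\<lambda>i. prod_avg \<Omega> P (\<lambda>\<xi>. b \<xi> i) \<xi>)"
    using q(3)[OF t0, of "\<lambda>_. 1"] q(4) t0 by (simp add: mult_left_mono)
  also have "\<dots> \<le> prod_avg \<Omega> P (\<lambda>\<xi>. q (b \<xi>)) \<xi>" by (rule jensen)
  also have "\<dots> \<le> prod_avg \<Omega> P (\<lambda>\<xi>. p (\<Sum>i<N. a \<xi> i *\<^sub>R e i)) \<xi>"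
  proof (rule prod_avg_mono)
    fix \<xi>
    have "b \<xi> = (\<lambda>i. \<bar>if i < N then a \<xi> i else t\<bar>)" using t0 by (auto simp: b_def)
    then have "q (b \<xi>) \<le> p (\<Sum>i<N. (if i < N then a \<xi> i else t) *\<^sub>R e i)"
      using q(1)[of "\<lambda>i. if i < N then a \<xi> i else t"] by simp
    then show "q (b \<xi>) \<le> p (\<Sum>i<N. a \<xi> i *\<^sub>R e i)" by simp
  qed
  finally show ?thesis .
qed

end

lemma sqdist_block_sum_upd:
  fixes h :: "nat \<Rightarrow> 'h::real_inner"
  assumes m: "m > 0"
  shows "sqdist N (block_sum m (h(q := a))) (block_sum m (h(q := b))) \<le> (norm (a - b))^2"
proof (cases "q < N * m")
  case True
  define i j where "i = q div m" and "j = q mod m"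
  have q: "q = i * m + j" and ij: "i < N" "j < m"
    using True m by (auto simp: i_def j_def less_mult_imp_div_less)
  have "block_sum m (h(q := a)) i' - block_sum m (h(q := b)) i' = (if i' = i then (1 / sqrt m) *\<^sub>R (a - b) else 0)" for i'
    unfolding q block_sum_upd[OF ij] by (simp add: algebra_simps)
  then have "sqdist N (block_sum m (h(q := a))) (block_sum m (h(q := b)))
      = (\<Sum>i'<N. if i' = i then (norm ((1 / sqrt m) *\<^sub>R (a - b)))^2 else 0)"
    unfolding sqdist_def by (intro sum.cong) auto
  also have "\<dots> = (norm (a - b))^2 / m"
    using ij by (simp add: power_mult_distrib power_divide)
  also have "\<dots> \<le> (norm (a - b))^2 / 1"
    using m by (intro divide_left_mono) auto
  finally show ?thesis by simp
next
  case False
  have "block_sum m (h(q := a)) i = block_sum m (h(q := b)) i" if "i < N" for i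
    by (rule block_sum_cong[OF that]) (use False in auto)
  then show ?thesis by (simp add: sqdist_def)
qed

lemma avg_times_bool:
  assumes "finite W"
  shows "avg ((UNIV :: bool set) \<times> W) g = (avg W (\<lambda>w. g (True, w)) + avg W (\<lambda>w. g (False, w))) / 2"
proof -
  have "(\<Sum>x\<in>(UNIV :: bool set) \<times> W. g x) = (\<Sum>b\<in>UNIV. \<Sum>w\<in>W. g (b, w))"
    by (simp add: sum.cartesian_product)
  then show ?thesis
    by (simp add: avg_def UNIV_bool card_cartesian_product add_divide_distrib)
qed

context seminorm
begin

text \<open>Everything is decided by second moments. The regularized functions and the regularized
  norm have variances bounded independently of \<open>N\<close>, so that the sum of their normalized
  squared deviations has mean at most \<open>T\<close>, and one outcome \<open>\<xi>\<close> serves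
  them all. The means for different reflections agree approximately, because reflecting the argument
  amounts to reflecting the \<open>z i\<close>, and the law of their summands is almost invariant.
  The constants depend on each other in one direction only: \<open>s\<close> and \<open>D\<close>
  come before the system \<open>e\<close>, then comes \<open>m\<close>, and the law is last.\<close>

lemma almost_invariant_map_aux:
  fixes f :: "'i \<Rightarrow> (nat \<Rightarrow> 'b) \<Rightarrow> real" and x :: "'i \<Rightarrow> nat \<Rightarrow> fseq" and V :: "fseq set"
  assumes spread: "\<And>A. \<exists>N e. spread A N e"
    and V: "finite V" "0 \<in> V" and supp: "\<And>v i. v \<in> V \<Longrightarrow> k \<le> i \<Longrightarrow> coord v i = 0" and k: "0 < k"
    and I: "finite I" and f0: "\<And>i y. i \<in> I \<Longrightarrow> 0 \<le> f i y" and fB: "\<And>i y. i \<in> I \<Longrightarrow> f i y \<le> B"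
    and uc: "\<And>\<epsilon>. \<epsilon> > 0 \<Longrightarrow> \<exists>\<delta>>0. \<forall>i\<in>I. \<forall>y y'. (\<forall>t<n. p (y t - y' t) \<le> \<delta>) \<longrightarrow> \<bar>f i y - f i y'\<bar> \<le> \<epsilon>"
    and xC: "\<And>i t. i \<in> I \<Longrightarrow> t < n \<Longrightarrow> norm (x i t) \<le> C"
    and \<epsilon>: "0 < \<epsilon>" and B: "1 \<le> B" and C: "1 \<le> C"
  shows "\<exists>U c. linear U \<and> c < k \<and> \<bar>p (U (unit_seq c)) - 1\<bar> \<le> \<epsilon> \<and>
    (\<forall>i\<in>I. \<forall>v\<in>V. \<bar>f i (\<lambda>t. U (x i t)) - f i (\<lambda>t. U (reflect v (x i t)))\<bar> \<le> 7 * \<epsilon>)"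
proof -
  \<comment> \<open>One unit for the norm and one for each pair of a function and a reflection: this
    bounds the mean of \<open>S\<close> below.\<close>
  define T where "T = 1 + real (card I * card V)"
  have T: "T \<ge> 1" by (simp add: T_def)
  \<comment> \<open>If the squared deviations divided by \<open>\<tau>\<close> sum to at most
    \<open>T\<close>, each deviation is at most \<open>\<epsilon>\<close>.\<close>
  define \<tau> where "\<tau> = \<epsilon>^2 / T"
  have \<tau>: "\<tau> > 0" using \<epsilon> T by (simp add: \<tau>_def)
  \<comment> \<open>Near-minimizers lie within squared distance \<open>D\<close>, which is of order
    \<open>s\<close>, so the variance bound \<open>8 * D / s^2\<close> decreases like
    \<open>1 / s\<close>.\<close>
  define s where "s = max 1 (16 * (2 * B + 2) / \<tau>)"
  have s: "s \<ge> 1" "s > 0" by (auto simp: s_def)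
  define D where "D = 2 * s * B + 2"
  have D: "D > 0" using s B by (simp add: D_def add_nonneg_pos)
  have sD: "8 * D / s^2 \<le> \<tau> / 2"
  proof -
    have "D \<le> s * (2 * B + 2)" using s by (simp add: D_def algebra_simps)
    then have "8 * D / s^2 \<le> 8 * (s * (2 * B + 2)) / s^2" by (intro divide_right_mono) auto
    also have "\<dots> = 8 * (2 * B + 2) / s" using s by (simp add: power2_eq_square)
    also have "\<dots> \<le> \<tau> / 2"
    proof -
      have "16 * (2 * B + 2) / \<tau> \<le> s" by (simp add: s_def)
      then have "16 * (2 * B + 2) \<le> s * \<tau>" using \<tau> by (simp add: pos_divide_le_eq)
      then show ?thesis using s by (simp add: pos_divide_le_eq mult.commute)
    qed
    finally show ?thesis .
  qed
  obtain \<delta> where \<delta>: "\<delta> > 0" and uc\<delta>: "\<And>i y y'. i \<in> I \<Longrightarrow> (\<And>t. t < n \<Longrightarrow> p (y t - y' t) \<le> \<delta>) \<Longrightarrow> \<bar>f i y - f i y'\<bar> \<le> \<epsilon>"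
    using uc[OF \<epsilon>] by (elim exE conjE) (rule that, auto)
  \<comment> \<open>The required size of the mean norm: large enough that a move of \<open>z\<close>
    by \<open>sqrt D\<close> changes the images of the \<open>x i t\<close> by at most
    \<open>\<delta>\<close> after normalization, and that a deviation by
    \<open>4 + 10 * sqrt T\<close> is at most the fraction \<open>\<epsilon>\<close> of it.\<close>
  define A0 where "A0 = max (max 1 (C * sqrt D / \<delta>)) ((4 + 10 * sqrt T) / \<epsilon>)"
  have A0: "A0 \<ge> 1" "C * sqrt D / \<delta> \<le> A0" "(4 + 10 * sqrt T) / \<epsilon> \<le> A0" by (auto simp: A0_def)
  define ck where "ck = 1 / (2 * real k * sqrt (8 * real k))"
  have ck: "ck > 0" using k by (simp add: ck_def)
  \<comment> \<open>\<open>ck\<close> bounds the mean modulus of a coordinate of \<open>z i\<close>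
    from below; 4 is the loss in passing from the norm to its infimal convolution.\<close>
  define A where "A = (A0 + 4) / ck"
  have A: "A > 0" using A0 ck by (simp add: A_def)
  obtain N e where e: "spread A N e" using spread by blast
  have e2: "p (\<Sum>i<N. a i *\<^sub>R e i) \<le> sqrt (\<Sum>i<N. (a i)^2)" for a
    using e by (simp add: spread_def)
  \<comment> \<open>\<open>m\<close> is chosen after \<open>N\<close>, so large that the second term
    of the variance bound and the tolerance of the near-minimizers become negligible.\<close>
  obtain m :: nat where "real m > N + 36 * N / \<tau> + 1 / \<epsilon> + 1" using reals_Archimedean2 by blast
  moreover have "0 \<le> 36 * N / \<tau>" "0 \<le> 1 / \<epsilon>" using \<tau> \<epsilon> by auto
  ultimately have mm: "real m \<ge> 1" "real m \<ge> N" "36 * N / \<tau> \<le> m" "1 / \<epsilon> \<le> m" by linarith+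
  then have m: "m > 0" by simp
  have m\<tau>: "18 * N / (m * s^2) \<le> \<tau> / 2"
  proof -
    have "36 * real N \<le> m * \<tau> * 1" using mm(3) \<tau> by (simp add: pos_divide_le_eq)
    also have "m * \<tau> * 1 \<le> m * \<tau> * s^2"
      by (intro mult_left_mono) (use s \<tau> in auto)
    finally show ?thesis using m s by (simp add: field_simps)
  qed
  have mN: "18 * real N / (real m * 1^2) \<le> 18" using mm m by (simp add: pos_divide_le_eq)
  have \<eta>: "1 / (m * s) \<le> \<epsilon>" "1 / (real m * s) \<le> 1"
  proof -
    have "1 / (m * s) \<le> 1 / real m" using s m by (intro divide_left_mono) auto
    also have "\<dots> \<le> \<epsilon>" using mm(4) \<epsilon> m by (simp add: field_simps)
    finally show "1 / (m * s) \<le> \<epsilon>" .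
    have "1 * 1 \<le> real m * s" using mm s by (intro mult_mono) auto
    then show "1 / (real m * s) \<le> 1" by simp
  qed
  define P where "P = N * m"
  define \<epsilon>' where "\<epsilon>' = \<epsilon> / (2 * P + 2)"
  have \<epsilon>': "\<epsilon>' > 0" "P * (2 * \<epsilon>') \<le> \<epsilon>" using \<epsilon> by (auto simp: \<epsilon>'_def field_simps)
  obtain \<delta>2 where \<delta>2: "\<delta>2 > 0" and uc\<delta>2: "\<And>i y y'. i \<in> I \<Longrightarrow> (\<And>t. t < n \<Longrightarrow> p (y t - y' t) \<le> \<delta>2) \<Longrightarrow> \<bar>f i y - f i y'\<bar> \<le> \<epsilon>'"
    using uc[OF \<epsilon>'(1)] by (elim exE conjE) (rule that, auto)
  define \<delta>' where "\<delta>' = \<delta>2 * A0 / C"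
  have \<delta>': "\<delta>' > 0" using \<delta>2 A0 C by (simp add: \<delta>'_def)
  define x0 where "x0 = unit_seq 0"
  have x0: "norm x0 = 1" "k \<le> i \<Longrightarrow> coord x0 i = 0" for i using k by (auto simp: x0_def)
  obtain l where osc: "\<And>\<Psi> g h. \<lbrakk>\<And>y. \<bar>\<Psi> y\<bar> \<le> B; \<And>y y'. norm (y - y') \<le> \<delta>' \<Longrightarrow> \<bar>\<Psi> y - \<Psi> y'\<bar> \<le> \<epsilon>';
      g \<in> lists V; h \<in> lists V\<rbrakk> \<Longrightarrow> \<bar>avg (words V l) (\<lambda>w. \<Psi> (reflects (g @ w) x0)) -
       avg (words V l) (\<lambda>w. \<Psi> (reflects (h @ w) x0))\<bar> \<le> 2 * \<epsilon>'"
  proof -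
    have "\<exists>l. \<forall>\<Psi>. (\<forall>x. \<bar>\<Psi> x\<bar> \<le> B) \<longrightarrow> (\<forall>x y. norm (x - y) \<le> \<delta>' \<longrightarrow> \<bar>\<Psi> x - \<Psi> y\<bar> \<le> \<epsilon>') \<longrightarrow>
      (\<forall>g\<in>lists V. \<forall>h\<in>lists V. \<bar>avg (words V l) (\<lambda>w. \<Psi> (reflects (g @ w) x0)) -
         avg (words V l) (\<lambda>w. \<Psi> (reflects (h @ w) x0))\<bar> \<le> 2 * \<epsilon>')"
      by (rule words_oscillation[of V k]) (use V supp x0 \<delta>' \<epsilon>' in auto)
    then show ?thesis by (elim exE) (rule that, blast)
  qed
  let ?W = "words V l"
  \<comment> \<open>The random sign centres the coordinates of the vectors \<open>pt z\<close>,
    which the words alone need not do.\<close>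
  define \<Omega> where "\<Omega> = (UNIV :: bool set) \<times> ?W"
  have finW: "finite ?W" using finite_words V by blast
  interpret finite_law \<Omega>
    using finW words_ne[OF V(2)] by unfold_locales (auto simp: \<Omega>_def)
  define pt where "pt = (\<lambda>(b, w). (if b then 1 else - 1) *\<^sub>R reflects w x0)"
  have npt: "norm (pt z) = 1" for z by (auto simp: pt_def x0 split: prod.split)
  have avg\<Omega>: "avg \<Omega> g = (avg ?W (\<lambda>w. g (True, w)) + avg ?W (\<lambda>w. g (False, w))) / 2" for g
    unfolding \<Omega>_def by (rule avg_times_bool[OF finW])
  have avgneg: "avg ?W (\<lambda>w. - g w) = - avg ?W g" for g
    by (simp add: avg_def sum_negf)
  \<comment> \<open>The squares of the \<open>k\<close> coordinates of a unit vector sum to 1, so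
    some coordinate has mean square at least \<open>1 / k\<close>. Which one depends on the law, and
    so the conclusion only speaks of some \<open>c\<close>.\<close>
  obtain c where c: "c < k" "avg \<Omega> (\<lambda>z. (coord (pt z) c)^2) \<ge> 1 / k"
  proof (rule ccontr)
    assume "\<not> thesis"
    then have "\<And>c. c < k \<Longrightarrow> avg \<Omega> (\<lambda>z. (coord (pt z) c)^2) < 1 / k" using that by force
    then have "(\<Sum>c<k. avg \<Omega> (\<lambda>z. (coord (pt z) c)^2)) < (\<Sum>c<k. 1 / k)"
      using k by (intro sum_strict_mono) auto
    also have "\<dots> = 1" using k by simp
    also have "(\<Sum>c<k. avg \<Omega> (\<lambda>z. (coord (pt z) c)^2)) = avg \<Omega> (\<lambda>z. \<Sum>c<k. (coord (pt z) c)^2)"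
      by (simp add: avg_sum)
    also have "\<dots> = avg \<Omega> (\<lambda>z. 1)"
    proof -
      have "(\<Sum>c<k. (coord (pt z) c)^2) = 1" if z: "z \<in> \<Omega>" for z
      proof -
        have "coord (pt z) i = 0" if "k \<le> i" for i
        proof -
          obtain b w where bw: "z = (b, w)" "w \<in> ?W" using z by (auto simp: \<Omega>_def)
          have "coord (reflects w x0) i = 0"
            by (rule reflects_supported[of _ k]) (use bw supp x0 that in \<open>auto simp: words_def\<close>)
          then show ?thesis using bw by (simp add: pt_def)
        qed
        then have "inner (pt z) (pt z) = (\<Sum>c<k. coord (pt z) c * coord (pt z) c)"
          by (intro inner_fseq_superset) (force simp: not_less[symmetric])+
        then show ?thesis using npt[of z] by (simp add: power2_eq_square norm_eq_1)
      qed
      then show ?thesis unfolding avg_def by simp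
    qed
    finally show False by simp
  qed
  define X where "X z = coord (pt z) c" for z
  have X1: "\<bar>X z\<bar> \<le> 1" for z using abs_coord_le_norm[of "pt z" c] npt[of z] by (simp add: X_def)
  have X0: "avg \<Omega> X = 0" unfolding avg\<Omega> X_def pt_def by (simp add: avgneg)
  define W where "W z y = (\<Sum>i<N. inner y (z i) *\<^sub>R e i)" for z and y :: fseq
  have W_lip: "p (W z y - W z' y) \<le> norm y * sqrt (sqdist N z z')" for z z' y
  proof -
    have "W z y - W z' y = (\<Sum>i<N. inner y (z i - z' i) *\<^sub>R e i)"
      by (simp add: W_def sum_subtractf[symmetric] scaleR_diff_left[symmetric] inner_diff_right)
    then have "p (W z y - W z' y) \<le> sqrt (\<Sum>i<N. (inner y (z i - z' i))^2)" using e2 by simp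
    also have "\<dots> \<le> sqrt (\<Sum>i<N. (norm y)^2 * (norm (z i - z' i))^2)"
    proof (intro real_sqrt_le_mono sum_mono)
      fix i
      have "\<bar>inner y (z i - z' i)\<bar> \<le> norm y * norm (z i - z' i)" by (rule Cauchy_Schwarz_ineq2)
      then have "\<bar>inner y (z i - z' i)\<bar>^2 \<le> (norm y * norm (z i - z' i))^2" by (intro power_mono) auto
      then show "(inner y (z i - z' i))^2 \<le> (norm y)^2 * (norm (z i - z' i))^2"
        by (simp add: power_mult_distrib)
    qed
    also have "\<dots> = norm y * sqrt (sqdist N z z')"
      by (simp add: sqdist_def sum_distrib_left[symmetric] real_sqrt_mult)
    finally show ?thesis .
  qed
  have W_lin: "linear (W z)" for z
    by (rule linearI) (simp_all add: W_def inner_add_left scaleR_add_left sum.distrib scaleR_sum_right)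
  \<comment> \<open>Reflections are self-adjoint, so precomposition with one is the same as
    reflecting all \<open>z i\<close>.\<close>
  have W_refl: "W (\<lambda>i. reflect v (z i)) y = W z (reflect v y)" for v z y
  proof -
    have "inner y (reflect v (z i)) = inner (reflect v y) (z i)" for i
      by (metis inner_reflect reflect_reflect)
    then show ?thesis by (simp add: W_def)
  qed
  define \<Phi>n where "\<Phi>n z = p (W z (unit_seq c))" for z
  have \<Phi>n0: "0 \<le> \<Phi>n z" for z by (simp add: \<Phi>n_def)
  have \<Phi>n_lip: "\<bar>\<Phi>n z - \<Phi>n y\<bar> \<le> sqrt (sqdist N z y)" for z y
    using abs_p_diff_le[of "W z (unit_seq c)" "W y (unit_seq c)"] W_lip[of z "unit_seq c" y]
    by (simp add: \<Phi>n_def)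
  \<comment> \<open>The norm is 1-Lipschitz in \<open>z\<close>, so the distance \<open>t\<close> to
    a near-minimizer satisfies \<open>t^2 / 2 \<le> t + 1\<close>.\<close>
  have near_n: "sqdist N z y \<le> 9" if "\<Phi>n y + sqdist N z y / (2 * 1) \<le> inf_conv N 1 \<Phi>n z + 1 / (m * 1)" for z y
  proof -
    define t where "t = sqrt (sqdist N z y)"
    have t: "t \<ge> 0" "t^2 = sqdist N z y" by (auto simp: t_def)
    have "inf_conv N 1 \<Phi>n z \<le> \<Phi>n z" using inf_conv_le[of 1 \<Phi>n N z z] \<Phi>n0 by simp
    moreover have "1 / (real m * 1) \<le> 1" using mm by simp
    ultimately have "t^2 / 2 \<le> t + 1" using that \<Phi>n_lip[of z y] t by (simp add: t_def[symmetric] abs_le_iff)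
    then have "t * t \<le> 2 * t + 2" by (simp add: power2_eq_square)
    have "t \<le> 3"
    proof (rule ccontr)
      assume "\<not> t \<le> 3"
      then have "3 * t \<le> t * t" by (intro mult_right_mono) auto
      then show False using \<open>t * t \<le> 2 * t + 2\<close> \<open>\<not> t \<le> 3\<close> by linarith
    qed
    then have "t^2 \<le> 3^2" using t by (intro power_mono) auto
    then show ?thesis using t by simp
  qed
  have near_n': "\<bar>\<Phi>n z - inf_conv N 1 \<Phi>n z\<bar> \<le> 4" for z
  proof -
    have "0 < 1 / real m" using m by simp
    then obtain y where y: "\<Phi>n y + sqdist N z y / (2 * 1) \<le> inf_conv N 1 \<Phi>n z + 1 / m"
      using inf_conv_near[of 1 \<Phi>n "1 / m" N z] \<Phi>n0 by auto
    then have "sqdist N z y \<le> 3^2" using near_n[of y z] by simp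
    then have "sqrt (sqdist N z y) \<le> 3" by (rule real_le_lsqrt[rotated]) simp
    moreover have "0 \<le> sqdist N z y / (2 * 1)" by simp
    moreover have "1 / real m \<le> 1" using mm by simp
    moreover have "inf_conv N 1 \<Phi>n z \<le> \<Phi>n z" using inf_conv_le[of 1 \<Phi>n N z z] \<Phi>n0 by simp
    ultimately show ?thesis using y \<Phi>n_lip[of z y] by linarith
  qed
  define \<xi>0 :: "nat \<Rightarrow> bool \<times> fseq list" where "\<xi>0 = undefined"
  define bs where "bs \<xi> = block_sum m (pt \<circ> \<xi>)" for \<xi>
  define E where "E F = prod_avg \<Omega> P F \<xi>0" for F
  \<comment> \<open>The normalization is the mean of the regularized norm, since it is this function
    whose variance is controlled.\<close>
  define A' where "A' = E (\<lambda>\<xi>. inf_conv N 1 \<Phi>n (bs \<xi>))"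
  have A': "A' \<ge> A0"
  proof -
    define t where "t = sum_avg X m (\<lambda>s. \<bar>s\<bar>) / sqrt m"
    have t: "t \<ge> ck" unfolding t_def ck_def
      using sum_avg_abs_ge[of X k m] X0 X1 k c(2) m unfolding X_def by simp
    have "t * A \<le> prod_avg \<Omega> P (\<lambda>\<xi>. p (\<Sum>i<N. inner (unit_seq c) (bs \<xi> i) *\<^sub>R e i)) \<xi>0"
    proof (rule spread_mean[OF _ e])
      fix i assume i: "i < N"
      have "\<bar>inner (unit_seq c) (bs \<xi> i)\<bar> = \<bar>\<Sum>j<m. X (\<xi> (i * m + j))\<bar> / sqrt m" for \<xi>
        by (simp add: bs_def block_sum_def X_def abs_mult)
      then have "prod_avg \<Omega> P (\<lambda>\<xi>. \<bar>inner (unit_seq c) (bs \<xi> i)\<bar>) \<xi>0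
          = prod_avg \<Omega> P (\<lambda>\<xi>. (\<lambda>s. \<bar>s\<bar> / sqrt m) (\<Sum>j<m. X (\<xi> (i * m + j)))) \<xi>0" by simp
      also have "\<dots> = sum_avg X m (\<lambda>s. \<bar>s\<bar> / sqrt m)"
      proof (rule prod_avg_sum_avg)
        fix j assume "j < m"
        then have "i * m + j < Suc i * m" by simp
        also have "\<dots> \<le> N * m" using i by (intro mult_right_mono) auto
        finally show "i * m + j < P" by (simp add: P_def)
      qed (auto simp: inj_on_def)
      also have "\<dots> = t" using sum_avg_cmult[of X m "1 / sqrt m" "\<lambda>s. \<bar>s\<bar>"] by (simp add: t_def)
      finally show "prod_avg \<Omega> P (\<lambda>\<xi>. \<bar>inner (unit_seq c) (bs \<xi> i)\<bar>) \<xi>0 = t" .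
    next
      show "finite_law \<Omega>" by unfold_locales
      show "0 \<le> t" using t ck by linarith
    qed
    also have "\<dots> = E (\<lambda>\<xi>. \<Phi>n (bs \<xi>))" by (simp add: E_def \<Phi>n_def W_def)
    also have "\<dots> \<le> E (\<lambda>\<xi>. inf_conv N 1 \<Phi>n (bs \<xi>) + 4)"
      unfolding E_def by (rule prod_avg_mono) (use near_n' in \<open>smt (verit)\<close>)
    also have "\<dots> = A' + 4" by (simp add: E_def A'_def prod_avg_add)
    finally have "t * A \<le> A' + 4" .
    moreover have "ck * A \<le> t * A" using t A by (intro mult_right_mono) auto
    moreover have "ck * A = A0 + 4" using ck by (simp add: A_def)
    ultimately show ?thesis by linarith
  qed
  have A'pos: "A' > 0" using A' A0 by linarith
  define \<Phi> where "\<Phi> i z = f i (\<lambda>t. (1 / A') *\<^sub>R W z (x i t))" for i z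
  have \<Phi>0: "0 \<le> \<Phi> i z" and \<Phi>B: "\<Phi> i z \<le> B" if "i \<in> I" for i z
    using f0[OF that] fB[OF that] by (auto simp: \<Phi>_def)
  have W_lip': "p ((1 / A') *\<^sub>R W z (x i t) - (1 / A') *\<^sub>R W z' (x i t)) \<le> C / A0 * r"
    if it: "i \<in> I" "t < n" and r: "sqrt (sqdist N z z') \<le> r" for i t z z' r
  proof -
    have "p ((1 / A') *\<^sub>R W z (x i t) - (1 / A') *\<^sub>R W z' (x i t)) = (1 / A') * p (W z (x i t) - W z' (x i t))"
      using A'pos by (simp add: scaleR_diff_right[symmetric] scale)
    also have "\<dots> \<le> (1 / A0) * (C * r)"
    proof (rule mult_mono)
      show "1 / A' \<le> 1 / A0" using A' A0 by (intro divide_left_mono) auto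
      have "p (W z (x i t) - W z' (x i t)) \<le> norm (x i t) * sqrt (sqdist N z z')" by (rule W_lip)
      also have "\<dots> \<le> C * r" using xC[OF it] r C by (intro mult_mono) auto
      finally show "p (W z (x i t) - W z' (x i t)) \<le> C * r" .
    qed (use A0 in auto)
    finally show ?thesis by simp
  qed
  have \<Phi>near: "sqdist N z y \<le> D" if "i \<in> I" "\<Phi> i y + sqdist N z y / (2 * s) \<le> inf_conv N s (\<Phi> i) z + 1 / (m * s)"
    for i z y
  proof -
    have "inf_conv N s (\<Phi> i) z \<le> \<Phi> i z" using inf_conv_le[of s "\<Phi> i" N z z] \<Phi>0 s that by simp
    then have "sqdist N z y / (2 * s) \<le> B + 1 / (m * s)"
      using that \<Phi>0[of i y] \<Phi>B[of i z] by linarith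
    then have "sqdist N z y \<le> (B + 1 / (m * s)) * (2 * s)"
      using s by (simp add: pos_divide_le_eq)
    also have "\<dots> = 2 * s * B + 2 / m" using s m by (simp add: field_simps)
    also have "\<dots> \<le> D" using mm m by (simp add: D_def field_simps)
    finally show ?thesis .
  qed
  \<comment> \<open>A near-minimizer \<open>y\<close> is within \<open>sqrt D\<close> of
    \<open>z\<close>, a distance that the normalized map hardly sees; the regularization therefore
    costs only \<open>2 * \<epsilon>\<close>.\<close>
  have \<Phi>close: "\<bar>\<Phi> i z - inf_conv N s (\<Phi> i) z\<bar> \<le> 2 * \<epsilon>" if i: "i \<in> I" for i z
  proof -
    have "1 / (m * s) > 0" using m s by simp
    then obtain y where y: "\<Phi> i y + sqdist N z y / (2 * s) \<le> inf_conv N s (\<Phi> i) z + 1 / (m * s)"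
      using inf_conv_near[of s "\<Phi> i" "1 / (m * s)" N z] \<Phi>0[OF i] s by auto
    have sq: "sqrt (sqdist N z y) \<le> sqrt D" using \<Phi>near[OF i y] by simp
    have "\<bar>\<Phi> i z - \<Phi> i y\<bar> \<le> \<epsilon>"
      unfolding \<Phi>_def
    proof (rule uc\<delta>[OF i])
      fix t assume "t < n"
      then have "p ((1 / A') *\<^sub>R W z (x i t) - (1 / A') *\<^sub>R W y (x i t)) \<le> C / A0 * sqrt D"
        using W_lip'[OF i _ sq] by blast
      also have "\<dots> \<le> \<delta>" using A0(1,2) \<delta> by (simp add: field_simps)
      finally show "p ((1 / A') *\<^sub>R W z (x i t) - (1 / A') *\<^sub>R W y (x i t)) \<le> \<delta>" .
    qed
    moreover have "inf_conv N s (\<Phi> i) z \<le> \<Phi> i z" using inf_conv_le[of s "\<Phi> i" N z z] \<Phi>0 s i by simp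
    moreover have "0 \<le> sqdist N z y / (2 * s)" using s by simp
    ultimately show ?thesis using y \<eta>(1) by (simp add: abs_le_iff)
  qed
  define F where "F i h = inf_conv N s (\<Phi> i) (block_sum m h)" for i h
  have FB: "\<bar>F i h\<bar> \<le> B" if "i \<in> I" for i h
    using inf_conv_nonneg[of s "\<Phi> i" N "block_sum m h"] inf_conv_le[of s "\<Phi> i" N "block_sum m h" "block_sum m h"]
      \<Phi>0[OF that] \<Phi>B[OF that, of "block_sum m h"] s by (simp add: F_def)
  \<comment> \<open>Changing one summand translates the block sums, and translations pass through
    the infimal convolution. The finer modulus \<open>\<delta>2\<close> is needed here because the
    resulting error will be multiplied by the number \<open>P\<close> of summands.\<close>
  have Fcont: "\<bar>F i (h(q := a)) - F i (h(q := b))\<bar> \<le> \<epsilon>'" if i: "i \<in> I" and ab: "norm (a - b) \<le> \<delta>'" for i h q a b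
  proof -
    define z d where "z = block_sum m (h(q := b))" and "d i = block_sum m (h(q := a)) i - block_sum m (h(q := b)) i" for i
    have za: "block_sum m (h(q := a)) = (\<lambda>i. z i + d i)" by (auto simp: z_def d_def)
    have "\<bar>\<Phi> i (\<lambda>j. y j + d j) - \<Phi> i y\<bar> \<le> \<epsilon>'" for y
      unfolding \<Phi>_def
    proof (rule uc\<delta>2[OF i])
      fix t assume t: "t < n"
      have "sqdist N (\<lambda>j. y j + d j) y = sqdist N (block_sum m (h(q := a))) (block_sum m (h(q := b)))"
        by (simp add: sqdist_def d_def)
      also have "\<dots> \<le> (norm (a - b))^2" by (rule sqdist_block_sum_upd[OF m])
      also have "\<dots> \<le> \<delta>'^2" using ab by (intro power_mono) auto
      finally have "sqrt (sqdist N (\<lambda>j. y j + d j) y) \<le> \<delta>'"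
        using \<delta>' by (intro real_le_lsqrt) auto
      from W_lip'[OF i t this] A0 C
      show "p ((1 / A') *\<^sub>R W (\<lambda>j. y j + d j) (x i t) - (1 / A') *\<^sub>R W y (x i t)) \<le> \<delta>2"
        by (simp add: \<delta>'_def)
    qed
    then show ?thesis
      unfolding F_def za z_def[symmetric] by (intro inf_conv_translate) (use s \<Phi>0[OF i] in auto)
  qed
  have Fsupp: "F i h = F i h'" if "\<And>q. q < P \<Longrightarrow> h q = h' q" for i h h'
    unfolding F_def by (intro inf_conv_cong block_sum_cong) (use that in \<open>auto simp: P_def\<close>)
  define cc where "cc i v = E (\<lambda>\<xi>. F i (reflect v \<circ> pt \<circ> \<xi>))" for i v
  have inv: "\<bar>cc i v - cc i 0\<bar> \<le> \<epsilon>" if i: "i \<in> I" and v: "v \<in> V" for i v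
  proof -
    have "\<bar>avg \<Omega> (\<lambda>z. F i (h(q := (reflect v \<circ> pt) z))) - avg \<Omega> (\<lambda>z. F i (h(q := pt z)))\<bar> \<le> 2 * \<epsilon>'" for h q
    proof -
      \<comment> \<open>Almost invariance of averages over words: those continued to the left by
        \<open>v\<close> are compared with the words themselves, once for each sign.\<close>
      have 1: "\<bar>avg ?W (\<lambda>w. F i (h(q := \<sigma> *\<^sub>R reflects ([v] @ w) x0)))
          - avg ?W (\<lambda>w. F i (h(q := \<sigma> *\<^sub>R reflects ([] @ w) x0)))\<bar> \<le> 2 * \<epsilon>'"
        if \<sigma>: "\<bar>\<sigma>\<bar> = 1" for \<sigma> :: real
      proof (rule osc[of "\<lambda>y. F i (h(q := \<sigma> *\<^sub>R y))"])
        fix y y' :: fseq assume "norm (y - y') \<le> \<delta>'"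
        then have "norm (\<sigma> *\<^sub>R y - \<sigma> *\<^sub>R y') \<le> \<delta>'"
          using \<sigma> by (simp add: scaleR_diff_right[symmetric])
        then show "\<bar>F i (h(q := \<sigma> *\<^sub>R y)) - F i (h(q := \<sigma> *\<^sub>R y'))\<bar> \<le> \<epsilon>'" by (rule Fcont[OF i])
      qed (use FB[OF i] v in auto)
      have 2: "reflect v (- y) = - reflect v y" for y by (rule linear_neg[OF linear_reflect])
      show ?thesis
        unfolding avg\<Omega> using 1[of 1] 1[of "-1"]
        by (simp add: pt_def o_def 2) (auto simp: abs_le_iff field_simps)
    qed
    from prod_avg_replace[of "F i" "reflect v \<circ> pt" pt "2 * \<epsilon>'" P \<xi>0, OF this Fsupp]
    have "\<bar>cc i v - cc i 0\<bar> \<le> P * (2 * \<epsilon>')"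
      by (simp add: cc_def E_def o_assoc)
    then show ?thesis using \<epsilon>' by linarith
  qed
  \<comment> \<open>The variance of the regularized norm is at most \<open>8 * 9 + 18 = 90\<close>,
    whence the divisor 100.\<close>
  define S where "S \<xi> = (inf_conv N 1 \<Phi>n (bs \<xi>) - A')^2 / 100
      + (\<Sum>(i, v)\<in>I \<times> V. (F i (reflect v \<circ> pt \<circ> \<xi>) - cc i v)^2 / \<tau>)" for \<xi>
  have "E S \<le> T"
  proof -
    have 1: "E (\<lambda>\<xi>. (inf_conv N 1 \<Phi>n (bs \<xi>) - A')^2) \<le> 100"
    proof -
      have "prod_avg \<Omega> (N * m) (\<lambda>\<xi>'. (inf_conv N 1 \<Phi>n (block_sum m (pt \<circ> \<xi>')) -
          prod_avg \<Omega> (N * m) (\<lambda>\<xi>. inf_conv N 1 \<Phi>n (block_sum m (pt \<circ> \<xi>))) \<xi>0)^2) \<xi>0 \<le> 8 * 9 / 1^2 + 18 * N / (real m * (1::real)^2)"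
        by (rule inf_conv_variance) (use npt m \<Phi>n0 near_n in auto)
      then show ?thesis using mN by (simp add: E_def A'_def bs_def P_def)
    qed
    have 2: "E (\<lambda>\<xi>. (F i (reflect v \<circ> pt \<circ> \<xi>) - cc i v)^2) \<le> \<tau>" if i: "i \<in> I" for i v
    proof -
      have "prod_avg \<Omega> (N * m) (\<lambda>\<xi>'. (inf_conv N s (\<Phi> i) (block_sum m ((reflect v \<circ> pt) \<circ> \<xi>')) -
          prod_avg \<Omega> (N * m) (\<lambda>\<xi>. inf_conv N s (\<Phi> i) (block_sum m ((reflect v \<circ> pt) \<circ> \<xi>))) \<xi>0)^2) \<xi>0
          \<le> 8 * D / s^2 + 18 * N / (m * s^2)"
        by (rule inf_conv_variance) (use npt m \<Phi>0[OF i] \<Phi>near[OF i] s in auto)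
      then show ?thesis using sD m\<tau> by (simp add: E_def cc_def F_def P_def)
    qed
    have "E S = (1 / 100) * E (\<lambda>\<xi>. (inf_conv N 1 \<Phi>n (bs \<xi>) - A')^2)
      + (\<Sum>(i, v)\<in>I \<times> V. (1 / \<tau>) * E (\<lambda>\<xi>. (F i (reflect v \<circ> pt \<circ> \<xi>) - cc i v)^2))"
      unfolding E_def S_def prod_avg_cmult[symmetric] prod_avg_add
      by (simp add: prod_avg_sum case_prod_unfold)
    also have "(\<Sum>(i, v)\<in>I \<times> V. (1 / \<tau>) * E (\<lambda>\<xi>. (F i (reflect v \<circ> pt \<circ> \<xi>) - cc i v)^2))
      \<le> (\<Sum>(i, v)\<in>I \<times> V. 1)"
    proof (rule sum_mono, clarsimp)
      fix i v assume "i \<in> I"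
      then show "E (\<lambda>\<xi>. (F i (reflect v \<circ> pt \<circ> \<xi>) - cc i v)^2) / \<tau> \<le> 1"
        using 2 \<tau> by (simp add: pos_divide_le_eq)
    qed
    finally show ?thesis using 1 by (simp add: T_def card_cartesian_product)
  qed
  then obtain \<xi> where \<xi>: "S \<xi> \<le> T"
    using prod_avg_exists_le[of S P \<xi>0] by (auto simp: E_def intro: order_trans)
  have nn: "0 \<le> (F i (reflect v \<circ> pt \<circ> \<xi>) - cc i v)^2 / \<tau>" for i v using \<tau> by simp
  have sum0: "0 \<le> (\<Sum>(i, v)\<in>I \<times> V. (F i (reflect v \<circ> pt \<circ> \<xi>) - cc i v)^2 / \<tau>)"
    by (rule sum_nonneg) (use \<tau> in auto)
  have \<xi>n: "\<bar>inf_conv N 1 \<Phi>n (bs \<xi>) - A'\<bar> \<le> 10 * sqrt T"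
  proof -
    have "(inf_conv N 1 \<Phi>n (bs \<xi>) - A')^2 \<le> (10 * sqrt T)^2"
      using \<xi> sum0 T by (simp add: S_def power_mult_distrib)
    then have "\<bar>inf_conv N 1 \<Phi>n (bs \<xi>) - A'\<bar> \<le> \<bar>10 * sqrt T\<bar>" by (simp only: abs_le_square_iff)
    then show ?thesis using T by simp
  qed
  have \<xi>F: "\<bar>F i (reflect v \<circ> pt \<circ> \<xi>) - cc i v\<bar> \<le> \<epsilon>" if iv: "i \<in> I" "v \<in> V" for i v
  proof -
    have "(F i (reflect v \<circ> pt \<circ> \<xi>) - cc i v)^2 / \<tau> \<le> (\<Sum>(i, v)\<in>I \<times> V. (F i (reflect v \<circ> pt \<circ> \<xi>) - cc i v)^2 / \<tau>)"
      using member_le_sum[of "(i, v)" "I \<times> V" "\<lambda>(i, v). (F i (reflect v \<circ> pt \<circ> \<xi>) - cc i v)^2 / \<tau>"]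
        iv I V \<tau> by auto
    also have "\<dots> \<le> T" using \<xi> unfolding S_def by (smt (verit) divide_nonneg_nonneg zero_le_power2)
    finally have "(F i (reflect v \<circ> pt \<circ> \<xi>) - cc i v)^2 \<le> T * \<tau>" using \<tau> by (simp add: pos_divide_le_eq)
    then have "(F i (reflect v \<circ> pt \<circ> \<xi>) - cc i v)^2 \<le> \<epsilon>^2" using T by (simp add: \<tau>_def)
    then show ?thesis using \<epsilon> by (metis abs_le_square_iff abs_of_pos)
  qed
  define U where "U y = (1 / A') *\<^sub>R W (bs \<xi>) y" for y
  have linU: "linear U"
    by (rule linearI)
       (simp_all add: U_def linear_add[OF W_lin] linear_scale[OF W_lin] scaleR_add_right)
  have "\<bar>p (U (unit_seq c)) - 1\<bar> \<le> \<epsilon>"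
  proof -
    have "\<bar>\<Phi>n (bs \<xi>) - A'\<bar> \<le> 4 + 10 * sqrt T" using \<xi>n near_n'[of "bs \<xi>"] by linarith
    also have "\<dots> \<le> A0 * \<epsilon>" using A0(3) \<epsilon> by (simp add: pos_divide_le_eq)
    also have "\<dots> \<le> A' * \<epsilon>" using A' \<epsilon> by (intro mult_right_mono) auto
    finally have "\<bar>\<Phi>n (bs \<xi>) - A'\<bar> / A' \<le> \<epsilon>" using A'pos by (simp add: pos_divide_le_eq mult.commute)
    moreover have "p (U (unit_seq c)) - 1 = (\<Phi>n (bs \<xi>) - A') / A'"
      using A'pos by (simp add: U_def scale \<Phi>n_def diff_divide_distrib)
    ultimately show ?thesis using A'pos by (simp add: abs_divide)
  qed
  moreover have "\<bar>f i (\<lambda>t. U (x i t)) - f i (\<lambda>t. U (reflect v (x i t)))\<bar> \<le> 7 * \<epsilon>" if iv: "i \<in> I" "v \<in> V" for i v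
  proof -
    have 1: "f i (\<lambda>t. U (reflect v (x i t))) = \<Phi> i (block_sum m (reflect v \<circ> pt \<circ> \<xi>))" for v
    proof -
      have "block_sum m (reflect v \<circ> pt \<circ> \<xi>) = (\<lambda>i. reflect v (bs \<xi> i))"
        using block_sum_linear[OF linear_reflect, of m v "pt \<circ> \<xi>"] by (auto simp: bs_def o_assoc)
      then show ?thesis by (simp add: \<Phi>_def U_def W_refl)
    qed
    have 2: "\<bar>f i (\<lambda>t. U (reflect v (x i t))) - F i (reflect v \<circ> pt \<circ> \<xi>)\<bar> \<le> 2 * \<epsilon>" for v
      unfolding 1 F_def using \<Phi>close[OF iv(1)] .
    \<comment> \<open>Regularization costs \<open>2 * \<epsilon>\<close> on each side, the
      deviations from the two means cost \<open>\<epsilon>\<close> each, and the difference of the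
      means another \<open>\<epsilon>\<close>.\<close>
    show ?thesis
      using 2[of v] 2[of 0] \<xi>F[OF iv] \<xi>F[OF iv(1) V(2)] inv[OF iv] by simp
  qed
  ultimately show ?thesis using linU c(1) by blast
qed

text \<open>To replace the unknown index \<open>c\<close> by 0, the norm, truncated to be bounded,
  joins the functions, and the reflections exchanging \<open>unit_seq 0\<close> with the other unit
  vectors join \<open>V\<close>. Adding \<open>B\<close> makes the given functions
  nonnegative.\<close>

lemma almost_invariant_map:
  fixes f :: "'i \<Rightarrow> (nat \<Rightarrow> 'b) \<Rightarrow> real" and x :: "'i \<Rightarrow> nat \<Rightarrow> fseq" and V :: "fseq set"
  assumes spread: "\<And>A. \<exists>N e. spread A N e"
    and V: "finite V" and I: "finite I" and fB: "\<And>i y. i \<in> I \<Longrightarrow> \<bar>f i y\<bar> \<le> B"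
    and uc: "\<And>\<epsilon>. \<epsilon> > 0 \<Longrightarrow> \<exists>\<delta>>0. \<forall>i\<in>I. \<forall>y y'. (\<forall>t<n. p (y t - y' t) \<le> \<delta>) \<longrightarrow> \<bar>f i y - f i y'\<bar> \<le> \<epsilon>"
    and \<epsilon>: "0 < \<epsilon>"
  shows "\<exists>U. linear U \<and> \<bar>p (U (unit_seq 0)) - 1\<bar> \<le> \<epsilon> \<and>
    (\<forall>i\<in>I. \<forall>v\<in>V. \<bar>f i (\<lambda>t. U (x i t)) - f i (\<lambda>t. U (reflect v (x i t)))\<bar> \<le> \<epsilon>)"
proof -
  have "finite (\<Union>v\<in>V. {i. coord v i \<noteq> 0})" using V by simp
  then obtain k0 where k0: "\<forall>i\<in>(\<Union>v\<in>V. {i. coord v i \<noteq> 0}). i \<le> k0"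
    unfolding finite_nat_set_iff_bounded_le ..
  define k where "k = Suc k0"
  have kV: "coord v i = 0" if "v \<in> V" "k \<le> i" for v i
    using k0 that by (force simp: k_def)
  define V' where "V' = insert 0 V \<union> (\<lambda>c. unit_seq 0 - unit_seq c) ` {..<k}"
  define I' where "I' = insert None (Some ` I)"
  define f' where "f' i y = (case i of None \<Rightarrow> min (p (y 0)) 2 | Some i \<Rightarrow> f i y + B)" for i y
  define x' where "x' i t = (case i of None \<Rightarrow> unit_seq 0 | Some i \<Rightarrow> x i t)" for i t
  define n' where "n' = max n 1"
  \<comment> \<open>The total error \<open>8 * \<epsilon>0\<close> is also at most 1/2, so the
    truncation at 2 is not reached near norm 1.\<close>
  define \<epsilon>0 where "\<epsilon>0 = min (\<epsilon> / 8) (1 / 16)"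
  have \<epsilon>0: "\<epsilon>0 > 0" "8 * \<epsilon>0 \<le> \<epsilon>" "\<epsilon>0 \<le> 1 / 16" using \<epsilon> by (auto simp: \<epsilon>0_def)
  define C where "C = 1 + (\<Sum>i\<in>I. \<Sum>t<n'. norm (x i t))"
  have C0: "1 \<le> C" by (simp add: C_def sum_nonneg)
  have xC: "norm (x i t) \<le> C" if "i \<in> I" "t < n'" for i t
  proof -
    have "norm (x i t) \<le> (\<Sum>t<n'. norm (x i t))" using that by (intro member_le_sum) auto
    also have "\<dots> \<le> (\<Sum>i\<in>I. \<Sum>t<n'. norm (x i t))"
      using that I by (intro member_le_sum[of i I "\<lambda>i. \<Sum>t<n'. norm (x i t)"]) (auto intro: sum_nonneg)
    finally show ?thesis by (simp add: C_def)
  qed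
  have "\<exists>U c. linear U \<and> c < k \<and> \<bar>p (U (unit_seq c)) - 1\<bar> \<le> \<epsilon>0 \<and>
    (\<forall>i\<in>I'. \<forall>v\<in>V'. \<bar>f' i (\<lambda>t. U (x' i t)) - f' i (\<lambda>t. U (reflect v (x' i t)))\<bar> \<le> 7 * \<epsilon>0)"
  proof (rule almost_invariant_map_aux[where n = n' and B = "max 2 (2 * B)" and C = C])
    show "finite V'" "0 \<in> V'" "0 < k" "finite I'" "0 < \<epsilon>0" "1 \<le> max 2 (2 * B)" "1 \<le> C"
      using V I \<epsilon>0 C0 by (auto simp: V'_def k_def I'_def)
    show "coord v i = 0" if "v \<in> V'" "k \<le> i" for v i
      using that kV by (auto simp: V'_def)
    show "0 \<le> f' i y" if "i \<in> I'" for i y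
      using that fB[of _ y] by (fastforce simp: I'_def f'_def abs_le_iff split: option.split)
    show "f' i y \<le> max 2 (2 * B)" if "i \<in> I'" for i y
      using that fB[of _ y] by (fastforce simp: I'_def f'_def abs_le_iff split: option.split)
    show "norm (x' i t) \<le> C" if "i \<in> I'" "t < n'" for i t
      using that xC C0 by (auto simp: I'_def x'_def split: option.split)
    show "\<exists>N e. spread A N e" for A by (rule spread)
    fix \<epsilon> :: real assume "\<epsilon> > 0"
    from uc[OF this] obtain \<delta> where \<delta>: "\<delta> > 0"
      "\<And>i y y'. i \<in> I \<Longrightarrow> (\<And>t. t < n \<Longrightarrow> p (y t - y' t) \<le> \<delta>) \<Longrightarrow> \<bar>f i y - f i y'\<bar> \<le> \<epsilon>"
      by (elim exE conjE) (rule that, auto)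
    have "\<bar>f' i y - f' i y'\<bar> \<le> \<epsilon>" if "i \<in> I'" and y: "\<forall>t<n'. p (y t - y' t) \<le> min \<delta> \<epsilon>" for i y y'
    proof (cases i)
      case None
      have "p (y 0 - y' 0) \<le> \<epsilon>" using y by (auto simp: n'_def)
      then have "\<bar>p (y 0) - p (y' 0)\<bar> \<le> \<epsilon>" using abs_p_diff_le order_trans by blast
      then show ?thesis by (auto simp: None f'_def min_def abs_le_iff)
    next
      case (Some j)
      then show ?thesis using that \<delta>(2)[of j y y'] by (auto simp: f'_def I'_def n'_def)
    qed
    then show "\<exists>\<delta>>0. \<forall>i\<in>I'. \<forall>y y'. (\<forall>t<n'. p (y t - y' t) \<le> \<delta>) \<longrightarrow> \<bar>f' i y - f' i y'\<bar> \<le> \<epsilon>"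
      using \<delta>(1) \<open>\<epsilon> > 0\<close> by (intro exI[of _ "min \<delta> \<epsilon>"]) auto
  qed
  then obtain U c where U: "linear U" and c: "c < k" "\<bar>p (U (unit_seq c)) - 1\<bar> \<le> \<epsilon>0"
    and inv: "\<And>i v. i \<in> I' \<Longrightarrow> v \<in> V' \<Longrightarrow> \<bar>f' i (\<lambda>t. U (x' i t)) - f' i (\<lambda>t. U (reflect v (x' i t)))\<bar> \<le> 7 * \<epsilon>0"
    by blast
  have "\<bar>p (U (unit_seq 0)) - 1\<bar> \<le> \<epsilon>"
  proof -
    have "reflect (unit_seq 0 - unit_seq c) (unit_seq 0) = unit_seq c"
      by (rule reflect_diff_swap) simp
    then have "\<bar>min (p (U (unit_seq 0))) 2 - min (p (U (unit_seq c))) 2\<bar> \<le> 7 * \<epsilon>0"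
      using inv[of None "unit_seq 0 - unit_seq c"] c by (simp add: I'_def V'_def f'_def x'_def)
    then show ?thesis using c(2) \<epsilon>0 by (auto simp: min_def abs_le_iff split: if_splits)
  qed
  moreover have "\<bar>f i (\<lambda>t. U (x i t)) - f i (\<lambda>t. U (reflect v (x i t)))\<bar> \<le> \<epsilon>" if "i \<in> I" "v \<in> V" for i v
    using inv[of "Some i" v] that \<epsilon>0 by (auto simp: I'_def V'_def f'_def x'_def)
  ultimately show ?thesis using U by blast
qed

end

section \<open>Systems with an upper \<open>\<ell>\<^sub>2\<close>-estimate and large random combinations\<close>

context seminorm
begin

text \<open>Ramsey's theorem for sets of \<open>r\<close> indices, coloured by the rounded norms of
  all combinations with coefficients in a finite grid. Along a homogeneous set these norms are
  independent of the chosen indices up to the rounding.\<close>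

lemma spreading_subsequence_grid:
  fixes v :: "nat \<Rightarrow> 'b" and r D :: nat
  assumes v: "\<And>i. p (v i) \<le> 1" and D: "D > 0"
  shows "\<exists>g :: nat \<Rightarrow> nat. strict_mono g \<and> (\<forall>b :: nat \<Rightarrow> int. \<forall>\<sigma> \<sigma>' :: nat \<Rightarrow> nat. (\<forall>t<r. \<bar>b t\<bar> \<le> int D) \<longrightarrow>
    strict_mono_on {..<r} \<sigma> \<longrightarrow> strict_mono_on {..<r} \<sigma>' \<longrightarrow>
    \<bar>p (\<Sum>t<r. (b t / D) *\<^sub>R v (g (\<sigma> t))) - p (\<Sum>t<r. (b t / D) *\<^sub>R v (g (\<sigma>' t)))\<bar> \<le> 1 / D)"
proof -
  define B where "B = {..<r} \<rightarrow>\<^sub>E {- int D..int D}"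
  define val where "val b \<sigma> = p (\<Sum>t<r. (real_of_int (b t) / D) *\<^sub>R v (\<sigma> t))" for b :: "nat \<Rightarrow> int" and \<sigma>
  define col where "col X = (\<lambda>b\<in>B. \<lfloor>D * val b (\<lambda>t. sorted_list_of_set X ! t)\<rfloor>)" for X :: "nat set"
  define C where "C = B \<rightarrow>\<^sub>E {0..int (D * r)}"
  have finB: "finite B" unfolding B_def by (intro finite_PiE) auto
  have finC: "finite C" unfolding C_def using finB by (intro finite_PiE) auto
  have val: "0 \<le> val b \<sigma>" "b \<in> B \<Longrightarrow> val b \<sigma> \<le> r" for b \<sigma>
  proof -
    show "0 \<le> val b \<sigma>" by (simp add: val_def)
    assume b: "b \<in> B"
    have "val b \<sigma> \<le> (\<Sum>t<r. p ((real_of_int (b t) / D) *\<^sub>R v (\<sigma> t)))" unfolding val_def by (rule p_sum)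
    also have "\<dots> \<le> (\<Sum>t<r. 1 * 1)"
    proof (rule sum_mono)
      fix t assume "t \<in> {..<r}"
      then have "b t \<in> {- int D..int D}"
        using PiE_mem[of b "{..<r}" "\<lambda>_. {- int D..int D}" t] b by (simp add: B_def)
      then have "\<bar>real_of_int (b t)\<bar> \<le> D" by auto
      then have "\<bar>real_of_int (b t) / D\<bar> \<le> 1" using D by (simp add: abs_divide)
      then show "p ((real_of_int (b t) / D) *\<^sub>R v (\<sigma> t)) \<le> 1 * 1"
        unfolding scale using v by (intro mult_mono) auto
    qed
    finally show "val b \<sigma> \<le> r" by simp
  qed
  have "col X \<in> C" for X
  proof -
    have "\<lfloor>D * val b (\<lambda>t. sorted_list_of_set X ! t)\<rfloor> \<in> {0..int (D * r)}" if "b \<in> B" for b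
    proof -
      have "D * val b (\<lambda>t. sorted_list_of_set X ! t) \<le> D * real r"
        using val(2)[OF that] by (intro mult_left_mono) auto
      then have "\<lfloor>D * val b (\<lambda>t. sorted_list_of_set X ! t)\<rfloor> \<le> \<lfloor>real (D * r)\<rfloor>"
        by (intro floor_mono) simp
      then have "\<lfloor>D * val b (\<lambda>t. sorted_list_of_set X ! t)\<rfloor> \<le> int (D * r)"
        by (simp only: floor_of_nat)
      then show ?thesis using val(1) by (simp del: of_nat_mult)
    qed
    then show ?thesis unfolding col_def C_def restrict_PiE_iff by blast
  qed
  moreover obtain h where h: "bij_betw h C {0..<card C}"
    using ex_bij_betw_finite_nat[OF finC] by blast
  ultimately have "\<forall>X. X \<subseteq> UNIV \<and> finite X \<and> card X = r \<longrightarrow> h (col X) < card C"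
    by (auto simp: bij_betw_def)
  then obtain Y t where Y: "infinite Y" "\<And>X. X \<subseteq> Y \<Longrightarrow> finite X \<Longrightarrow> card X = r \<Longrightarrow> h (col X) = t"
    using Ramsey[of UNIV r "\<lambda>X. h (col X)" "card C"] by auto
  define g where "g = enumerate Y"
  have g: "strict_mono g" "\<And>i. g i \<in> Y"
    using Y(1) by (auto simp: g_def strict_mono_enumerate enumerate_in_set)
  have "\<bar>val b (g \<circ> \<sigma>) - val b (g \<circ> \<sigma>')\<bar> \<le> 1 / D"
    if b: "\<forall>t<r. \<bar>b t\<bar> \<le> int D" and \<sigma>: "strict_mono_on {..<r} \<sigma>" "strict_mono_on {..<r} \<sigma>'" for b and \<sigma> \<sigma>' :: "nat \<Rightarrow> nat"
  proof -
    define b' where "b' = restrict b {..<r}"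
    have b': "b' \<in> B" using b unfolding B_def b'_def restrict_PiE_iff by (auto simp: abs_le_iff)
    have vb: "val b \<sigma> = val b' \<sigma>" for \<sigma> by (simp add: val_def b'_def)
    define X where "X \<sigma> = (g \<circ> \<sigma>) ` {..<r}" for \<sigma>
    have X: "X \<sigma> \<subseteq> Y" "finite (X \<sigma>)" "card (X \<sigma>) = r" "val b' (g \<circ> \<sigma>) = val b' (\<lambda>t. sorted_list_of_set (X \<sigma>) ! t)"
      if \<sigma>: "strict_mono_on {..<r} \<sigma>" for \<sigma>
    proof -
      have sm: "strict_mono_on {..<r} (g \<circ> \<sigma>)"
        using g(1) \<sigma> by (auto simp: strict_mono_on_def strict_mono_def)
      show "X \<sigma> \<subseteq> Y" "finite (X \<sigma>)" using g by (auto simp: X_def)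
      show "card (X \<sigma>) = r" using card_image[OF strict_mono_on_imp_inj_on[OF sm]] by (simp only: X_def card_lessThan)
      have "sorted (map (g \<circ> \<sigma>) [0..<r])" "distinct (map (g \<circ> \<sigma>) [0..<r])"
      proof -
        show "sorted (map (g \<circ> \<sigma>) [0..<r])"
          unfolding sorted_iff_nth_mono
          using strict_mono_on_leD[OF sm] by auto
        show "distinct (map (g \<circ> \<sigma>) [0..<r])"
          using strict_mono_on_imp_inj_on[OF sm] by (simp add: distinct_map atLeast0LessThan)
      qed
      then have "sorted_list_of_set (X \<sigma>) = map (g \<circ> \<sigma>) [0..<r]"
        using sorted_list_of_set.idem_if_sorted_distinct[of "map (g \<circ> \<sigma>) [0..<r]"]
        by (simp add: X_def atLeast0LessThan)
      then show "val b' (g \<circ> \<sigma>) = val b' (\<lambda>t. sorted_list_of_set (X \<sigma>) ! t)"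
        by (simp add: val_def)
    qed
    have "h (col (X \<sigma>)) = h (col (X \<sigma>'))" using Y(2) X \<sigma> by simp
    then have "col (X \<sigma>) = col (X \<sigma>')"
      using h \<open>\<And>X. col X \<in> C\<close> by (auto simp: bij_betw_def inj_on_def)
    then have "\<lfloor>D * val b' (g \<circ> \<sigma>)\<rfloor> = \<lfloor>D * val b' (g \<circ> \<sigma>')\<rfloor>"
      using b' X(4)[OF \<sigma>(1)] X(4)[OF \<sigma>(2)] by (metis col_def restrict_apply')
    then have "\<bar>D * val b' (g \<circ> \<sigma>) - D * val b' (g \<circ> \<sigma>')\<bar> \<le> 1" by linarith
    then have "D * \<bar>val b' (g \<circ> \<sigma>) - val b' (g \<circ> \<sigma>')\<bar> \<le> 1"
      by (simp add: right_diff_distrib[symmetric] abs_mult)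
    then show ?thesis using D by (simp add: vb pos_le_divide_eq mult.commute)
  qed
  then show ?thesis using g(1) by (intro exI[of _ g]) (simp add: val_def)
qed

lemma spreading_subsequence:
  fixes v :: "nat \<Rightarrow> 'b" and r :: nat
  assumes v: "\<And>i. p (v i) \<le> 1" and \<theta>: "\<theta> > 0"
  shows "\<exists>g :: nat \<Rightarrow> nat. strict_mono g \<and>
    (\<forall>a. \<forall>\<sigma> \<sigma>' :: nat \<Rightarrow> nat. (\<forall>t<r. \<bar>a t\<bar> \<le> 1) \<longrightarrow> strict_mono_on {..<r} \<sigma> \<longrightarrow> strict_mono_on {..<r} \<sigma>' \<longrightarrow>
      p (\<Sum>t<r. a t *\<^sub>R v (g (\<sigma> t))) \<le> p (\<Sum>t<r. a t *\<^sub>R v (g (\<sigma>' t))) + \<theta>)"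
proof -
  \<comment> \<open>The grid contributes \<open>1 / D\<close>, and rounding the coefficients
    contributes \<open>r / D\<close> on either side.\<close>
  obtain D :: nat where "(1 + 2 * real r) / \<theta> < real D" using reals_Archimedean2 by blast
  moreover have "0 < (1 + 2 * real r) / \<theta>" using \<theta> by (intro divide_pos_pos) auto
  ultimately have "real D > 0" "(1 + 2 * real r) / \<theta> \<le> D" by linarith+
  then have D: "D > 0" "(1 + 2 * real r) / D \<le> \<theta>"
    using \<theta> by (auto simp: pos_divide_le_eq mult.commute)
  obtain g :: "nat \<Rightarrow> nat" where g: "strict_mono g" and grid: "\<And>b :: nat \<Rightarrow> int. \<And>\<sigma> \<sigma>' :: nat \<Rightarrow> nat. (\<forall>t<r. \<bar>b t\<bar> \<le> int D) \<Longrightarrow>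
    strict_mono_on {..<r} \<sigma> \<Longrightarrow> strict_mono_on {..<r} \<sigma>' \<Longrightarrow>
    \<bar>p (\<Sum>t<r. (b t / D) *\<^sub>R v (g (\<sigma> t))) - p (\<Sum>t<r. (b t / D) *\<^sub>R v (g (\<sigma>' t)))\<bar> \<le> 1 / D"
    using spreading_subsequence_grid[of v D r, OF v D(1)] by (elim exE conjE) (rule that, auto)
  show ?thesis
  proof (intro exI[of _ g] conjI g allI impI)
    fix a :: "nat \<Rightarrow> real" and \<sigma> \<sigma>' :: "nat \<Rightarrow> nat"
    assume a: "\<forall>t<r. \<bar>a t\<bar> \<le> 1" and \<sigma>: "strict_mono_on {..<r} \<sigma>" "strict_mono_on {..<r} \<sigma>'"
    define b where "b t = \<lfloor>D * a t\<rfloor>" for t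
    have b: "\<forall>t<r. \<bar>b t\<bar> \<le> int D"
    proof (intro allI impI)
      fix t assume "t < r"
      then have "\<bar>D * a t\<bar> \<le> D" using a by (simp add: abs_mult mult_left_le)
      then have "- real D \<le> D * a t" "D * a t \<le> D" by linarith+
      then have "- int D \<le> b t" "b t \<le> int D" unfolding b_def by linarith+
      then show "\<bar>b t\<bar> \<le> int D" by simp
    qed
    have ab: "\<bar>a t - b t / D\<bar> \<le> 1 / D" for t
    proof -
      have "\<bar>D * a t - b t\<bar> \<le> 1" unfolding b_def by linarith
      moreover have "D * (a t - b t / D) = D * a t - b t" using D by (simp add: right_diff_distrib)
      ultimately have "D * \<bar>a t - b t / D\<bar> \<le> 1" by (metis abs_mult abs_of_nat)
      then show ?thesis using D by (simp add: pos_le_divide_eq mult.commute)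
    qed
    have round: "p ((\<Sum>t<r. a t *\<^sub>R v (g (\<sigma> t))) - (\<Sum>t<r. (b t / D) *\<^sub>R v (g (\<sigma> t)))) \<le> r / D" for \<sigma>
    proof -
      have "(\<Sum>t<r. a t *\<^sub>R v (g (\<sigma> t))) - (\<Sum>t<r. (b t / D) *\<^sub>R v (g (\<sigma> t))) = (\<Sum>t<r. (a t - b t / D) *\<^sub>R v (g (\<sigma> t)))"
        by (simp add: sum_subtractf[symmetric] scaleR_diff_left)
      also have "p \<dots> \<le> (\<Sum>t<r. p ((a t - b t / D) *\<^sub>R v (g (\<sigma> t))))" by (rule p_sum)
      also have "\<dots> \<le> (\<Sum>t<r. 1 / D * 1)"
        unfolding scale using ab v by (intro sum_mono mult_mono) auto
      finally show ?thesis by simp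
    qed
    have "(1 + 2 * real r) / D = 1 / D + r / D + r / D" by (simp add: add_divide_distrib)
    then show "p (\<Sum>t<r. a t *\<^sub>R v (g (\<sigma> t))) \<le> p (\<Sum>t<r. a t *\<^sub>R v (g (\<sigma>' t))) + \<theta>"
      using grid[OF b \<sigma>] abs_p_diff_le[of "\<Sum>t<r. a t *\<^sub>R v (g (\<sigma> t))" "\<Sum>t<r. (b t / D) *\<^sub>R v (g (\<sigma> t))"]
        abs_p_diff_le[of "\<Sum>t<r. a t *\<^sub>R v (g (\<sigma>' t))" "\<Sum>t<r. (b t / D) *\<^sub>R v (g (\<sigma>' t))"]
        round[of \<sigma>] round[of \<sigma>'] D(2) by linarith
  qed
qed

text \<open>Suppression unconditionality with constant 2, for vectors of norm comparable to 1.
  Changes of sign are handled later by splitting the index set in two.\<close>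

definition unconditional :: "nat \<Rightarrow> (nat \<Rightarrow> 'b) \<Rightarrow> bool" where
  "unconditional N e \<longleftrightarrow> (\<forall>l<N. 1 / 2 \<le> p (e l) \<and> p (e l) \<le> 2) \<and>
     (\<forall>a. \<forall>A\<subseteq>{..<N}. p (\<Sum>l\<in>A. a l *\<^sub>R e l) \<le> 2 * p (\<Sum>l<N. a l *\<^sub>R e l))"

text \<open>
  Differences of consecutive terms of a spreading sequence are unconditional: moving one of them
  along the sequence and averaging removes it from a linear combination, by telescoping.
\<close>

lemma unconditional_exists:
  fixes v :: "nat \<Rightarrow> 'b" and N :: nat
  assumes v: "\<And>i. p (v i) \<le> 1" and sep: "\<And>i j. i \<noteq> j \<Longrightarrow> 1 / 2 \<le> p (v i - v j)"
  shows "\<exists>e. unconditional N e"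
proof -
  \<comment> \<open>Deleting up to \<open>N\<close> terms costs at most
    \<open>N * \<kappa> \<le> 1 / 4\<close>. This absolute error can be absorbed, since a
    combination with largest coefficient of modulus 1 has norm at least 1/4.\<close>
  define \<kappa> where "\<kappa> = 1 / (4 * (real N + 1))"
  define Q :: nat where "Q = 16 * (N + 1)"
  \<comment> \<open>The gap between consecutive pairs leaves room for \<open>Q\<close> positions of
    a pair, none of which reaches the next one.\<close>
  define G where "G = Suc Q"
  have \<kappa>: "\<kappa> > 0" "N * \<kappa> \<le> 1 / 4" by (auto simp: \<kappa>_def field_simps)
  have Q: "2 / Q \<le> \<kappa> / 2" by (simp add: \<kappa>_def Q_def field_simps)
  obtain g :: "nat \<Rightarrow> nat" where g: "strict_mono g" and spr: "\<And>a. \<And>\<sigma> \<sigma>' :: nat \<Rightarrow> nat. (\<forall>t<2 * N. \<bar>a t\<bar> \<le> 1) \<Longrightarrow>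
      strict_mono_on {..<2 * N} \<sigma> \<Longrightarrow> strict_mono_on {..<2 * N} \<sigma>' \<Longrightarrow>
      p (\<Sum>t<2 * N. a t *\<^sub>R v (g (\<sigma> t))) \<le> p (\<Sum>t<2 * N. a t *\<^sub>R v (g (\<sigma>' t))) + \<kappa> / 2"
  proof -
    have "\<kappa> / 2 > 0" using \<kappa> by simp
    from spreading_subsequence[of v, OF v this, of "2 * N"] show ?thesis
      by (elim exE conjE) (rule that, auto)
  qed
  define w where "w i = v (g i)" for i
  have gneq: "g i \<noteq> g j" if "i \<noteq> j" for i j using that strict_mono_eq[OF g] by simp
  define e where "e l = w (l * G) - w (l * G + 1)" for l
  have pw: "p (w i - w j) \<le> 2" for i j
    using triangle[of "w i" "- w j"] v[of "g i"] v[of "g j"] by (simp add: w_def)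
  have e: "1 / 2 \<le> p (e l)" "p (e l) \<le> 2" for l
    using sep[OF gneq[of "l * G" "l * G + 1"]] pw by (auto simp: e_def w_def)
  have pair: "(\<Sum>t<2 * n. h t) = (\<Sum>l<n. h (2 * l) + h (2 * l + 1))" for h :: "nat \<Rightarrow> 'b" and n
  proof (induction n)
    case (Suc n)
    have "(\<Sum>t<2 * Suc n. h t) = (\<Sum>t<2 * n. h t) + h (2 * n) + h (2 * n + 1)" by simp
    then show ?case using Suc by (simp only: sum.lessThan_Suc add.assoc)
  qed simp
  have drop1: "p (\<Sum>l\<in>{..<N} - {l0}. a l *\<^sub>R e l) \<le> p (\<Sum>l<N. a l *\<^sub>R e l) + \<kappa>"
    if a: "\<And>l. l < N \<Longrightarrow> \<bar>a l\<bar> \<le> 1" and l0: "l0 < N" for a l0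
  proof -
    \<comment> \<open>The entries \<open>2 * l\<close> and \<open>2 * l + 1\<close> sit at the two
      positions of the \<open>l\<close>-th pair; only the pair \<open>l0\<close> is shifted, by
      \<open>s\<close>.\<close>
    define \<sigma> where "\<sigma> s t = (t div 2) * G + (if t div 2 = l0 then s else 0) + t mod 2" for s t :: nat
    have mono: "strict_mono_on {..<2 * N} (\<sigma> s)" if s: "s < Q" for s
    proof (rule strict_mono_onI)
      fix t t' :: nat assume "t < t'"
      then have le: "t div 2 \<le> t' div 2" by (intro div_le_mono) simp
      have "t mod 2 < t' mod 2" if "t div 2 = t' div 2"
        using div_mult_mod_eq[of t 2] div_mult_mod_eq[of t' 2] \<open>t < t'\<close> that by linarith
      with le consider "t div 2 = t' div 2" "t mod 2 < t' mod 2" | "t div 2 < t' div 2" by linarith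
      then show "\<sigma> s t < \<sigma> s t'"
      proof cases
        case 1
        then show ?thesis by (simp add: \<sigma>_def)
      next
        case 2
        have "\<sigma> s t < Suc (t div 2) * G" using s by (auto simp: \<sigma>_def G_def)
        also have "\<dots> \<le> (t' div 2) * G" using 2 by (intro mult_right_mono) auto
        also have "\<dots> \<le> \<sigma> s t'" by (simp add: \<sigma>_def)
        finally show ?thesis .
      qed
    qed
    define a' where "a' t = (if even t then a (t div 2) else - a (t div 2))" for t
    define y where "y = (\<Sum>l\<in>{..<N} - {l0}. a l *\<^sub>R e l)"
    define x where "x s = y + a l0 *\<^sub>R (w (l0 * G + s) - w (l0 * G + Suc s))" for s
    have xs: "(\<Sum>t<2 * N. a' t *\<^sub>R v (g (\<sigma> s t))) = x s" for s
    proof -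
      have "(\<Sum>t<2 * N. a' t *\<^sub>R v (g (\<sigma> s t)))
          = (\<Sum>l<N. a l *\<^sub>R (w (l * G + (if l = l0 then s else 0)) - w (Suc (l * G + (if l = l0 then s else 0)))))"
        unfolding pair by (rule sum.cong) (auto simp: a'_def \<sigma>_def w_def scaleR_diff_right)
      also have "\<dots> = x s"
        using l0 by (subst sum.remove[of _ l0]) (auto simp: x_def y_def e_def intro!: sum.cong)
      finally show ?thesis .
    qed
    have x0: "x 0 = (\<Sum>l<N. a l *\<^sub>R e l)"
      using l0 by (subst sum.remove[of _ l0]) (auto simp: x_def y_def e_def)
    have px: "p (x s) \<le> p (x 0) + \<kappa> / 2" if "s < Q" for s
      unfolding xs[symmetric]
      by (rule spr) (use a mono that in \<open>auto simp: a'_def Q_def\<close>)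
    have "(\<Sum>s<Q. x s) = Q *\<^sub>R y + a l0 *\<^sub>R (w (l0 * G) - w (l0 * G + Q))"
    proof -
      have "(\<Sum>s<Q. w (l0 * G + s) - w (l0 * G + Suc s)) = w (l0 * G) - w (l0 * G + Q)"
        using sum_lessThan_telescope'[of "\<lambda>s. w (l0 * G + s)" Q] by simp
      then show ?thesis
        by (simp add: x_def sum.distrib scaleR_sum_right[symmetric] sum_constant_scaleR)
    qed
    then have "Q *\<^sub>R y = (\<Sum>s<Q. x s) + (- a l0) *\<^sub>R (w (l0 * G) - w (l0 * G + Q))" by simp
    then have "Q * p y \<le> p (\<Sum>s<Q. x s) + \<bar>a l0\<bar> * p (w (l0 * G) - w (l0 * G + Q))"
      using triangle[of "\<Sum>s<Q. x s" "(- a l0) *\<^sub>R (w (l0 * G) - w (l0 * G + Q))"] by (metis scale abs_minus abs_of_nat)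
    also have "p (\<Sum>s<Q. x s) \<le> (\<Sum>s<Q. p (x 0) + \<kappa> / 2)"
      by (rule order_trans[OF p_sum sum_mono]) (use px in auto)
    also have "\<bar>a l0\<bar> * p (w (l0 * G) - w (l0 * G + Q)) \<le> 1 * 2"
      using a[OF l0] pw by (intro mult_mono) auto
    finally have "Q * p y \<le> Q * (p (x 0) + \<kappa> / 2) + 2" by simp
    then have "p y \<le> p (x 0) + \<kappa> / 2 + 2 / Q" by (simp add: Q_def field_simps)
    then show ?thesis using Q unfolding x0 y_def[symmetric] by linarith
  qed
  have drop: "p (\<Sum>l\<in>{..<N} - A. a l *\<^sub>R e l) \<le> p (\<Sum>l<N. a l *\<^sub>R e l) + 1 / 4"
    if a: "\<And>l. l < N \<Longrightarrow> \<bar>a l\<bar> \<le> 1" and A: "A \<subseteq> {..<N}" for a A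
  proof -
    have "finite A" using A finite_subset by blast
    then have "p (\<Sum>l\<in>{..<N} - A. a l *\<^sub>R e l) \<le> p (\<Sum>l<N. a l *\<^sub>R e l) + card A * \<kappa>"
      using A
    proof (induction A)
      case (insert l0 A)
      define a' where "a' l = (if l \<in> A then 0 else a l)" for l
      have s: "(\<Sum>l\<in>B. a' l *\<^sub>R e l) = (\<Sum>l\<in>B - A. a l *\<^sub>R e l)" if "finite B" for B
        using that by (intro sum.mono_neutral_cong_right) (auto simp: a'_def)
      have "p (\<Sum>l\<in>{..<N} - {l0}. a' l *\<^sub>R e l) \<le> p (\<Sum>l<N. a' l *\<^sub>R e l) + \<kappa>"
        by (rule drop1) (use a insert.prems in \<open>auto simp: a'_def\<close>)
      then have "p (\<Sum>l\<in>{..<N} - insert l0 A. a l *\<^sub>R e l) \<le> p (\<Sum>l\<in>{..<N} - A. a l *\<^sub>R e l) + \<kappa>"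
        by (simp add: s Diff_insert2[symmetric] Diff_insert[symmetric] insert_commute)
      then show ?case using insert by (simp add: algebra_simps)
    qed simp
    moreover have "card A * \<kappa> \<le> N * \<kappa>"
      using card_mono[OF _ A] \<kappa> by (intro mult_right_mono) auto
    ultimately show ?thesis using \<kappa> by linarith
  qed
  have unc1: "p (\<Sum>l\<in>A. a l *\<^sub>R e l) \<le> 2 * p (\<Sum>l<N. a l *\<^sub>R e l)"
    if a: "\<And>l. l < N \<Longrightarrow> \<bar>a l\<bar> \<le> 1" and l0: "l0 < N" "\<bar>a l0\<bar> = 1" and A: "A \<subseteq> {..<N}" for a A l0
  proof -
    have "{..<N} - ({..<N} - A) = A" "{..<N} - ({..<N} - {l0}) = {l0}" using A l0 by auto
    then have "p (\<Sum>l\<in>A. a l *\<^sub>R e l) \<le> p (\<Sum>l<N. a l *\<^sub>R e l) + 1 / 4"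
      "p (\<Sum>l\<in>{l0}. a l *\<^sub>R e l) \<le> p (\<Sum>l<N. a l *\<^sub>R e l) + 1 / 4"
      using drop[of a "{..<N} - A"] drop[of a "{..<N} - {l0}"] a by auto
    then show ?thesis using e(1)[of l0] l0 by (simp add: scale)
  qed
  have "p (\<Sum>l\<in>A. a l *\<^sub>R e l) \<le> 2 * p (\<Sum>l<N. a l *\<^sub>R e l)" if A: "A \<subseteq> {..<N}" for a A
  proof (cases "\<exists>l<N. a l \<noteq> 0")
    case False
    then have "(\<Sum>l\<in>A. a l *\<^sub>R e l) = 0" using A by (intro sum.neutral) auto
    then show ?thesis by simp
  next
    case True
    define \<mu> where "\<mu> = Max ((\<lambda>l. \<bar>a l\<bar>) ` {..<N})"
    have le: "\<bar>a l\<bar> \<le> \<mu>" if "l < N" for l unfolding \<mu>_def using that by (intro Max_ge) auto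
    have "\<mu> \<in> (\<lambda>l. \<bar>a l\<bar>) ` {..<N}" unfolding \<mu>_def using True by (intro Max_in) auto
    then obtain l0 where l0: "l0 < N" "\<bar>a l0\<bar> = \<mu>" by auto
    have \<mu>: "\<mu> > 0" using True le by force
    have sc: "(\<Sum>l\<in>B. a l *\<^sub>R e l) = \<mu> *\<^sub>R (\<Sum>l\<in>B. (a l / \<mu>) *\<^sub>R e l)" for B
      using \<mu> by (simp add: scaleR_sum_right)
    have "p (\<Sum>l\<in>A. (a l / \<mu>) *\<^sub>R e l) \<le> 2 * p (\<Sum>l<N. (a l / \<mu>) *\<^sub>R e l)"
      by (rule unc1[of "\<lambda>l. a l / \<mu>" l0 A]) (use le l0 \<mu> A in \<open>auto simp: abs_divide\<close>)
    then show ?thesis unfolding sc scale using \<mu> by simp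
  qed
  then show ?thesis unfolding unconditional_def using e by blast
qed

section \<open>From unconditional to spread systems\<close>

lemma unconditional_subset:
  "unconditional N e \<Longrightarrow> A \<subseteq> {..<N} \<Longrightarrow> p (\<Sum>l\<in>A. a l *\<^sub>R e l) \<le> 2 * p (\<Sum>l<N. a l *\<^sub>R e l)"
  by (simp add: unconditional_def)

lemma unconditional_abs:
  assumes "unconditional N e"
  shows "p (\<Sum>l<N. \<bar>a l\<bar> *\<^sub>R e l) \<le> 4 * p (\<Sum>l<N. a l *\<^sub>R e l)"
proof -
  define A B where "A = {l. l < N \<and> a l \<ge> 0}" and "B = {l. l < N \<and> a l < 0}"
  have AB: "A \<subseteq> {..<N}" "B \<subseteq> {..<N}" "A \<union> B = {..<N}" "A \<inter> B = {}" "finite A" "finite B" by (auto simp: A_def B_def)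
  have "(\<Sum>l<N. \<bar>a l\<bar> *\<^sub>R e l) = (\<Sum>l\<in>A. \<bar>a l\<bar> *\<^sub>R e l) + (\<Sum>l\<in>B. \<bar>a l\<bar> *\<^sub>R e l)"
    unfolding AB(3)[symmetric] by (rule sum.union_disjoint) (use AB in auto)
  also have "\<dots> = (\<Sum>l\<in>A. a l *\<^sub>R e l) + - (\<Sum>l\<in>B. a l *\<^sub>R e l)"
    by (simp add: A_def B_def sum_negf[symmetric])
  also have "p \<dots> \<le> p (\<Sum>l\<in>A. a l *\<^sub>R e l) + p (\<Sum>l\<in>B. a l *\<^sub>R e l)"
    using triangle[of "\<Sum>l\<in>A. a l *\<^sub>R e l" "- (\<Sum>l\<in>B. a l *\<^sub>R e l)"] by simp
  also have "\<dots> \<le> 4 * p (\<Sum>l<N. a l *\<^sub>R e l)"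
    using unconditional_subset[OF assms AB(1), of a] unconditional_subset[OF assms AB(2), of a] by linarith
  finally show ?thesis .
qed

text \<open>A convex function on a cube is largest at a vertex. The translate \<open>z\<close>
  collects the vectors whose coefficient has been fixed in the course of the induction.\<close>

lemma convex_hull_cube:
  assumes "finite S" "\<And>A. A \<subseteq> S \<Longrightarrow> p (z + (\<Sum>l\<in>A. e l)) \<le> K" "\<And>l. l \<in> S \<Longrightarrow> 0 \<le> a l \<and> a l \<le> 1"
  shows "p (z + (\<Sum>l\<in>S. a l *\<^sub>R e l)) \<le> K"
  using assms
proof (induction S arbitrary: z)
  case (insert x S)
  let ?y = "\<Sum>l\<in>S. a l *\<^sub>R e l"
  have "p (z + ?y) \<le> K" by (rule insert.IH) (use insert.prems in blast)+
  moreover have "p ((z + e x) + ?y) \<le> K"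
  proof (rule insert.IH)
    fix A assume A: "A \<subseteq> S"
    then have "finite A" "x \<notin> A" using insert finite_subset by blast+
    then show "p ((z + e x) + (\<Sum>l\<in>A. e l)) \<le> K"
      using insert.prems(1)[of "insert x A"] A by (simp add: subset_insertI2 add.assoc)
  qed (use insert.prems in blast)
  moreover have "z + (\<Sum>l\<in>insert x S. a l *\<^sub>R e l) = (1 - a x) *\<^sub>R (z + ?y) + a x *\<^sub>R ((z + e x) + ?y)"
    using insert by (simp add: algebra_simps)
  moreover have "0 \<le> a x" "a x \<le> 1" using insert.prems by auto
  ultimately have "p (z + (\<Sum>l\<in>insert x S. a l *\<^sub>R e l)) \<le> (1 - a x) * K + a x * K"
    using triangle[of "(1 - a x) *\<^sub>R (z + ?y)" "a x *\<^sub>R ((z + e x) + ?y)"]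
      mult_left_mono[of "p (z + ?y)" K "1 - a x"] mult_left_mono[of "p ((z + e x) + ?y)" K "a x"]
    by (simp add: scale)
  then show ?case by (simp add: algebra_simps)
qed (use assms(2)[of "{}"] in auto)

text \<open>The sublinear function is a quarter of the norm of the combination: passing from
  coefficients to their moduli costs the factor 4 of \<open>unconditional_abs\<close>, for which the
  lower bound \<open>4 * A\<close> compensates.\<close>

lemma spread_of_unconditional:
  assumes e: "unconditional N e" and c: "\<And>l. 0 \<le> c l"
    and upper: "\<And>b. p (\<Sum>l<N. (b l * c l) *\<^sub>R e l) \<le> sqrt (\<Sum>l<N. (b l)^2)"
    and lower: "4 * A \<le> p (\<Sum>l<N. c l *\<^sub>R e l)"
  shows "spread A N (\<lambda>l. c l *\<^sub>R e l)"
  unfolding spread_def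
proof (intro conjI exI[of _ "\<lambda>b. p (\<Sum>l<N. (b l * c l) *\<^sub>R e l) / 4"] allI impI)
  fix a b :: "nat \<Rightarrow> real"
  show "p (\<Sum>i<N. a i *\<^sub>R c i *\<^sub>R e i) \<le> sqrt (\<Sum>i<N. (a i)\<^sup>2)" using upper[of a] by simp
  have "(\<lambda>l. \<bar>a l * c l\<bar>) = (\<lambda>l. \<bar>a l\<bar> * c l)" using c by (auto simp: abs_mult)
  then show "p (\<Sum>l<N. (\<bar>a l\<bar> * c l) *\<^sub>R e l) / 4 \<le> p (\<Sum>i<N. a i *\<^sub>R c i *\<^sub>R e i)"
    using unconditional_abs[OF e, of "\<lambda>l. a l * c l"] by (simp add: fun_eq_iff)
  have "(\<Sum>l<N. ((a l + b l) * c l) *\<^sub>R e l) = (\<Sum>l<N. (a l * c l) *\<^sub>R e l) + (\<Sum>l<N. (b l * c l) *\<^sub>R e l)"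
    by (simp add: distrib_right scaleR_add_left sum.distrib)
  then show "p (\<Sum>l<N. ((a l + b l) * c l) *\<^sub>R e l) / 4
      \<le> p (\<Sum>l<N. (a l * c l) *\<^sub>R e l) / 4 + p (\<Sum>l<N. (b l * c l) *\<^sub>R e l) / 4"
    using triangle[of "\<Sum>l<N. (a l * c l) *\<^sub>R e l" "\<Sum>l<N. (b l * c l) *\<^sub>R e l"] by simp
next
  fix d :: real and a :: "nat \<Rightarrow> real" assume "0 \<le> d"
  have "(\<Sum>l<N. (d * a l * c l) *\<^sub>R e l) = d *\<^sub>R (\<Sum>l<N. (a l * c l) *\<^sub>R e l)"
    by (simp add: scaleR_sum_right mult.assoc)
  then show "p (\<Sum>l<N. (d * a l * c l) *\<^sub>R e l) / 4 = d * (p (\<Sum>l<N. (a l * c l) *\<^sub>R e l) / 4)"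
    using \<open>0 \<le> d\<close> by (simp add: scale)
qed (use lower in simp)

text \<open>
  Suppose that no system is \<open>A\<close>-spread. The vector at which the \<open>\<ell>\<^sub>2\<close>-bound \<open>L\<close> of an
  unconditional system is almost attained cannot be flat, so it has a coefficient bounded away from
  \<open>0\<close>; removing that coefficient shows that \<open>L\<close> is bounded independently of the length. Then the sums
  of the system are bounded as well, i.e. the system is like the basis of \<open>\<ell>\<^sub>\<infinity>\<close> in dimension
  \<open>2\<^sup>n\<close>, where the Rademacher vectors form a basis of \<open>\<ell>\<^sub>1\<close> in dimension \<open>n\<close> and are spread.
\<close>

lemma spread_exists_aux:
  fixes A :: real
  assumes unc: "\<And>N. \<exists>e. unconditional N e" and A: "A \<ge> 1"
  shows "\<exists>N e. spread A N e"
proof (rule ccontr)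
  assume "\<not> ?thesis"
  then have nospread: "\<not> spread A N e" for N e by blast
  \<comment> \<open>A near-maximizer whose coefficients are at most \<open>\<delta>\<close> yields,
    after rescaling, a sum of norm at least \<open>1 / (8 * \<delta>)\<close>, which is
    \<open>4 * A\<close>.\<close>
  define \<delta> where "\<delta> = 1 / (32 * A)"
  have \<delta>: "\<delta> > 0" "\<delta> \<le> 1" using A by (auto simp: \<delta>_def field_simps)
  \<comment> \<open>A coefficient of size \<open>\<delta>\<close> in a near-maximizer forces
    \<open>L * (\<delta>^2 / 4) < 2\<close>.\<close>
  define L0 where "L0 = 8 / \<delta>^2"
  have L0: "L0 > 0" using \<delta> by (simp add: L0_def)
  have upper: "p (\<Sum>l<N. a l *\<^sub>R e l) \<le> L0 * sqrt (\<Sum>l<N. (a l)^2)" if e: "unconditional N e" for N e a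
  proof -
    define S where "S = {p (\<Sum>l<N. a l *\<^sub>R e l) | a. (\<Sum>l<N. (a l)^2) \<le> 1}"
    define L where "L = Sup S"
    have pe: "1 / 2 \<le> p (e l)" "p (e l) \<le> 2" if "l < N" for l
      using e that by (auto simp: unconditional_def)
    have a1: "\<bar>a l\<bar> \<le> 1" if "(\<Sum>l<N. (a l)^2) \<le> 1" "l < N" for a :: "nat \<Rightarrow> real" and l
    proof -
      have "(a l)^2 \<le> (\<Sum>l<N. (a l)^2)" using that by (intro member_le_sum) auto
      then have "(a l)^2 \<le> 1" using that by linarith
      then show ?thesis by (simp only: abs_square_le_1)
    qed
    have bdd: "bdd_above S"
    proof (rule bdd_aboveI[of _ "\<Sum>l<N. 1 * 2"])
      fix x assume "x \<in> S"
      then obtain a where a: "x = p (\<Sum>l<N. a l *\<^sub>R e l)" "(\<Sum>l<N. (a l)^2) \<le> 1" by (auto simp: S_def)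
      have "x \<le> (\<Sum>l<N. p (a l *\<^sub>R e l))" unfolding a(1) by (rule p_sum)
      also have "\<dots> \<le> (\<Sum>l<N. 1 * 2)"
        unfolding scale using a1[OF a(2)] pe by (intro sum_mono mult_mono) auto
      finally show "x \<le> (\<Sum>l<N. 1 * 2)" .
    qed
    have ne: "S \<noteq> {}" unfolding S_def by (auto intro!: exI[of _ "\<lambda>_. 0"])
    have L1: "p (\<Sum>l<N. a l *\<^sub>R e l) \<le> L" if "(\<Sum>l<N. (a l)^2) \<le> 1" for a
      unfolding L_def using that bdd by (intro cSup_upper) (auto simp: S_def)
    have Lup: "p (\<Sum>l<N. a l *\<^sub>R e l) \<le> L * sqrt (\<Sum>l<N. (a l)^2)" for a
    proof (cases "(\<Sum>l<N. (a l)^2) = 0")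
      case True
      then have "\<forall>l\<in>{..<N}. (a l)^2 = 0" by (subst (asm) sum_nonneg_eq_0_iff) auto
      then have "(\<Sum>l<N. a l *\<^sub>R e l) = 0" by (intro sum.neutral) auto
      then show ?thesis using True by simp
    next
      case False
      define r where "r = sqrt (\<Sum>l<N. (a l)^2)"
      have "(\<Sum>l<N. (a l)^2) \<ge> 0" by (simp add: sum_nonneg)
      then have r: "r > 0" "r^2 = (\<Sum>l<N. (a l)^2)" using False by (auto simp: r_def)
      have "(\<Sum>l<N. (a l / r)^2) = 1"
        using False by (simp add: power_divide sum_divide_distrib[symmetric] r(2))
      then have "p (\<Sum>l<N. (a l / r) *\<^sub>R e l) \<le> L" by (intro L1) simp
      moreover have "(\<Sum>l<N. a l *\<^sub>R e l) = r *\<^sub>R (\<Sum>l<N. (a l / r) *\<^sub>R e l)"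
        using r by (simp add: scaleR_sum_right)
      ultimately show ?thesis using r by (simp add: scale r_def[symmetric] mult.commute)
    qed
    have "L \<le> L0"
    proof (rule ccontr)
      assume "\<not> L \<le> L0"
      then have L: "L > L0" "L > 0" using L0 by auto
      \<comment> \<open>The defect \<open>\<eta>\<close> is half of the relative loss
        \<open>\<delta>^2 / 2\<close> that the l2-bound suffers when a coefficient of size
        \<open>\<delta>\<close> is removed.\<close>
      define \<eta> where "\<eta> = \<delta>^2 / 4"
      have \<eta>: "\<eta> > 0" "\<eta> \<le> 1 / 2" using \<delta> power_le_one[of \<delta> 2] by (auto simp: \<eta>_def)
      have "(1 - \<eta>) * L < Sup S" using \<eta> L by (simp add: L_def[symmetric] algebra_simps)
      then obtain x where "x \<in> S" "(1 - \<eta>) * L < x" using less_cSup_iff[OF ne bdd] by blast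
      then obtain a where a: "(\<Sum>l<N. (a l)^2) \<le> 1" "(1 - \<eta>) * L < p (\<Sum>l<N. a l *\<^sub>R e l)" by (auto simp: S_def)
      show False
      proof (cases "\<exists>l<N. \<bar>a l\<bar> \<ge> \<delta>")
        case True
        then obtain l0 where l0: "l0 < N" "\<bar>a l0\<bar> \<ge> \<delta>" by blast
        define a' where "a' = a(l0 := 0)"
        have "(\<Sum>l<N. (a' l)^2) = (\<Sum>l<N. (a l)^2) - (a l0)^2"
          using l0 by (simp add: a'_def sum.remove[of "{..<N}" l0])
        moreover have "\<delta>^2 \<le> (a l0)^2" using l0 \<delta> power_mono[of \<delta> "\<bar>a l0\<bar>" 2] by simp
        ultimately have "(\<Sum>l<N. (a' l)^2) \<le> 1 - \<delta>^2" using a by linarith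
        also have "\<dots> \<le> (1 - \<delta>^2 / 2)^2"
          using power2_diff[of 1 "\<delta>^2 / 2"] zero_le_power2[of "\<delta>^2 / 2"] by simp
        finally have sq: "sqrt (\<Sum>l<N. (a' l)^2) \<le> 1 - \<delta>^2 / 2"
          using \<delta> power_le_one[of \<delta> 2] by (intro real_le_lsqrt) auto
        have "(\<Sum>l<N. a l *\<^sub>R e l) = a l0 *\<^sub>R e l0 + (\<Sum>l<N. a' l *\<^sub>R e l)"
          using l0 by (simp add: a'_def sum.remove[of "{..<N}" l0])
        then have "p (\<Sum>l<N. a l *\<^sub>R e l) \<le> \<bar>a l0\<bar> * p (e l0) + p (\<Sum>l<N. a' l *\<^sub>R e l)"
          using triangle by (simp add: scale[symmetric])
        also have "\<bar>a l0\<bar> * p (e l0) \<le> 1 * 2" using a1[OF a(1) l0(1)] pe[OF l0(1)] by (intro mult_mono) auto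
        also have "p (\<Sum>l<N. a' l *\<^sub>R e l) \<le> L * (1 - \<delta>^2 / 2)"
          using Lup[of a'] mult_left_mono[OF sq, of L] L by linarith
        finally have "(1 - \<eta>) * L < 2 + L * (1 - \<delta>^2 / 2)" using a(2) by linarith
        then have "L * (\<delta>^2 / 4) < 2" by (simp add: \<eta>_def algebra_simps)
        then have "L < L0" using \<delta> by (simp add: L0_def field_simps)
        then show False using L by simp
      next
        case False
        have "\<exists>l<N. a l \<noteq> 0"
        proof (rule ccontr)
          assume "\<not> ?thesis"
          then have "(\<Sum>l<N. a l *\<^sub>R e l) = 0" by (intro sum.neutral) auto
          then have "(1 - \<eta>) * L < 0" using a(2) by simp
          then show False using \<eta> L by (simp add: mult_less_0_iff)
        qed
        \<comment> \<open>The moduli are rescaled so that each is at most \<open>1 / L\<close>: this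
          cancels the l2-bound \<open>L\<close> and gives the upper estimate with constant
          1.\<close>
        define c where "c l = (if l < N then \<bar>a l\<bar> / (\<delta> * L) else 0)" for l
        have "spread A N (\<lambda>l. c l *\<^sub>R e l)"
        proof (rule spread_of_unconditional[OF e])
          show "0 \<le> c l" for l using \<delta> L by (simp add: c_def)
          fix b :: "nat \<Rightarrow> real"
          have "p (\<Sum>l<N. (b l * c l) *\<^sub>R e l) \<le> L * sqrt (\<Sum>l<N. (b l * c l)^2)" by (rule Lup)
          also have "\<dots> \<le> L * sqrt (\<Sum>l<N. (b l)^2 * (1 / L)^2)"
          proof (intro mult_left_mono real_sqrt_le_mono sum_mono)
            fix l assume l: "l \<in> {..<N}"
            then have "\<bar>a l\<bar> \<le> \<delta>" using False by force
            then have "\<bar>a l\<bar> / (\<delta> * L) \<le> \<delta> / (\<delta> * L)" using \<delta> L by (intro divide_right_mono) auto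
            then have "c l \<le> 1 / L" using \<delta> L l by (simp add: c_def)
            moreover have "0 \<le> c l" using \<delta> L by (simp add: c_def)
            ultimately show "(b l * c l)^2 \<le> (b l)^2 * (1 / L)^2"
              unfolding power_mult_distrib by (intro mult_left_mono power_mono) auto
          qed (use L in auto)
          also have "\<dots> = sqrt (\<Sum>l<N. (b l)^2)"
            using L by (simp add: sum_distrib_right[symmetric] real_sqrt_mult)
          finally show "p (\<Sum>l<N. (b l * c l) *\<^sub>R e l) \<le> sqrt (\<Sum>l<N. (b l)^2)" .
        next
          have "(\<Sum>l<N. c l *\<^sub>R e l) = (1 / (\<delta> * L)) *\<^sub>R (\<Sum>l<N. \<bar>a l\<bar> *\<^sub>R e l)"
            by (simp add: c_def scaleR_sum_right)
          moreover have "p (\<Sum>l<N. a l *\<^sub>R e l) \<le> 4 * p (\<Sum>l<N. \<bar>a l\<bar> *\<^sub>R e l)"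
          proof -
            define P' M where "P' = {l. l < N \<and> a l \<ge> 0}" and "M = {l. l < N \<and> a l < 0}"
            have PM: "P' \<subseteq> {..<N}" "M \<subseteq> {..<N}" "P' \<union> M = {..<N}" "P' \<inter> M = {}" "finite P'" "finite M"
              by (auto simp: P'_def M_def)
            have "(\<Sum>l<N. a l *\<^sub>R e l) = (\<Sum>l\<in>P'. a l *\<^sub>R e l) + (\<Sum>l\<in>M. a l *\<^sub>R e l)"
              unfolding PM(3)[symmetric] by (rule sum.union_disjoint) (use PM in auto)
            also have "\<dots> = (\<Sum>l\<in>P'. \<bar>a l\<bar> *\<^sub>R e l) + - (\<Sum>l\<in>M. \<bar>a l\<bar> *\<^sub>R e l)"
              by (simp add: P'_def M_def sum_negf[symmetric])
            also have "p \<dots> \<le> p (\<Sum>l\<in>P'. \<bar>a l\<bar> *\<^sub>R e l) + p (\<Sum>l\<in>M. \<bar>a l\<bar> *\<^sub>R e l)"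
              using triangle[of "\<Sum>l\<in>P'. \<bar>a l\<bar> *\<^sub>R e l" "- (\<Sum>l\<in>M. \<bar>a l\<bar> *\<^sub>R e l)"] by simp
            also have "\<dots> \<le> 4 * p (\<Sum>l<N. \<bar>a l\<bar> *\<^sub>R e l)"
              using unconditional_subset[OF e PM(1), of "\<lambda>l. \<bar>a l\<bar>"]
                unconditional_subset[OF e PM(2), of "\<lambda>l. \<bar>a l\<bar>"] by linarith
            finally show ?thesis .
          qed
          moreover have "L / 2 \<le> (1 - \<eta>) * L" using \<eta> L mult_right_mono[of "1/2" "1 - \<eta>" L] by simp
          ultimately have "L / 8 \<le> p (\<Sum>l<N. \<bar>a l\<bar> *\<^sub>R e l)"
            and sc: "p (\<Sum>l<N. c l *\<^sub>R e l) = 1 / (\<delta> * L) * p (\<Sum>l<N. \<bar>a l\<bar> *\<^sub>R e l)"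
            using a(2) \<delta> L by (linarith, simp add: scale)
          then have "(1 / (\<delta> * L)) * (L / 8) \<le> p (\<Sum>l<N. c l *\<^sub>R e l)"
            unfolding sc using \<delta> L by (intro mult_left_mono) auto
          then show "4 * A \<le> p (\<Sum>l<N. c l *\<^sub>R e l)" using L A by (simp add: \<delta>_def)
        qed
        then show False using nospread by blast
      qed
    qed
    then have "L * sqrt (\<Sum>l<N. (a l)^2) \<le> L0 * sqrt (\<Sum>l<N. (a l)^2)"
      by (intro mult_right_mono) (auto intro: sum_nonneg)
    then show ?thesis using Lup[of a] by linarith
  qed
  \<comment> \<open>If the sum of the \<open>e l\<close> had a larger norm than this, the system
    divided by \<open>L0\<close> would be \<open>A\<close>-spread.\<close>
  define C0 where "C0 = 4 * A * L0"
  have C0: "C0 > 0" using A L0 by (simp add: C0_def)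
  have cube: "p (\<Sum>l<N. a l *\<^sub>R e l) \<le> 4 * C0 * K"
    if e: "unconditional N e" and a: "\<And>l. l < N \<Longrightarrow> \<bar>a l\<bar> \<le> K" and K: "K > 0" for N e a K
  proof -
    have sum_e: "p (\<Sum>l<N. e l) \<le> C0"
    proof (rule ccontr)
      assume "\<not> ?thesis"
      then have C: "C0 < p (\<Sum>l<N. e l)" by simp
      have sc: "(\<Sum>l<N. (b l * (1 / L0)) *\<^sub>R e l) = (1 / L0) *\<^sub>R (\<Sum>l<N. b l *\<^sub>R e l)" for b :: "nat \<Rightarrow> real"
        by (simp add: scaleR_sum_right)
      have "spread A N (\<lambda>l. (1 / L0) *\<^sub>R e l)"
      proof (rule spread_of_unconditional[OF e])
        show "p (\<Sum>l<N. (b l * (1 / L0)) *\<^sub>R e l) \<le> sqrt (\<Sum>l<N. (b l)^2)" for b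
          using upper[OF e, of b] L0 unfolding sc scale by (simp add: pos_divide_le_eq mult.commute)
        have "(\<Sum>l<N. (1 / L0) *\<^sub>R e l) = (1 / L0) *\<^sub>R (\<Sum>l<N. e l)" by (simp add: scaleR_sum_right)
        then show "4 * A \<le> p (\<Sum>l<N. (1 / L0) *\<^sub>R e l)"
          using C L0 by (simp add: scale C0_def pos_le_divide_eq)
      qed (use L0 in simp)
      then show False using nospread by blast
    qed
    have pos: "p (\<Sum>l<N. b l *\<^sub>R e l) \<le> 2 * C0" if "\<And>l. l < N \<Longrightarrow> 0 \<le> b l \<and> b l \<le> 1" for b
    proof -
      have "p (0 + (\<Sum>l<N. b l *\<^sub>R e l)) \<le> 2 * C0"
      proof (rule convex_hull_cube)
        fix S assume "S \<subseteq> {..<N}"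
        then have "p (\<Sum>l\<in>S. 1 *\<^sub>R e l) \<le> 2 * p (\<Sum>l<N. 1 *\<^sub>R e l)"
          by (rule unconditional_subset[OF e])
        then show "p (0 + (\<Sum>l\<in>S. e l)) \<le> 2 * C0" using sum_e by simp
      qed (use that in auto)
      then show ?thesis by simp
    qed
    define a1 a2 where "a1 l = max 0 (a l / K)" and "a2 l = max 0 (- a l / K)" for l
    have bnd: "\<bar>a l / K\<bar> \<le> 1" if "l < N" for l using a[OF that] K by (simp add: abs_divide)
    have "a l = K * (a1 l - a2 l)" for l using K by (simp add: a1_def a2_def max_def)
    then have "(\<Sum>l<N. a l *\<^sub>R e l) = K *\<^sub>R ((\<Sum>l<N. a1 l *\<^sub>R e l) - (\<Sum>l<N. a2 l *\<^sub>R e l))"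
      by (simp add: scaleR_sum_right scaleR_diff_left sum_subtractf[symmetric] scaleR_diff_right right_diff_distrib)
    then have "p (\<Sum>l<N. a l *\<^sub>R e l) \<le> K * (p (\<Sum>l<N. a1 l *\<^sub>R e l) + p (\<Sum>l<N. a2 l *\<^sub>R e l))"
      using K triangle[of "\<Sum>l<N. a1 l *\<^sub>R e l" "- (\<Sum>l<N. a2 l *\<^sub>R e l)"] by (simp add: scale)
    also have "\<dots> \<le> K * (2 * C0 + 2 * C0)"
    proof (intro mult_left_mono add_mono pos)
      show "0 \<le> a1 l \<and> a1 l \<le> 1" "0 \<le> a2 l \<and> a2 l \<le> 1" if "l < N" for l
        using abs_le_D1[OF bnd[OF that]] abs_le_D2[OF bnd[OF that]] by (simp_all add: a1_def a2_def)
    qed (use K in simp)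
    finally show ?thesis by (simp add: mult.commute mult.left_commute)
  qed
  \<comment> \<open>With \<open>c\<close> as defined below, the sublinear function of the new system
    takes the value \<open>sqrt n / (16 * C0)\<close> at the vector of ones; this has to reach
    \<open>A\<close>.\<close>
  obtain n :: nat where "(16 * C0 * A)^2 < n" using reals_Archimedean2 by blast
  then have n: "n > 0" "16 * C0 * A \<le> sqrt n"
    by (auto intro: real_le_rsqrt less_imp_le simp: gr0_conv_Suc) (metis of_nat_0 not_less zero_le_power2 gr0_conv_Suc gr0I)+
  obtain e where e: "unconditional (2 ^ n) e" using unc by blast
  obtain h where h: "bij_betw h {0..<(2::nat) ^ n} (Pow {..<n})"
    using ex_bij_betw_nat_finite[of "Pow {..<n}"] by (auto simp: card_Pow)
  \<comment> \<open>The Rademacher matrix: its columns are all sign patterns of length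
    \<open>n\<close>, and \<open>h\<close> enumerates the patterns by their sets of positive
    signs.\<close>
  define s where "s j \<sigma> = (if j \<in> h \<sigma> then 1 else - 1 :: real)" for j \<sigma>
  \<comment> \<open>With this factor the bound \<open>cube\<close>, followed by the comparison of
    the l1-norm and the l2-norm of \<open>b\<close>, gives the upper estimate with constant
    1.\<close>
  define c where "c = 1 / (4 * C0 * sqrt n)"
  have c: "c > 0" using C0 n by (simp add: c_def)
  define f where "f j = c *\<^sub>R (\<Sum>\<sigma><2 ^ n. s j \<sigma> *\<^sub>R e \<sigma>)" for j
  have comb: "(\<Sum>j<n. b j *\<^sub>R f j) = c *\<^sub>R (\<Sum>\<sigma><2 ^ n. (\<Sum>j<n. b j * s j \<sigma>) *\<^sub>R e \<sigma>)" for b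
  proof -
    have "(\<Sum>j<n. b j *\<^sub>R f j) = (\<Sum>j<n. \<Sum>\<sigma><2 ^ n. c *\<^sub>R (b j * s j \<sigma>) *\<^sub>R e \<sigma>)"
      by (simp add: f_def scaleR_sum_right mult.commute mult.left_commute)
    also have "\<dots> = (\<Sum>\<sigma><2 ^ n. \<Sum>j<n. c *\<^sub>R (b j * s j \<sigma>) *\<^sub>R e \<sigma>)" by (rule sum.swap)
    finally show ?thesis by (simp add: scaleR_sum_right scaleR_sum_left)
  qed
  have "spread A n f"
    unfolding spread_def
  proof (intro conjI exI[of _ "\<lambda>b. (c / 4) * (\<Sum>j<n. b j)"] allI impI)
    fix b :: "nat \<Rightarrow> real"
    show "p (\<Sum>j<n. b j *\<^sub>R f j) \<le> sqrt (\<Sum>j<n. (b j)\<^sup>2)"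
    proof (cases "(\<Sum>j<n. \<bar>b j\<bar>) = 0")
      case True
      then have "\<forall>j\<in>{..<n}. \<bar>b j\<bar> = 0" by (subst (asm) sum_nonneg_eq_0_iff) auto
      then have "(\<Sum>j<n. b j *\<^sub>R f j) = 0" by (intro sum.neutral) auto
      then show ?thesis by (simp add: sum_nonneg)
    next
      case False
      moreover have "(\<Sum>j<n. \<bar>b j\<bar>) \<ge> 0" by (simp add: sum_nonneg)
      ultimately have K: "(\<Sum>j<n. \<bar>b j\<bar>) > 0" by linarith
      have "p (\<Sum>\<sigma><2 ^ n. (\<Sum>j<n. b j * s j \<sigma>) *\<^sub>R e \<sigma>) \<le> 4 * C0 * (\<Sum>j<n. \<bar>b j\<bar>)"
      proof (rule cube[OF e _ K])
        fix \<sigma>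
        have "\<bar>\<Sum>j<n. b j * s j \<sigma>\<bar> \<le> (\<Sum>j<n. \<bar>b j * s j \<sigma>\<bar>)" by (rule sum_abs)
        then show "\<bar>\<Sum>j<n. b j * s j \<sigma>\<bar> \<le> (\<Sum>j<n. \<bar>b j\<bar>)" by (simp add: s_def abs_mult if_distrib cong: if_cong)
      qed
      then have "p (\<Sum>j<n. b j *\<^sub>R f j) \<le> c * (4 * C0 * (\<Sum>j<n. \<bar>b j\<bar>))"
        unfolding comb scale using c by (simp add: mult_left_mono)
      also have "\<dots> = (\<Sum>j<n. \<bar>b j\<bar>) / sqrt n" using C0 by (simp add: c_def)
      also have "(\<Sum>j<n. \<bar>b j\<bar>) \<le> sqrt n * sqrt (\<Sum>j<n. (b j)^2)"
        using L2_set_mult_ineq[of "\<lambda>_. 1" b "{..<n}"] by (simp add: L2_set_def)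
      finally show ?thesis using n by (simp add: divide_right_mono)
    qed
    \<comment> \<open>The sign pattern of \<open>b\<close>: here the coefficient of the combination
      is the l1-norm of \<open>b\<close>, and by unconditionality a single term has at most twice
      the norm of the whole.\<close>
    obtain \<sigma>0 where \<sigma>0: "\<sigma>0 < 2 ^ n" "h \<sigma>0 = {j. j < n \<and> b j \<ge> 0}"
    proof -
      have "{j. j < n \<and> b j \<ge> 0} \<in> h ` {0..<2 ^ n}" using h by (auto simp: bij_betw_def)
      then show ?thesis using that by auto
    qed
    have sg: "(\<Sum>j<n. b j * s j \<sigma>0) = (\<Sum>j<n. \<bar>b j\<bar>)"
      by (rule sum.cong) (auto simp: s_def \<sigma>0)
    have "p (\<Sum>\<sigma>\<in>{\<sigma>0}. (\<Sum>j<n. b j * s j \<sigma>) *\<^sub>R e \<sigma>) \<le> 2 * p (\<Sum>\<sigma><2 ^ n. (\<Sum>j<n. b j * s j \<sigma>) *\<^sub>R e \<sigma>)"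
      by (rule unconditional_subset[OF e]) (use \<sigma>0(1) in simp)
    moreover have "(\<Sum>j<n. \<bar>b j\<bar>) * (1 / 2) \<le> (\<Sum>j<n. \<bar>b j\<bar>) * p (e \<sigma>0)"
      using e \<sigma>0(1) by (intro mult_left_mono) (auto simp: unconditional_def sum_nonneg)
    ultimately have "(\<Sum>j<n. \<bar>b j\<bar>) / 4 \<le> p (\<Sum>\<sigma><2 ^ n. (\<Sum>j<n. b j * s j \<sigma>) *\<^sub>R e \<sigma>)"
      by (simp add: sg scale sum_nonneg)
    then have "c * ((\<Sum>j<n. \<bar>b j\<bar>) / 4) \<le> c * p (\<Sum>\<sigma><2 ^ n. (\<Sum>j<n. b j * s j \<sigma>) *\<^sub>R e \<sigma>)"
      using c by (intro mult_left_mono) auto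
    then show "(c / 4) * (\<Sum>j<n. \<bar>b j\<bar>) \<le> p (\<Sum>j<n. b j *\<^sub>R f j)"
      unfolding comb scale using c by simp
  next
    have "16 * C0 * A * sqrt n \<le> sqrt n * sqrt n" using n by (intro mult_right_mono) auto
    then show "A \<le> (c / 4) * (\<Sum>j<n. 1)" using C0 n by (simp add: c_def field_simps)
  qed (simp_all add: sum.distrib sum_distrib_left algebra_simps)
  then show False using nospread by blast
qed

lemma spread_exists:
  fixes v :: "nat \<Rightarrow> 'b"
  assumes "\<And>i. p (v i) \<le> 1" "\<And>i j. i \<noteq> j \<Longrightarrow> 1 / 2 \<le> p (v i - v j)"
  shows "\<exists>N e. spread A N e"
proof -
  have "\<exists>e. unconditional N e" for N
    by (rule unconditional_exists[of v]) (use assms in auto)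
  then obtain N e where "spread (max A 1) N e" using spread_exists_aux[of "max A 1"] by auto
  then have "spread A N e" unfolding spread_def by (meson max.cobounded1 order_trans)
  then show ?thesis by blast
qed

end

section \<open>Continuity of formulas\<close>

lemma compact_real_box: "compact {x :: nat \<Rightarrow> real. \<forall>i. \<bar>x i\<bar> \<le> B}"
proof -
  have "compactin (product_topology (\<lambda>_. euclidean) UNIV) (PiE (UNIV :: nat set) (\<lambda>_. {- B..B :: real}))"
    by (subst compactin_PiE) auto
  moreover have "PiE (UNIV :: nat set) (\<lambda>_. {- B..B :: real}) = {x. \<forall>i. \<bar>x i\<bar> \<le> B}"
    by (auto simp: PiE_def Pi_def abs_le_iff) (metis minus_le_iff)+
  ultimately show ?thesis by (simp add: euclidean_product_topology)
qed

lemma continuous_box_bounded: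
  fixes u :: "(nat \<Rightarrow> real) \<Rightarrow> real"
  assumes "continuous_on UNIV u"
  shows "\<exists>C. \<forall>x. (\<forall>i. \<bar>x i\<bar> \<le> B) \<longrightarrow> \<bar>u x\<bar> \<le> C"
proof -
  have "compact (u ` {x. \<forall>i. \<bar>x i\<bar> \<le> B})"
    by (intro compact_continuous_image compact_real_box continuous_on_subset[OF assms]) auto
  then have "bounded (u ` {x. \<forall>i. \<bar>x i\<bar> \<le> B})" by (rule compact_imp_bounded)
  then show ?thesis unfolding bounded_iff by auto
qed

text \<open>The box is compact in the product topology. The product metric is bounded by twice the
  largest difference of coordinates plus an arbitrarily small tail, so closeness in all coordinates
  with a common bound suffices.\<close>

lemma continuous_box_uniform:
  fixes u :: "(nat \<Rightarrow> real) \<Rightarrow> real"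
  assumes "continuous_on UNIV u" and "\<epsilon> > 0"
  shows "\<exists>\<delta>>0. \<forall>x y. (\<forall>i. \<bar>x i\<bar> \<le> B) \<longrightarrow> (\<forall>i. \<bar>y i\<bar> \<le> B) \<longrightarrow> (\<forall>i. \<bar>x i - y i\<bar> \<le> \<delta>) \<longrightarrow> \<bar>u x - u y\<bar> \<le> \<epsilon>"
proof -
  have "uniformly_continuous_on {x. \<forall>i. \<bar>x i\<bar> \<le> B} u"
    by (intro compact_uniformly_continuous compact_real_box continuous_on_subset[OF assms(1)]) auto
  from this[unfolded uniformly_continuous_on_def, THEN spec, THEN mp, OF \<open>\<epsilon> > 0\<close>]
  obtain d where d: "d > 0" "\<And>x y. x \<in> {x. \<forall>i. \<bar>x i\<bar> \<le> B} \<Longrightarrow> y \<in> {x. \<forall>i. \<bar>x i\<bar> \<le> B} \<Longrightarrow>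
      dist y x < d \<Longrightarrow> dist (u y) (u x) < \<epsilon>"
    by (elim exE conjE) (rule that, assumption, blast)
  have "dist x y \<le> 2 * (d / 4)" if "\<forall>i. \<bar>x i - y i\<bar> \<le> d / 4" for x y :: "nat \<Rightarrow> real"
  proof (rule field_le_epsilon)
    fix e :: real assume "e > 0"
    then obtain N where N: "(1 / 2) ^ N < e" using real_arch_pow_inv[of e "1 / 2"] by auto
    have "Max {dist (x (from_nat n)) (y (from_nat n)) | n. n \<le> N} \<le> d / 4"
      using that by (subst Max_le_iff) (auto simp: dist_real_def)
    then show "dist x y \<le> 2 * (d / 4) + e"
      using dist_fun_le_dist_first_terms[of x y N] N by linarith
  qed
  then have "\<bar>u x - u y\<bar> \<le> \<epsilon>" if "\<forall>i. \<bar>x i\<bar> \<le> B" "\<forall>i. \<bar>y i\<bar> \<le> B" "\<forall>i. \<bar>x i - y i\<bar> \<le> d / 4" for x y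
  proof -
    have "dist x y < d" using \<open>\<And>x y. \<forall>i. \<bar>x i - y i\<bar> \<le> d / 4 \<Longrightarrow> dist x y \<le> 2 * (d / 4)\<close>[OF that(3)] d(1)
      by linarith
    then have "dist (u x) (u y) < \<epsilon>" using that by (intro d(2)) auto
    then show ?thesis by (simp add: dist_real_def)
  qed
  then show ?thesis using d(1) by (intro exI[of _ "d / 4"]) (simp add: field_simps)
qed

lemma finite_common_delta:
  assumes "finite S" "\<And>s. s \<in> S \<Longrightarrow> \<exists>\<delta>>0::real. P s \<delta>"
    and "\<And>s \<delta> \<delta>'. P s \<delta> \<Longrightarrow> \<delta>' \<le> \<delta> \<Longrightarrow> P s \<delta>'"
  shows "\<exists>\<delta>>0. \<forall>s\<in>S. P s \<delta>"
  using assms(1,2)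
proof (induction S)
  case empty
  show ?case by (auto intro: exI[of _ 1])
next
  case (insert s S)
  obtain \<delta>1 where \<delta>1: "\<delta>1 > 0" "P s \<delta>1" using insert.prems by blast
  obtain \<delta>2 where \<delta>2: "\<delta>2 > 0" "\<forall>s\<in>S. P s \<delta>2" using insert by blast
  have "P s (min \<delta>1 \<delta>2)" "\<forall>s\<in>S. P s (min \<delta>1 \<delta>2)"
    using assms(3)[OF \<delta>1(2), of "min \<delta>1 \<delta>2"] assms(3)[of _ \<delta>2 "min \<delta>1 \<delta>2"] \<delta>2 by auto
  then show ?case using \<delta>1 \<delta>2 by (intro exI[of _ "min \<delta>1 \<delta>2"]) auto
qed

lemma eval_trm_cong:
  "(\<And>v. v \<in> vars_trm t \<Longrightarrow> e v = e' v) \<Longrightarrow> eval_trm M e t = eval_trm M e' t"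
proof (induction t)
  case (Fn g ts)
  then have "map (eval_trm M e) ts = map (eval_trm M e') ts" by (intro map_cong) auto
  then show ?case by (simp only: eval_trm.simps)
qed simp

lemma eval_fm_cong:
  "(\<And>v. v \<in> free_vars \<phi> \<Longrightarrow> e v = e' v) \<Longrightarrow> eval_fm M e \<phi> = eval_fm M e' \<phi>"
proof (induction \<phi> arbitrary: e e')
  case (FDist s t)
  then show ?case using eval_trm_cong[of s e e' M] eval_trm_cong[of t e e' M] by simp
next
  case (FPred q ts)
  then have "map (eval_trm M e) ts = map (eval_trm M e') ts" by (intro map_cong eval_trm_cong) auto
  then show ?case by (simp only: eval_fm.simps)
next
  case (FConn u \<phi>s)
  have "map (eval_fm M e) \<phi>s = map (eval_fm M e') \<phi>s"
  proof (rule map_cong[OF refl])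
    fix \<phi> assume mem: "\<phi> \<in> set \<phi>s"
    have "e v = e' v" if "v \<in> free_vars \<phi>" for v using FConn.prems[of v] mem that by auto
    then show "eval_fm M e \<phi> = eval_fm M e' \<phi>" by (rule FConn.IH[OF mem])
  qed
  then show ?case by (simp only: eval_fm.simps)
next
  case (FSup i \<phi>)
  have "eval_fm M (e(i := x)) \<phi> = eval_fm M (e'(i := x)) \<phi>" for x
    by (rule FSup.IH) (use FSup.prems in simp)
  then show ?case by simp
next
  case (FInf i \<phi>)
  have "eval_fm M (e(i := x)) \<phi> = eval_fm M (e'(i := x)) \<phi>" for x
    by (rule FInf.IH) (use FInf.prems in simp)
  then show ?case by simp
qed

lemma abs_cSUP_diff_le:
  fixes f g :: "'x \<Rightarrow> real"
  assumes "U \<noteq> {}" "bdd_above (f ` U)" "bdd_above (g ` U)" "\<And>x. x \<in> U \<Longrightarrow> \<bar>f x - g x\<bar> \<le> \<epsilon>"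
  shows "\<bar>(SUP x\<in>U. f x) - (SUP x\<in>U. g x)\<bar> \<le> \<epsilon>"
proof -
  have 1: "(SUP x\<in>U. f x) \<le> (SUP x\<in>U. g x) + \<epsilon>"
  proof (rule cSUP_least[OF assms(1)])
    fix x assume x: "x \<in> U"
    then show "f x \<le> (SUP x\<in>U. g x) + \<epsilon>"
      using cSUP_upper[OF x assms(3)] assms(4)[OF x] by linarith
  qed
  have 2: "(SUP x\<in>U. g x) \<le> (SUP x\<in>U. f x) + \<epsilon>"
  proof (rule cSUP_least[OF assms(1)])
    fix x assume x: "x \<in> U"
    then show "g x \<le> (SUP x\<in>U. f x) + \<epsilon>"
      using cSUP_upper[OF x assms(2)] assms(4)[OF x] by linarith
  qed
  from 1 2 show ?thesis by linarith
qed

lemma cINF_eq_minus_cSUP: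
  fixes f :: "'x \<Rightarrow> real" shows "(INF x\<in>U. f x) = - (SUP x\<in>U. - f x)"
  by (simp add: Inf_real_def image_image)

text \<open>The bound on the distance makes the values of all formulas bounded; real suprema and
  infima behave as intended on bounded sets only.\<close>

locale bounded_mstructure =
  fixes L :: "('g, 'q) language" and M :: "('x, 'g, 'q) mstructure" and C :: real
  assumes mstructure: "is_mstructure L M"
    and lang: "is_language L"
    and dist_le: "\<And>x y. x \<in> universe M \<Longrightarrow> y \<in> universe M \<Longrightarrow> distance M x y \<le> C"
begin

lemma universe_ne: "universe M \<noteq> {}"
  using mstructure by (simp add: is_mstructure_def)

lemma metric: "Metric_space (universe M) (distance M)"
  using mstructure by (simp add: is_mstructure_def)

lemma finterp_closed: "g \<in> fsyms L \<Longrightarrow> length xs = farity L g \<Longrightarrow> set xs \<subseteq> universe M \<Longrightarrow> finterp M g xs \<in> universe M"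
  using mstructure by (simp add: is_mstructure_def tuples_def)

lemma finterp_modulus:
  assumes "g \<in> fsyms L" "\<epsilon> > 0" "length xs = farity L g" "set xs \<subseteq> universe M"
    "length ys = farity L g" "set ys \<subseteq> universe M" "\<And>i. i < farity L g \<Longrightarrow> distance M (xs ! i) (ys ! i) < fmodulus L g \<epsilon>"
  shows "distance M (finterp M g xs) (finterp M g ys) \<le> \<epsilon>"
  using mstructure assms by (simp add: is_mstructure_def tuples_def)

lemma pinterp_bounds:
  "q \<in> psyms L \<Longrightarrow> length xs = parity L q \<Longrightarrow> set xs \<subseteq> universe M \<Longrightarrow> pinterp M q xs \<in> {plower L q..pupper L q}"
  using mstructure by (simp add: is_mstructure_def tuples_def)

lemma pinterp_modulus:
  assumes "q \<in> psyms L" "\<epsilon> > 0" "length xs = parity L q" "set xs \<subseteq> universe M"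
    "length ys = parity L q" "set ys \<subseteq> universe M" "\<And>i. i < parity L q \<Longrightarrow> distance M (xs ! i) (ys ! i) < pmodulus L q \<epsilon>"
  shows "\<bar>pinterp M q xs - pinterp M q ys\<bar> \<le> \<epsilon>"
  using mstructure assms by (simp add: is_mstructure_def tuples_def)

lemma eval_trm_closed:
  "wf_trm L t \<Longrightarrow> (\<And>v. e v \<in> universe M) \<Longrightarrow> eval_trm M e t \<in> universe M"
proof (induction t)
  case (Fn g ts)
  then show ?case by (auto intro!: finterp_closed)
qed simp

lemma eval_trm_uniform:
  assumes "wf_trm L t" "\<epsilon> > 0"
  shows "\<exists>\<delta>>0. \<forall>e e'. (\<forall>v. e v \<in> universe M) \<longrightarrow> (\<forall>v. e' v \<in> universe M) \<longrightarrow>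
    (\<forall>v\<in>vars_trm t. distance M (e v) (e' v) < \<delta>) \<longrightarrow> distance M (eval_trm M e t) (eval_trm M e' t) \<le> \<epsilon>"
  using assms
proof (induction t arbitrary: \<epsilon>)
  case (Var i)
  then show ?case by (intro exI[of _ \<epsilon>]) auto
next
  case (Fn g ts)
  define m where "m = fmodulus L g \<epsilon>"
  have g: "g \<in> fsyms L" "length ts = farity L g" "\<And>t. t \<in> set ts \<Longrightarrow> wf_trm L t" using Fn.prems by auto
  have m: "m > 0" using lang g Fn.prems(2) by (simp add: is_language_def m_def)
  define P where "P t \<delta> \<longleftrightarrow> (\<forall>e e'. (\<forall>v. e v \<in> universe M) \<longrightarrow> (\<forall>v. e' v \<in> universe M) \<longrightarrow>
    (\<forall>v\<in>vars_trm t. distance M (e v) (e' v) < \<delta>) \<longrightarrow> distance M (eval_trm M e t) (eval_trm M e' t) \<le> m / 2)" for t \<delta>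
  have "\<exists>\<delta>>0. \<forall>t\<in>set ts. P t \<delta>"
  proof (rule finite_common_delta)
    show "\<exists>\<delta>>0. P t \<delta>" if "t \<in> set ts" for t
      unfolding P_def by (rule Fn.IH) (use that g m in auto)
    show "P t \<delta>'" if "P t \<delta>" "\<delta>' \<le> \<delta>" for t \<delta> \<delta>'
      using that unfolding P_def by (meson less_le_trans)
  qed simp
  then obtain \<delta> where \<delta>: "\<delta> > 0" "\<And>t. t \<in> set ts \<Longrightarrow> P t \<delta>" by blast
  have "distance M (eval_trm M e (Fn g ts)) (eval_trm M e' (Fn g ts)) \<le> \<epsilon>"
    if e: "\<forall>v. e v \<in> universe M" "\<forall>v. e' v \<in> universe M" "\<forall>v\<in>vars_trm (Fn g ts). distance M (e v) (e' v) < \<delta>" for e e'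
    unfolding eval_trm.simps
  proof (rule finterp_modulus)
    show "set (map (eval_trm M e) ts) \<subseteq> universe M" "set (map (eval_trm M e') ts) \<subseteq> universe M"
      using e g by (auto intro!: eval_trm_closed)
    fix i assume i: "i < farity L g"
    then have t: "ts ! i \<in> set ts" using g by simp
    have "distance M (eval_trm M e (ts ! i)) (eval_trm M e' (ts ! i)) \<le> m / 2"
      using \<delta>(2)[OF t] e t unfolding P_def by auto
    then show "distance M (map (eval_trm M e) ts ! i) (map (eval_trm M e') ts ! i) < fmodulus L g \<epsilon>"
      using i g m by (simp add: m_def)
  qed (use g Fn.prems in auto)
  then show ?case using \<delta>(1) by (intro exI[of _ \<delta>]) auto
qed

definition conn_args :: "(nat \<Rightarrow> 'x) \<Rightarrow> ('g, 'q) fm list \<Rightarrow> nat \<Rightarrow> real" where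
  "conn_args e \<phi>s i = (if i < length \<phi>s then eval_fm M e (\<phi>s ! i) else 0)"

lemma eval_FConn: "eval_fm M e (FConn u \<phi>s) = u (conn_args e \<phi>s)"
proof -
  have "(\<lambda>i. if i < length \<phi>s then map (eval_fm M e) \<phi>s ! i else 0) = conn_args e \<phi>s"
    by (auto simp: conn_args_def)
  then show ?thesis by (simp add: Let_def)
qed

text \<open>Bounds for the arguments of a connective place them in a compact box of sequences, on
  which the connective is bounded.\<close>

lemma eval_fm_bounded:
  "wf_fm L \<phi> \<Longrightarrow> \<exists>B. \<forall>e. (\<forall>v. e v \<in> universe M) \<longrightarrow> \<bar>eval_fm M e \<phi>\<bar> \<le> B"
proof (induction \<phi>)
  case (FDist s t)
  have "\<bar>eval_fm M e (FDist s t)\<bar> \<le> C" if "\<forall>v. e v \<in> universe M" for e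
    using FDist that dist_le eval_trm_closed Metric_space.nonneg[OF metric] by simp
  then show ?case by blast
next
  case (FPred q ts)
  have "\<bar>eval_fm M e (FPred q ts)\<bar> \<le> max \<bar>plower L q\<bar> \<bar>pupper L q\<bar>" if "\<forall>v. e v \<in> universe M" for e
  proof -
    have "pinterp M q (map (eval_trm M e) ts) \<in> {plower L q..pupper L q}"
      by (rule pinterp_bounds) (use FPred that eval_trm_closed in auto)
    then show ?thesis by auto
  qed
  then show ?case by blast
next
  case (FConn u \<phi>s)
  have "\<exists>B. \<forall>\<phi>\<in>set \<phi>s. \<forall>e. (\<forall>v. e v \<in> universe M) \<longrightarrow> \<bar>eval_fm M e \<phi>\<bar> \<le> B"
    using FConn
  proof (induction \<phi>s)
    case (Cons \<phi> \<phi>s)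
    obtain B1 where B1: "\<forall>e. (\<forall>v. e v \<in> universe M) \<longrightarrow> \<bar>eval_fm M e \<phi>\<bar> \<le> B1"
      using Cons.prems(1)[of \<phi>] Cons.prems(2) by auto
    have "\<exists>B. \<forall>\<phi>\<in>set \<phi>s. \<forall>e. (\<forall>v. e v \<in> universe M) \<longrightarrow> \<bar>eval_fm M e \<phi>\<bar> \<le> B"
      by (rule Cons.IH) (use Cons.prems in auto)
    then obtain B2 where B2: "\<forall>\<phi>\<in>set \<phi>s. \<forall>e. (\<forall>v. e v \<in> universe M) \<longrightarrow> \<bar>eval_fm M e \<phi>\<bar> \<le> B2" by blast
    have "\<forall>\<psi>\<in>set (\<phi> # \<phi>s). \<forall>e. (\<forall>v. e v \<in> universe M) \<longrightarrow> \<bar>eval_fm M e \<psi>\<bar> \<le> max B1 B2"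
      using B1 B2 by (auto intro: max.coboundedI1 max.coboundedI2)
    then show ?case by blast
  qed simp
  then obtain B where B: "\<And>\<phi> e. \<phi> \<in> set \<phi>s \<Longrightarrow> (\<forall>v. e v \<in> universe M) \<Longrightarrow> \<bar>eval_fm M e \<phi>\<bar> \<le> B" by blast
  obtain D where D: "\<And>x. (\<forall>i. \<bar>x i\<bar> \<le> \<bar>B\<bar>) \<Longrightarrow> \<bar>u x\<bar> \<le> D"
    using continuous_box_bounded[of u "\<bar>B\<bar>"] FConn.prems by auto
  have "\<bar>eval_fm M e (FConn u \<phi>s)\<bar> \<le> D" if e: "\<forall>v. e v \<in> universe M" for e
    unfolding eval_FConn
  proof (rule D, intro allI)
    fix i show "\<bar>conn_args e \<phi>s i\<bar> \<le> \<bar>B\<bar>"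
      using B[of "\<phi>s ! i" e] e by (force simp: conn_args_def)
  qed
  then show ?case by blast
next
  case (FSup i \<phi>)
  then obtain B where B: "\<And>e. (\<forall>v. e v \<in> universe M) \<Longrightarrow> \<bar>eval_fm M e \<phi>\<bar> \<le> B" by auto
  have "\<bar>eval_fm M e (FSup i \<phi>)\<bar> \<le> B" if e: "\<forall>v. e v \<in> universe M" for e
    unfolding eval_fm.simps by (rule cSup_abs_le) (use universe_ne e B in auto)
  then show ?case by blast
next
  case (FInf i \<phi>)
  then obtain B where B: "\<And>e. (\<forall>v. e v \<in> universe M) \<Longrightarrow> \<bar>eval_fm M e \<phi>\<bar> \<le> B" by auto
  have "\<bar>eval_fm M e (FInf i \<phi>)\<bar> \<le> B" if e: "\<forall>v. e v \<in> universe M" for e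
    unfolding eval_fm.simps by (rule cInf_abs_ge) (use universe_ne e B in auto)
  then show ?case by blast
qed

text \<open>The modulus serves all environments at once. It passes through quantifiers because
  suprema and infima preserve uniform bounds and the quantified variable has the same value in both
  environments.\<close>

lemma eval_fm_uniform:
  assumes "wf_fm L \<phi>" "\<epsilon> > 0"
  shows "\<exists>\<delta>>0. \<forall>e e'. (\<forall>v. e v \<in> universe M) \<longrightarrow> (\<forall>v. e' v \<in> universe M) \<longrightarrow>
    (\<forall>v\<in>free_vars \<phi>. distance M (e v) (e' v) < \<delta>) \<longrightarrow> \<bar>eval_fm M e \<phi> - eval_fm M e' \<phi>\<bar> \<le> \<epsilon>"
  using assms
proof (induction \<phi> arbitrary: \<epsilon>)
  case (FDist s t)
  obtain \<delta>1 where \<delta>1: "\<delta>1 > 0" "\<And>e e'. (\<forall>v. e v \<in> universe M) \<Longrightarrow> (\<forall>v. e' v \<in> universe M) \<Longrightarrow>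
    (\<forall>v\<in>vars_trm s. distance M (e v) (e' v) < \<delta>1) \<Longrightarrow> distance M (eval_trm M e s) (eval_trm M e' s) \<le> \<epsilon> / 2"
    using eval_trm_uniform[of s "\<epsilon> / 2"] FDist by auto
  obtain \<delta>2 where \<delta>2: "\<delta>2 > 0" "\<And>e e'. (\<forall>v. e v \<in> universe M) \<Longrightarrow> (\<forall>v. e' v \<in> universe M) \<Longrightarrow>
    (\<forall>v\<in>vars_trm t. distance M (e v) (e' v) < \<delta>2) \<Longrightarrow> distance M (eval_trm M e t) (eval_trm M e' t) \<le> \<epsilon> / 2"
    using eval_trm_uniform[of t "\<epsilon> / 2"] FDist by auto
  interpret Metric_space "universe M" "distance M" by (rule metric)
  have "\<bar>eval_fm M e (FDist s t) - eval_fm M e' (FDist s t)\<bar> \<le> \<epsilon>"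
    if e: "\<forall>v. e v \<in> universe M" "\<forall>v. e' v \<in> universe M"
      "\<forall>v\<in>free_vars (FDist s t). distance M (e v) (e' v) < min \<delta>1 \<delta>2" for e e'
  proof -
    let ?s = "eval_trm M e s" and ?s' = "eval_trm M e' s" and ?t = "eval_trm M e t" and ?t' = "eval_trm M e' t"
    have cl: "?s \<in> universe M" "?s' \<in> universe M" "?t \<in> universe M" "?t' \<in> universe M"
      using FDist.prems e by (auto intro!: eval_trm_closed)
    have "distance M ?s ?s' \<le> \<epsilon> / 2" "distance M ?t ?t' \<le> \<epsilon> / 2" using \<delta>1(2) \<delta>2(2) e by auto
    then show ?thesis
      using triangle[OF cl(1,2,3)] triangle[OF cl(2,4,3)] triangle[OF cl(2,1,4)] triangle[OF cl(1,3,4)]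
        commute[of ?s ?s'] commute[of ?t ?t'] by simp
  qed
  then show ?case using \<delta>1 \<delta>2 by (intro exI[of _ "min \<delta>1 \<delta>2"]) auto
next
  case (FPred q ts)
  define m where "m = pmodulus L q \<epsilon>"
  have q: "q \<in> psyms L" "length ts = parity L q" "\<And>t. t \<in> set ts \<Longrightarrow> wf_trm L t" using FPred.prems by auto
  have m: "m > 0" using lang q FPred.prems(2) by (simp add: is_language_def m_def)
  define P where "P t \<delta> \<longleftrightarrow> (\<forall>e e'. (\<forall>v. e v \<in> universe M) \<longrightarrow> (\<forall>v. e' v \<in> universe M) \<longrightarrow>
    (\<forall>v\<in>vars_trm t. distance M (e v) (e' v) < \<delta>) \<longrightarrow> distance M (eval_trm M e t) (eval_trm M e' t) \<le> m / 2)" for t \<delta>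
  have "\<exists>\<delta>>0. \<forall>t\<in>set ts. P t \<delta>"
  proof (rule finite_common_delta)
    show "\<exists>\<delta>>0. P t \<delta>" if "t \<in> set ts" for t
      unfolding P_def by (rule eval_trm_uniform) (use that q m in auto)
    show "P t \<delta>'" if "P t \<delta>" "\<delta>' \<le> \<delta>" for t \<delta> \<delta>'
      using that unfolding P_def by (meson less_le_trans)
  qed simp
  then obtain \<delta> where \<delta>: "\<delta> > 0" "\<And>t. t \<in> set ts \<Longrightarrow> P t \<delta>" by blast
  have "\<bar>eval_fm M e (FPred q ts) - eval_fm M e' (FPred q ts)\<bar> \<le> \<epsilon>"
    if e: "\<forall>v. e v \<in> universe M" "\<forall>v. e' v \<in> universe M" "\<forall>v\<in>free_vars (FPred q ts). distance M (e v) (e' v) < \<delta>" for e e'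
    unfolding eval_fm.simps
  proof (rule pinterp_modulus)
    show "set (map (eval_trm M e) ts) \<subseteq> universe M" "set (map (eval_trm M e') ts) \<subseteq> universe M"
      using e q by (auto intro!: eval_trm_closed)
    fix i assume i: "i < parity L q"
    then have t: "ts ! i \<in> set ts" using q by simp
    have "distance M (eval_trm M e (ts ! i)) (eval_trm M e' (ts ! i)) \<le> m / 2"
      using \<delta>(2)[OF t] e t unfolding P_def by auto
    then show "distance M (map (eval_trm M e) ts ! i) (map (eval_trm M e') ts ! i) < pmodulus L q \<epsilon>"
      using i q m by (simp add: m_def)
  qed (use q FPred.prems in auto)
  then show ?case using \<delta>(1) by (intro exI[of _ \<delta>]) auto
next
  case (FConn u \<phi>s)
  have "\<exists>B. \<forall>\<phi>\<in>set \<phi>s. \<forall>e. (\<forall>v. e v \<in> universe M) \<longrightarrow> \<bar>eval_fm M e \<phi>\<bar> \<le> B"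
    using FConn.prems(1)
  proof (induction \<phi>s)
    case (Cons \<phi> \<phi>s)
    obtain B1 where B1: "\<forall>e. (\<forall>v. e v \<in> universe M) \<longrightarrow> \<bar>eval_fm M e \<phi>\<bar> \<le> B1"
      using eval_fm_bounded[of \<phi>] Cons.prems by auto
    obtain B2 where B2: "\<forall>\<phi>\<in>set \<phi>s. \<forall>e. (\<forall>v. e v \<in> universe M) \<longrightarrow> \<bar>eval_fm M e \<phi>\<bar> \<le> B2"
      using Cons by auto
    have "\<forall>\<psi>\<in>set (\<phi> # \<phi>s). \<forall>e. (\<forall>v. e v \<in> universe M) \<longrightarrow> \<bar>eval_fm M e \<psi>\<bar> \<le> max B1 B2"
      using B1 B2 by (auto intro: max.coboundedI1 max.coboundedI2)
    then show ?case by blast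
  qed simp
  then obtain B where B: "\<And>\<phi> e. \<phi> \<in> set \<phi>s \<Longrightarrow> (\<forall>v. e v \<in> universe M) \<Longrightarrow> \<bar>eval_fm M e \<phi>\<bar> \<le> B" by blast
  obtain \<eta> where \<eta>: "\<eta> > 0" "\<And>x y. (\<forall>i. \<bar>x i\<bar> \<le> \<bar>B\<bar>) \<Longrightarrow> (\<forall>i. \<bar>y i\<bar> \<le> \<bar>B\<bar>) \<Longrightarrow> (\<forall>i. \<bar>x i - y i\<bar> \<le> \<eta>) \<Longrightarrow> \<bar>u x - u y\<bar> \<le> \<epsilon>"
    using continuous_box_uniform[of u \<epsilon> "\<bar>B\<bar>"] FConn.prems by auto
  define P where "P \<phi> \<delta> \<longleftrightarrow> (\<forall>e e'. (\<forall>v. e v \<in> universe M) \<longrightarrow> (\<forall>v. e' v \<in> universe M) \<longrightarrow>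
    (\<forall>v\<in>free_vars \<phi>. distance M (e v) (e' v) < \<delta>) \<longrightarrow> \<bar>eval_fm M e \<phi> - eval_fm M e' \<phi>\<bar> \<le> \<eta>)" for \<phi> \<delta>
  have "\<exists>\<delta>>0. \<forall>\<phi>\<in>set \<phi>s. P \<phi> \<delta>"
  proof (rule finite_common_delta)
    show "\<exists>\<delta>>0. P \<phi> \<delta>" if "\<phi> \<in> set \<phi>s" for \<phi>
      unfolding P_def by (rule FConn.IH) (use that FConn.prems \<eta> in auto)
    show "P \<phi> \<delta>'" if "P \<phi> \<delta>" "\<delta>' \<le> \<delta>" for \<phi> \<delta> \<delta>'
      using that unfolding P_def by (meson less_le_trans)
  qed simp
  then obtain \<delta> where \<delta>: "\<delta> > 0" "\<And>\<phi>. \<phi> \<in> set \<phi>s \<Longrightarrow> P \<phi> \<delta>" by blast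
  have "\<bar>eval_fm M e (FConn u \<phi>s) - eval_fm M e' (FConn u \<phi>s)\<bar> \<le> \<epsilon>"
    if e: "\<forall>v. e v \<in> universe M" "\<forall>v. e' v \<in> universe M" "\<forall>v\<in>free_vars (FConn u \<phi>s). distance M (e v) (e' v) < \<delta>" for e e'
    unfolding eval_FConn
  proof (rule \<eta>(2); intro allI)
    fix i
    show "\<bar>conn_args e \<phi>s i\<bar> \<le> \<bar>B\<bar>" "\<bar>conn_args e' \<phi>s i\<bar> \<le> \<bar>B\<bar>"
      using B[of "\<phi>s ! i" e] B[of "\<phi>s ! i" e'] e by (force simp: conn_args_def)+
    show "\<bar>conn_args e \<phi>s i - conn_args e' \<phi>s i\<bar> \<le> \<eta>"
    proof (cases "i < length \<phi>s")
      case True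
      then have mem: "\<phi>s ! i \<in> set \<phi>s" by simp
      have "\<forall>v\<in>free_vars (\<phi>s ! i). distance M (e v) (e' v) < \<delta>" using e(3) mem by auto
      then have "\<bar>eval_fm M e (\<phi>s ! i) - eval_fm M e' (\<phi>s ! i)\<bar> \<le> \<eta>"
        using \<delta>(2)[OF mem] e(1,2) unfolding P_def by blast
      then show ?thesis using True by (simp add: conn_args_def)
    qed (use \<eta> in \<open>simp add: conn_args_def\<close>)
  qed
  then show ?case using \<delta>(1) by (intro exI[of _ \<delta>]) auto
next
  case (FSup i \<phi>)
  then obtain \<delta> where \<delta>: "\<delta> > 0" "\<And>e e'. (\<forall>v. e v \<in> universe M) \<Longrightarrow> (\<forall>v. e' v \<in> universe M) \<Longrightarrow>
    (\<forall>v\<in>free_vars \<phi>. distance M (e v) (e' v) < \<delta>) \<Longrightarrow> \<bar>eval_fm M e \<phi> - eval_fm M e' \<phi>\<bar> \<le> \<epsilon>"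
    by (metis wf_fm.simps(4))
  have "wf_fm L \<phi>" using FSup.prems by simp
  from eval_fm_bounded[OF this] obtain B where B0: "\<forall>e. (\<forall>v. e v \<in> universe M) \<longrightarrow> \<bar>eval_fm M e \<phi>\<bar> \<le> B"
    by (elim exE) (rule that)
  have B: "\<bar>eval_fm M e \<phi>\<bar> \<le> B" if "\<forall>v. e v \<in> universe M" for e
    using B0[THEN spec, of e] that by simp
  have "\<bar>eval_fm M e (FSup i \<phi>) - eval_fm M e' (FSup i \<phi>)\<bar> \<le> \<epsilon>"
    if e: "\<forall>v. e v \<in> universe M" "\<forall>v. e' v \<in> universe M" "\<forall>v\<in>free_vars (FSup i \<phi>). distance M (e v) (e' v) < \<delta>" for e e'
    unfolding eval_fm.simps
  proof (rule abs_cSUP_diff_le[OF universe_ne])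
    show "bdd_above ((\<lambda>x. eval_fm M (e(i := x)) \<phi>) ` universe M)" "bdd_above ((\<lambda>x. eval_fm M (e'(i := x)) \<phi>) ` universe M)"
      using e by (auto intro!: bdd_aboveI[of _ B] abs_le_D1[OF B])
    fix x assume "x \<in> universe M"
    then show "\<bar>eval_fm M (e(i := x)) \<phi> - eval_fm M (e'(i := x)) \<phi>\<bar> \<le> \<epsilon>"
      using e \<delta>(1) Metric_space.zero[OF metric, of x x] by (intro \<delta>(2)) auto
  qed
  then show ?case using \<delta>(1) by (intro exI[of _ \<delta>]) auto
next
  case (FInf i \<phi>)
  then obtain \<delta> where \<delta>: "\<delta> > 0" "\<And>e e'. (\<forall>v. e v \<in> universe M) \<Longrightarrow> (\<forall>v. e' v \<in> universe M) \<Longrightarrow>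
    (\<forall>v\<in>free_vars \<phi>. distance M (e v) (e' v) < \<delta>) \<Longrightarrow> \<bar>eval_fm M e \<phi> - eval_fm M e' \<phi>\<bar> \<le> \<epsilon>"
    by (metis wf_fm.simps(5))
  have "wf_fm L \<phi>" using FInf.prems by simp
  from eval_fm_bounded[OF this] obtain B where B0: "\<forall>e. (\<forall>v. e v \<in> universe M) \<longrightarrow> \<bar>eval_fm M e \<phi>\<bar> \<le> B"
    by (elim exE) (rule that)
  have B: "\<bar>eval_fm M e \<phi>\<bar> \<le> B" if "\<forall>v. e v \<in> universe M" for e
    using B0[THEN spec, of e] that by simp
  have "\<bar>eval_fm M e (FInf i \<phi>) - eval_fm M e' (FInf i \<phi>)\<bar> \<le> \<epsilon>"
    if e: "\<forall>v. e v \<in> universe M" "\<forall>v. e' v \<in> universe M" "\<forall>v\<in>free_vars (FInf i \<phi>). distance M (e v) (e' v) < \<delta>" for e e'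
  proof -
    have "\<bar>(SUP x\<in>universe M. - eval_fm M (e(i := x)) \<phi>) - (SUP x\<in>universe M. - eval_fm M (e'(i := x)) \<phi>)\<bar> \<le> \<epsilon>"
    proof (rule abs_cSUP_diff_le[OF universe_ne])
      show "bdd_above ((\<lambda>x. - eval_fm M (e(i := x)) \<phi>) ` universe M)" "bdd_above ((\<lambda>x. - eval_fm M (e'(i := x)) \<phi>) ` universe M)"
        using e by (auto intro!: bdd_aboveI[of _ B] abs_le_D2[OF B])
      fix x assume "x \<in> universe M"
      then have "\<bar>eval_fm M (e(i := x)) \<phi> - eval_fm M (e'(i := x)) \<phi>\<bar> \<le> \<epsilon>"
        using e \<delta>(1) Metric_space.zero[OF metric, of x x] by (intro \<delta>(2)) auto
      then show "\<bar>- eval_fm M (e(i := x)) \<phi> - - eval_fm M (e'(i := x)) \<phi>\<bar> \<le> \<epsilon>" by linarith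
    qed
    then show ?thesis unfolding eval_fm.simps cINF_eq_minus_cSUP by linarith
  qed
  then show ?case using \<delta>(1) by (intro exI[of _ \<delta>]) auto
qed

end

section \<open>Ultrafilters\<close>

locale ultra =
  fixes F :: "'i filter"
  assumes nontrivial: "F \<noteq> bot"
    and ultra: "eventually P F \<or> eventually (\<lambda>i. \<not> P i) F"

text \<open>Zorn's lemma for the families with the finite intersection property that contain
  \<open>\<B>\<close>. A set outside a maximal family is disjoint from some finite intersection of
  its members, which decides every predicate.\<close>

lemma ultra_exists:
  fixes \<B> :: "'i set set"
  assumes fip: "\<And>X. finite X \<Longrightarrow> X \<subseteq> \<B> \<Longrightarrow> \<Inter> X \<noteq> {}"
  shows "\<exists>F. ultra F \<and> (\<forall>S\<in>\<B>. eventually (\<lambda>i. i \<in> S) F)"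
proof -
  define \<F> where "\<F> = {A. \<B> \<subseteq> A \<and> (\<forall>X. finite X \<longrightarrow> X \<subseteq> A \<longrightarrow> \<Inter> X \<noteq> ({} :: 'i set))}"
  have "\<B> \<in> \<F>" using fip by (simp add: \<F>_def)
  have "\<exists>A\<in>\<F>. \<forall>A'\<in>\<F>. A \<subseteq> A' \<longrightarrow> A' = A"
  proof (rule subset_Zorn_nonempty)
    show "\<F> \<noteq> {}" using \<open>\<B> \<in> \<F>\<close> by blast
    fix c assume c: "c \<noteq> {}" "subset.chain \<F> c"
    have "\<Inter> X \<noteq> {}" if X: "finite X" "X \<subseteq> \<Union> c" for X
    proof -
      obtain A where "A \<in> c" "X \<subseteq> A"
        using finite_subset_Union_chain[OF X c] by blast
      then show ?thesis using c(2) X(1) by (auto simp: \<F>_def subset.chain_def)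
    qed
    moreover have "\<B> \<subseteq> \<Union> c"
    proof -
      obtain A where "A \<in> c" using c(1) by blast
      moreover have "A \<in> \<F>" using c(2) \<open>A \<in> c\<close> by (auto simp: subset.chain_def)
      ultimately show ?thesis by (auto simp: \<F>_def)
    qed
    ultimately show "\<Union> c \<in> \<F>" by (simp add: \<F>_def)
  qed
  then obtain A where A: "A \<in> \<F>" and maximal: "\<And>A'. A' \<in> \<F> \<Longrightarrow> A \<subseteq> A' \<Longrightarrow> A' = A" by blast
  define F where "F = (INF S\<in>A. principal S)"
  have ev: "eventually P F \<longleftrightarrow> (\<exists>X. finite X \<and> X \<subseteq> A \<and> \<Inter> X \<subseteq> Collect P)" for P
  proof -
    have "eventually P (INF S\<in>X. principal S) \<longleftrightarrow> \<Inter> X \<subseteq> Collect P" if "finite X" for X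
      using that by (auto simp: INF_principal_finite eventually_principal)
    then show ?thesis unfolding F_def by (subst eventually_INF) metis
  qed
  have "F \<noteq> bot"
    using A unfolding trivial_limit_def ev by (fastforce simp: \<F>_def)
  moreover have "eventually P F \<or> eventually (\<lambda>i. \<not> P i) F" for P
  proof (cases "Collect P \<in> A")
    case True
    then have "eventually P F" unfolding ev by (intro exI[of _ "{Collect P}"]) auto
    then show ?thesis ..
  next
    case False
    then have "insert (Collect P) A \<notin> \<F>" using maximal[of "insert (Collect P) A"] by blast
    then obtain X where X: "finite X" "X \<subseteq> insert (Collect P) A" "\<Inter> X = {}"
      using A by (auto simp: \<F>_def)
    have "\<Inter> (X - {Collect P}) \<subseteq> Collect (\<lambda>i. \<not> P i)" using X(3) by blast
    then have "eventually (\<lambda>i. \<not> P i) F" unfolding ev using X by (intro exI[of _ "X - {Collect P}"]) auto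
    then show ?thesis ..
  qed
  moreover have "eventually (\<lambda>i. i \<in> S) F" if "S \<in> \<B>" for S
    unfolding ev using A that by (intro exI[of _ "{S}"]) (auto simp: \<F>_def)
  ultimately show ?thesis unfolding ultra_def by blast
qed

context ultra
begin

lemma not_eventually_iff: "\<not> eventually P F \<longleftrightarrow> eventually (\<lambda>i. \<not> P i) F"
proof
  assume "eventually (\<lambda>i. \<not> P i) F"
  moreover have "\<not> eventually (\<lambda>i. P i \<and> \<not> P i) F" using nontrivial by (simp add: trivial_limit_def[symmetric])
  ultimately show "\<not> eventually P F" using eventually_conj by blast
qed (use ultra[of P] in blast)

text \<open>The limit is the supremum of the numbers that are eventually lower bounds: the
  ultrafilter decides each comparison with a number, so larger numbers are eventually upper
  bounds.\<close>

lemma bounded_tendsto_Lim: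
  fixes f :: "'i \<Rightarrow> real"
  assumes "eventually (\<lambda>i. \<bar>f i\<bar> \<le> B) F"
  shows "(f \<longlongrightarrow> Lim F f) F"
proof -
  define S where "S = {c. eventually (\<lambda>i. c \<le> f i) F}"
  have lower: "- B \<in> S" unfolding S_def using assms by (auto elim!: eventually_mono)
  have upper: "c \<le> B" if "c \<in> S" for c
  proof -
    have "eventually (\<lambda>i. c \<le> B) F"
      using eventually_conj[OF assms that[unfolded S_def mem_Collect_eq]] by (auto elim!: eventually_mono)
    then show ?thesis using nontrivial by (simp add: eventually_const_iff)
  qed
  have bdd: "bdd_above S" using upper by (rule bdd_aboveI)
  have "(f \<longlongrightarrow> Sup S) F"
  proof (rule order_tendstoI)
    fix a assume "a < Sup S"
    then obtain c where "c \<in> S" "a < c" using less_cSup_iff[of S a] lower bdd by blast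
    then show "eventually (\<lambda>i. a < f i) F" by (auto simp: S_def elim!: eventually_mono)
  next
    fix a assume a: "Sup S < a"
    show "eventually (\<lambda>i. f i < a) F"
    proof (rule ccontr)
      assume "\<not> ?thesis"
      then have "eventually (\<lambda>i. \<not> f i < a) F" by (simp add: not_eventually_iff)
      then have "a \<in> S" by (auto simp: S_def not_less)
      then show False using a cSup_upper[OF _ bdd] by force
    qed
  qed
  then show ?thesis using tendsto_Lim[OF nontrivial] by metis
qed

end

section \<open>Banach spaces with carriers\<close>

lemma (in abelian_group) minus_eq_zero_iff:
  "a \<in> carrier G \<Longrightarrow> b \<in> carrier G \<Longrightarrow> a \<ominus> b = \<zero> \<longleftrightarrow> a = b"
  by (metis minus_equality minus_minus a_inv_closed a_minus_def r_neg)

context banach_space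
begin

lemma carrier_scalars [simp]: "carrier (scalars K) = K" "zero (scalars K) = 0" "one (scalars K) = 1"
  "add (scalars K) = (+)" "mult (scalars K) = (*)"
  by (simp_all add: scalars_def)

lemma real_in_K [simp]: "complex_of_real r \<in> K"
  using scalar_field by (auto simp: is_scalar_field_def)

lemma one_in_K [simp]: "1 \<in> K" "0 \<in> K" "-1 \<in> K"
  using real_in_K[of 1] real_in_K[of 0] real_in_K[of "-1"] by simp_all

lemma K_add_mult: "a \<in> K \<Longrightarrow> b \<in> K \<Longrightarrow> a + b \<in> K" "a \<in> K \<Longrightarrow> b \<in> K \<Longrightarrow> a - b \<in> K" "a \<in> K \<Longrightarrow> b \<in> K \<Longrightarrow> a * b \<in> K"
  using scalar_field by (auto simp: is_scalar_field_def)

lemma sm_closed [simp]: "a \<in> K \<Longrightarrow> x \<in> carrier X \<Longrightarrow> a \<odot> x \<in> carrier X"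
  using smult_closed by simp

lemma sm_add_left: "a \<in> K \<Longrightarrow> b \<in> K \<Longrightarrow> x \<in> carrier X \<Longrightarrow> (a + b) \<odot> x = a \<odot> x \<oplus> b \<odot> x"
  using smult_l_distr by simp

lemma sm_add_right: "a \<in> K \<Longrightarrow> x \<in> carrier X \<Longrightarrow> y \<in> carrier X \<Longrightarrow> a \<odot> (x \<oplus> y) = a \<odot> x \<oplus> a \<odot> y"
  using smult_r_distr by simp

lemma sm_assoc: "a \<in> K \<Longrightarrow> b \<in> K \<Longrightarrow> x \<in> carrier X \<Longrightarrow> (a * b) \<odot> x = a \<odot> (b \<odot> x)"
  using smult_assoc1 by simp

lemma sm_one: "x \<in> carrier X \<Longrightarrow> 1 \<odot> x = x"
  using smult_one by simp

lemma sm_zero_left [simp]: "x \<in> carrier X \<Longrightarrow> 0 \<odot> x = \<zero>"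
  using smult_l_null by simp

lemma sm_minus_one: "x \<in> carrier X \<Longrightarrow> \<ominus> x = (- 1) \<odot> x"
proof (rule M.minus_equality)
  assume x: "x \<in> carrier X"
  show "(- 1) \<odot> x \<oplus> x = \<zero>"
    using sm_add_left[of "-1" 1 x] sm_one[OF x] x by simp
qed auto

lemma sm_minus_right: "a \<in> K \<Longrightarrow> x \<in> carrier X \<Longrightarrow> a \<odot> (\<ominus> x) = \<ominus> (a \<odot> x)"
  by (simp add: sm_minus_one sm_assoc[symmetric])

lemma diff_closed [simp]: "x \<in> carrier X \<Longrightarrow> y \<in> carrier X \<Longrightarrow> x \<ominus> y \<in> carrier X"
  by (simp add: a_minus_def)

lemma sm_diff_right: "a \<in> K \<Longrightarrow> x \<in> carrier X \<Longrightarrow> y \<in> carrier X \<Longrightarrow> a \<odot> (x \<ominus> y) = a \<odot> x \<ominus> a \<odot> y"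
  by (simp add: a_minus_def sm_add_right sm_minus_right)

lemma sm_diff_left: "a \<in> K \<Longrightarrow> b \<in> K \<Longrightarrow> x \<in> carrier X \<Longrightarrow> (a - b) \<odot> x = a \<odot> x \<ominus> b \<odot> x"
proof -
  assume a: "a \<in> K" "b \<in> K" "x \<in> carrier X"
  have "- b \<in> K" using K_add_mult(2)[of 0 b] a by simp
  moreover have "(- b) \<odot> x = \<ominus> (b \<odot> x)"
    using a sm_assoc[of "-1" b x] by (simp add: sm_minus_one)
  ultimately show ?thesis using a sm_add_left[of a "- b" x] by (simp add: a_minus_def)
qed

lemma diff_diff_add: "a \<in> carrier X \<Longrightarrow> b \<in> carrier X \<Longrightarrow> c \<in> carrier X \<Longrightarrow> d \<in> carrier X \<Longrightarrow>
    (a \<oplus> b) \<ominus> (c \<oplus> d) = (a \<ominus> c) \<oplus> (b \<ominus> d)"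
  by (simp add: a_minus_def M.minus_add M.a_ac)

lemma diff_trans: "a \<in> carrier X \<Longrightarrow> b \<in> carrier X \<Longrightarrow> c \<in> carrier X \<Longrightarrow> (a \<ominus> b) \<oplus> (b \<ominus> c) = a \<ominus> c"
proof -
  assume a: "a \<in> carrier X" "b \<in> carrier X" "c \<in> carrier X"
  have "(a \<ominus> b) \<oplus> (b \<ominus> c) = a \<oplus> ((\<ominus> b \<oplus> b) \<oplus> \<ominus> c)"
    using a by (simp only: a_minus_def M.a_assoc M.a_inv_closed M.add.m_closed)
  then show ?thesis using a by (simp add: M.l_neg a_minus_def)
qed

lemma diff_self [simp]: "a \<in> carrier X \<Longrightarrow> a \<ominus> a = \<zero>"
  by (simp add: a_minus_def M.r_neg)

lemma diff_zero [simp]: "a \<in> carrier X \<Longrightarrow> a \<ominus> \<zero> = a"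
  by (simp add: a_minus_def)

lemma diff_eq_zero_iff: "a \<in> carrier X \<Longrightarrow> b \<in> carrier X \<Longrightarrow> a \<ominus> b = \<zero> \<longleftrightarrow> a = b"
  by (rule M.minus_eq_zero_iff)

lemma nrm_zero [simp]: "nrm X \<zero> = 0"
  using nrm_eq_0_iff by simp

lemma nrm_minus [simp]: "x \<in> carrier X \<Longrightarrow> nrm X (\<ominus> x) = nrm X x"
  using nrm_smult[of "-1" x] by (simp add: sm_minus_one)

lemma nrm_sm_real [simp]: "x \<in> carrier X \<Longrightarrow> nrm X (complex_of_real r \<odot> x) = \<bar>r\<bar> * nrm X x"
  using nrm_smult[of "complex_of_real r" x] by simp

lemma nrm_diff_commute: "x \<in> carrier X \<Longrightarrow> y \<in> carrier X \<Longrightarrow> nrm X (x \<ominus> y) = nrm X (y \<ominus> x)"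
proof -
  assume a: "x \<in> carrier X" "y \<in> carrier X"
  have "\<ominus> (x \<ominus> y) = y \<ominus> x" using a by (simp add: a_minus_def M.minus_add M.a_comm)
  then show ?thesis using nrm_minus[of "x \<ominus> y"] a by simp
qed

lemma nrm_diff_triangle: "x \<in> carrier X \<Longrightarrow> y \<in> carrier X \<Longrightarrow> z \<in> carrier X \<Longrightarrow>
    nrm X (x \<ominus> z) \<le> nrm X (x \<ominus> y) + nrm X (y \<ominus> z)"
  using nrm_triangle[of "x \<ominus> y" "y \<ominus> z"] by (simp add: diff_trans)

lemma nrm_diff_le: "x \<in> carrier X \<Longrightarrow> y \<in> carrier X \<Longrightarrow> nrm X (x \<ominus> y) \<le> nrm X x + nrm X y"
  using nrm_triangle[of x "\<ominus> y"] by (simp add: a_minus_def)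

lemma abs_nrm_diff_le: "x \<in> carrier X \<Longrightarrow> y \<in> carrier X \<Longrightarrow> \<bar>nrm X x - nrm X y\<bar> \<le> nrm X (x \<ominus> y)"
  using nrm_diff_triangle[of x y \<zero>] nrm_diff_triangle[of y x \<zero>] nrm_diff_commute[of x y] by simp

lemma ndist_eq: "x \<in> carrier X \<Longrightarrow> y \<in> carrier X \<Longrightarrow> ndist X x y = nrm X (x \<ominus> y)"
  by (simp add: ndist_def)

lemma Metric_space_ndist: "S \<subseteq> carrier X \<Longrightarrow> Metric_space S (ndist X)"
proof
  fix x y z assume S: "S \<subseteq> carrier X"
  show "0 \<le> ndist X x y" by (simp add: ndist_def nrm_nonneg)
  show "ndist X x y = ndist X y x" by (auto simp: ndist_def nrm_diff_commute)
  show "x \<in> S \<Longrightarrow> y \<in> S \<Longrightarrow> (ndist X x y = 0) = (x = y)"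
    using S by (auto simp: ndist_eq subset_iff nrm_eq_0_iff diff_eq_zero_iff)
  show "x \<in> S \<Longrightarrow> y \<in> S \<Longrightarrow> z \<in> S \<Longrightarrow> ndist X x z \<le> ndist X x y + ndist X y z"
    using S by (auto simp: ndist_eq subset_iff nrm_diff_triangle)
qed

sublocale met: Metric_space "carrier X" "ndist X"
  by (rule Metric_space_ndist) simp

lemma unit_ball_carrier: "x \<in> unit_ball X \<Longrightarrow> x \<in> carrier X" "x \<in> unit_ball X \<Longrightarrow> nrm X x \<le> 1"
  by (auto simp: unit_ball_def)

lemma zero_unit_ball [simp]: "\<zero> \<in> unit_ball X"
  by (simp add: unit_ball_def)

lemma lin_comb_closed:
  "set as \<subseteq> K \<Longrightarrow> length xs = length as \<Longrightarrow> set xs \<subseteq> carrier X \<Longrightarrow> lin_comb X as xs \<in> carrier X"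
  unfolding lin_comb_def
proof (rule M.finsum_closed, rule Pi_I)
  fix i assume a: "set as \<subseteq> K" "length xs = length as" "set xs \<subseteq> carrier X" and "i \<in> {..<length as}"
  then have "as ! i \<in> set as" "xs ! i \<in> set xs" by auto
  then have "as ! i \<in> K" "xs ! i \<in> carrier X" using a by (simp_all only: subset_iff)
  then show "as ! i \<odot> xs ! i \<in> carrier X" by (rule sm_closed)
qed

lemma ball_comb_eq:
  assumes "set as \<subseteq> K" "length xs = length as" "set xs \<subseteq> carrier X"
  shows "ball_comb X as xs = complex_of_real (1 / max 1 (nrm X (lin_comb X as xs))) \<odot> lin_comb X as xs"
  using lin_comb_closed[OF assms] sm_one by (auto simp: ball_comb_def Let_def max_def)

lemma unit_ball_mcomplete: "Metric_space.mcomplete (unit_ball X) (ndist X)"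
proof -
  have sub: "unit_ball X \<subseteq> carrier X" by (auto simp: unit_ball_def)
  interpret U: Submetric "carrier X" "ndist X" "unit_ball X"
    by unfold_locales (rule sub)
  have "closedin met.mtopology (unit_ball X)"
    unfolding met.metric_closedin_iff_sequentially_closed
  proof (intro conjI allI impI sub)
    fix \<sigma> l assume s: "range \<sigma> \<subseteq> unit_ball X \<and> limitin met.mtopology \<sigma> l sequentially"
    then have l: "l \<in> carrier X" and lim: "\<And>e. e > 0 \<Longrightarrow> \<exists>N. \<forall>n\<ge>N. \<sigma> n \<in> carrier X \<and> ndist X (\<sigma> n) l < e"
      by (auto simp: met.limitin_metric eventually_sequentially)
    have "nrm X l \<le> 1"
    proof (rule field_le_epsilon)
      fix e :: real assume "e > 0"
      then obtain n where n: "ndist X (\<sigma> n) l < e" using lim by blast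
      have sn: "\<sigma> n \<in> carrier X" "nrm X (\<sigma> n) \<le> 1" using s by (auto simp: unit_ball_def)
      then show "nrm X l \<le> 1 + e" using n abs_nrm_diff_le[OF sn(1) l] l by (simp add: ndist_eq)
    qed
    then show "l \<in> unit_ball X" using l by (simp add: unit_ball_def)
  qed
  then show ?thesis
    using complete by (intro U.closedin_mcomplete_imp_mcomplete) auto
qed

end

section \<open>Ultrapowers of Banach structures\<close>

lemma banach_structure_imp_banach_space: "banach_structure K E X \<Longrightarrow> banach_space K X"
  by (simp add: banach_structure_def)

text \<open>\<open>rank\<close> tends to infinity along the ultrafilter, which is therefore
  countably incomplete. In the construction of limits it tells how far a Cauchy sequence may be
  followed at a given index.\<close>

locale ultrapower = ultra F
  for F :: "'i filter" +
  fixes K :: "complex set" and E :: "('f, 'p) language" and M :: "('a, 'f, 'p) banach_data"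
    and rank :: "'i \<Rightarrow> nat"
  assumes base: "banach_structure K E M"
    and rank: "eventually (\<lambda>i. n \<le> rank i) F"

sublocale ultrapower \<subseteq> B: banach_space K M
  using base by (rule banach_structure_imp_banach_space)

context ultrapower
begin

definition bfun :: "('i \<Rightarrow> 'a) set" where
  "bfun = {f. (\<forall>i. f i \<in> carrier M) \<and> (\<exists>C. \<forall>i. nrm M (f i) \<le> C)}"

definition len :: "('i \<Rightarrow> 'a) \<Rightarrow> real" where
  "len f = Lim F (\<lambda>i. nrm M (f i))"

definition eqv :: "('i \<Rightarrow> 'a) \<Rightarrow> ('i \<Rightarrow> 'a) \<Rightarrow> bool" where
  "eqv f g \<longleftrightarrow> ((\<lambda>i. nrm M (f i \<ominus>\<^bsub>M\<^esub> g i)) \<longlongrightarrow> 0) F"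

text \<open>
  The representatives of the classes are chosen so that elements of the unit ball are represented
  by functions all of whose values lie in the unit ball.
\<close>

definition rep :: "('i \<Rightarrow> 'a) \<Rightarrow> ('i \<Rightarrow> 'a)" where
  "rep f = (SOME g. g \<in> bfun \<and> eqv g f \<and> (\<forall>i. nrm M (g i) \<le> len f))"

text \<open>The elements are chosen representatives instead of equivalence classes, so they are
  functions from the index type to the base space, as the type of the model in the theorem demands.
  The operations are pointwise, followed by the choice of a representative.\<close>

definition pow :: "(('i \<Rightarrow> 'a), 'f, 'p) banach_data" where
  "pow = \<lparr>carrier = rep ` bfun, mult = (\<lambda>x y. x), one = rep (\<lambda>_. \<zero>\<^bsub>M\<^esub>), zero = rep (\<lambda>_. \<zero>\<^bsub>M\<^esub>),
     add = (\<lambda>x y. rep (\<lambda>i. x i \<oplus>\<^bsub>M\<^esub> y i)), smult = (\<lambda>a x. rep (\<lambda>i. a \<odot>\<^bsub>M\<^esub> x i)),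
     nrm = len,
     ext_fun = (\<lambda>f xs. rep (\<lambda>i. ext_fun M f (map (\<lambda>x. x i) xs))),
     ext_pred = (\<lambda>p xs. Lim F (\<lambda>i. ext_pred M p (map (\<lambda>x. x i) xs)))\<rparr>"

lemma bfun_closed: "f \<in> bfun \<Longrightarrow> f i \<in> carrier M"
  by (simp add: bfun_def)

lemma bfunI: "(\<And>i. f i \<in> carrier M) \<Longrightarrow> (\<And>i. nrm M (f i) \<le> C) \<Longrightarrow> f \<in> bfun"
  by (auto simp: bfun_def)

lemma bfun_zero [simp]: "(\<lambda>_. \<zero>\<^bsub>M\<^esub>) \<in> bfun"
  by (rule bfunI[where C = 0]) auto

lemma bfun_add: "f \<in> bfun \<Longrightarrow> g \<in> bfun \<Longrightarrow> (\<lambda>i. f i \<oplus>\<^bsub>M\<^esub> g i) \<in> bfun"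
proof -
  assume f: "f \<in> bfun" "g \<in> bfun"
  then obtain C D where "\<And>i. nrm M (f i) \<le> C" "\<And>i. nrm M (g i) \<le> D" by (auto simp: bfun_def)
  then have "nrm M (f i \<oplus>\<^bsub>M\<^esub> g i) \<le> C + D" for i
    using B.nrm_triangle[of "f i" "g i"] f by (smt (verit) bfun_closed)
  then show ?thesis using f by (intro bfunI) (auto simp: bfun_closed)
qed

lemma bfun_sm: "a \<in> K \<Longrightarrow> f \<in> bfun \<Longrightarrow> (\<lambda>i. a \<odot>\<^bsub>M\<^esub> f i) \<in> bfun"
proof -
  assume a: "a \<in> K" and f: "f \<in> bfun"
  then obtain C where "\<And>i. nrm M (f i) \<le> C" by (auto simp: bfun_def)
  then have "nrm M (a \<odot>\<^bsub>M\<^esub> f i) \<le> cmod a * C" for i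
    using a f by (simp add: B.nrm_smult bfun_closed mult_left_mono)
  then show ?thesis using a f by (intro bfunI) (auto simp: bfun_closed)
qed

lemma bfun_minus: "f \<in> bfun \<Longrightarrow> (\<lambda>i. \<ominus>\<^bsub>M\<^esub> f i) \<in> bfun"
  using bfun_sm[of "-1" f] by (simp add: B.sm_minus_one bfun_closed)

lemma bfun_diff: "f \<in> bfun \<Longrightarrow> g \<in> bfun \<Longrightarrow> (\<lambda>i. f i \<ominus>\<^bsub>M\<^esub> g i) \<in> bfun"
  using bfun_add[of f "\<lambda>i. \<ominus>\<^bsub>M\<^esub> g i"] bfun_minus[of g] by (simp add: a_minus_def)

lemma len_tendsto: "f \<in> bfun \<Longrightarrow> ((\<lambda>i. nrm M (f i)) \<longlongrightarrow> len f) F"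
proof -
  assume f: "f \<in> bfun"
  then obtain C where "\<And>i. nrm M (f i) \<le> C" by (auto simp: bfun_def)
  then have "eventually (\<lambda>i. \<bar>nrm M (f i)\<bar> \<le> C) F"
    using f by (simp add: B.nrm_nonneg bfun_closed)
  then show ?thesis unfolding len_def by (rule bounded_tendsto_Lim)
qed

lemma len_eqI: "((\<lambda>i. nrm M (f i)) \<longlongrightarrow> c) F \<Longrightarrow> len f = c"
  unfolding len_def using tendsto_Lim[OF nontrivial] .

lemma len_nonneg: "f \<in> bfun \<Longrightarrow> 0 \<le> len f"
  by (rule tendsto_lowerbound[OF len_tendsto]) (auto simp: B.nrm_nonneg bfun_closed nontrivial)

lemma eqv_I_bound:
  assumes "(h \<longlongrightarrow> 0) F" "\<And>i. f i \<in> carrier M" "\<And>i. g i \<in> carrier M"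
    "eventually (\<lambda>i. nrm M (f i \<ominus>\<^bsub>M\<^esub> g i) \<le> h i) F"
  shows "eqv f g"
  unfolding eqv_def
  by (rule tendsto_sandwich[OF _ assms(4) tendsto_const assms(1)]) (use assms in \<open>auto simp: B.nrm_nonneg\<close>)

lemma eqv_refl: "(\<And>i. f i \<in> carrier M) \<Longrightarrow> eqv f f"
  by (simp add: eqv_def)

lemma eqv_sym: "(\<And>i. f i \<in> carrier M) \<Longrightarrow> (\<And>i. g i \<in> carrier M) \<Longrightarrow> eqv f g \<Longrightarrow> eqv g f"
  by (simp add: eqv_def B.nrm_diff_commute)

lemma eqv_trans:
  assumes "\<And>i. f i \<in> carrier M" "\<And>i. g i \<in> carrier M" "\<And>i. h i \<in> carrier M" "eqv f g" "eqv g h"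
  shows "eqv f h"
proof (rule eqv_I_bound)
  show "((\<lambda>i. nrm M (f i \<ominus>\<^bsub>M\<^esub> g i) + nrm M (g i \<ominus>\<^bsub>M\<^esub> h i)) \<longlongrightarrow> 0) F"
    using tendsto_add[OF assms(4,5)[unfolded eqv_def]] by simp
qed (use assms in \<open>auto simp: B.nrm_diff_triangle\<close>)

lemma eqv_len: "f \<in> bfun \<Longrightarrow> g \<in> bfun \<Longrightarrow> eqv f g \<Longrightarrow> len f = len g"
proof (rule len_eqI)
  assume f: "f \<in> bfun" "g \<in> bfun" "eqv f g"
  have "((\<lambda>i. nrm M (f i) - nrm M (g i)) \<longlongrightarrow> 0) F"
  proof (rule Lim_null_comparison)
    show "((\<lambda>i. nrm M (f i \<ominus>\<^bsub>M\<^esub> g i)) \<longlongrightarrow> 0) F" using f by (simp add: eqv_def)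
    show "\<forall>\<^sub>F i in F. norm (nrm M (f i) - nrm M (g i)) \<le> nrm M (f i \<ominus>\<^bsub>M\<^esub> g i)"
      using f by (auto simp: B.abs_nrm_diff_le bfun_closed)
  qed
  from tendsto_add[OF this len_tendsto[OF f(2)]] show "((\<lambda>i. nrm M (f i)) \<longlongrightarrow> len g) F" by simp
qed

text \<open>Values of norm above \<open>len f\<close> are scaled down to that norm. The change is at
  most the difference between the norm and its limit, hence does not affect the class.\<close>

lemma rep_ex:
  assumes f: "f \<in> bfun"
  shows "\<exists>g. g \<in> bfun \<and> eqv g f \<and> (\<forall>i. nrm M (g i) \<le> len f)"
proof -
  define l where "l = len f"
  have l: "l \<ge> 0" using len_nonneg f by (simp add: l_def)
  define c where "c i = (if nrm M (f i) \<le> l then 1 else l / nrm M (f i))" for i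
  define g where "g i = complex_of_real (c i) \<odot>\<^bsub>M\<^esub> f i" for i
  have fc: "f i \<in> carrier M" for i using f by (rule bfun_closed)
  have c: "0 \<le> c i" "c i \<le> 1" "c i * nrm M (f i) \<le> l" "(1 - c i) * nrm M (f i) \<le> \<bar>nrm M (f i) - l\<bar>" for i
    using l by (auto simp: c_def field_simps)
  have gc: "g i \<in> carrier M" for i by (simp add: g_def fc)
  have gl: "nrm M (g i) \<le> l" for i using c by (simp add: g_def fc)
  have "eqv g f"
  proof (rule eqv_I_bound)
    show "((\<lambda>i. \<bar>nrm M (f i) - l\<bar>) \<longlongrightarrow> 0) F"
      using tendsto_rabs[OF tendsto_diff[OF len_tendsto[OF f] tendsto_const, of l]] by (simp add: l_def)
    have "nrm M (g i \<ominus>\<^bsub>M\<^esub> f i) \<le> \<bar>nrm M (f i) - l\<bar>" for i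
    proof -
      have "g i \<ominus>\<^bsub>M\<^esub> f i = complex_of_real (c i - 1) \<odot>\<^bsub>M\<^esub> f i"
        using B.sm_diff_left[of "complex_of_real (c i)" 1 "f i"] fc B.sm_one by (simp add: g_def)
      then have "nrm M (g i \<ominus>\<^bsub>M\<^esub> f i) = \<bar>c i - 1\<bar> * nrm M (f i)" by (simp only: B.nrm_sm_real[OF fc])
      then show ?thesis using c(2,4)[of i] by simp
    qed
    then show "eventually (\<lambda>i. nrm M (g i \<ominus>\<^bsub>M\<^esub> f i) \<le> \<bar>nrm M (f i) - l\<bar>) F" by simp
  qed (use gc fc in auto)
  moreover have "g \<in> bfun" using gc gl by (rule bfunI)
  ultimately show ?thesis using gl by (auto simp: l_def)
qed

lemma rep:
  assumes "f \<in> bfun"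
  shows rep_bfun: "rep f \<in> bfun" and rep_eqv: "eqv (rep f) f" and rep_le: "nrm M (rep f i) \<le> len f"
  using someI_ex[OF rep_ex[OF assms]] unfolding rep_def[symmetric] by auto

lemma rep_eq_iff:
  assumes f: "f \<in> bfun" and g: "g \<in> bfun"
  shows "rep f = rep g \<longleftrightarrow> eqv f g"
proof
  assume "rep f = rep g"
  then have "eqv f (rep f)" "eqv (rep f) g"
    using rep_eqv[OF f] rep_eqv[OF g] eqv_sym rep_bfun[OF f] f by (auto simp: bfun_closed)
  then show "eqv f g" using eqv_trans f g rep_bfun[OF f] by (metis bfun_closed)
next
  assume fg: "eqv f g"
  have "(h \<in> bfun \<and> eqv h f \<and> (\<forall>i. nrm M (h i) \<le> len f)) \<longleftrightarrow> (h \<in> bfun \<and> eqv h g \<and> (\<forall>i. nrm M (h i) \<le> len g))" for h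
    using eqv_len[OF f g fg] eqv_trans[of h f g] eqv_trans[of h g f] fg eqv_sym[of f g] f g
    by (auto simp: bfun_closed)
  then show "rep f = rep g" unfolding rep_def by simp
qed

lemma rep_eqI: "f \<in> bfun \<Longrightarrow> g \<in> bfun \<Longrightarrow> eqv f g \<Longrightarrow> rep f = rep g"
  by (simp add: rep_eq_iff)

lemma len_rep: "f \<in> bfun \<Longrightarrow> len (rep f) = len f"
  using eqv_len rep_bfun rep_eqv by blast

lemma pow_carrier: "x \<in> carrier pow \<Longrightarrow> x \<in> bfun \<and> rep x = x"
  by (auto simp: pow_def rep_bfun rep_eqv rep_eqI)

lemma rep_carrier: "f \<in> bfun \<Longrightarrow> rep f \<in> carrier pow"
  by (simp add: pow_def)

lemma pow_simps:
  "zero pow = rep (\<lambda>_. \<zero>\<^bsub>M\<^esub>)" "add pow x y = rep (\<lambda>i. x i \<oplus>\<^bsub>M\<^esub> y i)"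
  "smult pow a x = rep (\<lambda>i. a \<odot>\<^bsub>M\<^esub> x i)" "nrm pow x = len x"
  "ext_fun pow f xs = rep (\<lambda>i. ext_fun M f (map (\<lambda>x. x i) xs))"
  "ext_pred pow p xs = Lim F (\<lambda>i. ext_pred M p (map (\<lambda>x. x i) xs))"
  by (simp_all add: pow_def)

lemma eqv_add:
  assumes "f \<in> bfun" "g \<in> bfun" "f' \<in> bfun" "g' \<in> bfun" "eqv f f'" "eqv g g'"
  shows "eqv (\<lambda>i. f i \<oplus>\<^bsub>M\<^esub> g i) (\<lambda>i. f' i \<oplus>\<^bsub>M\<^esub> g' i)"
proof (rule eqv_I_bound)
  show "((\<lambda>i. nrm M (f i \<ominus>\<^bsub>M\<^esub> f' i) + nrm M (g i \<ominus>\<^bsub>M\<^esub> g' i)) \<longlongrightarrow> 0) F"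
    using tendsto_add[OF assms(5,6)[unfolded eqv_def]] by simp
qed (use assms in \<open>auto simp: B.diff_diff_add bfun_closed intro!: B.nrm_triangle always_eventually\<close>)

lemma eqv_sm:
  assumes "a \<in> K" "f \<in> bfun" "f' \<in> bfun" "eqv f f'"
  shows "eqv (\<lambda>i. a \<odot>\<^bsub>M\<^esub> f i) (\<lambda>i. a \<odot>\<^bsub>M\<^esub> f' i)"
proof (rule eqv_I_bound)
  show "((\<lambda>i. cmod a * nrm M (f i \<ominus>\<^bsub>M\<^esub> f' i)) \<longlongrightarrow> 0) F"
    using tendsto_mult[OF tendsto_const[of "cmod a"] assms(4)[unfolded eqv_def]] by simp
qed (use assms in \<open>auto simp: B.sm_diff_right[symmetric] B.nrm_smult bfun_closed\<close>)

lemma add_rep: "f \<in> bfun \<Longrightarrow> g \<in> bfun \<Longrightarrow> add pow (rep f) (rep g) = rep (\<lambda>i. f i \<oplus>\<^bsub>M\<^esub> g i)"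
  by (simp add: pow_simps rep_eqI bfun_add rep_bfun eqv_add rep_eqv)

lemma sm_rep: "a \<in> K \<Longrightarrow> f \<in> bfun \<Longrightarrow> smult pow a (rep f) = rep (\<lambda>i. a \<odot>\<^bsub>M\<^esub> f i)"
  by (simp add: pow_simps rep_eqI bfun_sm rep_bfun eqv_sm rep_eqv)

lemma pow_cases:
  assumes "x \<in> carrier pow" obtains f where "f \<in> bfun" "x = rep f"
  using assms by (auto simp: pow_def)

section \<open>Banach space structure of the ultrapower\<close>

lemma pow_abelian_group: "abelian_group pow"
proof (rule abelian_groupI)
  fix x y z assume x: "x \<in> carrier pow"
  obtain f where f: "f \<in> bfun" "x = rep f" using x by (rule pow_cases)
  show "zero pow \<oplus>\<^bsub>pow\<^esub> x = x"
    using f add_rep[of "\<lambda>_. \<zero>\<^bsub>M\<^esub>" f] by (simp add: pow_simps(1) bfun_closed)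
  have "rep (\<lambda>i. \<ominus>\<^bsub>M\<^esub> f i) \<oplus>\<^bsub>pow\<^esub> x = zero pow"
    using f bfun_minus[of f] by (simp add: add_rep pow_simps(1) bfun_closed B.M.l_neg)
  then show "\<exists>y\<in>carrier pow. y \<oplus>\<^bsub>pow\<^esub> x = zero pow"
    using f bfun_minus rep_carrier by blast
  assume y: "y \<in> carrier pow"
  obtain g where g: "g \<in> bfun" "y = rep g" using y by (rule pow_cases)
  show "x \<oplus>\<^bsub>pow\<^esub> y \<in> carrier pow" using f g by (simp add: add_rep rep_carrier bfun_add)
  show "x \<oplus>\<^bsub>pow\<^esub> y = y \<oplus>\<^bsub>pow\<^esub> x"
    using f g by (simp add: add_rep) (simp add: bfun_closed B.M.a_comm)
  assume z: "z \<in> carrier pow"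
  obtain h where h: "h \<in> bfun" "z = rep h" using z by (rule pow_cases)
  show "x \<oplus>\<^bsub>pow\<^esub> y \<oplus>\<^bsub>pow\<^esub> z = x \<oplus>\<^bsub>pow\<^esub> (y \<oplus>\<^bsub>pow\<^esub> z)"
    using f g h by (simp add: add_rep bfun_add) (simp add: bfun_closed B.M.a_assoc)
qed (simp add: pow_simps(1) rep_carrier)

lemma pow_module: "module (scalars K) pow"
proof (rule moduleI)
  show "cring (scalars K)" using B.module_axioms by (simp add: module_def)
  show "abelian_group pow" by (rule pow_abelian_group)
next
  fix a x assume "a \<in> carrier (scalars K)" "x \<in> carrier pow"
  then show "a \<odot>\<^bsub>pow\<^esub> x \<in> carrier pow"
    by (elim pow_cases) (simp add: sm_rep bfun_sm rep_carrier)
next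
  fix a b x assume "a \<in> carrier (scalars K)" "b \<in> carrier (scalars K)" "x \<in> carrier pow"
  then obtain f where a: "a \<in> K" "b \<in> K" and f: "f \<in> bfun" "x = rep f" by (auto elim: pow_cases)
  show "(a \<oplus>\<^bsub>scalars K\<^esub> b) \<odot>\<^bsub>pow\<^esub> x = a \<odot>\<^bsub>pow\<^esub> x \<oplus>\<^bsub>pow\<^esub> b \<odot>\<^bsub>pow\<^esub> x"
    using a f B.K_add_mult(1)[of a b] by (simp add: sm_rep add_rep bfun_sm) (simp add: bfun_closed B.sm_add_left)
  show "(a \<otimes>\<^bsub>scalars K\<^esub> b) \<odot>\<^bsub>pow\<^esub> x = a \<odot>\<^bsub>pow\<^esub> (b \<odot>\<^bsub>pow\<^esub> x)"
    using a f B.K_add_mult(3)[of a b] by (simp add: sm_rep bfun_sm) (simp add: bfun_closed B.sm_assoc)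
next
  fix a x y assume "a \<in> carrier (scalars K)" "x \<in> carrier pow" "y \<in> carrier pow"
  then obtain f g where a: "a \<in> K" and f: "f \<in> bfun" "x = rep f" "g \<in> bfun" "y = rep g" by (auto elim!: pow_cases)
  show "a \<odot>\<^bsub>pow\<^esub> (x \<oplus>\<^bsub>pow\<^esub> y) = a \<odot>\<^bsub>pow\<^esub> x \<oplus>\<^bsub>pow\<^esub> a \<odot>\<^bsub>pow\<^esub> y"
    using a f by (simp add: sm_rep add_rep bfun_sm bfun_add) (simp add: bfun_closed B.sm_add_right)
next
  fix x assume "x \<in> carrier pow"
  then obtain f where f: "f \<in> bfun" "x = rep f" by (auto elim: pow_cases)
  then show "\<one>\<^bsub>scalars K\<^esub> \<odot>\<^bsub>pow\<^esub> x = x" by (simp add: sm_rep) (simp add: bfun_closed B.sm_one)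
qed

lemma minus_pow:
  assumes "f \<in> bfun" "g \<in> bfun"
  shows "rep f \<ominus>\<^bsub>pow\<^esub> rep g = rep (\<lambda>i. f i \<ominus>\<^bsub>M\<^esub> g i)"
proof -
  interpret P: abelian_group pow by (rule pow_abelian_group)
  have "\<ominus>\<^bsub>pow\<^esub> rep g = rep (\<lambda>i. \<ominus>\<^bsub>M\<^esub> g i)"
  proof (rule P.minus_equality)
    show "rep (\<lambda>i. \<ominus>\<^bsub>M\<^esub> g i) \<oplus>\<^bsub>pow\<^esub> rep g = \<zero>\<^bsub>pow\<^esub>"
      using assms bfun_minus[of g] by (simp add: add_rep pow_simps(1) bfun_closed B.M.l_neg)
  qed (use assms bfun_minus rep_carrier in auto)
  then show ?thesis using assms bfun_minus[of g] by (simp add: a_minus_def add_rep)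
qed

lemma minus_pow': "x \<in> carrier pow \<Longrightarrow> y \<in> carrier pow \<Longrightarrow> x \<ominus>\<^bsub>pow\<^esub> y = rep (\<lambda>i. x i \<ominus>\<^bsub>M\<^esub> y i)"
  using minus_pow[of x y] pow_carrier[of x] pow_carrier[of y] by simp

lemma ndist_pow: "x \<in> carrier pow \<Longrightarrow> y \<in> carrier pow \<Longrightarrow> ndist pow x y = len (\<lambda>i. x i \<ominus>\<^bsub>M\<^esub> y i)"
  by (simp add: ndist_def minus_pow' pow_simps(4) len_rep bfun_diff pow_carrier)

text \<open>
  Near the limit, a Cauchy sequence is followed up to the largest index, at most the rank, up to
  which it converges at the prescribed rate.
\<close>

lemma pow_complete_aux:
  assumes met: "Metric_space (carrier pow) (ndist pow)"
  shows "Metric_space.mcomplete (carrier pow) (ndist pow)"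
proof -
  interpret Metric_space "carrier pow" "ndist pow" by (rule met)
  show ?thesis
    unfolding mcomplete_def
  proof (intro allI impI)
    fix \<sigma> assume "MCauchy \<sigma>"
    then have \<sigma>: "\<And>n. \<sigma> n \<in> carrier pow" and cau: "\<And>e. e > 0 \<Longrightarrow> \<exists>N. \<forall>n n'. N \<le> n \<longrightarrow> N \<le> n' \<longrightarrow> ndist pow (\<sigma> n) (\<sigma> n') < e"
      by (auto simp: MCauchy_def)
    have \<sigma>b: "\<sigma> n \<in> bfun" for n using \<sigma> pow_carrier by blast
    have sc: "\<sigma> n i \<in> carrier M" for n i using \<sigma>b by (rule bfun_closed)
    define e :: "nat \<Rightarrow> real" where "e j = (1 / 2) ^ j" for j
    have e0: "e j > 0" for j by (simp add: e_def)
    obtain k where k: "\<And>j n n'. k j \<le> n \<Longrightarrow> k j \<le> n' \<Longrightarrow> ndist pow (\<sigma> n) (\<sigma> n') < e j"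
      using cau[OF e0] by metis
    \<comment> \<open>A nondecreasing choice, so that the rate \<open>e j\<close> holds between
      \<open>\<tau> j\<close> and every later term.\<close>
    define k' where "k' j = Max (k ` {..j})" for j
    have kk': "k j \<le> k' m" if "j \<le> m" for j m unfolding k'_def using that by (intro Max_ge) auto
    define \<tau> where "\<tau> j = \<sigma> (k' j)" for j
    have \<tau>c: "\<tau> j i \<in> carrier M" for j i by (simp add: \<tau>_def sc)
    have \<tau>d: "ndist pow (\<tau> j) (\<tau> m) < e j" if "j \<le> m" for j m
      unfolding \<tau>_def using that by (intro k kk') auto
    define good where "good i j \<longleftrightarrow> (\<forall>m\<le>j. nrm M (\<tau> m i \<ominus>\<^bsub>M\<^esub> \<tau> j i) \<le> e m)" for i j
    have ev: "eventually (\<lambda>i. good i j) F" for j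
    proof -
      have "eventually (\<lambda>i. nrm M (\<tau> m i \<ominus>\<^bsub>M\<^esub> \<tau> j i) \<le> e m) F" if "m \<le> j" for m
      proof -
        have "((\<lambda>i. nrm M (\<tau> m i \<ominus>\<^bsub>M\<^esub> \<tau> j i)) \<longlongrightarrow> ndist pow (\<tau> m) (\<tau> j)) F"
          using len_tendsto[OF bfun_diff] \<sigma> \<sigma>b by (simp add: \<tau>_def ndist_pow)
        from order_tendstoD(2)[OF this \<tau>d[OF that]] show ?thesis by (auto elim: eventually_mono)
      qed
      then have "eventually (\<lambda>i. \<forall>m\<in>{..j}. nrm M (\<tau> m i \<ominus>\<^bsub>M\<^esub> \<tau> j i) \<le> e m) F"
        by (intro eventually_ball_finite) auto
      then show ?thesis unfolding good_def by (rule eventually_mono) auto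
    qed
    define J where "J i = Max {j. j \<le> rank i \<and> good i j}" for i
    have g0: "good i 0" for i using sc by (auto simp: good_def e_def \<tau>c)
    have Jfin: "finite {j. j \<le> rank i \<and> good i j}" for i by simp
    have J: "good i (J i)" for i
      using Max_in[OF Jfin[of i]] g0[of i] unfolding J_def by blast
    have Jge: "j \<le> J i" if "j \<le> rank i" "good i j" for i j
      unfolding J_def using that by (intro Max_ge) auto
    define f where "f i = \<tau> (J i) i" for i
    have fc: "f i \<in> carrier M" for i by (simp add: f_def \<tau>c)
    have f: "f \<in> bfun"
    proof -
      obtain C where C: "\<And>i. nrm M (\<tau> 0 i) \<le> C" using \<sigma>b[of "k' 0"] by (auto simp: bfun_def \<tau>_def)
      have "nrm M (f i) \<le> C + 1" for i
      proof -
        have "nrm M (\<tau> 0 i \<ominus>\<^bsub>M\<^esub> f i) \<le> 1" using J[of i] by (auto simp: good_def f_def e_def)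
        then show ?thesis using C[of i] B.abs_nrm_diff_le[OF \<tau>c fc, of 0 i i] by linarith
      qed
      then show ?thesis using fc by (intro bfunI)
    qed
    have close: "ndist pow (\<tau> j) (rep f) \<le> e j" for j
    proof -
      have ev1: "eventually (\<lambda>i. nrm M (\<tau> j i \<ominus>\<^bsub>M\<^esub> f i) \<le> e j) F"
        using eventually_conj[OF ev[of j] rank[of j]]
      proof eventually_elim
        case (elim i)
        then have "j \<le> J i" using Jge by blast
        then show ?case using J[of i] by (auto simp: good_def f_def)
      qed
      have lim1: "((\<lambda>i. nrm M (\<tau> j i \<ominus>\<^bsub>M\<^esub> f i)) \<longlongrightarrow> ndist pow (\<tau> j) (rep f)) F"
      proof -
        have "\<sigma> (k' j) \<ominus>\<^bsub>pow\<^esub> rep f = rep (\<lambda>i. \<sigma> (k' j) i \<ominus>\<^bsub>M\<^esub> f i)"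
          using minus_pow[of "\<sigma> (k' j)" f] \<sigma>b f pow_carrier[OF \<sigma>] by simp
        then have "ndist pow (\<tau> j) (rep f) = len (\<lambda>i. \<tau> j i \<ominus>\<^bsub>M\<^esub> f i)"
          using \<sigma> f rep_carrier \<sigma>b by (simp add: ndist_def \<tau>_def pow_simps(4) len_rep bfun_diff)
        then show ?thesis using len_tendsto[OF bfun_diff] \<sigma>b f by (simp add: \<tau>_def)
      qed
      show ?thesis by (rule tendsto_upperbound[OF lim1 ev1 nontrivial])
    qed
    have "limitin mtopology \<sigma> (rep f) sequentially"
      unfolding limitin_metric eventually_sequentially
    proof (intro conjI allI impI)
      show rf: "rep f \<in> carrier pow" using f by (rule rep_carrier)
      fix \<epsilon> :: real assume "\<epsilon> > 0"
      then obtain j where j: "e j < \<epsilon> / 2" unfolding e_def using real_arch_pow_inv[of "\<epsilon> / 2" "1 / 2"] by auto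
      have "ndist pow (\<sigma> n) (rep f) < \<epsilon>" if "k' j \<le> n" for n
      proof -
        have "ndist pow (\<sigma> n) (\<tau> j) < e j" unfolding \<tau>_def using kk'[of j j] that by (intro k) auto
        moreover have "ndist pow (\<sigma> n) (rep f) \<le> ndist pow (\<sigma> n) (\<tau> j) + ndist pow (\<tau> j) (rep f)"
          by (rule triangle) (use \<sigma> rf in \<open>auto simp: \<tau>_def\<close>)
        ultimately show ?thesis using close[of j] j by linarith
      qed
      then show "\<exists>N. \<forall>n\<ge>N. \<sigma> n \<in> carrier pow \<and> ndist pow (\<sigma> n) (rep f) < \<epsilon>" using \<sigma> by blast
    qed
    then show "\<exists>x. limitin mtopology \<sigma> x sequentially" by blast
  qed
qed

lemma pow_nrm_eq_0:
  assumes "x \<in> carrier pow" shows "len x = 0 \<longleftrightarrow> x = zero pow"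
proof -
  obtain f where f: "f \<in> bfun" "x = rep f" using assms by (rule pow_cases)
  have "len x = 0 \<longleftrightarrow> eqv f (\<lambda>_. \<zero>\<^bsub>M\<^esub>)"
    using len_tendsto[OF f(1)] len_eqI[of f 0] f by (auto simp: len_rep eqv_def bfun_closed)
  then show ?thesis using f rep_eq_iff[of f "\<lambda>_. \<zero>\<^bsub>M\<^esub>"] by (simp add: pow_simps(1))
qed

lemma pow_banach_space: "banach_space K pow"
proof -
  interpret P: module "scalars K" pow by (rule pow_module)
  have tri: "len (x \<oplus>\<^bsub>pow\<^esub> y) \<le> len x + len y" if "x \<in> carrier pow" "y \<in> carrier pow" for x y
  proof -
    have b: "x \<in> bfun" "y \<in> bfun" using that pow_carrier by auto
    have "len (\<lambda>i. x i \<oplus>\<^bsub>M\<^esub> y i) \<le> len x + len y"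
      by (rule tendsto_le[OF nontrivial tendsto_add[OF len_tendsto[OF b(1)] len_tendsto[OF b(2)]] len_tendsto[OF bfun_add[OF b]]])
         (use b in \<open>simp add: B.nrm_triangle bfun_closed\<close>)
    then show ?thesis using b by (simp add: pow_simps len_rep bfun_add)
  qed
  have sm: "len (a \<odot>\<^bsub>pow\<^esub> x) = cmod a * len x" if "a \<in> K" "x \<in> carrier pow" for a x
  proof -
    have b: "x \<in> bfun" using that pow_carrier by auto
    have "len (\<lambda>i. a \<odot>\<^bsub>M\<^esub> x i) = cmod a * len x"
      by (rule len_eqI) (use that b tendsto_mult[OF tendsto_const len_tendsto[OF b]] in \<open>simp add: B.nrm_smult bfun_closed\<close>)
    then show ?thesis using that b by (simp add: pow_simps len_rep bfun_sm)
  qed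
  have met: "Metric_space (carrier pow) (ndist pow)"
  proof
    fix x y z
    have nn: "0 \<le> len (\<lambda>i. x i \<ominus>\<^bsub>M\<^esub> y i)" if "x \<in> carrier pow" "y \<in> carrier pow" for x y
      using that pow_carrier by (intro len_nonneg bfun_diff) auto
    show "0 \<le> ndist pow x y" using nn[of x y] ndist_pow[of x y] by (auto simp: ndist_def)
    show "ndist pow x y = ndist pow y x"
    proof (cases "x \<in> carrier pow \<and> y \<in> carrier pow")
      case True
      then have "nrm M (x i \<ominus>\<^bsub>M\<^esub> y i) = nrm M (y i \<ominus>\<^bsub>M\<^esub> x i)" for i
        using pow_carrier by (intro B.nrm_diff_commute bfun_closed) auto
      then show ?thesis using True by (simp add: ndist_pow len_def)
    qed (auto simp: ndist_def)
    show "x \<in> carrier pow \<Longrightarrow> y \<in> carrier pow \<Longrightarrow> (ndist pow x y = 0) = (x = y)"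
      using pow_nrm_eq_0[of "x \<ominus>\<^bsub>pow\<^esub> y"]
      by (simp add: ndist_def pow_simps(4)) (auto simp: P.M.minus_eq_zero_iff)
    assume "x \<in> carrier pow" "y \<in> carrier pow" "z \<in> carrier pow"
    then have b: "x \<in> bfun" "y \<in> bfun" "z \<in> bfun" and c: "x \<in> carrier pow" "y \<in> carrier pow" "z \<in> carrier pow" using pow_carrier by auto
    have "len (\<lambda>i. x i \<ominus>\<^bsub>M\<^esub> z i) \<le> len (\<lambda>i. x i \<ominus>\<^bsub>M\<^esub> y i) + len (\<lambda>i. y i \<ominus>\<^bsub>M\<^esub> z i)"
      by (rule tendsto_le[OF nontrivial tendsto_add[OF len_tendsto len_tendsto] len_tendsto])
         (use b in \<open>auto simp: bfun_diff bfun_closed B.nrm_diff_triangle\<close>)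
    then show "ndist pow x z \<le> ndist pow x y + ndist pow y z" using c by (simp add: ndist_pow)
  qed
  show ?thesis
  proof (intro banach_space.intro banach_space_axioms.intro pow_module)
    show "is_scalar_field K" by (rule B.scalar_field)
    show "Metric_space.mcomplete (carrier pow) (ndist pow)" using met by (rule pow_complete_aux)
    show "0 \<le> nrm pow x" "(nrm pow x = 0) = (x = \<zero>\<^bsub>pow\<^esub>)" if "x \<in> carrier pow" for x
      using that len_nonneg pow_carrier pow_nrm_eq_0 by (simp_all add: pow_simps(4))
    show "nrm pow (x \<oplus>\<^bsub>pow\<^esub> y) \<le> nrm pow x + nrm pow y" if "x \<in> carrier pow" "y \<in> carrier pow" for x y
      unfolding pow_simps(4) using that by (rule tri)
    show "nrm pow (a \<odot>\<^bsub>pow\<^esub> x) = cmod a * nrm pow x" if "a \<in> K" "x \<in> carrier pow" for a x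
      unfolding pow_simps(4) using that by (rule sm)
  qed
qed

sublocale P: banach_space K pow
  by (rule pow_banach_space)

end

section \<open>The ultrapower as a metric structure\<close>

lemma metric_structure_simps [simp]:
  "universe (metric_structure X) = unit_ball X"
  "distance (metric_structure X) = ndist X"
  "finterp (metric_structure X) ZeroC xs = \<zero>\<^bsub>X\<^esub>"
  "finterp (metric_structure X) (SigmaF as) xs = ball_comb X as xs"
  "finterp (metric_structure X) (ExtF f) xs = ext_fun X f xs"
  "pinterp (metric_structure X) (NormP as) xs = nrm X (lin_comb X as xs)"
  "pinterp (metric_structure X) (ExtP q) xs = ext_pred X q xs"
  by (simp_all add: metric_structure_def)

lemma banach_language_is_language:
  assumes "is_language E" shows "is_language (banach_language K E)"
proof -
  have s: "0 \<le> (\<Sum>a\<leftarrow>as. cmod a)" for as by (induction as) auto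
  then have s1: "0 < 1 + (\<Sum>a\<leftarrow>as. cmod a)" for as by (simp add: add_pos_nonneg)
  have s2: "0 < 2 + 2 * (\<Sum>a\<leftarrow>as. cmod a)" for as using s1[of as] by simp
  show ?thesis using assms s s1
    by (auto simp: is_language_def banach_language_def intro!: divide_pos_pos s2)
qed

lemma banach_bounded_mstructure:
  assumes "banach_structure K E X"
  shows "bounded_mstructure (banach_language K E) (metric_structure X) 2"
proof -
  interpret banach_space K X using assms by (simp add: banach_structure_def)
  show ?thesis
  proof
    show "distance (metric_structure X) x y \<le> 2"
      if "x \<in> universe (metric_structure X)" "y \<in> universe (metric_structure X)" for x y
      using that nrm_diff_le[of x y] by (simp add: unit_ball_def ndist_eq)
  qed (use assms banach_language_is_language in \<open>auto simp: banach_structure_def\<close>)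
qed

lemma finite_vars_trm: "finite (vars_trm t)"
  by (induction t) auto

lemma finite_free_vars: "finite (free_vars \<phi>)"
  by (induction \<phi>) (auto simp: finite_vars_trm)

context ultrapower
begin

abbreviation "LL \<equiv> banach_language K E"
abbreviation "MM \<equiv> metric_structure M"
abbreviation "NN \<equiv> metric_structure pow"

definition ballf :: "('i \<Rightarrow> 'a) set" where
  "ballf = {f. \<forall>i. f i \<in> unit_ball M}"

lemma ballf_mem: "f \<in> ballf \<Longrightarrow> f i \<in> unit_ball M" "f \<in> ballf \<Longrightarrow> f i \<in> carrier M"
  by (auto simp: ballf_def unit_ball_def)

lemma ballf_bfun: "f \<in> ballf \<Longrightarrow> f \<in> bfun"
  by (rule bfunI[where C = 1]) (auto simp: ballf_def unit_ball_def)

lemma rep_unit_ball: "f \<in> ballf \<Longrightarrow> rep f \<in> unit_ball pow"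
proof -
  assume f: "f \<in> ballf"
  have "len f \<le> 1"
    by (rule tendsto_upperbound[OF len_tendsto[OF ballf_bfun[OF f]] _ nontrivial])
       (use f in \<open>auto simp: ballf_def unit_ball_def\<close>)
  then show ?thesis using f by (simp add: unit_ball_def rep_carrier ballf_bfun pow_simps(4) len_rep)
qed

lemma unit_ball_ballf: "x \<in> unit_ball pow \<Longrightarrow> x \<in> ballf"
proof -
  assume "x \<in> unit_ball pow"
  then have x: "x \<in> bfun" "rep x = x" "len x \<le> 1" using pow_carrier by (auto simp: unit_ball_def pow_simps(4))
  have "nrm M (x i) \<le> 1" for i using rep_le[OF x(1), of i] x by simp
  then show ?thesis using x(1) by (simp add: ballf_def unit_ball_def bfun_closed)
qed

lemma eqv_alt:
  assumes "\<And>i. f i \<in> carrier M" "\<And>i. g i \<in> carrier M"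
  shows "eqv f g \<longleftrightarrow> (\<forall>\<epsilon>>0. eventually (\<lambda>i. nrm M (f i \<ominus>\<^bsub>M\<^esub> g i) \<le> \<epsilon>) F)"
proof
  assume q: "eqv f g"
  show "\<forall>\<epsilon>>0. eventually (\<lambda>i. nrm M (f i \<ominus>\<^bsub>M\<^esub> g i) \<le> \<epsilon>) F"
  proof (intro allI impI)
    fix \<epsilon> :: real assume "\<epsilon> > 0"
    from order_tendstoD(2)[OF q[unfolded eqv_def] this]
    show "eventually (\<lambda>i. nrm M (f i \<ominus>\<^bsub>M\<^esub> g i) \<le> \<epsilon>) F" by (rule eventually_mono) simp
  qed
next
  assume r: "\<forall>\<epsilon>>0. eventually (\<lambda>i. nrm M (f i \<ominus>\<^bsub>M\<^esub> g i) \<le> \<epsilon>) F"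
  show "eqv f g" unfolding eqv_def
  proof (rule tendstoI)
    fix \<epsilon> :: real assume "\<epsilon> > 0"
    have "eventually (\<lambda>i. nrm M (f i \<ominus>\<^bsub>M\<^esub> g i) \<le> \<epsilon> / 2) F"
      using r[rule_format, OF half_gt_zero[OF \<open>\<epsilon> > 0\<close>]] .
    then show "eventually (\<lambda>i. dist (nrm M (f i \<ominus>\<^bsub>M\<^esub> g i)) 0 < \<epsilon>) F"
    proof (rule eventually_mono)
      fix i assume "nrm M (f i \<ominus>\<^bsub>M\<^esub> g i) \<le> \<epsilon> / 2"
      moreover have "0 \<le> nrm M (f i \<ominus>\<^bsub>M\<^esub> g i)" using assms by (simp add: B.nrm_nonneg)
      ultimately show "dist (nrm M (f i \<ominus>\<^bsub>M\<^esub> g i)) 0 < \<epsilon>" using \<open>\<epsilon> > 0\<close> by (simp add: dist_real_def)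
    qed
  qed
qed

interpretation BM: bounded_mstructure LL MM 2
  by (rule banach_bounded_mstructure[OF base])

lemma lin_comb_pow:
  assumes as: "set as \<subseteq> K" and xs: "length xs = length as" "set xs \<subseteq> carrier pow"
  shows "lin_comb pow as xs = rep (\<lambda>k. lin_comb M as (map (\<lambda>x. x k) xs)) \<and> (\<lambda>k. lin_comb M as (map (\<lambda>x. x k) xs)) \<in> bfun"
proof -
  have a: "as ! i \<in> K" and x: "xs ! i \<in> carrier pow" if "i < length as" for i
    using as xs that nth_mem[of i as] nth_mem[of i xs] by (simp_all add: subset_iff)
  have xb: "xs ! i \<in> bfun" if "i < length as" for i using x[OF that] pow_carrier by blast
  have xk: "(xs ! i) k \<in> carrier M" if "i < length as" for i k using xb[OF that] by (rule bfun_closed)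
  have "finsum pow (\<lambda>i. as ! i \<odot>\<^bsub>pow\<^esub> xs ! i) A = rep (\<lambda>k. finsum M (\<lambda>i. as ! i \<odot>\<^bsub>M\<^esub> (xs ! i) k) A) \<and>
      (\<lambda>k. finsum M (\<lambda>i. as ! i \<odot>\<^bsub>M\<^esub> (xs ! i) k) A) \<in> bfun"
    if "finite A" "A \<subseteq> {..<length as}" for A
    using that
  proof (induction A)
    case empty
    then show ?case by (simp add: pow_simps(1))
  next
    case (insert j A)
    have fA: "(\<lambda>i. as ! i \<odot>\<^bsub>pow\<^esub> xs ! i) \<in> A \<rightarrow> carrier pow"
      "\<And>k. (\<lambda>i. as ! i \<odot>\<^bsub>M\<^esub> (xs ! i) k) \<in> A \<rightarrow> carrier M"
      using insert.prems a x xk by (auto intro!: P.sm_closed B.sm_closed)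
    have j: "j < length as" using insert.prems by simp
    have 1: "finsum pow (\<lambda>i. as ! i \<odot>\<^bsub>pow\<^esub> xs ! i) (insert j A)
        = as ! j \<odot>\<^bsub>pow\<^esub> xs ! j \<oplus>\<^bsub>pow\<^esub> finsum pow (\<lambda>i. as ! i \<odot>\<^bsub>pow\<^esub> xs ! i) A"
      by (rule P.M.finsum_insert) (use insert fA a[OF j] x[OF j] in auto)
    have 2: "finsum M (\<lambda>i. as ! i \<odot>\<^bsub>M\<^esub> (xs ! i) k) (insert j A)
        = as ! j \<odot>\<^bsub>M\<^esub> (xs ! j) k \<oplus>\<^bsub>M\<^esub> finsum M (\<lambda>i. as ! i \<odot>\<^bsub>M\<^esub> (xs ! i) k) A" for k
      by (rule B.M.finsum_insert) (use insert fA a[OF j] xk[OF j] in auto)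
    have IH: "finsum pow (\<lambda>i. as ! i \<odot>\<^bsub>pow\<^esub> xs ! i) A = rep (\<lambda>k. finsum M (\<lambda>i. as ! i \<odot>\<^bsub>M\<^esub> (xs ! i) k) A)"
      "(\<lambda>k. finsum M (\<lambda>i. as ! i \<odot>\<^bsub>M\<^esub> (xs ! i) k) A) \<in> bfun" using insert by auto
    have 3: "as ! j \<odot>\<^bsub>pow\<^esub> xs ! j = rep (\<lambda>k. as ! j \<odot>\<^bsub>M\<^esub> (xs ! j) k)" by (simp add: pow_simps(3))
    show ?case unfolding 1 2 3 IH(1)
      using add_rep[OF bfun_sm[OF a[OF j] xb[OF j]] IH(2)] bfun_add[OF bfun_sm[OF a[OF j] xb[OF j]] IH(2)] by simp
  qed
  note this[of "{..<length as}", simplified]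
  moreover have "lin_comb M as (map (\<lambda>x. x k) xs) = finsum M (\<lambda>i. as ! i \<odot>\<^bsub>M\<^esub> (xs ! i) k) {..<length as}" for k
    unfolding lin_comb_def
    by (rule B.M.finsum_cong') (use xs a xk in auto)
  ultimately show ?thesis unfolding lin_comb_def[of pow] by simp
qed

lemma arity_simps:
  "SigmaF as \<in> fsyms LL \<longleftrightarrow> set as \<subseteq> K" "farity LL (SigmaF as) = length as"
  "NormP as \<in> psyms LL \<longleftrightarrow> set as \<subseteq> K" "parity LL (NormP as) = length as"
  by (auto simp: banach_language_def)

lemma finterp_ballf:
  assumes "g \<in> fsyms LL" "length xs = farity LL g" "set xs \<subseteq> ballf"
  shows "(\<lambda>k. finterp MM g (map (\<lambda>x. x k) xs)) \<in> ballf"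
proof -
  have "finterp MM g (map (\<lambda>x. x k) xs) \<in> universe MM" for k
    by (rule BM.finterp_closed) (use assms ballf_mem(1) in auto)
  then show ?thesis by (simp add: ballf_def)
qed

text \<open>For \<open>SigmaF\<close>, the factor that brings a linear combination into the ball is
  a continuous function of its norm and so commutes with the limit. The other symbols are
  interpreted this way by definition.\<close>

lemma finterp_pow:
  assumes g: "g \<in> fsyms LL" "length xs = farity LL g" and xs: "set xs \<subseteq> unit_ball pow"
  shows "finterp NN g xs = rep (\<lambda>k. finterp MM g (map (\<lambda>x. x k) xs))"
proof (cases g)
  case ZeroC
  then show ?thesis by (simp add: pow_simps(1))
next
  case (ExtF f)
  then show ?thesis by (simp add: pow_simps(5))
next
  case (SigmaF as)
  define h where "h k = lin_comb M as (map (\<lambda>x. x k) xs)" for k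
  have as: "set as \<subseteq> K" "length xs = length as" using g SigmaF by (auto simp: arity_simps)
  have xc: "set xs \<subseteq> carrier pow" using xs by (auto simp: unit_ball_def)
  have lc: "lin_comb pow as xs = rep h" "h \<in> bfun" using lin_comb_pow[OF as xc] by (auto simp: h_def[abs_def])
  have hc: "h k \<in> carrier M" for k using lc(2) by (rule bfun_closed)
  have xM: "set (map (\<lambda>x. x k) xs) \<subseteq> carrier M" for k
  proof -
    have "x k \<in> carrier M" if "x \<in> set xs" for x
      using xc that pow_carrier[of x] bfun_closed[of x k] by auto
    then show ?thesis by auto
  qed
  define c where "c = 1 / max 1 (len h)"
  have bM: "ball_comb M as (map (\<lambda>x. x k) xs) = complex_of_real (1 / max 1 (nrm M (h k))) \<odot>\<^bsub>M\<^esub> h k" for k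
    unfolding h_def by (rule B.ball_comb_eq) (use as xM in auto)
  have bN: "ball_comb pow as xs = rep (\<lambda>k. complex_of_real c \<odot>\<^bsub>M\<^esub> h k)"
  proof -
    have nl: "nrm pow (rep h) = len h" using lc(2) by (simp add: pow_simps(4) len_rep)
    show ?thesis
      unfolding P.ball_comb_eq[OF as xc] lc(1) nl c_def by (rule sm_rep[OF B.real_in_K lc(2)])
  qed
  have bf: "(\<lambda>k. ball_comb M as (map (\<lambda>x. x k) xs)) \<in> bfun"
    using finterp_ballf[OF g] xs unit_ball_ballf SigmaF by (intro ballf_bfun) auto
  have "eqv (\<lambda>k. complex_of_real c \<odot>\<^bsub>M\<^esub> h k) (\<lambda>k. ball_comb M as (map (\<lambda>x. x k) xs))"
  proof (rule eqv_I_bound)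
    have "((\<lambda>k. 1 / max 1 (nrm M (h k))) \<longlongrightarrow> c) F" unfolding c_def
      by (intro tendsto_divide tendsto_const tendsto_max len_tendsto lc(2)) simp
    then have "((\<lambda>k. \<bar>c - 1 / max 1 (nrm M (h k))\<bar> * nrm M (h k)) \<longlongrightarrow> \<bar>c - c\<bar> * len h) F"
      by (intro tendsto_mult tendsto_rabs tendsto_diff tendsto_const len_tendsto lc(2))
    then show "((\<lambda>k. \<bar>c - 1 / max 1 (nrm M (h k))\<bar> * nrm M (h k)) \<longlongrightarrow> 0) F" by simp
    show "eventually (\<lambda>k. nrm M (complex_of_real c \<odot>\<^bsub>M\<^esub> h k \<ominus>\<^bsub>M\<^esub> ball_comb M as (map (\<lambda>x. x k) xs))
        \<le> \<bar>c - 1 / max 1 (nrm M (h k))\<bar> * nrm M (h k)) F"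
    proof (rule always_eventually, rule allI)
      fix k
      have "complex_of_real c \<odot>\<^bsub>M\<^esub> h k \<ominus>\<^bsub>M\<^esub> ball_comb M as (map (\<lambda>x. x k) xs)
         = (complex_of_real c - complex_of_real (1 / max 1 (nrm M (h k)))) \<odot>\<^bsub>M\<^esub> h k"
        unfolding bM by (rule B.sm_diff_left[OF B.real_in_K B.real_in_K hc, symmetric])
      also have "\<dots> = complex_of_real (c - 1 / max 1 (nrm M (h k))) \<odot>\<^bsub>M\<^esub> h k" by (simp only: of_real_diff)
      finally show "nrm M (complex_of_real c \<odot>\<^bsub>M\<^esub> h k \<ominus>\<^bsub>M\<^esub> ball_comb M as (map (\<lambda>x. x k) xs))
        \<le> \<bar>c - 1 / max 1 (nrm M (h k))\<bar> * nrm M (h k)" by (simp only: B.nrm_sm_real[OF hc])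
    qed
  qed (use hc bf bfun_closed in auto)
  then have "rep (\<lambda>k. complex_of_real c \<odot>\<^bsub>M\<^esub> h k) = rep (\<lambda>k. ball_comb M as (map (\<lambda>x. x k) xs))"
    using bf bfun_sm lc(2) by (intro rep_eqI) auto
  then show ?thesis using bN SigmaF by simp
qed

lemma pinterp_pow_tendsto:
  assumes q: "q \<in> psyms LL" "length xs = parity LL q" and xs: "set xs \<subseteq> unit_ball pow"
  shows "((\<lambda>k. pinterp MM q (map (\<lambda>x. x k) xs)) \<longlongrightarrow> pinterp NN q xs) F"
proof -
  have "pinterp NN q xs = Lim F (\<lambda>k. pinterp MM q (map (\<lambda>x. x k) xs))"
  proof (cases q)
    case (NormP as)
    have "set as \<subseteq> K" "length xs = length as" "set xs \<subseteq> carrier pow"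
      using q NormP xs by (auto simp: arity_simps unit_ball_def)
    from lin_comb_pow[OF this] show ?thesis using NormP by (simp add: pow_simps(4) len_rep) (simp add: len_def)
  next
    case (ExtP p)
    then show ?thesis by (simp add: pow_simps(6))
  qed
  moreover have "eventually (\<lambda>k. \<bar>pinterp MM q (map (\<lambda>x. x k) xs)\<bar> \<le> max \<bar>plower LL q\<bar> \<bar>pupper LL q\<bar>) F"
  proof (rule always_eventually, rule allI)
    fix k
    have "pinterp MM q (map (\<lambda>x. x k) xs) \<in> {plower LL q..pupper LL q}"
      by (rule BM.pinterp_bounds) (use q xs unit_ball_ballf ballf_mem(1) in auto)
    then show "\<bar>pinterp MM q (map (\<lambda>x. x k) xs)\<bar> \<le> max \<bar>plower LL q\<bar> \<bar>pupper LL q\<bar>" by auto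
  qed
  ultimately show ?thesis using bounded_tendsto_Lim by metis
qed

lemma eventually_close_lists:
  assumes xs: "set xs \<subseteq> ballf" "set ys \<subseteq> ballf" "length xs = n" "length ys = n"
    and d: "\<And>i. i < n \<Longrightarrow> len (\<lambda>k. (xs ! i) k \<ominus>\<^bsub>M\<^esub> (ys ! i) k) < \<delta>"
  shows "eventually (\<lambda>k. \<forall>i<n. ndist M (map (\<lambda>x. x k) xs ! i) (map (\<lambda>x. x k) ys ! i) < \<delta>) F"
proof -
  have m: "xs ! i \<in> ballf" "ys ! i \<in> ballf" if "i < n" for i
    using that xs nth_mem[of i xs] nth_mem[of i ys] by (simp_all add: subset_iff)
  have "eventually (\<lambda>k. ndist M (map (\<lambda>x. x k) xs ! i) (map (\<lambda>x. x k) ys ! i) < \<delta>) F" if i: "i < n" for i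
    using order_tendstoD(2)[OF len_tendsto[OF bfun_diff[OF ballf_bfun ballf_bfun]] d[OF i]] m[OF i] i xs
    by (simp add: B.ndist_eq ballf_mem)
  then have "eventually (\<lambda>k. \<forall>i\<in>{..<n}. ndist M (map (\<lambda>x. x k) xs ! i) (map (\<lambda>x. x k) ys ! i) < \<delta>) F"
    by (intro eventually_ball_finite) auto
  then show ?thesis by (rule eventually_mono) auto
qed

text \<open>A strict bound on distances in the ultrapower holds eventually at the indices, where the
  modulus of \<open>M\<close> applies; the resulting weak inequality survives the limit. The strict
  premise and weak conclusion in the definition of a modulus are what allows the same moduli to be
  kept.\<close>

lemma pow_mstructure: "is_mstructure LL NN"
  unfolding is_mstructure_def tuples_def
proof (intro conjI ballI allI impI; (elim conjE CollectE)?)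
  show "universe NN \<noteq> {}" using P.zero_unit_ball unfolding metric_structure_simps by blast
  show "Metric_space (universe NN) (distance NN)"
    unfolding metric_structure_simps by (rule P.Metric_space_ndist) (auto simp: unit_ball_def)
  show "Metric_space.mcomplete (universe NN) (distance NN)"
    unfolding metric_structure_simps by (rule P.unit_ball_mcomplete)
next
  fix g xs assume g: "g \<in> fsyms LL" "length xs = farity LL g" "set xs \<subseteq> universe NN"
  then show "finterp NN g xs \<in> universe NN"
    using finterp_pow[of g xs] rep_unit_ball finterp_ballf[of g xs] unit_ball_ballf by auto
next
  fix g \<epsilon> xs ys assume g: "g \<in> fsyms LL" and e: "0 < (\<epsilon>::real)"
    and xs: "length xs = farity LL g" "set xs \<subseteq> universe NN" and ys: "length ys = farity LL g" "set ys \<subseteq> universe NN"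
    and d: "\<forall>i<farity LL g. distance NN (xs ! i) (ys ! i) < fmodulus LL g \<epsilon>"
  let ?f = "\<lambda>xs k. finterp MM g (map (\<lambda>x. x k) xs)"
  have b: "set xs \<subseteq> ballf" "set ys \<subseteq> ballf" using xs ys unit_ball_ballf by auto
  have m: "xs ! i \<in> carrier pow" "ys ! i \<in> carrier pow" if "i < farity LL g" for i
    using that xs ys nth_mem[of i xs] nth_mem[of i ys] by (auto simp: subset_iff unit_ball_def)
  have "eventually (\<lambda>k. \<forall>i<farity LL g. ndist M (map (\<lambda>x. x k) xs ! i) (map (\<lambda>x. x k) ys ! i) < fmodulus LL g \<epsilon>) F"
    by (rule eventually_close_lists) (use b xs ys d m ndist_pow in auto)
  then have "eventually (\<lambda>k. nrm M (?f xs k \<ominus>\<^bsub>M\<^esub> ?f ys k) \<le> \<epsilon>) F"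
  proof (rule eventually_mono)
    fix k assume "\<forall>i<farity LL g. ndist M (map (\<lambda>x. x k) xs ! i) (map (\<lambda>x. x k) ys ! i) < fmodulus LL g \<epsilon>"
    then have "distance MM (?f xs k) (?f ys k) \<le> \<epsilon>"
      by (intro BM.finterp_modulus[OF g e]) (use xs ys b ballf_mem(1) in auto)
    then show "nrm M (?f xs k \<ominus>\<^bsub>M\<^esub> ?f ys k) \<le> \<epsilon>"
      using ballf_mem(2)[OF finterp_ballf[OF g xs(1) b(1)], of k] ballf_mem(2)[OF finterp_ballf[OF g ys(1) b(2)], of k]
      by (simp add: B.ndist_eq)
  qed
  moreover have fb: "?f xs \<in> bfun" "?f ys \<in> bfun"
    using finterp_ballf[OF g] xs ys b ballf_bfun by auto
  ultimately have "len (\<lambda>k. ?f xs k \<ominus>\<^bsub>M\<^esub> ?f ys k) \<le> \<epsilon>"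
    using tendsto_upperbound[OF len_tendsto[OF bfun_diff[OF fb]] _ nontrivial] by blast
  then show "distance NN (finterp NN g xs) (finterp NN g ys) \<le> \<epsilon>"
    using finterp_pow[OF g xs(1)] finterp_pow[OF g ys(1)] xs ys fb minus_pow[OF fb] rep_carrier
    by (simp add: ndist_def pow_simps(4) len_rep bfun_diff)
next
  fix q xs assume q: "q \<in> psyms LL" "length xs = parity LL q" "set xs \<subseteq> universe NN"
  have ev: "eventually (\<lambda>k. plower LL q \<le> pinterp MM q (map (\<lambda>x. x k) xs)) F"
    "eventually (\<lambda>k. pinterp MM q (map (\<lambda>x. x k) xs) \<le> pupper LL q) F"
  proof -
    have "pinterp MM q (map (\<lambda>x. x k) xs) \<in> {plower LL q..pupper LL q}" for k
      by (rule BM.pinterp_bounds) (use q unit_ball_ballf ballf_mem(1) in auto)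
    then show "eventually (\<lambda>k. plower LL q \<le> pinterp MM q (map (\<lambda>x. x k) xs)) F"
      "eventually (\<lambda>k. pinterp MM q (map (\<lambda>x. x k) xs) \<le> pupper LL q) F" by auto
  qed
  have t: "((\<lambda>k. pinterp MM q (map (\<lambda>x. x k) xs)) \<longlongrightarrow> pinterp NN q xs) F"
    by (rule pinterp_pow_tendsto) (use q in auto)
  show "pinterp NN q xs \<in> {plower LL q..pupper LL q}"
    using tendsto_lowerbound[OF t ev(1) nontrivial] tendsto_upperbound[OF t ev(2) nontrivial] by simp
next
  fix q \<epsilon> xs ys assume q: "q \<in> psyms LL" and e: "0 < (\<epsilon>::real)"
    and xs: "length xs = parity LL q" "set xs \<subseteq> universe NN" and ys: "length ys = parity LL q" "set ys \<subseteq> universe NN"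
    and d: "\<forall>i<parity LL q. distance NN (xs ! i) (ys ! i) < pmodulus LL q \<epsilon>"
  have b: "set xs \<subseteq> ballf" "set ys \<subseteq> ballf" using xs ys unit_ball_ballf by auto
  have m: "xs ! i \<in> carrier pow" "ys ! i \<in> carrier pow" if "i < parity LL q" for i
    using that xs ys nth_mem[of i xs] nth_mem[of i ys] by (auto simp: subset_iff unit_ball_def)
  have "eventually (\<lambda>k. \<forall>i<parity LL q. ndist M (map (\<lambda>x. x k) xs ! i) (map (\<lambda>x. x k) ys ! i) < pmodulus LL q \<epsilon>) F"
    by (rule eventually_close_lists) (use b xs ys d m ndist_pow in auto)
  then have ev: "eventually (\<lambda>k. \<bar>pinterp MM q (map (\<lambda>x. x k) xs) - pinterp MM q (map (\<lambda>x. x k) ys)\<bar> \<le> \<epsilon>) F"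
  proof (rule eventually_mono)
    fix k assume "\<forall>i<parity LL q. ndist M (map (\<lambda>x. x k) xs ! i) (map (\<lambda>x. x k) ys ! i) < pmodulus LL q \<epsilon>"
    then show "\<bar>pinterp MM q (map (\<lambda>x. x k) xs) - pinterp MM q (map (\<lambda>x. x k) ys)\<bar> \<le> \<epsilon>"
      by (intro BM.pinterp_modulus[OF q e]) (use xs ys b ballf_mem(1) in auto)
  qed
  have "((\<lambda>k. \<bar>pinterp MM q (map (\<lambda>x. x k) xs) - pinterp MM q (map (\<lambda>x. x k) ys)\<bar>) \<longlongrightarrow> \<bar>pinterp NN q xs - pinterp NN q ys\<bar>) F"
    by (intro tendsto_rabs tendsto_diff pinterp_pow_tendsto) (use q xs ys in auto)
  then show "\<bar>pinterp NN q xs - pinterp NN q ys\<bar> \<le> \<epsilon>" using ev nontrivial by (rule tendsto_upperbound)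
qed

lemma pow_banach_structure: "banach_structure K E pow"
  using base pow_mstructure P.banach_space_axioms by (simp add: banach_structure_def)

interpretation BN: bounded_mstructure LL NN 2
  by (rule banach_bounded_mstructure[OF pow_banach_structure])

section \<open>Los's theorem for continuous logic\<close>

lemma eval_trm_los:
  assumes "wf_trm LL t" "\<And>v. e v \<in> unit_ball pow"
  shows "eqv (eval_trm NN e t) (\<lambda>k. eval_trm MM (\<lambda>v. e v k) t)"
  using assms
proof (induction t)
  case (Var v)
  then show ?case using eqv_refl ballf_mem(2) unit_ball_ballf by simp
next
  case (Fn g ts)
  have g: "g \<in> fsyms LL" "length ts = farity LL g" "\<And>t. t \<in> set ts \<Longrightarrow> wf_trm LL t" using Fn.prems by auto
  define xs where "xs = map (eval_trm NN e) ts"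
  define ys where "ys = map (\<lambda>t k. eval_trm MM (\<lambda>v. e v k) t) ts"
  have xN: "set xs \<subseteq> unit_ball pow" using BN.eval_trm_closed g Fn.prems(2) by (auto simp: xs_def)
  then have xb: "set xs \<subseteq> ballf" using unit_ball_ballf by blast
  have yb: "set ys \<subseteq> ballf"
    using BM.eval_trm_closed g ballf_mem(1)[OF unit_ball_ballf[OF Fn.prems(2)]] by (auto simp: ys_def ballf_def)
  have l: "length xs = farity LL g" "length ys = farity LL g" using g by (auto simp: xs_def ys_def)
  let ?f = "\<lambda>xs k. finterp MM g (map (\<lambda>x. x k) xs)"
  have fb: "?f xs \<in> ballf" "?f ys \<in> ballf" using finterp_ballf[OF g(1)] l xb yb by auto
  have "eqv (?f xs) (?f ys)"
    unfolding eqv_alt[OF ballf_mem(2)[OF fb(1)] ballf_mem(2)[OF fb(2)]]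
  proof (intro allI impI)
    fix \<epsilon> :: real assume e: "\<epsilon> > 0"
    have "0 < fmodulus LL g \<epsilon>" using BM.lang g e by (simp add: is_language_def)
    then have "eventually (\<lambda>k. \<forall>i<farity LL g. ndist M (map (\<lambda>x. x k) xs ! i) (map (\<lambda>x. x k) ys ! i) < fmodulus LL g \<epsilon>) F"
    proof (intro eventually_close_lists xb yb l)
      fix i assume i: "i < farity LL g"
      have "eqv (xs ! i) (ys ! i)" using Fn.IH[of "ts ! i"] Fn.prems g i by (simp add: xs_def ys_def)
      then have "len (\<lambda>k. (xs ! i) k \<ominus>\<^bsub>M\<^esub> (ys ! i) k) = 0" unfolding eqv_def by (rule len_eqI)
      then show "len (\<lambda>k. (xs ! i) k \<ominus>\<^bsub>M\<^esub> (ys ! i) k) < fmodulus LL g \<epsilon>" using \<open>0 < fmodulus LL g \<epsilon>\<close> by simp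
    qed
    then show "eventually (\<lambda>k. nrm M (?f xs k \<ominus>\<^bsub>M\<^esub> ?f ys k) \<le> \<epsilon>) F"
    proof (rule eventually_mono)
      fix k assume "\<forall>i<farity LL g. ndist M (map (\<lambda>x. x k) xs ! i) (map (\<lambda>x. x k) ys ! i) < fmodulus LL g \<epsilon>"
      then have "distance MM (?f xs k) (?f ys k) \<le> \<epsilon>"
        by (intro BM.finterp_modulus[OF g(1) e]) (use l xb yb ballf_mem(1) in auto)
      then show "nrm M (?f xs k \<ominus>\<^bsub>M\<^esub> ?f ys k) \<le> \<epsilon>"
        using ballf_mem(2)[OF fb(1), of k] ballf_mem(2)[OF fb(2), of k] by (simp add: B.ndist_eq)
    qed
  qed
  moreover have "eval_trm NN e (Fn g ts) = rep (?f xs)"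
    using finterp_pow[OF g(1) l(1) xN] by (simp add: xs_def)
  moreover have "(\<lambda>k. eval_trm MM (\<lambda>v. e v k) (Fn g ts)) = ?f ys" by (auto simp: ys_def o_def)
  moreover have "eqv (rep (?f xs)) (?f xs)" using fb ballf_bfun rep_eqv by blast
  ultimately show ?case
    using eqv_trans[of "rep (?f xs)" "?f xs" "?f ys"] fb ballf_mem(2) ballf_bfun rep_bfun bfun_closed by metis
qed

text \<open>Since the modulus of a formula serves all environments, the environments may vary with
  the index; only finitely many variables have to be close.\<close>

lemma eval_fm_eqv:
  assumes wf: "wf_fm LL \<phi>" and a: "\<And>k v. a k v \<in> unit_ball M" and b: "\<And>k v. b k v \<in> unit_ball M"
    and ab: "\<And>v. v \<in> free_vars \<phi> \<Longrightarrow> eqv (\<lambda>k. a k v) (\<lambda>k. b k v)"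
  shows "((\<lambda>k. eval_fm MM (a k) \<phi> - eval_fm MM (b k) \<phi>) \<longlongrightarrow> 0) F"
proof (rule tendstoI)
  fix \<epsilon> :: real assume e: "\<epsilon> > 0"
  then have "\<epsilon> / 2 > 0" by simp
  from BM.eval_fm_uniform[OF wf this] obtain \<delta> where \<delta>: "\<delta> > 0"
    and u: "\<forall>e e'. (\<forall>v. e v \<in> universe MM) \<longrightarrow> (\<forall>v. e' v \<in> universe MM) \<longrightarrow>
      (\<forall>v\<in>free_vars \<phi>. distance MM (e v) (e' v) < \<delta>) \<longrightarrow> \<bar>eval_fm MM e \<phi> - eval_fm MM e' \<phi>\<bar> \<le> \<epsilon> / 2"
    by (elim exE conjE) (rule that)
  have "eventually (\<lambda>k. distance MM (a k v) (b k v) < \<delta>) F" if "v \<in> free_vars \<phi>" for v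
    using order_tendstoD(2)[OF ab[OF that, unfolded eqv_def] \<delta>] a b by (simp add: B.ndist_eq unit_ball_def)
  then have "eventually (\<lambda>k. \<forall>v\<in>free_vars \<phi>. distance MM (a k v) (b k v) < \<delta>) F"
    by (intro eventually_ball_finite finite_free_vars) auto
  then show "eventually (\<lambda>k. dist (eval_fm MM (a k) \<phi> - eval_fm MM (b k) \<phi>) 0 < \<epsilon>) F"
  proof (rule eventually_mono)
    fix k assume "\<forall>v\<in>free_vars \<phi>. distance MM (a k v) (b k v) < \<delta>"
    then have "\<bar>eval_fm MM (a k) \<phi> - eval_fm MM (b k) \<phi>\<bar> \<le> \<epsilon> / 2"
      using u[THEN spec, of "a k", THEN spec, of "b k"] a b by simp
    then show "dist (eval_fm MM (a k) \<phi> - eval_fm MM (b k) \<phi>) 0 < \<epsilon>" using e by (simp add: dist_real_def)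
  qed
qed

text \<open>The value at each element of the ultrapower is at most the limit of the suprema.
  Conversely, near-optimal elements chosen at every index form one element of the ultrapower. The
  sign \<open>s\<close> treats suprema and infima together.\<close>

lemma los_sup:
  fixes s :: real
  assumes wf: "wf_fm LL \<phi>" and e: "\<And>v. e v \<in> unit_ball pow" and s: "s = 1 \<or> s = -1"
    and IH: "\<And>e. (\<And>v. e v \<in> unit_ball pow) \<Longrightarrow> ((\<lambda>k. eval_fm MM (\<lambda>v. e v k) \<phi>) \<longlongrightarrow> eval_fm NN e \<phi>) F"
  shows "((\<lambda>k. SUP x\<in>unit_ball M. s * eval_fm MM ((\<lambda>v. e v k)(j := x)) \<phi>)
    \<longlongrightarrow> (SUP x\<in>unit_ball pow. s * eval_fm NN (e(j := x)) \<phi>)) F"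
proof -
  from BM.eval_fm_bounded[OF wf] obtain B where B0: "\<forall>e. (\<forall>v. e v \<in> universe MM) \<longrightarrow> \<bar>eval_fm MM e \<phi>\<bar> \<le> B"
    by (elim exE) (rule that)
  from BN.eval_fm_bounded[OF wf] obtain B' where B0': "\<forall>e. (\<forall>v. e v \<in> universe NN) \<longrightarrow> \<bar>eval_fm NN e \<phi>\<bar> \<le> B'"
    by (elim exE) (rule that)
  have eM: "e v k \<in> unit_ball M" for v k using ballf_mem(1)[OF unit_ball_ballf[OF e]] .
  define h where "h k x = s * eval_fm MM ((\<lambda>v. e v k)(j := x)) \<phi>" for k x
  define H where "H x = s * eval_fm NN (e(j := x)) \<phi>" for x
  define S where "S k = (SUP x\<in>unit_ball M. h k x)" for k
  have hB: "\<bar>h k x\<bar> \<le> B" if "x \<in> unit_ball M" for k x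
    using B0[THEN spec, of "(\<lambda>v. e v k)(j := x)"] that eM s by (auto simp: h_def abs_mult)
  have HB: "\<bar>H x\<bar> \<le> B'" if "x \<in> unit_ball pow" for x
    using B0'[THEN spec, of "e(j := x)"] that e s by (auto simp: H_def abs_mult)
  have bh: "bdd_above (h k ` unit_ball M)" for k by (rule bdd_aboveI[of _ B]) (use hB in \<open>force simp: abs_le_iff\<close>)
  have bH: "bdd_above (H ` unit_ball pow)" by (rule bdd_aboveI[of _ B']) (use HB in \<open>force simp: abs_le_iff\<close>)
  have neM: "unit_ball M \<noteq> {}" and neN: "unit_ball pow \<noteq> {}" using B.zero_unit_ball P.zero_unit_ball by blast+
  have SB: "\<bar>S k\<bar> \<le> B" for k unfolding S_def by (rule cSup_abs_le) (use neM hB in auto)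
  have SL: "(S \<longlongrightarrow> Lim F S) F" by (rule bounded_tendsto_Lim[of _ B]) (use SB in simp)
  \<comment> \<open>At single indices the representative of \<open>x\<close> may differ from
    \<open>x\<close>, but the difference tends to 0 and the formula does not see it in the
    limit.\<close>
  have lim: "((\<lambda>k. h k (x k)) \<longlongrightarrow> H (rep x)) F" if x: "x \<in> ballf" for x
  proof -
    have "((\<lambda>k. eval_fm MM (\<lambda>v. (e(j := rep x)) v k) \<phi>) \<longlongrightarrow> eval_fm NN (e(j := rep x)) \<phi>) F"
      by (rule IH) (use e rep_unit_ball[OF x] in auto)
    moreover have "((\<lambda>k. eval_fm MM ((\<lambda>v. e v k)(j := x k)) \<phi> - eval_fm MM (\<lambda>v. (e(j := rep x)) v k) \<phi>) \<longlongrightarrow> 0) F"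
    proof (rule eval_fm_eqv[OF wf])
      fix v
      have "eqv x (rep x)"
        using rep_eqv[OF ballf_bfun[OF x]] eqv_sym rep_bfun[OF ballf_bfun[OF x]] x by (simp add: bfun_closed ballf_mem)
      then show "eqv (\<lambda>k. ((\<lambda>v. e v k)(j := x k)) v) (\<lambda>k. (e(j := rep x)) v k)"
        using eqv_refl[of "e v"] eM by (auto simp: unit_ball_def)
    qed (use eM x rep_unit_ball[OF x] unit_ball_ballf ballf_mem(1) in auto)
    ultimately have "((\<lambda>k. eval_fm MM ((\<lambda>v. e v k)(j := x k)) \<phi>) \<longlongrightarrow> eval_fm NN (e(j := rep x)) \<phi>) F"
      using tendsto_add by fastforce
    then show ?thesis unfolding h_def H_def by (intro tendsto_mult tendsto_const)
  qed
  have up: "H x \<le> Lim F S" if x: "x \<in> unit_ball pow" for x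
  proof -
    have xb: "x \<in> ballf" and rx: "rep x = x"
      using x unit_ball_ballf pow_carrier[of x] by (auto simp: unit_ball_def)
    have "eventually (\<lambda>k. h k (x k) \<le> S k) F"
      unfolding S_def by (intro always_eventually allI cSUP_upper bh ballf_mem(1)[OF xb])
    then show ?thesis using tendsto_le[OF nontrivial SL lim[OF xb]] rx by simp
  qed
  have "Lim F S \<le> (SUP x\<in>unit_ball pow. H x)"
  proof (rule field_le_epsilon)
    fix \<epsilon> :: real assume "\<epsilon> > 0"
    have "\<exists>x. x \<in> unit_ball M \<and> S k - \<epsilon> \<le> h k x" for k
    proof -
      have "S k - \<epsilon> < Sup (h k ` unit_ball M)" using \<open>\<epsilon> > 0\<close> by (simp add: S_def)
      then show ?thesis using less_cSup_iff[OF _ bh[of k]] neM by (auto intro: less_imp_le)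
    qed
    then obtain x where x: "\<And>k. x k \<in> unit_ball M" "\<And>k. S k - \<epsilon> \<le> h k (x k)" by metis
    have xb: "x \<in> ballf" using x by (simp add: ballf_def)
    have "Lim F S - \<epsilon> \<le> H (rep x)"
      by (rule tendsto_le[OF nontrivial lim[OF xb] tendsto_diff[OF SL tendsto_const]]) (use x in simp)
    also have "H (rep x) \<le> (SUP x\<in>unit_ball pow. H x)" by (intro cSUP_upper rep_unit_ball xb bH)
    finally show "Lim F S \<le> (SUP x\<in>unit_ball pow. H x) + \<epsilon>" by simp
  qed
  moreover have "(SUP x\<in>unit_ball pow. H x) \<le> Lim F S" by (rule cSUP_least[OF neN up])
  ultimately show ?thesis using SL by (simp add: S_def[abs_def] h_def H_def)
qed

theorem los:
  assumes "wf_fm LL \<phi>" "\<And>v. e v \<in> unit_ball pow"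
  shows "((\<lambda>k. eval_fm MM (\<lambda>v. e v k) \<phi>) \<longlongrightarrow> eval_fm NN e \<phi>) F"
  using assms
proof (induction \<phi> arbitrary: e)
  case (FDist s t)
  have eM: "e v k \<in> unit_ball M" for v k using ballf_mem(1)[OF unit_ball_ballf[OF FDist.prems(2)]] .
  let ?s = "eval_trm NN e s" and ?t = "eval_trm NN e t"
  let ?s' = "\<lambda>k. eval_trm MM (\<lambda>v. e v k) s" and ?t' = "\<lambda>k. eval_trm MM (\<lambda>v. e v k) t"
  have N: "?s \<in> unit_ball pow" "?t \<in> unit_ball pow"
    using BN.eval_trm_closed[of s e] BN.eval_trm_closed[of t e] FDist.prems by auto
  have c: "?s k \<in> carrier M" "?t k \<in> carrier M" for k using N unit_ball_ballf ballf_mem(2) by auto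
  have c': "?s' k \<in> carrier M" "?t' k \<in> carrier M" for k
    using BM.eval_trm_closed[of s "\<lambda>v. e v k"] BM.eval_trm_closed[of t "\<lambda>v. e v k"] FDist.prems eM
    by (auto simp: unit_ball_def)
  have q: "eqv ?s ?s'" "eqv ?t ?t'" using eval_trm_los FDist.prems by auto
  have "((\<lambda>k. nrm M (?s k \<ominus>\<^bsub>M\<^esub> ?t k)) \<longlongrightarrow> eval_fm NN e (FDist s t)) F"
    using len_tendsto[OF bfun_diff] ndist_pow N unit_ball_ballf ballf_bfun by (simp add: unit_ball_def)
  moreover have "((\<lambda>k. nrm M (?s' k \<ominus>\<^bsub>M\<^esub> ?t' k) - nrm M (?s k \<ominus>\<^bsub>M\<^esub> ?t k)) \<longlongrightarrow> 0) F"
  proof (rule Lim_null_comparison)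
    show "((\<lambda>k. nrm M (?s k \<ominus>\<^bsub>M\<^esub> ?s' k) + nrm M (?t k \<ominus>\<^bsub>M\<^esub> ?t' k)) \<longlongrightarrow> 0) F"
      using tendsto_add[OF q[unfolded eqv_def]] by simp
    show "\<forall>\<^sub>F k in F. norm (nrm M (?s' k \<ominus>\<^bsub>M\<^esub> ?t' k) - nrm M (?s k \<ominus>\<^bsub>M\<^esub> ?t k)) \<le> nrm M (?s k \<ominus>\<^bsub>M\<^esub> ?s' k) + nrm M (?t k \<ominus>\<^bsub>M\<^esub> ?t' k)"
    proof (rule always_eventually, rule allI)
      fix k
      show "norm (nrm M (?s' k \<ominus>\<^bsub>M\<^esub> ?t' k) - nrm M (?s k \<ominus>\<^bsub>M\<^esub> ?t k)) \<le> nrm M (?s k \<ominus>\<^bsub>M\<^esub> ?s' k) + nrm M (?t k \<ominus>\<^bsub>M\<^esub> ?t' k)"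
        using B.nrm_diff_triangle[OF c'(1) c(1) c'(2), of k k k] B.nrm_diff_triangle[OF c(1) c(2) c'(2), of k k k]
          B.nrm_diff_triangle[OF c(1) c'(1) c(2), of k k k] B.nrm_diff_triangle[OF c'(1) c'(2) c(2), of k k k]
          B.nrm_diff_commute[OF c(1) c'(1), of k k] B.nrm_diff_commute[OF c(2) c'(2), of k k] by simp
    qed
  qed
  ultimately have "((\<lambda>k. nrm M (?s' k \<ominus>\<^bsub>M\<^esub> ?t' k)) \<longlongrightarrow> eval_fm NN e (FDist s t)) F"
    using tendsto_add by fastforce
  then show ?case using c' by (simp add: B.ndist_eq)
next
  case (FPred q ts)
  have q: "q \<in> psyms LL" "length ts = parity LL q" "\<And>t. t \<in> set ts \<Longrightarrow> wf_trm LL t" using FPred.prems by auto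
  have eM: "e v k \<in> unit_ball M" for v k using ballf_mem(1)[OF unit_ball_ballf[OF FPred.prems(2)]] .
  define xs where "xs = map (eval_trm NN e) ts"
  define ys where "ys = map (\<lambda>t k. eval_trm MM (\<lambda>v. e v k) t) ts"
  have xN: "set xs \<subseteq> unit_ball pow" using BN.eval_trm_closed q FPred.prems(2) by (auto simp: xs_def)
  then have xb: "set xs \<subseteq> ballf" using unit_ball_ballf by blast
  have yb: "set ys \<subseteq> ballf" using BM.eval_trm_closed q eM by (auto simp: ys_def ballf_def)
  have l: "length xs = parity LL q" "length ys = parity LL q" using q by (auto simp: xs_def ys_def)
  have "((\<lambda>k. pinterp MM q (map (\<lambda>x. x k) ys) - pinterp MM q (map (\<lambda>x. x k) xs)) \<longlongrightarrow> 0) F"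
  proof (rule tendstoI)
    fix \<epsilon> :: real assume e: "\<epsilon> > 0"
    then have e2: "\<epsilon> / 2 > 0" by simp
    have pos: "0 < pmodulus LL q (\<epsilon> / 2)" using BM.lang q e2 unfolding is_language_def by blast
    have "eventually (\<lambda>k. \<forall>i<parity LL q. ndist M (map (\<lambda>x. x k) xs ! i) (map (\<lambda>x. x k) ys ! i) < pmodulus LL q (\<epsilon> / 2)) F"
    proof (intro eventually_close_lists xb yb l)
      fix i assume i: "i < parity LL q"
      have "eqv (xs ! i) (ys ! i)" using eval_trm_los[of "ts ! i" e] FPred.prems q i by (simp add: xs_def ys_def)
      then have "len (\<lambda>k. (xs ! i) k \<ominus>\<^bsub>M\<^esub> (ys ! i) k) = 0" unfolding eqv_def by (rule len_eqI)
      then show "len (\<lambda>k. (xs ! i) k \<ominus>\<^bsub>M\<^esub> (ys ! i) k) < pmodulus LL q (\<epsilon> / 2)" using pos by simp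
    qed
    then show "eventually (\<lambda>k. dist (pinterp MM q (map (\<lambda>x. x k) ys) - pinterp MM q (map (\<lambda>x. x k) xs)) 0 < \<epsilon>) F"
    proof (rule eventually_mono)
      fix k assume "\<forall>i<parity LL q. ndist M (map (\<lambda>x. x k) xs ! i) (map (\<lambda>x. x k) ys ! i) < pmodulus LL q (\<epsilon> / 2)"
      then have "\<bar>pinterp MM q (map (\<lambda>x. x k) xs) - pinterp MM q (map (\<lambda>x. x k) ys)\<bar> \<le> \<epsilon> / 2"
        by (intro BM.pinterp_modulus[OF q(1) e2]) (use l xb yb ballf_mem(1) in auto)
      then show "dist (pinterp MM q (map (\<lambda>x. x k) ys) - pinterp MM q (map (\<lambda>x. x k) xs)) 0 < \<epsilon>"
        using e by (simp add: dist_real_def abs_minus_commute)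
    qed
  qed
  from tendsto_add[OF this pinterp_pow_tendsto[OF q(1) l(1) xN]]
  have "((\<lambda>k. pinterp MM q (map (\<lambda>x. x k) ys)) \<longlongrightarrow> pinterp NN q xs) F" by simp
  then show ?case by (simp add: xs_def ys_def o_def)
next
  case (FConn u \<phi>s)
  have eM: "e v k \<in> unit_ball M" for v k using ballf_mem(1)[OF unit_ball_ballf[OF FConn.prems(2)]] .
  have wf: "\<And>\<phi>. \<phi> \<in> set \<phi>s \<Longrightarrow> wf_fm LL \<phi>" "continuous_on UNIV u" using FConn.prems by auto
  define a where "a k = BM.conn_args (\<lambda>v. e v k) \<phi>s" for k
  define b where "b = BN.conn_args e \<phi>s"
  have conv: "((\<lambda>k. a k i) \<longlongrightarrow> b i) F" for i
  proof (cases "i < length \<phi>s")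
    case True
    then have "((\<lambda>k. eval_fm MM (\<lambda>v. e v k) (\<phi>s ! i)) \<longlongrightarrow> eval_fm NN e (\<phi>s ! i)) F"
      by (intro FConn.IH) (use wf FConn.prems in auto)
    then show ?thesis using True by (simp add: a_def b_def BM.conn_args_def BN.conn_args_def)
  qed (simp add: a_def b_def BM.conn_args_def BN.conn_args_def)
  define B where "B = 1 + (\<Sum>i<length \<phi>s. \<bar>b i\<bar>)"
  have bB: "\<bar>b i\<bar> + 1 \<le> B" for i
  proof (cases "i < length \<phi>s")
    case True
    then show ?thesis unfolding B_def using member_le_sum[of i "{..<length \<phi>s}" "\<lambda>i. \<bar>b i\<bar>"] by simp
  qed (simp add: B_def b_def BN.conn_args_def sum_nonneg)
  have "((\<lambda>k. u (a k)) \<longlongrightarrow> u b) F"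
  proof (rule tendstoI)
    fix \<epsilon> :: real assume e: "\<epsilon> > 0"
    then have "\<epsilon> / 2 > 0" by simp
    from continuous_box_uniform[OF wf(2) this, of B] obtain \<delta> where \<delta>: "\<delta> > 0"
      and u: "\<forall>x y. (\<forall>i. \<bar>x i\<bar> \<le> B) \<longrightarrow> (\<forall>i. \<bar>y i\<bar> \<le> B) \<longrightarrow> (\<forall>i. \<bar>x i - y i\<bar> \<le> \<delta>) \<longrightarrow> \<bar>u x - u y\<bar> \<le> \<epsilon> / 2"
      by (elim exE conjE) (rule that)
    have "eventually (\<lambda>k. \<bar>a k i - b i\<bar> < min 1 \<delta>) F" for i
      using tendstoD[OF conv[of i], of "min 1 \<delta>"] \<delta> by (simp add: dist_real_def)
    then have "eventually (\<lambda>k. \<forall>i\<in>{..<length \<phi>s}. \<bar>a k i - b i\<bar> < min 1 \<delta>) F"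
      by (intro eventually_ball_finite) auto
    then show "eventually (\<lambda>k. dist (u (a k)) (u b) < \<epsilon>) F"
    proof (rule eventually_mono)
      fix k assume k: "\<forall>i\<in>{..<length \<phi>s}. \<bar>a k i - b i\<bar> < min 1 \<delta>"
      have k': "\<bar>a k i - b i\<bar> < min 1 \<delta>" for i
        using k \<delta> by (cases "i < length \<phi>s") (simp_all add: a_def b_def BM.conn_args_def BN.conn_args_def)
      have "\<bar>a k i\<bar> \<le> B" "\<bar>b i\<bar> \<le> B" "\<bar>a k i - b i\<bar> \<le> \<delta>" for i
        using k'[of i] bB[of i] by linarith+
      then have "\<bar>u (a k) - u b\<bar> \<le> \<epsilon> / 2" using u[THEN spec, of "a k", THEN spec, of b] by simp
      then show "dist (u (a k)) (u b) < \<epsilon>" using e by (simp add: dist_real_def)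
    qed
  qed
  then show ?case unfolding a_def b_def BM.eval_FConn BN.eval_FConn .
next
  case (FSup j \<phi>)
  then have "((\<lambda>k. SUP x\<in>unit_ball M. 1 * eval_fm MM ((\<lambda>v. e v k)(j := x)) \<phi>)
    \<longlongrightarrow> (SUP x\<in>unit_ball pow. 1 * eval_fm NN (e(j := x)) \<phi>)) F"
    by (intro los_sup) auto
  then show ?case by simp
next
  case (FInf j \<phi>)
  then have "((\<lambda>k. SUP x\<in>unit_ball M. (-1) * eval_fm MM ((\<lambda>v. e v k)(j := x)) \<phi>)
    \<longlongrightarrow> (SUP x\<in>unit_ball pow. (-1) * eval_fm NN (e(j := x)) \<phi>)) F"
    by (intro los_sup) auto
  then show ?case unfolding eval_fm.simps cINF_eq_minus_cSUP by (intro tendsto_minus) simp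
qed

text \<open>The version for arbitrary functions into the unit ball, which need not be the chosen
  representatives.\<close>

lemma los_ballf:
  assumes wf: "wf_fm LL \<phi>" and e: "\<And>v. e v \<in> ballf"
  shows "((\<lambda>k. eval_fm MM (\<lambda>v. e v k) \<phi>) \<longlongrightarrow> eval_fm NN (\<lambda>v. rep (e v)) \<phi>) F"
proof -
  have r: "rep (e v) \<in> unit_ball pow" "rep (e v) \<in> ballf" for v using e rep_unit_ball unit_ball_ballf by auto
  have "((\<lambda>k. eval_fm MM (\<lambda>v. e v k) \<phi> - eval_fm MM (\<lambda>v. rep (e v) k) \<phi>) \<longlongrightarrow> 0) F"
  proof (rule eval_fm_eqv[OF wf])
    show "eqv (\<lambda>k. e v k) (\<lambda>k. rep (e v) k)" for v
      using eqv_sym[OF ballf_mem(2)[OF r(2)] ballf_mem(2)[OF e] rep_eqv[OF ballf_bfun[OF e]]] by simp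
  qed (use e r ballf_mem(1) in auto)
  from tendsto_add[OF this los[OF wf, of "\<lambda>v. rep (e v)", OF r(1)]] show ?thesis by simp
qed

lemma value_in_pow: "sentence LL \<phi> \<Longrightarrow> value_in NN \<phi> = value_in MM \<phi>"
proof -
  assume s: "sentence LL \<phi>"
  have a: "((\<lambda>k. eval_fm MM (\<lambda>v. zero pow k) \<phi>) \<longlongrightarrow> eval_fm NN (\<lambda>v. zero pow) \<phi>) F"
    by (rule los) (use s in \<open>auto simp: sentence_def\<close>)
  have b: "eval_fm MM (\<lambda>v. zero pow k) \<phi> = value_in MM \<phi>" for k
    unfolding value_in_def by (rule eval_fm_cong) (use s in \<open>auto simp: sentence_def\<close>)
  have c: "eval_fm NN (\<lambda>v. zero pow) \<phi> = value_in NN \<phi>"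
    unfolding value_in_def by (rule eval_fm_cong) (use s in \<open>auto simp: sentence_def\<close>)
  have "((\<lambda>k. value_in MM \<phi>) \<longlongrightarrow> value_in NN \<phi>) F" using a by (simp only: b c)
  then show ?thesis by (rule tendsto_unique[OF nontrivial _ tendsto_const])
qed

lemma pow_model:
  assumes "is_model K E T M" "T \<subseteq> {\<phi>. sentence LL \<phi>}"
  shows "is_model K E T pow"
  using assms pow_banach_structure value_in_pow by (auto simp: is_model_def satisfies_def)

end

section \<open>Real linear combinations\<close>

lemma cring_scalars: "is_scalar_field K \<Longrightarrow> cring (scalars K)"
proof (rule cringI)
  assume K: "is_scalar_field K"
  then have cl: "a \<in> K \<Longrightarrow> b \<in> K \<Longrightarrow> a + b \<in> K" "a \<in> K \<Longrightarrow> b \<in> K \<Longrightarrow> a * b \<in> K" "a \<in> K \<Longrightarrow> - a \<in> K" "0 \<in> K" "1 \<in> K" for a b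
    by (auto simp: is_scalar_field_def)
  show "abelian_group (scalars K)"
    by (rule abelian_groupI) (auto simp: scalars_def cl add.assoc add.commute intro!: bexI[of _ "- _"])
  show "Group.comm_monoid (scalars K)"
    by (rule comm_monoidI) (auto simp: scalars_def cl mult.assoc mult.commute)
qed (simp add: scalars_def distrib_right)

text \<open>Restriction of scalars on the same record, so that facts about submodules apply to real
  subspaces.\<close>

lemma (in banach_space) banach_space_real: "banach_space \<real> X"
proof (intro banach_space.intro banach_space_axioms.intro moduleI)
  show "cring (scalars \<real>)" by (rule cring_scalars) (simp add: is_scalar_field_def)
  show "abelian_group X" by (rule M.abelian_group_axioms)
  show "is_scalar_field \<real>" by (simp add: is_scalar_field_def)
  have RK: "a \<in> \<real> \<Longrightarrow> a \<in> K" for a using scalar_field by (auto simp: is_scalar_field_def)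
  show "nrm X (a \<odot> x) = cmod a * nrm X x" if "a \<in> \<real>" "x \<in> carrier X" for a x
    using that RK nrm_smult by blast
  show "Metric_space.mcomplete (carrier X) (ndist X)" by (rule complete)
  fix a b x y
  show "a \<in> carrier (scalars \<real>) \<Longrightarrow> x \<in> carrier X \<Longrightarrow> a \<odot> x \<in> carrier X"
    using RK by (simp add: scalars_def)
  show "a \<in> carrier (scalars \<real>) \<Longrightarrow> b \<in> carrier (scalars \<real>) \<Longrightarrow> x \<in> carrier X \<Longrightarrow>
      (a \<oplus>\<^bsub>scalars \<real>\<^esub> b) \<odot> x = a \<odot> x \<oplus> b \<odot> x"
    using RK by (simp add: scalars_def sm_add_left)
  show "a \<in> carrier (scalars \<real>) \<Longrightarrow> x \<in> carrier X \<Longrightarrow> y \<in> carrier X \<Longrightarrow> a \<odot> (x \<oplus> y) = a \<odot> x \<oplus> a \<odot> y"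
    using RK by (simp add: scalars_def sm_add_right)
  show "a \<in> carrier (scalars \<real>) \<Longrightarrow> b \<in> carrier (scalars \<real>) \<Longrightarrow> x \<in> carrier X \<Longrightarrow>
      (a \<otimes>\<^bsub>scalars \<real>\<^esub> b) \<odot> x = a \<odot> (b \<odot> x)"
    using RK by (simp add: scalars_def sm_assoc)
  show "x \<in> carrier X \<Longrightarrow> \<one>\<^bsub>scalars \<real>\<^esub> \<odot> x = x" by (simp add: scalars_def sm_one)
qed (use nrm_nonneg nrm_eq_0_iff nrm_triangle in auto)

lemma lin_span_real_subset:
  assumes "is_scalar_field K" shows "lin_span \<real> X S \<subseteq> lin_span K X S"
proof -
  have "\<real> \<subseteq> K" using assms by (auto simp: is_scalar_field_def)
  then have "submodule W (scalars \<real>) X" if "submodule W (scalars K) X" for W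
    using that by (auto simp: submodule_def submodule_axioms_def scalars_def subset_iff)
  then show ?thesis unfolding lin_span_def by blast
qed

context banach_space
begin

text \<open>The linear map taking the unit sequences to the vectors \<open>x i\<close>. It carries
  questions about a space with a carrier over to the type \<open>fseq\<close>, where the norm
  becomes a seminorm and the theory of real vector spaces is available.\<close>

definition lin :: "(nat \<Rightarrow> 'x) \<Rightarrow> fseq \<Rightarrow> 'x" where
  "lin x a = finsum X (\<lambda>i. complex_of_real (coord a i) \<odot> x i) {i. coord a i \<noteq> 0}"

context
  fixes x :: "nat \<Rightarrow> 'x"
  assumes x: "\<And>i. x i \<in> carrier X"
begin

lemma lin_superset:
  assumes "finite A" "{i. coord a i \<noteq> 0} \<subseteq> A"
  shows "lin x a = finsum X (\<lambda>i. complex_of_real (coord a i) \<odot> x i) A"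
proof -
  let ?f = "\<lambda>i. complex_of_real (coord a i) \<odot> x i"
  have "finsum X ?f ({i. coord a i \<noteq> 0} \<union> Z) = finsum X ?f {i. coord a i \<noteq> 0}"
    if "finite Z" "Z \<inter> {i. coord a i \<noteq> 0} = {}" for Z
    using that
  proof (induction Z)
    case (insert z Z)
    have "finsum X ?f (insert z ({i. coord a i \<noteq> 0} \<union> Z)) = ?f z \<oplus> finsum X ?f ({i. coord a i \<noteq> 0} \<union> Z)"
      by (rule M.finsum_insert) (use insert x in auto)
    moreover have "?f z = \<zero>" using insert.prems x by simp
    moreover have "finsum X ?f ({i. coord a i \<noteq> 0} \<union> Z) \<in> carrier X" by (rule M.finsum_closed) (use x in auto)
    ultimately show ?case using insert by simp
  qed simp
  from this[of "A - {i. coord a i \<noteq> 0}"] assms show ?thesis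
    by (simp add: lin_def Un_absorb1 Diff_disjoint Int_commute)
qed

lemma lin_closed [simp]: "lin x a \<in> carrier X"
  unfolding lin_def by (rule M.finsum_closed) (use x in auto)

lemma lin_add: "lin x (a + b) = lin x a \<oplus> lin x b"
proof -
  let ?A = "{i. coord a i \<noteq> 0} \<union> {i. coord b i \<noteq> 0}"
  have "lin x (a + b) = finsum X (\<lambda>i. complex_of_real (coord (a + b) i) \<odot> x i) ?A"
    by (rule lin_superset) auto
  also have "\<dots> = finsum X (\<lambda>i. complex_of_real (coord a i) \<odot> x i \<oplus> complex_of_real (coord b i) \<odot> x i) ?A"
    by (rule M.finsum_cong') (use x in \<open>auto simp: sm_add_left\<close>)
  also have "\<dots> = finsum X (\<lambda>i. complex_of_real (coord a i) \<odot> x i) ?A \<oplus> finsum X (\<lambda>i. complex_of_real (coord b i) \<odot> x i) ?A"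
    by (rule M.finsum_addf) (use x in auto)
  also have "finsum X (\<lambda>i. complex_of_real (coord a i) \<odot> x i) ?A = lin x a" by (rule lin_superset[symmetric]) auto
  also have "finsum X (\<lambda>i. complex_of_real (coord b i) \<odot> x i) ?A = lin x b" by (rule lin_superset[symmetric]) auto
  finally show ?thesis .
qed

lemma lin_scale: "lin x (c *\<^sub>R a) = complex_of_real c \<odot> lin x a"
proof -
  let ?A = "{i. coord a i \<noteq> 0}"
  have "lin x (c *\<^sub>R a) = finsum X (\<lambda>i. complex_of_real (coord (c *\<^sub>R a) i) \<odot> x i) ?A"
    by (rule lin_superset) auto
  also have "\<dots> = finsum X (\<lambda>i. complex_of_real c \<odot> (complex_of_real (coord a i) \<odot> x i)) ?A"
    by (rule M.finsum_cong') (use x in \<open>auto simp: sm_assoc\<close>)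
  also have "\<dots> = complex_of_real c \<odot> lin x a"
    unfolding lin_def by (rule finsum_smult_ldistr[symmetric]) (use x in auto)
  finally show ?thesis .
qed

lemma lin_zero [simp]: "lin x 0 = \<zero>"
  using lin_scale[of 0 0] by simp

lemma lin_diff: "lin x (a - b) = lin x a \<ominus> lin x b"
  using lin_add[of a "(-1) *\<^sub>R b"] lin_scale[of "-1" b] by (simp add: a_minus_def sm_minus_one)

lemma lin_unit [simp]: "lin x (unit_seq i) = x i"
proof -
  have "lin x (unit_seq i) = finsum X (\<lambda>j. complex_of_real (coord (unit_seq i) j) \<odot> x j) {i}"
    by (rule lin_superset) auto
  then show ?thesis using x by (simp add: sm_one)
qed

lemma lin_seminorm: "seminorm (\<lambda>a. nrm X (lin x a))"
  by unfold_locales (simp_all add: lin_add lin_scale nrm_triangle)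

lemma lin_mem_submodule:
  assumes W: "submodule W (scalars \<real>) X" and S: "\<And>i. i \<in> A \<Longrightarrow> x i \<in> W" and a: "a \<in> span (unit_seq ` A)"
  shows "lin x a \<in> W"
proof -
  interpret R: banach_space \<real> X by (rule banach_space_real)
  note sub = R.submoduleE[OF W]
  have "subspace {a. lin x a \<in> W}"
  proof (rule subspaceI)
    show "0 \<in> {a. lin x a \<in> W}"
    proof -
      obtain w where w: "w \<in> W" using sub(2) by blast
      then have "0 \<odot> w \<in> W" using sub(4)[of 0 w] by (simp add: scalars_def)
      then show ?thesis using w sub(1) by auto
    qed
    show "\<And>a b. a \<in> {a. lin x a \<in> W} \<Longrightarrow> b \<in> {a. lin x a \<in> W} \<Longrightarrow> a + b \<in> {a. lin x a \<in> W}"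
      using sub(5) by (simp add: lin_add)
    show "\<And>c a. a \<in> {a. lin x a \<in> W} \<Longrightarrow> c *\<^sub>R a \<in> {a. lin x a \<in> W}"
      using sub(4) by (simp add: lin_scale scalars_def)
  qed
  moreover have "unit_seq ` A \<subseteq> {a. lin x a \<in> W}" using S by auto
  ultimately have "span (unit_seq ` A) \<subseteq> {a. lin x a \<in> W}" by (rule span_minimal[rotated])
  then show ?thesis using a by blast
qed

lemma lin_span_finite: "lin_span \<real> X (x ` A) = lin x ` span (unit_seq ` A)"
proof
  interpret R: banach_space \<real> X by (rule banach_space_real)
  let ?W = "lin x ` span (unit_seq ` A)"
  have "submodule ?W (scalars \<real>) X"
  proof (rule R.submoduleI)
    show "?W \<subseteq> carrier X" by auto
    show "\<zero> \<in> ?W" using lin_zero span_zero by (metis image_eqI)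
    show "\<ominus> w \<in> ?W" if w: "w \<in> ?W" for w
    proof -
      obtain a where a: "w = lin x a" "a \<in> span (unit_seq ` A)" using w by auto
      then have "\<ominus> w = lin x ((-1) *\<^sub>R a)" by (simp add: sm_minus_one lin_scale[of "-1", simplified])
      then show ?thesis using span_scale[OF a(2)] by blast
    qed
    show "v \<oplus> w \<in> ?W" if vw: "v \<in> ?W" "w \<in> ?W" for v w
    proof -
      obtain a b where "v = lin x a" "a \<in> span (unit_seq ` A)" "w = lin x b" "b \<in> span (unit_seq ` A)"
        using vw by auto
      then show ?thesis using span_add[of a "unit_seq ` A" b] lin_add[of a b] by (metis image_eqI)
    qed
    show "c \<odot> w \<in> ?W" if cw: "c \<in> carrier (scalars \<real>)" "w \<in> ?W" for c w
    proof -
      obtain a where a: "w = lin x a" "a \<in> span (unit_seq ` A)" using cw by auto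
      obtain r where "c = complex_of_real r" using cw by (auto simp: scalars_def Reals_def)
      then have "c \<odot> w = lin x (r *\<^sub>R a)" using a by (simp add: lin_scale)
      then show ?thesis using span_scale[OF a(2)] by blast
    qed
  qed
  moreover have "x ` A \<subseteq> ?W"
  proof
    fix y assume "y \<in> x ` A"
    then obtain i where i: "i \<in> A" "y = x i" by blast
    then have "y = lin x (unit_seq i)" "unit_seq i \<in> span (unit_seq ` A)" by (auto intro: span_base)
    then show "y \<in> ?W" by blast
  qed
  ultimately show "lin_span \<real> X (x ` A) \<subseteq> ?W" unfolding lin_span_def by blast
  show "?W \<subseteq> lin_span \<real> X (x ` A)"
    unfolding lin_span_def using lin_mem_submodule[of _ A] by fastforce
qed

end

end

text \<open>Finite-dimensional subspaces are closed. In the induction, either \<open>b\<close> can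
  be approximated from the earlier span, and then agrees with one of its elements up to seminorm 0,
  or it has positive distance from that span, which makes its coefficients in the approximants a
  Cauchy sequence.\<close>

lemma (in seminorm) finite_span_closed:
  assumes "finite S" and "\<And>\<epsilon>. \<epsilon> > 0 \<Longrightarrow> \<exists>f\<in>span S. p (y - f) < \<epsilon>"
  shows "\<exists>f\<in>span S. p (y - f) = 0"
  using assms
proof (induction S arbitrary: y)
  case empty
  have "p y = 0"
  proof (rule ccontr)
    assume "p y \<noteq> 0"
    then have "p y > 0" using p_nonneg[of y] by linarith
    then show False using empty(1)[of "p y"] by simp
  qed
  then show ?case by simp
next
  case (insert b S)
  show ?case
  proof (cases "\<forall>\<epsilon>>0. \<exists>f\<in>span S. p (b - f) < \<epsilon>")
    case True
    then obtain f0 where f0: "f0 \<in> span S" "p (b - f0) = 0" using insert.IH[of b] by blast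
    have "\<exists>f\<in>span S. p (y - f) < \<epsilon>" if "\<epsilon> > 0" for \<epsilon>
    proof -
      obtain f where f: "f \<in> span (insert b S)" "p (y - f) < \<epsilon>" using insert.prems \<open>\<epsilon> > 0\<close> by blast
      then obtain t where t: "f - t *\<^sub>R b \<in> span S" using span_breakdown_eq by blast
      have "(f - t *\<^sub>R b) + t *\<^sub>R f0 \<in> span S" using t f0 by (intro span_add span_scale)
      moreover have "p (y - ((f - t *\<^sub>R b) + t *\<^sub>R f0)) \<le> p (y - f) + p (t *\<^sub>R (b - f0))"
        using triangle[of "y - f" "t *\<^sub>R (b - f0)"] by (simp add: algebra_simps)
      ultimately show ?thesis using f f0 by (intro bexI) (auto simp: scale)
    qed
    then obtain f where "f \<in> span S" "p (y - f) = 0" using insert.IH[of y] by blast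
    then show ?thesis using span_mono[of S "insert b S"] by blast
  next
    case False
    then obtain \<delta> where \<delta>: "\<delta> > 0" "\<And>f. f \<in> span S \<Longrightarrow> \<delta> \<le> p (b - f)" by (auto simp: not_less)
    have "\<exists>w t. w \<in> span S \<and> p (y - (w + t *\<^sub>R b)) < 1 / Suc k" for k
    proof -
      obtain f where f: "f \<in> span (insert b S)" "p (y - f) < 1 / Suc k" using insert.prems[of "1 / Suc k"] by auto
      then obtain t where "f - t *\<^sub>R b \<in> span S" using span_breakdown_eq by blast
      then show ?thesis using f by (intro exI[of _ "f - t *\<^sub>R b"] exI[of _ t]) simp
    qed
    then obtain w t where w: "\<And>k. w k \<in> span S" and wt: "\<And>k. p (y - (w k + t k *\<^sub>R b)) < 1 / Suc k" by metis
    have tb: "\<bar>t k - t l\<bar> * \<delta> \<le> 1 / Suc k + 1 / Suc l" for k l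
    proof (cases "t k = t l")
      case False
      have "(1 / (t k - t l)) *\<^sub>R (w l - w k) \<in> span S" using w by (intro span_scale span_diff)
      then have "\<delta> \<le> p (b - (1 / (t k - t l)) *\<^sub>R (w l - w k))" by (rule \<delta>(2))
      then have "\<bar>t k - t l\<bar> * \<delta> \<le> \<bar>t k - t l\<bar> * p (b - (1 / (t k - t l)) *\<^sub>R (w l - w k))" by (rule mult_left_mono) simp
      also have "\<dots> = p ((t k - t l) *\<^sub>R (b - (1 / (t k - t l)) *\<^sub>R (w l - w k)))" by (simp add: scale)
      also have "(t k - t l) *\<^sub>R (b - (1 / (t k - t l)) *\<^sub>R (w l - w k))
          = (y - (w l + t l *\<^sub>R b)) + - (y - (w k + t k *\<^sub>R b))"
        using False by (simp add: scaleR_diff_right scaleR_diff_left)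
      also have "p \<dots> \<le> p (y - (w l + t l *\<^sub>R b)) + p (y - (w k + t k *\<^sub>R b))"
        using triangle[of "y - (w l + t l *\<^sub>R b)" "- (y - (w k + t k *\<^sub>R b))"] by (simp only: p_minus)
      finally show ?thesis using wt[of k] wt[of l] by linarith
    qed simp
    have "Cauchy t"
      unfolding Cauchy_def
    proof (intro allI impI)
      fix e :: real assume e: "e > 0"
      obtain n where n: "1 / Suc n < e * \<delta> / 2" using \<delta> e nat_approx_posE[of "e * \<delta> / 2"] by auto
      have "dist (t k) (t l) < e" if "n \<le> k" "n \<le> l" for k l
      proof -
        have "1 / Suc k \<le> 1 / Suc n" "1 / Suc l \<le> 1 / Suc n" using that by (auto intro!: divide_left_mono)
        then have "\<bar>t k - t l\<bar> * \<delta> < e * \<delta>" using tb[of k l] n by linarith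
        then show ?thesis using \<delta> by (simp add: dist_real_def)
      qed
      then show "\<exists>M. \<forall>m\<ge>M. \<forall>n\<ge>M. dist (t m) (t n) < e" by blast
    qed
    then obtain t0 where t0: "t \<longlonglongrightarrow> t0" using Cauchy_convergent convergent_def by blast
    have "\<exists>f\<in>span S. p ((y - t0 *\<^sub>R b) - f) < \<epsilon>" if "\<epsilon> > 0" for \<epsilon>
    proof -
      have "(\<lambda>k. 1 / Suc k + \<bar>t k - t0\<bar> * p b) \<longlonglongrightarrow> 0 + \<bar>t0 - t0\<bar> * p b"
        by (intro tendsto_intros t0 LIMSEQ_Suc[OF lim_1_over_n])
      then have "eventually (\<lambda>k. 1 / Suc k + \<bar>t k - t0\<bar> * p b < \<epsilon>) sequentially"
        using that by (intro order_tendstoD(2)) auto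
      then obtain k where k: "1 / Suc k + \<bar>t k - t0\<bar> * p b < \<epsilon>" by (auto simp: eventually_sequentially)
      have "(y - t0 *\<^sub>R b) - w k = (y - (w k + t k *\<^sub>R b)) + (t k - t0) *\<^sub>R b" by (simp add: scaleR_diff_left)
      then have "p ((y - t0 *\<^sub>R b) - w k) \<le> p (y - (w k + t k *\<^sub>R b)) + \<bar>t k - t0\<bar> * p b"
        using triangle[of "y - (w k + t k *\<^sub>R b)" "(t k - t0) *\<^sub>R b"] by (simp only: scale)
      then show ?thesis using wt[of k] k w by (intro bexI[of _ "w k"]) auto
    qed
    then obtain f where f: "f \<in> span S" "p ((y - t0 *\<^sub>R b) - f) = 0" using insert.IH[of "y - t0 *\<^sub>R b"] by blast
    have "f + t0 *\<^sub>R b \<in> span (insert b S)"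
      using subsetD[OF span_mono[OF subset_insertI] f(1)] by (intro span_add span_scale[OF span_base]) auto
    moreover have "y - (f + t0 *\<^sub>R b) = (y - t0 *\<^sub>R b) - f" by simp
    ultimately show ?thesis using f(2) by metis
  qed
qed

context banach_space
begin

lemma finite_lin_span_closed:
  assumes S: "finite S" "S \<subseteq> carrier X" and y: "y \<in> carrier X"
    and near: "\<And>\<epsilon>. \<epsilon> > 0 \<Longrightarrow> \<exists>w\<in>lin_span \<real> X S. nrm X (y \<ominus> w) < \<epsilon>"
  shows "y \<in> lin_span \<real> X S"
proof -
  obtain h where h: "bij_betw h {0..<card S} S" using ex_bij_betw_nat_finite[OF S(1)] by blast
  \<comment> \<open>The vector \<open>y\<close> gets index 0 and the elements of \<open>S\<close>
    the indices from 1 on, so the span of \<open>S\<close> comes from the unit sequences with index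
    in \<open>A\<close>.\<close>
  define x where "x i = (if i = 0 then y else if i - 1 < card S then h (i - 1) else \<zero>)" for i
  define A where "A = {1..card S}"
  have xA: "x ` A = S"
  proof -
    have "x ` A = h ` (\<lambda>i. i - 1) ` A" by (auto simp: x_def A_def image_image intro!: image_cong)
    also have "(\<lambda>i. i - 1) ` A = {0..<card S}"
      by (auto simp: A_def image_iff intro!: bexI[of _ "Suc _"])
    finally show ?thesis using h by (simp add: bij_betw_def)
  qed
  have xc: "x i \<in> carrier X" for i
  proof (cases "i \<in> A")
    case True
    then show ?thesis using xA S by blast
  qed (use y in \<open>auto simp: x_def A_def\<close>)
  interpret seminorm "\<lambda>a. nrm X (lin x a)" by (rule lin_seminorm[OF xc])
  have y0: "lin x (unit_seq 0) = y" using lin_unit[of x 0, OF xc] by (simp add: x_def)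
  have "\<exists>f\<in>span (unit_seq ` A). nrm X (lin x (unit_seq 0 - f)) = 0"
  proof (rule finite_span_closed)
    fix \<epsilon> :: real assume "\<epsilon> > 0"
    then obtain w where "w \<in> lin_span \<real> X (x ` A)" "nrm X (y \<ominus> w) < \<epsilon>" using near xA by metis
    then show "\<exists>f\<in>span (unit_seq ` A). nrm X (lin x (unit_seq 0 - f)) < \<epsilon>"
      unfolding lin_span_finite[OF xc] by (auto simp: lin_diff[OF xc] y0)
  qed (simp add: A_def)
  then obtain f where f: "f \<in> span (unit_seq ` A)" "nrm X (lin x (unit_seq 0 - f)) = 0" by blast
  then have "y = lin x f"
    using xc y by (simp add: lin_diff[OF xc] y0 nrm_eq_0_iff diff_eq_zero_iff lin_closed)
  then show ?thesis using f(1) lin_span_finite[of x A, OF xc] xA by auto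
qed

lemma lin_span_carrier: "S \<subseteq> carrier X \<Longrightarrow> lin_span \<real> X S \<subseteq> carrier X"
proof -
  interpret R: banach_space \<real> X by (rule banach_space_real)
  show "S \<subseteq> carrier X \<Longrightarrow> ?thesis" unfolding lin_span_def using R.carrier_is_submodule by blast
qed

lemma lin_span_closed_ops:
  assumes S: "S \<subseteq> carrier X"
  shows "s \<in> S \<Longrightarrow> s \<in> lin_span \<real> X S" "v \<in> lin_span \<real> X S \<Longrightarrow> w \<in> lin_span \<real> X S \<Longrightarrow> v \<oplus> w \<in> lin_span \<real> X S"
    "w \<in> lin_span \<real> X S \<Longrightarrow> complex_of_real r \<odot> w \<in> lin_span \<real> X S" "\<zero> \<in> lin_span \<real> X S"
proof -
  interpret R: banach_space \<real> X by (rule banach_space_real)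
  show "s \<in> S \<Longrightarrow> s \<in> lin_span \<real> X S" by (auto simp: lin_span_def)
  show "v \<in> lin_span \<real> X S \<Longrightarrow> w \<in> lin_span \<real> X S \<Longrightarrow> v \<oplus> w \<in> lin_span \<real> X S"
    using R.submoduleE(5) by (auto simp: lin_span_def)
  show "w \<in> lin_span \<real> X S \<Longrightarrow> complex_of_real r \<odot> w \<in> lin_span \<real> X S"
    using R.submoduleE(4) by (auto simp: lin_span_def)
  have "\<zero> \<in> W" if W: "submodule W (scalars \<real>) X" for W
  proof -
    obtain w where w: "w \<in> W" using R.submoduleE(2)[OF W] by blast
    then show ?thesis using R.submoduleE(4)[OF W, of 0 w] R.submoduleE(1)[OF W] by auto
  qed
  then show "\<zero> \<in> lin_span \<real> X S" by (auto simp: lin_span_def)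
qed

text \<open>Riesz's lemma. The distance of \<open>y\<close> from the span is positive, because the
  span is closed; the vector \<open>y - w0\<close> is normalized for some \<open>w0\<close> in the
  span less than twice as far from \<open>y\<close> as this distance.\<close>

lemma riesz:
  assumes inf: "infinite_dimensional \<real> X (carrier X)" and S: "finite S" "S \<subseteq> carrier X"
  shows "\<exists>v\<in>carrier X. nrm X v \<le> 1 \<and> (\<forall>s\<in>S. 1 / 2 \<le> nrm X (v \<ominus> s))"
proof -
  let ?W = "lin_span \<real> X S"
  have Wc: "?W \<subseteq> carrier X" by (rule lin_span_carrier[OF S(2)])
  obtain y where y: "y \<in> carrier X" "y \<notin> ?W" using inf S unfolding infinite_dimensional_def by blast
  have "\<not> (\<forall>\<epsilon>>0. \<exists>w\<in>?W. nrm X (y \<ominus> w) < \<epsilon>)" using finite_lin_span_closed[OF S y(1)] y(2) by blast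
  then obtain \<epsilon> where \<epsilon>: "\<epsilon> > 0" "\<And>w. w \<in> ?W \<Longrightarrow> \<epsilon> \<le> nrm X (y \<ominus> w)"
    by (auto simp: not_less)
  define \<delta> where "\<delta> = (INF w\<in>?W. nrm X (y \<ominus> w))"
  have bdd: "bdd_below ((\<lambda>w. nrm X (y \<ominus> w)) ` ?W)" by (rule bdd_belowI[of _ \<epsilon>]) (use \<epsilon> in auto)
  have ne: "?W \<noteq> {}" using lin_span_closed_ops(4)[OF S(2)] by blast
  have \<delta>: "\<delta> \<ge> \<epsilon>" unfolding \<delta>_def by (rule cINF_greatest[OF ne]) (use \<epsilon> in auto)
  have \<delta>w: "\<delta> \<le> nrm X (y \<ominus> w)" if "w \<in> ?W" for w unfolding \<delta>_def by (rule cINF_lower[OF bdd that])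
  have "Inf ((\<lambda>w. nrm X (y \<ominus> w)) ` ?W) < 2 * \<delta>" using \<delta> \<epsilon>(1) by (simp add: \<delta>_def[symmetric])
  then obtain w0 where w0: "w0 \<in> ?W" "nrm X (y \<ominus> w0) < 2 * \<delta>"
    using cInf_less_iff[OF _ bdd] ne by auto
  define r where "r = nrm X (y \<ominus> w0)"
  have r: "r > 0" "r < 2 * \<delta>" using \<delta>w[OF w0(1)] \<delta> \<epsilon>(1) w0(2) by (auto simp: r_def)
  have w0c: "w0 \<in> carrier X" using w0 Wc by blast
  define v where "v = complex_of_real (1 / r) \<odot> (y \<ominus> w0)"
  have "nrm X v = \<bar>1 / r\<bar> * r" unfolding v_def r_def[symmetric]
    using nrm_sm_real[of "y \<ominus> w0" "1 / r"] y w0c by (simp add: r_def)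
  then have "nrm X v = 1" using r by simp
  moreover have "v \<in> carrier X" unfolding v_def by (rule sm_closed[OF real_in_K]) (use y w0c in simp)
  moreover have "1 / 2 \<le> nrm X (v \<ominus> s)" if s: "s \<in> S" for s
  proof -
    have sc: "s \<in> carrier X" using s S by blast
    have m: "w0 \<oplus> complex_of_real r \<odot> s \<in> ?W" using lin_span_closed_ops[OF S(2)] s w0 by blast
    have "complex_of_real (1 / r) \<odot> (y \<ominus> (w0 \<oplus> complex_of_real r \<odot> s)) = v \<ominus> s"
    proof -
      have "y \<ominus> (w0 \<oplus> complex_of_real r \<odot> s) = (y \<ominus> w0) \<ominus> complex_of_real r \<odot> s"
        using y w0c sc by (simp add: a_minus_def M.minus_add M.a_assoc)
      moreover have "complex_of_real (1 / r) \<odot> (complex_of_real r \<odot> s) = s"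
        using sm_assoc[OF real_in_K real_in_K sc, of "1 / r" r] r sc by (simp add: sm_one)
      ultimately show ?thesis
        unfolding v_def using y w0c sc sm_diff_right[OF real_in_K, of "y \<ominus> w0" "complex_of_real r \<odot> s" "1 / r"] by simp
    qed
    then have "nrm X (v \<ominus> s) = \<bar>1 / r\<bar> * nrm X (y \<ominus> (w0 \<oplus> complex_of_real r \<odot> s))"
      using nrm_sm_real[of "y \<ominus> (w0 \<oplus> complex_of_real r \<odot> s)" "1 / r"] m Wc y by (metis diff_closed subsetD)
    also have "\<dots> \<ge> \<bar>1 / r\<bar> * \<delta>" using \<delta>w[OF m] by (rule mult_left_mono) simp
    also have "\<bar>1 / r\<bar> * \<delta> \<ge> 1 / 2" using r by (simp add: field_simps)
    finally show ?thesis .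
  qed
  ultimately show ?thesis by (intro bexI[of _ v]) auto
qed

lemma separated_sequence:
  assumes inf: "infinite_dimensional \<real> X (carrier X)"
  obtains v :: "nat \<Rightarrow> 'x" where "\<And>i. v i \<in> carrier X" "\<And>i. nrm X (v i) \<le> 1" "\<And>i j. i \<noteq> j \<Longrightarrow> 1 / 2 \<le> nrm X (v i \<ominus> v j)"
proof -
  define pick where "pick S = (SOME v. v \<in> carrier X \<and> nrm X v \<le> 1 \<and> (\<forall>s\<in>S. 1 / 2 \<le> nrm X (v \<ominus> s)))" for S
  have pick: "pick S \<in> carrier X \<and> nrm X (pick S) \<le> 1 \<and> (\<forall>s\<in>S. 1 / 2 \<le> nrm X (pick S \<ominus> s))"
    if "finite S" "S \<subseteq> carrier X" for S
    unfolding pick_def by (rule someI_ex) (use riesz[OF inf that] in auto)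
  define G where "G = rec_nat {} (\<lambda>_ S. insert (pick S) S)"
  have G: "G 0 = {}" "G (Suc n) = insert (pick (G n)) (G n)" for n :: nat by (simp_all add: G_def)
  have fin: "finite (G n) \<and> G n \<subseteq> carrier X" for n
    by (induction n) (auto simp: G dest: pick)
  define v where "v n = pick (G n)" for n :: nat
  have mono: "v i \<in> G j" if "i < j" for i j
    using that by (induction j) (auto simp: G v_def less_Suc_eq)
  have sep: "1 / 2 \<le> nrm X (v j \<ominus> v i)" if "i < j" for i j
    using mono[OF that] pick[of "G j"] fin[of j] by (auto simp: v_def)
  have vc: "v i \<in> carrier X" for i using pick[of "G i"] fin[of i] by (simp add: v_def)
  show thesis
  proof (rule that[of v])
    show "1 / 2 \<le> nrm X (v i \<ominus> v j)" if "i \<noteq> j" for i j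
      using that sep[of i j] sep[of j i] nrm_diff_commute[OF vc vc, of i j] by (cases i j rule: linorder_cases) auto
  qed (use vc pick fin in \<open>auto simp: v_def\<close>)
qed

text \<open>The radial retraction onto the unit ball. Formulas have to be evaluated in the ball,
  whereas the linear maps into the space leave it.\<close>

definition clip :: "'x \<Rightarrow> 'x" where
  "clip z = complex_of_real (1 / max 1 (nrm X z)) \<odot> z"

lemma clip_ball: "z \<in> carrier X \<Longrightarrow> clip z \<in> unit_ball X"
proof -
  assume z: "z \<in> carrier X"
  have "nrm X (clip z) = \<bar>1 / max 1 (nrm X z)\<bar> * nrm X z" unfolding clip_def by (rule nrm_sm_real[OF z])
  then show ?thesis using z sm_closed[OF real_in_K z] by (simp add: unit_ball_def clip_def del: of_real_divide)
qed

lemma nrm_clip: "z \<in> carrier X \<Longrightarrow> nrm X (clip z) = min 1 (nrm X z)"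
proof -
  assume z: "z \<in> carrier X"
  have "nrm X (clip z) = \<bar>1 / max 1 (nrm X z)\<bar> * nrm X z" unfolding clip_def by (rule nrm_sm_real[OF z])
  then show ?thesis by (auto simp: max_def min_def)
qed

text \<open>One half of the factor 2 comes from scaling the difference of the vectors, the other
  from the difference of the scaling factors.\<close>

lemma clip_diff:
  assumes z: "z \<in> carrier X" and w: "w \<in> carrier X"
  shows "nrm X (clip z \<ominus> clip w) \<le> 2 * nrm X (z \<ominus> w)"
proof -
  define a b where "a = 1 / max 1 (nrm X z)" and "b = 1 / max 1 (nrm X w)"
  have ca: "complex_of_real a \<odot> u \<in> carrier X" "complex_of_real b \<odot> u \<in> carrier X" if "u \<in> carrier X" for u
    using sm_closed[OF real_in_K that] by auto
  have c: "clip z = complex_of_real a \<odot> z" "clip w = complex_of_real b \<odot> w" by (simp_all only: clip_def a_def b_def)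
  have "nrm X (clip z \<ominus> clip w) \<le> nrm X (complex_of_real a \<odot> z \<ominus> complex_of_real a \<odot> w) + nrm X (complex_of_real a \<odot> w \<ominus> complex_of_real b \<odot> w)"
    unfolding c by (rule nrm_diff_triangle) (use ca z w in auto)
  also have "complex_of_real a \<odot> z \<ominus> complex_of_real a \<odot> w = complex_of_real a \<odot> (z \<ominus> w)"
    by (rule sm_diff_right[OF real_in_K z w, symmetric])
  also have "complex_of_real a \<odot> w \<ominus> complex_of_real b \<odot> w = complex_of_real (a - b) \<odot> w"
    using sm_diff_left[OF real_in_K real_in_K w, of a b] by simp
  also have "nrm X (complex_of_real a \<odot> (z \<ominus> w)) = \<bar>a\<bar> * nrm X (z \<ominus> w)" by (rule nrm_sm_real) (use z w in simp)
  also have "nrm X (complex_of_real (a - b) \<odot> w) = \<bar>a - b\<bar> * nrm X w" by (rule nrm_sm_real[OF w])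
  also have "\<bar>a\<bar> * nrm X (z \<ominus> w) \<le> 1 * nrm X (z \<ominus> w)"
    by (rule mult_right_mono) (use z w in \<open>auto simp: a_def nrm_nonneg\<close>)
  also have "\<bar>a - b\<bar> * nrm X w \<le> nrm X (z \<ominus> w)"
  proof -
    define m k where "m = max 1 (nrm X z)" and "k = max 1 (nrm X w)"
    have mk: "m \<ge> 1" "k \<ge> 1" "nrm X w \<le> k" "\<bar>k - m\<bar> \<le> \<bar>nrm X z - nrm X w\<bar>" by (auto simp: m_def k_def)
    have "a - b = (k - m) / (m * k)" using mk by (simp add: a_def b_def m_def[symmetric] k_def[symmetric] diff_frac_eq)
    then have "\<bar>a - b\<bar> * nrm X w = \<bar>k - m\<bar> * (nrm X w / (m * k))" using mk by (simp add: abs_mult)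
    also have "\<dots> \<le> \<bar>k - m\<bar> * 1"
    proof (rule mult_left_mono)
      have "nrm X w \<le> m * k" using mk mult_right_mono[of 1 m k] by linarith
      then show "nrm X w / (m * k) \<le> 1" using mk by (simp add: pos_divide_le_eq)
    qed simp
    also have "\<dots> \<le> nrm X (z \<ominus> w)" using mk(4) abs_nrm_diff_le[OF z w] by simp
    finally show ?thesis .
  qed
  finally show ?thesis by simp
qed

end

section \<open>Invariant embeddings\<close>

definition pad :: "fseq list \<Rightarrow> nat \<Rightarrow> fseq" where
  "pad xs t = (if t < length xs then xs ! t else 0)"

text \<open>The requirements on the embedding are indexed by formulas, the only large type available.\<close>

definition vector_code :: "fseq \<Rightarrow> ('g, 'q) fm" where
  "vector_code x = FConn (\<lambda>s. if s = coord x then 1 else 0) []"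

text \<open>The codes are labels and are never evaluated. A vector is recorded by the indicator
  function of its coordinate sequence, which is not a continuous connective, and a list of vectors
  by a list of subformulas.\<close>

definition requirement_code :: "('g, 'q) fm \<times> fseq list \<times> fseq \<Rightarrow> ('g, 'q) fm" where
  "requirement_code = (\<lambda>(\<phi>, xs, w). FConn (\<lambda>_. 0) [\<phi>, FConn (\<lambda>_. 0) (map vector_code xs), vector_code w])"

lemma vector_code_inject: "vector_code x = vector_code y \<Longrightarrow> x = y"
proof -
  assume "(vector_code x :: ('g, 'q) fm) = vector_code y"
  then have "(\<lambda>s. if s = coord x then 1 else (0 :: real)) = (\<lambda>s. if s = coord y then 1 else 0)"
    by (simp add: vector_code_def)
  from fun_cong[OF this, of "coord x"] show "x = y" by (simp add: coord_inject split: if_splits)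
qed

lemma requirement_code_inj: "inj (requirement_code :: ('g, 'q) fm \<times> fseq list \<times> fseq \<Rightarrow> ('g, 'q) fm)"
proof (rule injI)
  fix r s :: "('g, 'q) fm \<times> fseq list \<times> fseq"
  obtain \<phi> xs w \<psi> ys z where rs: "r = (\<phi>, xs, w)" "s = (\<psi>, ys, z)" by (metis prod_cases3)
  assume "requirement_code r = requirement_code s"
  then have eq: "\<phi> = \<psi>" "map vector_code xs = (map vector_code ys :: ('g, 'q) fm list)"
    "(vector_code w :: ('g, 'q) fm) = vector_code z"
    by (simp_all add: rs requirement_code_def)
  moreover have "inj (vector_code :: fseq \<Rightarrow> ('g, 'q) fm)" using vector_code_inject by (rule injI)
  ultimately show "r = s" using vector_code_inject by (auto simp: rs dest: map_injective)
qed

text \<open>The families of finite sets containing a given formula have the finite intersection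
  property. The cardinalities tend to infinity because every language has infinitely many
  formulas.\<close>

lemma ultrafilter_finite_sets:
  "\<exists>F :: ('g, 'q) fm set filter. ultra F \<and> (\<forall>c. eventually (\<lambda>i. finite i \<and> c \<in> i) F) \<and>
     (\<forall>n. eventually (\<lambda>i. n \<le> card i) F)"
proof -
  define S :: "('g, 'q) fm \<Rightarrow> ('g, 'q) fm set set" where "S c = {i. finite i \<and> c \<in> i}" for c
  have "\<exists>F. ultra F \<and> (\<forall>A\<in>range S. eventually (\<lambda>i. i \<in> A) F)"
  proof (rule ultra_exists)
    fix X assume "finite X" "X \<subseteq> range S"
    then obtain C where C: "finite C" "X = S ` C" by (meson finite_subset_image)
    then have "C \<in> \<Inter> X" by (auto simp: S_def)
    then show "\<Inter> X \<noteq> {}" by blast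
  qed
  then obtain F where F: "ultra F" "\<And>c. eventually (\<lambda>i. i \<in> S c) F" by blast
  have ev: "eventually (\<lambda>i. finite i \<and> c \<in> i) F" for c using F(2)[of c] by (simp add: S_def)
  have "eventually (\<lambda>i. n \<le> card i) F" for n
  proof -
    define C :: "('g, 'q) fm set" where "C = (\<lambda>k. FDist (Var k) (Var k)) ` {..<n}"
    have C: "finite C" "card C = n" by (auto simp: C_def card_image inj_on_def)
    have "eventually (\<lambda>i. \<forall>c\<in>C. finite i \<and> c \<in> i) F" using C ev by (simp add: eventually_ball_finite)
    then show ?thesis using ev[of undefined] by eventually_elim (use C card_mono in blast)
  qed
  then show ?thesis using F(1) ev by blast
qed

section \<open>Almost invariant maps into the model\<close>

locale separated_space =
  fixes K :: "complex set" and E :: "('f, 'p) language" and M :: "('a, 'f, 'p) banach_data" and v :: "nat \<Rightarrow> 'a"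
  assumes banach: "banach_structure K E M"
    and v_closed: "v i \<in> carrier M"
    and v_bound: "nrm M (v i) \<le> 1"
    and v_sep: "i \<noteq> j \<Longrightarrow> 1 / 2 \<le> nrm M (v i \<ominus>\<^bsub>M\<^esub> v j)"
begin

interpretation B: banach_space K M
  using banach by (rule banach_structure_imp_banach_space)

abbreviation "J \<equiv> B.lin v"

lemmas J_closed [simp] = B.lin_closed[of v, OF v_closed]
  and J_add = B.lin_add[of v, OF v_closed]
  and J_diff = B.lin_diff[of v, OF v_closed]
  and J_scale = B.lin_scale[of v, OF v_closed]
  and J_zero [simp] = B.lin_zero[of v, OF v_closed]
  and J_unit = B.lin_unit[of v, OF v_closed]

lemma seminorm_J: "seminorm (\<lambda>a. nrm M (J a))"
  by (rule B.lin_seminorm[of v, OF v_closed])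

definition fval :: "('f bfun, 'p bpred) fm \<Rightarrow> (nat \<Rightarrow> fseq) \<Rightarrow> real" where
  "fval \<phi> y = eval_fm (metric_structure M) (\<lambda>t. B.clip (J (y t))) \<phi>"

text \<open>The norm of \<open>M\<close> is pulled back to \<open>fseq\<close> along
  \<open>J\<close>, and the functions to be made almost invariant are the values of formulas at
  clipped images. Finitely many requirements involve finitely many variables, below
  \<open>n\<close>.\<close>

lemma requirements_map:
  fixes R :: "(('f bfun, 'p bpred) fm \<times> fseq list \<times> fseq) set"
  assumes R: "finite R" "\<And>\<phi> xs w. (\<phi>, xs, w) \<in> R \<Longrightarrow> wf_fm (banach_language K E) \<phi>" and \<epsilon>: "\<epsilon> > 0"
  shows "\<exists>U :: fseq \<Rightarrow> fseq. linear U \<and> \<bar>nrm M (J (U (unit_seq 0))) - 1\<bar> \<le> \<epsilon> \<and>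
    (\<forall>\<phi> xs w. (\<phi>, xs, w) \<in> R \<longrightarrow>
       \<bar>fval \<phi> (\<lambda>t. U (pad xs t)) - fval \<phi> (\<lambda>t. U (reflect w (pad xs t)))\<bar> \<le> \<epsilon>)"
proof -
  interpret BM: bounded_mstructure "banach_language K E" "metric_structure M" 2
    by (rule banach_bounded_mstructure[OF banach])
  interpret S: seminorm "\<lambda>a. nrm M (J a)" by (rule seminorm_J)
  have spread: "\<exists>N e. S.spread A N e" for A
  proof (rule S.spread_exists[of unit_seq])
    show "nrm M (J (unit_seq i)) \<le> 1" for i using v_bound by (simp add: J_unit)
    show "1 / 2 \<le> nrm M (J (unit_seq i - unit_seq j))" if "i \<noteq> j" for i j
      using v_sep[OF that] by (simp add: J_unit J_diff)
  qed
  define n where "n = Suc (Max (insert 0 (\<Union>r\<in>R. free_vars (fst r))))"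
  have n: "t < n" if "r \<in> R" "t \<in> free_vars (fst r)" for r t
  proof -
    have "finite (insert 0 (\<Union>r\<in>R. free_vars (fst r)))" using R(1) finite_free_vars by auto
    then show ?thesis unfolding n_def using that by (auto simp: less_Suc_eq_le intro!: Max_ge)
  qed
  have wf: "wf_fm (banach_language K E) (fst r)" if "r \<in> R" for r using R(2) that by (metis prod.collapse)
  have clip: "B.clip (J y) \<in> universe (metric_structure M)" for y by (simp add: B.clip_ball)
  have "\<exists>B. \<forall>r\<in>R. \<forall>y. \<bar>fval (fst r) y\<bar> \<le> B"
  proof -
    have "\<exists>B. \<forall>y. \<bar>fval (fst r) y\<bar> \<le> B" if r: "r \<in> R" for r
    proof -
      obtain B where "\<forall>e. (\<forall>v. e v \<in> universe (metric_structure M)) \<longrightarrow> \<bar>eval_fm (metric_structure M) e (fst r)\<bar> \<le> B"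
        using BM.eval_fm_bounded[OF wf[OF r]] by (elim exE) (rule that)
      then show ?thesis unfolding fval_def using clip by (intro exI[of _ B]) simp
    qed
    then obtain C where C: "\<And>r y. r \<in> R \<Longrightarrow> \<bar>fval (fst r) y\<bar> \<le> C r" by metis
    have "\<bar>fval (fst r) y\<bar> \<le> Max (C ` R)" if "r \<in> R" for r y
    proof -
      have "C r \<le> Max (C ` R)" using that R(1) by (intro Max_ge) auto
      then show ?thesis using C[OF that, of y] by linarith
    qed
    then show ?thesis by blast
  qed
  then obtain B where B: "\<And>r y. r \<in> R \<Longrightarrow> \<bar>fval (fst r) y\<bar> \<le> B" by blast
  have "\<exists>U. linear U \<and> \<bar>nrm M (J (U (unit_seq 0))) - 1\<bar> \<le> \<epsilon> \<and>
    (\<forall>r\<in>R. \<forall>w\<in>(snd \<circ> snd) ` R. \<bar>fval (fst r) (\<lambda>t. U (pad (fst (snd r)) t)) -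
        fval (fst r) (\<lambda>t. U (reflect w (pad (fst (snd r)) t)))\<bar> \<le> \<epsilon>)"
  proof (rule S.almost_invariant_map[where f = "\<lambda>r. fval (fst r)" and x = "\<lambda>r. pad (fst (snd r))" and n = n and B = B])
    show "\<exists>N e. S.spread A N e" for A by (rule spread)
    show "finite ((snd \<circ> snd) ` R)" "finite R" using R by auto
    show "\<bar>fval (fst r) y\<bar> \<le> B" if "r \<in> R" for r y by (rule B[OF that])
    show "0 < \<epsilon>" by (rule \<epsilon>)
    fix \<eta> :: real assume \<eta>: "\<eta> > 0"
    have "\<exists>\<delta>>0. \<forall>r\<in>R. \<forall>y y'. (\<forall>t<n. nrm M (J (y t - y' t)) \<le> \<delta>) \<longrightarrow> \<bar>fval (fst r) y - fval (fst r) y'\<bar> \<le> \<eta>"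
    proof (rule finite_common_delta[OF R(1)])
      fix r assume r: "r \<in> R"
      obtain \<delta> where \<delta>: "\<delta> > 0" and un: "\<forall>e e'. (\<forall>v. e v \<in> universe (metric_structure M)) \<longrightarrow> (\<forall>v. e' v \<in> universe (metric_structure M)) \<longrightarrow>
          (\<forall>v\<in>free_vars (fst r). distance (metric_structure M) (e v) (e' v) < \<delta>) \<longrightarrow>
          \<bar>eval_fm (metric_structure M) e (fst r) - eval_fm (metric_structure M) e' (fst r)\<bar> \<le> \<eta>"
        using BM.eval_fm_uniform[OF wf[OF r] \<eta>] by (elim exE conjE) (rule that)
      \<comment> \<open>Clipping at most doubles distances; a third of \<open>\<delta>\<close>
        therefore leaves the strict inequality that the modulus asks for.\<close>
      have "\<bar>fval (fst r) y - fval (fst r) y'\<bar> \<le> \<eta>" if y: "\<forall>t<n. nrm M (J (y t - y' t)) \<le> \<delta> / 3" for y y'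
        unfolding fval_def
      proof (rule un[rule_format])
        fix t assume t: "t \<in> free_vars (fst r)"
        have "nrm M (B.clip (J (y t)) \<ominus>\<^bsub>M\<^esub> B.clip (J (y' t))) \<le> 2 * (\<delta> / 3)"
          using B.clip_diff[of "J (y t)" "J (y' t)"] y n[OF r t] by (fastforce simp: J_diff)
        then show "distance (metric_structure M) (B.clip (J (y t))) (B.clip (J (y' t))) < \<delta>"
          using \<delta> B.clip_ball by (simp add: B.ndist_eq B.unit_ball_carrier(1))
      qed (rule clip)+
      then show "\<exists>\<delta>>0. \<forall>y y'. (\<forall>t<n. nrm M (J (y t - y' t)) \<le> \<delta>) \<longrightarrow> \<bar>fval (fst r) y - fval (fst r) y'\<bar> \<le> \<eta>"
        using \<delta> by (intro exI[of _ "\<delta> / 3"]) auto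
    next
      fix r and \<delta> \<delta>' :: real
      assume "\<forall>y y'. (\<forall>t<n. nrm M (J (y t - y' t)) \<le> \<delta>) \<longrightarrow> \<bar>fval (fst r) y - fval (fst r) y'\<bar> \<le> \<eta>" "\<delta>' \<le> \<delta>"
      then show "\<forall>y y'. (\<forall>t<n. nrm M (J (y t - y' t)) \<le> \<delta>') \<longrightarrow> \<bar>fval (fst r) y - fval (fst r) y'\<bar> \<le> \<eta>"
        by (meson order_trans)
    qed
    then show "\<exists>\<delta>>0. \<forall>r\<in>R. \<forall>y y'. (\<forall>t<n. nrm M (J (y t - y' t)) \<le> \<delta>) \<longrightarrow> \<bar>fval (fst r) y - fval (fst r) y'\<bar> \<le> \<eta>" .
  qed
  then obtain U where U: "linear U" "\<bar>nrm M (J (U (unit_seq 0))) - 1\<bar> \<le> \<epsilon>"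
    "\<forall>r\<in>R. \<forall>w\<in>(snd \<circ> snd) ` R. \<bar>fval (fst r) (\<lambda>t. U (pad (fst (snd r)) t)) -
        fval (fst r) (\<lambda>t. U (reflect w (pad (fst (snd r)) t)))\<bar> \<le> \<epsilon>"
    by (elim exE conjE) (rule that)
  have "\<bar>fval \<phi> (\<lambda>t. U (pad xs t)) - fval \<phi> (\<lambda>t. U (reflect w (pad xs t)))\<bar> \<le> \<epsilon>" if r: "(\<phi>, xs, w) \<in> R" for \<phi> xs w
  proof -
    have "w \<in> (snd \<circ> snd) ` R" using r by force
    then show ?thesis using U(3)[rule_format, OF r, of w] by simp
  qed
  then show ?thesis using U(1,2) by (intro exI[of _ U]) simp
qed

text \<open>At the index \<open>i\<close>, the finitely many requirements coded in \<open>i\<close>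
  are met up to \<open>1 / Suc (card i)\<close>. Each requirement is coded eventually and the error
  tends to 0, so that all of them hold in the limit.\<close>

lemma limit_maps:
  "\<exists>(F :: ('f bfun, 'p bpred) fm set filter) (U :: ('f bfun, 'p bpred) fm set \<Rightarrow> fseq \<Rightarrow> fseq).
     ultrapower F K E M card \<and> (\<forall>i. linear (U i)) \<and> ((\<lambda>i. nrm M (J (U i (unit_seq 0)))) \<longlongrightarrow> 1) F \<and>
     (\<forall>\<phi> xs w. wf_fm (banach_language K E) \<phi> \<longrightarrow>
        ((\<lambda>i. fval \<phi> (\<lambda>t. U i (pad xs t)) - fval \<phi> (\<lambda>t. U i (reflect w (pad xs t)))) \<longlongrightarrow> 0) F)"
proof -
  obtain F :: "('f bfun, 'p bpred) fm set filter" where F: "ultra F"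
    and mem: "\<And>c. eventually (\<lambda>i. finite i \<and> c \<in> i) F" and rank: "\<And>n. eventually (\<lambda>i. n \<le> card i) F"
    using ultrafilter_finite_sets by blast
  have up: "ultrapower F K E M card"
    using F banach rank by (intro ultrapower.intro ultrapower_axioms.intro)
  define R where "R i = {r. finite i \<and> requirement_code r \<in> i \<and> wf_fm (banach_language K E) (fst r)}"
    for i :: "('f bfun, 'p bpred) fm set"
  have fin: "finite (R i)" for i
  proof (cases "finite i")
    case True
    then have "finite (requirement_code -` i)" using requirement_code_inj by (rule finite_vimageI)
    then show ?thesis by (rule rev_finite_subset) (auto simp: R_def)
  qed (simp add: R_def)
  define \<epsilon> where "\<epsilon> i = 1 / real (Suc (card i))" for i :: "('f bfun, 'p bpred) fm set"
  have "\<exists>U. linear U \<and> \<bar>nrm M (J (U (unit_seq 0))) - 1\<bar> \<le> \<epsilon> i \<and>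
    (\<forall>\<phi> xs w. (\<phi>, xs, w) \<in> R i \<longrightarrow>
       \<bar>fval \<phi> (\<lambda>t. U (pad xs t)) - fval \<phi> (\<lambda>t. U (reflect w (pad xs t)))\<bar> \<le> \<epsilon> i)" for i
    by (rule requirements_map[OF fin]) (auto simp: R_def \<epsilon>_def)
  then obtain U where U: "\<And>i. linear (U i)" "\<And>i. \<bar>nrm M (J (U i (unit_seq 0))) - 1\<bar> \<le> \<epsilon> i"
    "\<And>i \<phi> xs w. (\<phi>, xs, w) \<in> R i \<Longrightarrow>
       \<bar>fval \<phi> (\<lambda>t. U i (pad xs t)) - fval \<phi> (\<lambda>t. U i (reflect w (pad xs t)))\<bar> \<le> \<epsilon> i" by metis
  have \<epsilon>0: "(\<epsilon> \<longlongrightarrow> 0) F"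
  proof (rule tendstoI)
    fix e :: real assume "e > 0"
    then obtain n where n: "1 / Suc n < e" using nat_approx_posE by metis
    show "eventually (\<lambda>i. dist (\<epsilon> i) 0 < e) F"
      using rank[of n]
    proof eventually_elim
      case (elim i)
      then have "1 / real (Suc (card i)) \<le> 1 / Suc n" by (intro divide_left_mono) auto
      then show ?case using n by (simp add: \<epsilon>_def)
    qed
  qed
  have "((\<lambda>i. nrm M (J (U i (unit_seq 0))) - 1) \<longlongrightarrow> 0) F"
    by (rule Lim_null_comparison[OF _ \<epsilon>0]) (use U(2) in auto)
  then have lim: "((\<lambda>i. nrm M (J (U i (unit_seq 0)))) \<longlongrightarrow> 1) F" by (simp add: Lim_null[symmetric])
  have "((\<lambda>i. fval \<phi> (\<lambda>t. U i (pad xs t)) - fval \<phi> (\<lambda>t. U i (reflect w (pad xs t)))) \<longlongrightarrow> 0) F"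
    if wf: "wf_fm (banach_language K E) \<phi>" for \<phi> xs w
  proof (rule Lim_null_comparison[OF _ \<epsilon>0])
    show "eventually (\<lambda>i. norm (fval \<phi> (\<lambda>t. U i (pad xs t)) - fval \<phi> (\<lambda>t. U i (reflect w (pad xs t)))) \<le> \<epsilon> i) F"
      using mem[of "requirement_code (\<phi>, xs, w)"]
    proof eventually_elim
      case (elim i)
      then have "(\<phi>, xs, w) \<in> R i" using wf by (simp add: R_def)
      then show ?case using U(3) by simp
    qed
  qed
  then show ?thesis using up U(1) lim by blast
qed

end

lemma reflect_zero [simp]: "reflect w 0 = 0"
  by (rule linear_0[OF linear_reflect])

text \<open>Distances between entries are values of formulas, and so are norms: the constant
  \<open>ZeroC\<close> takes the place of the additional entry.\<close>

lemma same_type_congruent: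
  fixes X :: "('x, 'f, 'p) banach_data"
  assumes "banach_space K X" and bs: "bs \<in> tuples n (unit_ball X)" and cs: "cs \<in> tuples n (unit_ball X)"
    and same: "same_type (banach_language K E) (metric_structure X) {} bs cs"
  shows "congruent_tuples X bs cs"
proof -
  interpret banach_space K X by fact
  define u :: "nat \<Rightarrow> 'f bfun trm" where "u i = (if i < n then Var i else Fn ZeroC [])" for i
  have eval_u: "eval_trm (metric_structure X) (nth bs') (u i) = (bs' @ [\<zero>\<^bsub>X\<^esub>]) ! i"
    if "i \<le> n" "length bs' = n" for i bs'
    using that by (auto simp: u_def nth_append)
  have len: "length bs = n" "length cs = n" using bs cs by (auto simp: tuples_def)
  have car: "(bs' @ [\<zero>\<^bsub>X\<^esub>]) ! i \<in> carrier X" if "bs' \<in> tuples n (unit_ball X)" "i \<le> n" for bs' i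
    using that nth_mem[of i bs'] by (auto simp: tuples_def nth_append unit_ball_def subset_iff)
  show ?thesis
    unfolding congruent_tuples_def Let_def
  proof (intro conjI allI impI)
    show "length bs = length cs" using len by simp
    fix i j assume ij: "i \<le> length bs" "j \<le> length bs"
    have "wf_fm (banach_language K E) (FDist (u i) (u j))" by (auto simp: u_def banach_language_def)
    moreover have "free_vars (FDist (u i) (u j)) \<subseteq> {..<length bs + length []}" using len by (auto simp: u_def)
    ultimately have "eval_fm (metric_structure X) (nth bs) (FDist (u i) (u j)) = eval_fm (metric_structure X) (nth cs) (FDist (u i) (u j))"
      using same unfolding same_type_def by (metis append_Nil2 lists_empty singletonI)
    then show "nrm X ((bs @ [\<zero>\<^bsub>X\<^esub>]) ! i \<ominus>\<^bsub>X\<^esub> (bs @ [\<zero>\<^bsub>X\<^esub>]) ! j) = nrm X ((cs @ [\<zero>\<^bsub>X\<^esub>]) ! i \<ominus>\<^bsub>X\<^esub> (cs @ [\<zero>\<^bsub>X\<^esub>]) ! j)"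
      using ij len by (simp add: eval_u ndist_eq car[OF bs] car[OF cs])
  qed
qed

text \<open>Tuples of distinct members of \<open>B\<close> are congruent, as their distances are all
  \<open>r\<close> and their norms all 1.\<close>

lemma indiscernible_equidistant:
  fixes X :: "('x, 'f, 'p) banach_data"
  assumes "banach_space K X" and V: "indiscernible_subspace K E X {} V" and BV: "B \<subseteq> V"
    and one: "\<And>e. e \<in> B \<Longrightarrow> nrm X e = 1" and r: "\<And>e f. e \<in> B \<Longrightarrow> f \<in> B \<Longrightarrow> e \<noteq> f \<Longrightarrow> nrm X (e \<ominus>\<^bsub>X\<^esub> f) = r"
  shows "indiscernible_set (banach_language K E) (metric_structure X) B"
proof -
  interpret banach_space K X by fact
  have "submodule V (scalars \<real>) X" using V by (simp add: indiscernible_subspace_def real_subspace_def)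
  then have Vc: "V \<subseteq> carrier X"
    using module.submoduleE(1)[OF banach_space.axioms(1)[OF banach_space_real]] by blast
  then have B: "B \<subseteq> V \<inter> unit_ball X" using BV one by (auto simp: unit_ball_def)
  have Bc: "e \<in> carrier X" if "e \<in> B" for e using that BV Vc by blast
  have cong_bc: "congruent_tuples X bs cs"
    if bc: "bs \<in> tuples n B" "cs \<in> tuples n B" "distinct bs" "distinct cs" for bs cs n
  proof -
    have len: "length bs = n" "length cs = n" using bc by (auto simp: tuples_def)
    have val: "nrm X ((es @ [\<zero>\<^bsub>X\<^esub>]) ! i \<ominus>\<^bsub>X\<^esub> (es @ [\<zero>\<^bsub>X\<^esub>]) ! j) = (if i = j then 0 else if i < n \<and> j < n then r else 1)"
      if es: "es \<in> tuples n B" "distinct es" and ij: "i \<le> n" "j \<le> n" for es i j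
    proof -
      have l: "length es = n" using es by (simp add: tuples_def)
      have m: "es ! k \<in> B" if "k < n" for k using es nth_mem[of k es] that by (auto simp: tuples_def)
      consider "i = j" | "i \<noteq> j" "i < n" "j < n" | "i \<noteq> j" "i < n" "j = n" | "i \<noteq> j" "i = n" "j < n" using ij by linarith
      then show ?thesis
      proof cases
        case 1
        then show ?thesis using l ij m Bc by (cases "i < n") (auto simp: nth_append)
      next
        case 2
        then have "es ! i \<noteq> es ! j" using es l nth_eq_iff_index_eq by blast
        then show ?thesis using 2 l r m by (simp add: nth_append)
      next
        case 3
        then show ?thesis using l m Bc one by (simp add: nth_append)
      next
        case 4
        then show ?thesis using l m Bc one nrm_diff_commute[of "\<zero>\<^bsub>X\<^esub>" "es ! j"] by (simp add: nth_append)
      qed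
    qed
    show ?thesis
      unfolding congruent_tuples_def Let_def using len val[of bs] val[of cs] bc by simp
  qed
  have "same_type (banach_language K E) (metric_structure X) {} bs cs"
    if "bs \<in> tuples n B" "cs \<in> tuples n B" "distinct bs" "distinct cs" for bs cs n
  proof -
    have "bs \<in> tuples n (V \<inter> unit_ball X)" "cs \<in> tuples n (V \<inter> unit_ball X)"
      using that B by (auto simp: tuples_def)
    then show ?thesis using V cong_bc[OF that] that unfolding indiscernible_subspace_def by blast
  qed
  then show ?thesis using B unfolding indiscernible_set_def by (auto simp: metric_structure_simps)
qed

section \<open>The limit embedding and its closure\<close>

locale invariant_maps =
  ultrapower F K E M rank + separated_space K E M v
  for F :: "'i filter" and K :: "complex set" and E :: "('f, 'p) language" and M :: "('a, 'f, 'p) banach_data"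
    and rank :: "'i \<Rightarrow> nat" and v :: "nat \<Rightarrow> 'a" +
  fixes U :: "'i \<Rightarrow> fseq \<Rightarrow> fseq"
  assumes lin_U: "linear (U i)"
    and unit_U: "((\<lambda>i. nrm M (J (U i (unit_seq 0)))) \<longlongrightarrow> 1) F"
    and invariant_U: "wf_fm (banach_language K E) \<phi> \<Longrightarrow>
        ((\<lambda>i. fval \<phi> (\<lambda>t. U i (pad xs t)) - fval \<phi> (\<lambda>t. U i (reflect w (pad xs t)))) \<longlongrightarrow> 0) F"
begin

lemma JU_scale: "nrm M (J (U i (c *\<^sub>R x))) = \<bar>c\<bar> * nrm M (J (U i x))"
  by (simp add: linear_scale[OF lin_U] J_scale)

text \<open>A reflection exchanges vectors of equal norm, so the limit depends on
  \<open>norm x\<close> only, and homogeneity determines it. Formulas see the norm truncated at 1;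
  the radius 1/2 keeps clear of the truncation.\<close>

lemma norm_limit: "((\<lambda>i. nrm M (J (U i x))) \<longlongrightarrow> norm x) F"
proof -
  have half: "((\<lambda>i. nrm M (J (U i x))) \<longlongrightarrow> 1 / 2) F" if x: "norm x = 1 / 2" for x
  proof -
    define \<phi> :: "('f bfun, 'p bpred) fm" where "\<phi> = FPred (NormP [1]) [Var 0]"
    have wf: "wf_fm LL \<phi>" by (simp add: \<phi>_def banach_language_def)
    have val: "fval \<phi> y = min 1 (nrm M (J (y 0)))" for y
    proof -
      have "lin_comb M [1] [B.clip (J (y 0))] = B.clip (J (y 0))"
        unfolding lin_comb_def using B.clip_ball[of "J (y 0)"] by (simp add: lessThan_Suc B.unit_ball_carrier(1) B.sm_one)
      then show ?thesis by (simp add: \<phi>_def fval_def B.nrm_clip)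
    qed
    define z where "z = (1 / 2) *\<^sub>R unit_seq 0"
    have "reflect (x - z) x = z" by (rule reflect_diff_swap) (simp add: x z_def)
    then have d: "((\<lambda>i. min 1 (nrm M (J (U i x))) - min 1 (nrm M (J (U i z)))) \<longlongrightarrow> 0) F"
      using invariant_U[OF wf, of "[x]" "x - z"] by (simp add: val pad_def)
    have "((\<lambda>i. min 1 (nrm M (J (U i z)))) \<longlongrightarrow> min 1 (\<bar>1 / 2\<bar> * 1)) F"
      unfolding z_def JU_scale by (intro tendsto_min tendsto_const tendsto_mult unit_U)
    from tendsto_add[OF d this] have m: "((\<lambda>i. min 1 (nrm M (J (U i x)))) \<longlongrightarrow> 1 / 2) F" by simp
    then have "eventually (\<lambda>i. min 1 (nrm M (J (U i x))) < 1) F" by (rule order_tendstoD(2)) simp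
    then have "eventually (\<lambda>i. min 1 (nrm M (J (U i x))) = nrm M (J (U i x))) F" by (auto elim!: eventually_mono)
    then show ?thesis by (rule Lim_transform_eventually[OF m])
  qed
  show ?thesis
  proof (cases "x = 0")
    case True
    then show ?thesis by (simp add: linear_0[OF lin_U])
  next
    case False
    define y where "y = (1 / (2 * norm x)) *\<^sub>R x"
    have xy: "x = (2 * norm x) *\<^sub>R y" using False by (simp add: y_def)
    have "((\<lambda>i. nrm M (J (U i y))) \<longlongrightarrow> 1 / 2) F" by (rule half) (use False in \<open>simp add: y_def\<close>)
    then have "((\<lambda>i. \<bar>2 * norm x\<bar> * nrm M (J (U i y))) \<longlongrightarrow> \<bar>2 * norm x\<bar> * (1 / 2)) F" by (intro tendsto_mult tendsto_const)
    then have "((\<lambda>i. nrm M (J (U i ((2 * norm x) *\<^sub>R y)))) \<longlongrightarrow> \<bar>2 * norm x\<bar> * (1 / 2)) F" by (simp only: JU_scale)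
    then show ?thesis unfolding xy[symmetric] by simp
  qed
qed

text \<open>\<open>J (U i x)\<close> is known to be bounded only eventually; the cut-off makes it an
  element of \<open>bfun\<close> and is eventually inactive.\<close>

definition g :: "fseq \<Rightarrow> 'i \<Rightarrow> 'a" where
  "g x i = (if nrm M (J (U i x)) \<le> norm x + 1 then J (U i x) else \<zero>\<^bsub>M\<^esub>)"

lemma g_bfun [simp]: "g x \<in> bfun"
  by (rule bfunI[where C = "norm x + 1"]) (auto simp: g_def)

lemma g_eventually: "eventually (\<lambda>i. g x i = J (U i x)) F"
proof -
  have "eventually (\<lambda>i. nrm M (J (U i x)) < norm x + 1) F" by (rule order_tendstoD(2)[OF norm_limit]) simp
  then show ?thesis by eventually_elim (simp add: g_def)
qed

definition emb :: "fseq \<Rightarrow> 'i \<Rightarrow> 'a" where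
  "emb x = rep (g x)"

lemma emb_closed [simp]: "emb x \<in> carrier pow"
  by (simp add: emb_def rep_carrier)

lemma nrm_emb: "nrm pow (emb x) = norm x"
proof -
  have "((\<lambda>i. nrm M (g x i)) \<longlongrightarrow> norm x) F"
  proof (rule Lim_transform_eventually[OF norm_limit])
    show "eventually (\<lambda>i. nrm M (J (U i x)) = nrm M (g x i)) F" using g_eventually[of x] by eventually_elim simp
  qed
  then show ?thesis by (simp add: emb_def pow_simps(4) len_rep len_eqI)
qed

lemma rep_eventuallyI: "f \<in> bfun \<Longrightarrow> h \<in> bfun \<Longrightarrow> eventually (\<lambda>i. f i = h i) F \<Longrightarrow> rep f = rep h"
proof (rule rep_eqI)
  assume a: "f \<in> bfun" "h \<in> bfun" "eventually (\<lambda>i. f i = h i) F"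
  have "eventually (\<lambda>i. nrm M (f i \<ominus>\<^bsub>M\<^esub> h i) = 0) F" using a(3) by eventually_elim (use a in \<open>simp add: bfun_closed\<close>)
  then show "eqv f h" unfolding eqv_def by (rule tendsto_eventually)
qed

lemma emb_add: "emb (x + y) = emb x \<oplus>\<^bsub>pow\<^esub> emb y"
  unfolding emb_def add_rep[OF g_bfun g_bfun]
proof (rule rep_eventuallyI)
  show "eventually (\<lambda>i. g (x + y) i = g x i \<oplus>\<^bsub>M\<^esub> g y i) F"
    using g_eventually[of x] g_eventually[of y] g_eventually[of "x + y"]
    by eventually_elim (simp add: linear_add[OF lin_U] J_add)
qed (simp_all add: bfun_add)

lemma emb_scale: "emb (c *\<^sub>R x) = complex_of_real c \<odot>\<^bsub>pow\<^esub> emb x"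
  unfolding emb_def sm_rep[OF B.real_in_K g_bfun]
proof (rule rep_eventuallyI)
  show "eventually (\<lambda>i. g (c *\<^sub>R x) i = complex_of_real c \<odot>\<^bsub>M\<^esub> g x i) F"
    using g_eventually[of x] g_eventually[of "c *\<^sub>R x"]
    by eventually_elim (simp add: linear_scale[OF lin_U] J_scale)
qed (simp_all add: bfun_sm)

lemma emb_zero: "emb 0 = \<zero>\<^bsub>pow\<^esub>"
  using emb_scale[of 0 0] by simp

lemma emb_diff: "emb (x - y) = emb x \<ominus>\<^bsub>pow\<^esub> emb y"
  using emb_add[of x "(-1) *\<^sub>R y"] emb_scale[of "-1" y] by (simp add: a_minus_def P.sm_minus_one)

lemma nrm_emb_diff: "nrm pow (emb x \<ominus>\<^bsub>pow\<^esub> emb y) = norm (x - y)"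
  by (simp add: emb_diff[symmetric] nrm_emb)

text \<open>For vectors of norm at most 1 clipping tends to the identity, so the values
  \<open>fval\<close> converge to the values of formulas at the embedded vectors.\<close>

lemma emb_clip:
  assumes "norm x \<le> 1" shows "(\<lambda>i. B.clip (J (U i x))) \<in> ballf" "rep (\<lambda>i. B.clip (J (U i x))) = emb x"
proof -
  show b: "(\<lambda>i. B.clip (J (U i x))) \<in> ballf" by (simp add: ballf_def B.clip_ball)
  note c = ballf_mem(2)[OF b]
  show "rep (\<lambda>i. B.clip (J (U i x))) = emb x"
    unfolding emb_def
  proof (rule rep_eqI[OF ballf_bfun[OF b] g_bfun], rule eqv_I_bound)
    have "((\<lambda>i. max 1 (nrm M (J (U i x))) - 1) \<longlongrightarrow> max 1 (norm x) - 1) F"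
      by (intro tendsto_diff tendsto_max tendsto_const norm_limit)
    then show "((\<lambda>i. max 1 (nrm M (J (U i x))) - 1) \<longlongrightarrow> 0) F" using assms by simp
    show "eventually (\<lambda>i. nrm M (B.clip (J (U i x)) \<ominus>\<^bsub>M\<^esub> g x i) \<le> max 1 (nrm M (J (U i x))) - 1) F"
      using g_eventually[of x]
    proof eventually_elim
      case (elim i)
      define z where "z = J (U i x)"
      have z: "z \<in> carrier M" by (simp add: z_def)
      define k where "k = max 1 (nrm M z)"
      have k: "k \<ge> 1" "nrm M z \<le> k" by (auto simp: k_def)
      have "B.clip z \<ominus>\<^bsub>M\<^esub> z = complex_of_real (1 / k - 1) \<odot>\<^bsub>M\<^esub> z"
        unfolding B.clip_def k_def[symmetric] of_real_diff
        by (subst B.sm_diff_left) (use z in \<open>simp_all add: B.sm_one del: of_real_divide\<close>)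
      then have "nrm M (B.clip z \<ominus>\<^bsub>M\<^esub> z) = \<bar>1 / k - 1\<bar> * nrm M z" by (simp only: B.nrm_sm_real[OF z])
      also have "\<dots> \<le> \<bar>1 / k - 1\<bar> * k" by (rule mult_left_mono) (use k in auto)
      also have "\<dots> = k - 1" using k by (simp add: field_simps)
      finally show ?case by (simp add: elim z_def[symmetric] k_def)
    qed
  qed (use c in \<open>auto simp: bfun_closed\<close>)
qed

lemma eval_emb_reflect:
  assumes wf: "wf_fm LL \<phi>" and xs: "\<And>x. x \<in> set xs \<Longrightarrow> norm x \<le> 1"
  shows "eval_fm NN (\<lambda>t. emb (pad xs t)) \<phi> = eval_fm NN (\<lambda>t. emb (reflect w (pad xs t))) \<phi>"
proof -
  have n: "norm (pad xs t) \<le> 1" for t using xs by (auto simp: pad_def)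
  then have n': "norm (reflect w (pad xs t)) \<le> 1" for t by simp
  have lim: "((\<lambda>i. fval \<phi> (\<lambda>t. U i (y t))) \<longlongrightarrow> eval_fm NN (\<lambda>t. emb (y t)) \<phi>) F" if "\<And>t. norm (y t) \<le> 1" for y
    using los_ballf[OF wf, of "\<lambda>t i. B.clip (J (U i (y t)))"] emb_clip[OF that] by (simp add: fval_def)
  have "((\<lambda>i. fval \<phi> (\<lambda>t. U i (pad xs t)) - fval \<phi> (\<lambda>t. U i (reflect w (pad xs t)))) \<longlongrightarrow>
      eval_fm NN (\<lambda>t. emb (pad xs t)) \<phi> - eval_fm NN (\<lambda>t. emb (reflect w (pad xs t))) \<phi>) F"
    by (intro tendsto_diff lim n n')
  then show ?thesis using invariant_U[OF wf] nontrivial tendsto_unique by fastforce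
qed

text \<open>One reflection at a time. Only the first \<open>n\<close> entries matter to the formula,
  so at each stage they are packed into a list, as the invariance for a single reflection
  requires.\<close>

lemma eval_emb_reflects:
  assumes wf: "wf_fm LL \<phi>" and fv: "free_vars \<phi> \<subseteq> {..<n}" and x: "\<And>t. t < n \<Longrightarrow> norm (x t) \<le> 1"
  shows "eval_fm NN (\<lambda>t. emb (x t)) \<phi> = eval_fm NN (\<lambda>t. emb (reflects w (x t))) \<phi>"
proof (induction w)
  case (Cons u w)
  define xs where "xs = map (\<lambda>t. reflects w (x t)) [0..<n]"
  have p: "pad xs t = reflects w (x t)" if "t < n" for t using that by (simp add: pad_def xs_def)
  have "eval_fm NN (\<lambda>t. emb (reflects w (x t))) \<phi> = eval_fm NN (\<lambda>t. emb (pad xs t)) \<phi>"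
    by (rule eval_fm_cong) (use fv p in auto)
  also have "\<dots> = eval_fm NN (\<lambda>t. emb (reflect u (pad xs t))) \<phi>"
    by (rule eval_emb_reflect[OF wf]) (use x in \<open>auto simp: xs_def\<close>)
  also have "\<dots> = eval_fm NN (\<lambda>t. emb (reflects (u # w) (x t))) \<phi>"
    by (rule eval_fm_cong) (use fv p in auto)
  finally show ?case using Cons by simp
qed simp

definition V :: "('i \<Rightarrow> 'a) set" where
  "V = norm_topology pow closure_of range emb"

lemma V_iff: "y \<in> V \<longleftrightarrow> y \<in> carrier pow \<and> (\<forall>\<epsilon>>0. \<exists>x. nrm pow (y \<ominus>\<^bsub>pow\<^esub> emb x) < \<epsilon>)"
proof (cases "y \<in> carrier pow")
  case True
  then have "ndist pow y (emb x) = nrm pow (y \<ominus>\<^bsub>pow\<^esub> emb x)" for x by (simp add: P.ndist_eq)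
  then show ?thesis
    using True unfolding V_def norm_topology_def P.met.metric_closure_of by (simp add: P.met.in_mball)
next
  case False
  then show ?thesis unfolding V_def norm_topology_def P.met.metric_closure_of by simp
qed

lemma V_carrier: "V \<subseteq> carrier pow"
  by (auto simp: V_iff)

lemma emb_V [simp]: "emb x \<in> V"
  unfolding V_iff by (auto intro!: exI[of _ x])

lemma V_subspace: "real_subspace pow V"
  unfolding real_subspace_def
proof
  show "closedin (norm_topology pow) V" by (simp add: V_def)
  interpret R: banach_space \<real> pow by (rule P.banach_space_real)
  show "submodule V (scalars \<real>) pow"
  proof (rule R.submoduleI)
    show "V \<subseteq> carrier pow" by (rule V_carrier)
    show "\<zero>\<^bsub>pow\<^esub> \<in> V" using emb_V[of 0] by (simp add: emb_zero)
    show add: "y \<oplus>\<^bsub>pow\<^esub> z \<in> V" if yz: "y \<in> V" "z \<in> V" for y z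
      unfolding V_iff
    proof (intro conjI allI impI)
      have c: "y \<in> carrier pow" "z \<in> carrier pow" using yz V_carrier by auto
      then show "y \<oplus>\<^bsub>pow\<^esub> z \<in> carrier pow" by simp
      fix \<epsilon> :: real assume "\<epsilon> > 0"
      then obtain a b where ab: "nrm pow (y \<ominus>\<^bsub>pow\<^esub> emb a) < \<epsilon> / 2" "nrm pow (z \<ominus>\<^bsub>pow\<^esub> emb b) < \<epsilon> / 2"
        using yz unfolding V_iff by (meson half_gt_zero)
      have "(y \<oplus>\<^bsub>pow\<^esub> z) \<ominus>\<^bsub>pow\<^esub> emb (a + b) = (y \<ominus>\<^bsub>pow\<^esub> emb a) \<oplus>\<^bsub>pow\<^esub> (z \<ominus>\<^bsub>pow\<^esub> emb b)"
        unfolding emb_add using c by (intro P.diff_diff_add) auto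
      then have "nrm pow ((y \<oplus>\<^bsub>pow\<^esub> z) \<ominus>\<^bsub>pow\<^esub> emb (a + b)) < \<epsilon>"
        using P.nrm_triangle[of "y \<ominus>\<^bsub>pow\<^esub> emb a" "z \<ominus>\<^bsub>pow\<^esub> emb b"] ab c by simp
      then show "\<exists>x. nrm pow ((y \<oplus>\<^bsub>pow\<^esub> z) \<ominus>\<^bsub>pow\<^esub> emb x) < \<epsilon>" by blast
    qed
    have sm: "complex_of_real r \<odot>\<^bsub>pow\<^esub> y \<in> V" if y: "y \<in> V" for r y
      unfolding V_iff
    proof (intro conjI allI impI)
      have c: "y \<in> carrier pow" using y V_carrier by auto
      then show "complex_of_real r \<odot>\<^bsub>pow\<^esub> y \<in> carrier pow" by simp
      fix \<epsilon> :: real assume \<epsilon>: "\<epsilon> > 0"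
      then have "\<epsilon> / (\<bar>r\<bar> + 1) > 0" by (intro divide_pos_pos) auto
      then obtain a where a: "nrm pow (y \<ominus>\<^bsub>pow\<^esub> emb a) < \<epsilon> / (\<bar>r\<bar> + 1)" using y unfolding V_iff by blast
      have "complex_of_real r \<odot>\<^bsub>pow\<^esub> y \<ominus>\<^bsub>pow\<^esub> emb (r *\<^sub>R a) = complex_of_real r \<odot>\<^bsub>pow\<^esub> (y \<ominus>\<^bsub>pow\<^esub> emb a)"
        unfolding emb_scale using c by (intro P.sm_diff_right[symmetric]) auto
      then have "nrm pow (complex_of_real r \<odot>\<^bsub>pow\<^esub> y \<ominus>\<^bsub>pow\<^esub> emb (r *\<^sub>R a)) = \<bar>r\<bar> * nrm pow (y \<ominus>\<^bsub>pow\<^esub> emb a)"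
        using c P.nrm_sm_real[of "y \<ominus>\<^bsub>pow\<^esub> emb a" r] by simp
      also have "\<dots> \<le> \<bar>r\<bar> * (\<epsilon> / (\<bar>r\<bar> + 1))" by (rule mult_left_mono) (use a in auto)
      also have "\<dots> < \<epsilon>" using \<epsilon> by (simp add: divide_simps)
      finally show "\<exists>x. nrm pow (complex_of_real r \<odot>\<^bsub>pow\<^esub> y \<ominus>\<^bsub>pow\<^esub> emb x) < \<epsilon>" by blast
    qed
    show "\<ominus>\<^bsub>pow\<^esub> y \<in> V" if y: "y \<in> V" for y
    proof -
      have "y \<in> carrier pow" using y V_carrier by auto
      then show ?thesis using sm[OF y, of "-1"] by (simp add: P.sm_minus_one)
    qed
    show "a \<odot>\<^bsub>pow\<^esub> y \<in> V" if a: "a \<in> carrier (scalars \<real>)" "y \<in> V" for a y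
      using sm[OF a(2)] a(1) by (auto simp: scalars_def elim!: Reals_cases)
  qed
qed

text \<open>An approximating vector has norm at most \<open>1 + \<eta> / 2\<close>. Scaling it back
  to the unit ball, where formulas are evaluated, costs no more than another
  \<open>\<eta> / 2\<close>.\<close>

lemma V_approx:
  assumes y: "y \<in> V" "nrm pow y \<le> 1" and \<eta>: "\<eta> > 0"
  shows "\<exists>x. norm x \<le> 1 \<and> nrm pow (y \<ominus>\<^bsub>pow\<^esub> emb x) \<le> \<eta>"
proof -
  have yc: "y \<in> carrier pow" using y V_carrier by auto
  obtain x where x: "nrm pow (y \<ominus>\<^bsub>pow\<^esub> emb x) < \<eta> / 2" using y(1) \<eta> unfolding V_iff by (meson half_gt_zero)
  define k where "k = max 1 (norm x)"
  have k: "k \<ge> 1" "norm x \<le> k" by (auto simp: k_def)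
  have nx: "norm x \<le> 1 + \<eta> / 2"
    using P.abs_nrm_diff_le[OF yc emb_closed, of x] x y(2) by (simp add: nrm_emb)
  define z where "z = (1 / k) *\<^sub>R x"
  have "norm z = norm x / k" using k by (simp add: z_def)
  then have z1: "norm z \<le> 1" using k by simp
  have "x - z = (1 - 1 / k) *\<^sub>R x" by (simp add: z_def scaleR_diff_left)
  then have "norm (x - z) = (1 - 1 / k) * norm x" using k by simp
  also have "\<dots> \<le> (1 - 1 / k) * k" by (rule mult_left_mono) (use k in auto)
  also have "\<dots> = k - 1" using k by (simp add: field_simps)
  finally have "norm (x - z) \<le> \<eta> / 2" using nx \<eta> by (simp add: k_def)
  then have "nrm pow (y \<ominus>\<^bsub>pow\<^esub> emb z) \<le> \<eta>"
    using P.nrm_diff_triangle[OF yc emb_closed emb_closed, of z x] x by (simp add: nrm_emb_diff)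
  then show ?thesis using z1 by blast
qed

end

text \<open>Polarization with \<open>norm (x - y)\<close>: the three differences of squares
  contribute \<open>4 * \<eta>\<close>, \<open>4 * \<eta>\<close> and \<open>16 * \<eta>\<close>,
  and the inner product is half of their combination.\<close>

lemma gram_close:
  fixes x y x' y' :: "'h::real_inner" and \<eta> :: real
  assumes "norm x \<le> 1" "norm y \<le> 1" "norm x' \<le> 1" "norm y' \<le> 1"
    and "\<bar>norm x - norm x'\<bar> \<le> 2 * \<eta>" "\<bar>norm y - norm y'\<bar> \<le> 2 * \<eta>" "\<bar>norm (x - y) - norm (x' - y')\<bar> \<le> 4 * \<eta>"
  shows "\<bar>inner x y - inner x' y'\<bar> \<le> 12 * \<eta>"
proof -
  have sq: "\<bar>a\<^sup>2 - b\<^sup>2\<bar> \<le> c * k" if "0 \<le> a" "0 \<le> b" "a + b \<le> c" "\<bar>a - b\<bar> \<le> k" for a b c k :: real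
  proof -
    have "\<bar>a\<^sup>2 - b\<^sup>2\<bar> = (a + b) * \<bar>a - b\<bar>" using that by (simp add: power2_eq_square square_diff_square_factored abs_mult)
    also have "\<dots> \<le> c * k" using that by (intro mult_mono) auto
    finally show ?thesis .
  qed
  have pol: "inner a b = ((norm a)\<^sup>2 + (norm b)\<^sup>2 - (norm (a - b))\<^sup>2) / 2" for a b :: 'h
    by (simp add: power2_norm_eq_inner inner_diff_left inner_diff_right inner_commute)
  have abs3: "\<bar>p + q - r\<bar> \<le> \<bar>p\<bar> + \<bar>q\<bar> + \<bar>r\<bar>" for p q r :: real by linarith
  have "\<bar>(norm x)\<^sup>2 - (norm x')\<^sup>2\<bar> \<le> 2 * (2 * \<eta>)" "\<bar>(norm y)\<^sup>2 - (norm y')\<^sup>2\<bar> \<le> 2 * (2 * \<eta>)"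
    by (intro sq; use assms in simp)+
  moreover have "norm (x - y) \<le> 2" "norm (x' - y') \<le> 2"
    using norm_triangle_ineq4[of x y] norm_triangle_ineq4[of x' y'] assms by linarith+
  then have "\<bar>(norm (x - y))\<^sup>2 - (norm (x' - y'))\<^sup>2\<bar> \<le> 4 * (4 * \<eta>)"
    using assms by (intro sq) auto
  ultimately have "\<bar>((norm x)\<^sup>2 - (norm x')\<^sup>2) + ((norm y)\<^sup>2 - (norm y')\<^sup>2) - ((norm (x - y))\<^sup>2 - (norm (x' - y'))\<^sup>2)\<bar> \<le> 24 * \<eta>"
    using abs3[of "(norm x)\<^sup>2 - (norm x')\<^sup>2" "(norm y)\<^sup>2 - (norm y')\<^sup>2" "(norm (x - y))\<^sup>2 - (norm (x' - y'))\<^sup>2"] by linarith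
  moreover have "inner x y - inner x' y' =
      (((norm x)\<^sup>2 - (norm x')\<^sup>2) + ((norm y)\<^sup>2 - (norm y')\<^sup>2) - ((norm (x - y))\<^sup>2 - (norm (x' - y'))\<^sup>2)) / 2"
    unfolding pol by (simp only: diff_divide_distrib add_divide_distrib)
  ultimately show ?thesis by (simp only: abs_divide abs_numeral) simp
qed

lemma norm_unit_seq_diff: "c \<noteq> d \<Longrightarrow> norm (unit_seq c - unit_seq d) = sqrt 2"
  by (simp add: norm_eq_sqrt_inner inner_diff_left inner_diff_right)

section \<open>Indiscernibility and dimension of the closure\<close>

context invariant_maps
begin

text \<open>Congruence holds exactly for elements of the closure but only approximately for the
  embedded vectors near them. Hence the two tuples of approximants are matched up to an error by
  reflections, which preserve the value of the formula, and uniform continuity accounts for the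
  errors at both ends.\<close>

lemma congruent_same_type:
  assumes bs: "bs \<in> tuples n (V \<inter> unit_ball pow)" and cs: "cs \<in> tuples n (V \<inter> unit_ball pow)"
    and cong: "congruent_tuples pow bs cs"
  shows "same_type LL NN {} bs cs"
proof -
  interpret BN: bounded_mstructure LL NN 2
    by (rule banach_bounded_mstructure[OF pow_banach_structure])
  have len: "length bs = n" "length cs = n" using bs cs by (auto simp: tuples_def)
  have bV: "bs ! t \<in> V" "bs ! t \<in> carrier pow" "nrm pow (bs ! t) \<le> 1" if "t < n" for t
  proof -
    have "bs ! t \<in> V \<inter> unit_ball pow" using bs nth_mem[of t bs] that unfolding tuples_def by blast
    then show "bs ! t \<in> V" "bs ! t \<in> carrier pow" "nrm pow (bs ! t) \<le> 1" by (auto simp: unit_ball_def)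
  qed
  have cV: "cs ! t \<in> V" "cs ! t \<in> carrier pow" "nrm pow (cs ! t) \<le> 1" if "t < n" for t
  proof -
    have "cs ! t \<in> V \<inter> unit_ball pow" using cs nth_mem[of t cs] that unfolding tuples_def by blast
    then show "cs ! t \<in> V" "cs ! t \<in> carrier pow" "nrm pow (cs ! t) \<le> 1" by (auto simp: unit_ball_def)
  qed
  have cong': "nrm pow ((bs @ [\<zero>\<^bsub>pow\<^esub>]) ! i \<ominus>\<^bsub>pow\<^esub> (bs @ [\<zero>\<^bsub>pow\<^esub>]) ! j) = nrm pow ((cs @ [\<zero>\<^bsub>pow\<^esub>]) ! i \<ominus>\<^bsub>pow\<^esub> (cs @ [\<zero>\<^bsub>pow\<^esub>]) ! j)"
    if "i \<le> n" "j \<le> n" for i j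
    using cong that len by (simp add: congruent_tuples_def Let_def)
  have c1: "nrm pow (bs ! t) = nrm pow (cs ! t)" if "t < n" for t
    using cong'[of t n] that len bV cV by (simp add: nth_append)
  have c2: "nrm pow (bs ! s \<ominus>\<^bsub>pow\<^esub> bs ! t) = nrm pow (cs ! s \<ominus>\<^bsub>pow\<^esub> cs ! t)" if "s < n" "t < n" for s t
    using cong'[of s t] that len by (simp add: nth_append)
  have "\<bar>eval_fm NN (nth bs) \<phi> - eval_fm NN (nth cs) \<phi>\<bar> \<le> 2 * \<epsilon>"
    if wf: "wf_fm LL \<phi>" and fv: "free_vars \<phi> \<subseteq> {..<n}" and \<epsilon>: "\<epsilon> > 0" for \<phi> \<epsilon>
  proof -
    obtain \<delta> where \<delta>: "\<delta> > 0" and un: "\<forall>e e'. (\<forall>v. e v \<in> universe NN) \<longrightarrow> (\<forall>v. e' v \<in> universe NN) \<longrightarrow>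
        (\<forall>v\<in>free_vars \<phi>. distance NN (e v) (e' v) < \<delta>) \<longrightarrow> \<bar>eval_fm NN e \<phi> - eval_fm NN e' \<phi>\<bar> \<le> \<epsilon>"
      using BN.eval_fm_uniform[OF wf \<epsilon>] by (elim exE conjE) (rule that)
    have close: "\<bar>eval_fm NN e \<phi> - eval_fm NN e' \<phi>\<bar> \<le> \<epsilon>"
      if e: "\<And>t. t < n \<Longrightarrow> e t \<in> unit_ball pow \<and> e' t \<in> unit_ball pow \<and> nrm pow (e t \<ominus>\<^bsub>pow\<^esub> e' t) < \<delta>" for e e'
    proof -
      \<comment> \<open>Beyond the length of a tuple \<open>nth\<close> need not give points of the
        universe, while uniform continuity is stated for environments with all values in it; zero is
        substituted there.\<close>
      define r where "r e t = (if t < n then e t else \<zero>\<^bsub>pow\<^esub>)" for e and t :: nat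
      have "\<bar>eval_fm NN (r e) \<phi> - eval_fm NN (r e') \<phi>\<bar> \<le> \<epsilon>"
      proof (rule un[rule_format])
        show "r e t \<in> universe NN" "r e' t \<in> universe NN" for t using e by (auto simp: r_def)
        fix t assume "t \<in> free_vars \<phi>"
        then have t: "t < n" using fv by auto
        then show "distance NN (r e t) (r e' t) < \<delta>" using e[OF t] by (simp add: r_def P.ndist_eq P.unit_ball_carrier(1))
      qed
      moreover have "eval_fm NN (r e) \<phi> = eval_fm NN e \<phi>" "eval_fm NN (r e') \<phi> = eval_fm NN e' \<phi>"
        by (rule eval_fm_cong; use fv in \<open>auto simp: r_def\<close>)+
      ultimately show ?thesis by simp
    qed
    have \<delta>4: "\<delta> / 4 > 0" using \<delta> by simp
    obtain \<gamma> where \<gamma>: "\<gamma> > 0" and gr: "\<forall>x y :: nat \<Rightarrow> fseq. (\<forall>t<n. norm (x t) \<le> 1 \<and> norm (y t) \<le> 1) \<longrightarrow>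
        (\<forall>s<n. \<forall>t<n. \<bar>inner (x s) (x t) - inner (y s) (y t)\<bar> \<le> \<gamma>) \<longrightarrow>
        (\<exists>w. \<forall>t<n. norm (reflects w (x t) - y t) \<le> \<delta> / 4)"
      using close_gram_reflects[OF \<delta>4, of n] by (elim exE conjE) (rule that)
    \<comment> \<open>The Gram matrices differ by at most \<open>12 * \<eta>\<close>, which must not
      exceed \<open>\<gamma>\<close>; in the last estimate \<open>\<delta> / 4 + \<eta>\<close> has
      to stay below \<open>\<delta>\<close>.\<close>
    define \<eta> where "\<eta> = min (\<delta> / 4) (\<gamma> / 12)"
    have \<eta>: "\<eta> > 0" "\<eta> \<le> \<delta> / 4" "12 * \<eta> \<le> \<gamma>" using \<delta> \<gamma> by (auto simp: \<eta>_def)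
    have "\<forall>t. \<exists>x. t < n \<longrightarrow> norm x \<le> 1 \<and> nrm pow (bs ! t \<ominus>\<^bsub>pow\<^esub> emb x) \<le> \<eta>"
      using V_approx[OF _ _ \<eta>(1)] bV by blast
    then obtain x where x: "\<And>t. t < n \<Longrightarrow> norm (x t) \<le> 1" "\<And>t. t < n \<Longrightarrow> nrm pow (bs ! t \<ominus>\<^bsub>pow\<^esub> emb (x t)) \<le> \<eta>" by metis
    have "\<forall>t. \<exists>x. t < n \<longrightarrow> norm x \<le> 1 \<and> nrm pow (cs ! t \<ominus>\<^bsub>pow\<^esub> emb x) \<le> \<eta>"
      using V_approx[OF _ _ \<eta>(1)] cV by blast
    then obtain y where y: "\<And>t. t < n \<Longrightarrow> norm (y t) \<le> 1" "\<And>t. t < n \<Longrightarrow> nrm pow (cs ! t \<ominus>\<^bsub>pow\<^esub> emb (y t)) \<le> \<eta>" by metis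
    have n1: "\<bar>norm (x t) - norm (y t)\<bar> \<le> 2 * \<eta>" if t: "t < n" for t
      using P.abs_nrm_diff_le[OF bV(2)[OF t] emb_closed, of "x t"] P.abs_nrm_diff_le[OF cV(2)[OF t] emb_closed, of "y t"]
        x(2)[OF t] y(2)[OF t] c1[OF t] unfolding nrm_emb by linarith
    have n2: "\<bar>norm (x s - x t) - norm (y s - y t)\<bar> \<le> 4 * \<eta>" if st: "s < n" "t < n" for s t
    proof -
      have d: "\<bar>nrm pow (a \<ominus>\<^bsub>pow\<^esub> b) - norm (z - z')\<bar> \<le> nrm pow (a \<ominus>\<^bsub>pow\<^esub> emb z) + nrm pow (b \<ominus>\<^bsub>pow\<^esub> emb z')"
        if "a \<in> carrier pow" "b \<in> carrier pow" for a b z z'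
        using P.nrm_diff_triangle[of a "emb z" b] P.nrm_diff_triangle[of "emb z" "emb z'" b]
          P.nrm_diff_triangle[of "emb z" a "emb z'"] P.nrm_diff_triangle[of a b "emb z'"]
          P.nrm_diff_commute[of a "emb z"] P.nrm_diff_commute[of b "emb z'"] that nrm_emb_diff[of z z'] by simp
      show ?thesis
        using d[OF bV(2)[OF st(1)] bV(2)[OF st(2)], of "x s" "x t"] d[OF cV(2)[OF st(1)] cV(2)[OF st(2)], of "y s" "y t"]
          c2[OF st] x(2)[OF st(1)] x(2)[OF st(2)] y(2)[OF st(1)] y(2)[OF st(2)] by linarith
    qed
    have "\<exists>w. \<forall>t<n. norm (reflects w (x t) - y t) \<le> \<delta> / 4"
    proof (rule gr[rule_format])
      fix s t assume st: "s < n" "t < n"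
      have "\<bar>inner (x s) (x t) - inner (y s) (y t)\<bar> \<le> 12 * \<eta>"
        by (rule gram_close) (use st x(1) y(1) n1 n2 in auto)
      then show "\<bar>inner (x s) (x t) - inner (y s) (y t)\<bar> \<le> \<gamma>" using \<eta> by linarith
    qed (use x(1) y(1) in auto)
    then obtain w where w: "\<And>t. t < n \<Longrightarrow> norm (reflects w (x t) - y t) \<le> \<delta> / 4" by blast
    have embU: "emb z \<in> unit_ball pow" if "norm z \<le> 1" for z using that by (simp add: unit_ball_def nrm_emb)
    have "\<bar>eval_fm NN (nth bs) \<phi> - eval_fm NN (\<lambda>t. emb (x t)) \<phi>\<bar> \<le> \<epsilon>"
      by (rule close) (use bV x \<eta> \<delta> embU in \<open>force simp: unit_ball_def\<close>)
    moreover have "eval_fm NN (\<lambda>t. emb (x t)) \<phi> = eval_fm NN (\<lambda>t. emb (reflects w (x t))) \<phi>"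
      by (rule eval_emb_reflects[OF wf fv]) (use x in auto)
    moreover have "\<bar>eval_fm NN (\<lambda>t. emb (reflects w (x t))) \<phi> - eval_fm NN (nth cs) \<phi>\<bar> \<le> \<epsilon>"
    proof (rule close, intro conjI)
      fix t assume t: "t < n"
      show "emb (reflects w (x t)) \<in> unit_ball pow" using x t embU by simp
      show "cs ! t \<in> unit_ball pow" using cV t by (simp add: unit_ball_def)
      have "nrm pow (emb (reflects w (x t)) \<ominus>\<^bsub>pow\<^esub> cs ! t) \<le>
          nrm pow (emb (reflects w (x t)) \<ominus>\<^bsub>pow\<^esub> emb (y t)) + nrm pow (emb (y t) \<ominus>\<^bsub>pow\<^esub> cs ! t)"
        using cV t by (intro P.nrm_diff_triangle) auto
      also have "\<dots> \<le> \<delta> / 4 + \<eta>"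
        using w[OF t] y(2)[OF t] P.nrm_diff_commute[OF emb_closed cV(2)[OF t], of "y t"] by (simp add: nrm_emb_diff)
      also have "\<dots> < \<delta>" using \<eta> \<delta> by linarith
      finally show "nrm pow (emb (reflects w (x t)) \<ominus>\<^bsub>pow\<^esub> cs ! t) < \<delta>" .
    qed
    ultimately show ?thesis by linarith
  qed
  then have "eval_fm NN (nth bs) \<phi> = eval_fm NN (nth cs) \<phi>" if "wf_fm LL \<phi>" "free_vars \<phi> \<subseteq> {..<n}" for \<phi>
  proof -
    have "\<bar>eval_fm NN (nth bs) \<phi> - eval_fm NN (nth cs) \<phi>\<bar> \<le> 0"
    proof (rule field_le_epsilon)
      fix e :: real assume "e > 0"
      then show "\<bar>eval_fm NN (nth bs) \<phi> - eval_fm NN (nth cs) \<phi>\<bar> \<le> 0 + e"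
        using \<open>\<And>\<phi> \<epsilon>. wf_fm LL \<phi> \<Longrightarrow> free_vars \<phi> \<subseteq> {..<n} \<Longrightarrow> \<epsilon> > 0 \<Longrightarrow> \<bar>eval_fm NN (nth bs) \<phi> - eval_fm NN (nth cs) \<phi>\<bar> \<le> 2 * \<epsilon>\<close>[OF that, of "e / 2"] by simp
    qed
    then show ?thesis by simp
  qed
  then show ?thesis using len by (simp add: same_type_def)
qed

lemma V_indiscernible: "indiscernible_subspace K E pow {} V"
  unfolding indiscernible_subspace_def
proof (intro conjI allI ballI)
  fix n bs cs assume bc: "bs \<in> tuples n (V \<inter> unit_ball pow)" "cs \<in> tuples n (V \<inter> unit_ball pow)"
  then have bc': "bs \<in> tuples n (unit_ball pow)" "cs \<in> tuples n (unit_ball pow)" by (auto simp: tuples_def)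
  show "same_type LL NN {} bs cs \<longleftrightarrow> congruent_tuples pow bs cs"
    using congruent_same_type[OF bc] same_type_congruent[OF P.banach_space_axioms bc'] by blast
qed (use V_subspace in auto)

text \<open>A finite set spanning \<open>V\<close> is the image of finitely many unit sequences
  under \<open>lin x\<close>. Preimages of the embedded unit vectors in their span are independent,
  because the embedding is isometric, and there are more of them than the generators allow.\<close>

lemma V_infinite_dimensional: "infinite_dimensional \<real> pow V"
  unfolding infinite_dimensional_def
proof (intro notI, elim exE conjE)
  fix S assume S: "finite S" "S \<subseteq> V" "V \<subseteq> lin_span \<real> pow S"
  obtain h where h: "bij_betw h {0..<card S} S" using ex_bij_betw_nat_finite[OF S(1)] by blast
  define x where "x i = (if i < card S then h i else \<zero>\<^bsub>pow\<^esub>)" for i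
  define A where "A = {0..<card S}"
  have xA: "x ` A = S" using h by (auto simp: x_def A_def bij_betw_def image_iff)
  have xc: "x i \<in> carrier pow" for i
  proof (cases "i \<in> A")
    case True
    then show ?thesis using xA S V_carrier by blast
  qed (simp add: x_def A_def)
  have "\<exists>a\<in>span (unit_seq ` A). P.lin x a = emb (unit_seq c)" for c
    using subsetD[OF S(3) emb_V[of "unit_seq c"]] P.lin_span_finite[of x A, OF xc] xA by auto
  then obtain a where a: "\<And>c. a c \<in> span (unit_seq ` A)" "\<And>c. P.lin x (a c) = emb (unit_seq c)" by metis
  have comb: "P.lin x (\<Sum>c\<in>C. u c *\<^sub>R a c) = emb (\<Sum>c\<in>C. u c *\<^sub>R unit_seq c)" if "finite C" for C u
    using that by induction (simp_all add: P.lin_zero[of x, OF xc] emb_zero P.lin_add[of x, OF xc] emb_add P.lin_scale[of x, OF xc] emb_scale a(2))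
  have zero: "u c = 0" if C: "finite C" "c \<in> C" and s: "(\<Sum>c\<in>C. u c *\<^sub>R a c) = 0" for C u c
  proof -
    have "norm (\<Sum>c\<in>C. u c *\<^sub>R unit_seq c) = nrm pow (P.lin x 0)" by (simp only: nrm_emb[symmetric] comb[OF C(1), symmetric] s)
    then have "(\<Sum>c\<in>C. u c *\<^sub>R unit_seq c) = 0" by (simp add: P.lin_zero[of x, OF xc])
    then have "coord (\<Sum>c\<in>C. u c *\<^sub>R unit_seq c) c = 0" by simp
    also have "coord (\<Sum>c\<in>C. u c *\<^sub>R unit_seq c) c = (\<Sum>d\<in>C. if d = c then u d else 0)"
      unfolding coord_sum by (rule sum.cong) auto
    also have "\<dots> = u c" using C by (simp add: sum.delta)
    finally show ?thesis .
  qed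
  have inj: "inj a"
  proof (rule injI, rule ccontr)
    fix c d assume cd: "a c = a d" "c \<noteq> d"
    have "(\<Sum>e\<in>{c, d}. (if e = c then 1 else -1) *\<^sub>R a e) = 0" using cd by simp
    then have "(if c = c then 1 else -1) = (0 :: real)" by (rule zero[rotated 2]) auto
    then show False by simp
  qed
  define C where "C = {..card (unit_seq ` A)}"
  have "independent (a ` C)"
  proof
    assume "dependent (a ` C)"
    then obtain u where u: "\<exists>v\<in>a ` C. u v \<noteq> 0" "(\<Sum>v\<in>a ` C. u v *\<^sub>R v) = 0"
      using dependent_finite[of "a ` C"] by (auto simp: C_def)
    have "(\<Sum>c\<in>C. u (a c) *\<^sub>R a c) = 0"
      using u(2) sum.reindex[of a C "\<lambda>v. u v *\<^sub>R v"] inj by (simp add: inj_on_subset[OF inj])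
    then show False using u(1) zero[of C _ "\<lambda>c. u (a c)"] by (auto simp: C_def)
  qed
  moreover have "a ` C \<subseteq> span (unit_seq ` A)" using a(1) by auto
  ultimately have "card (a ` C) \<le> card (unit_seq ` A)"
    using independent_span_bound[of "unit_seq ` A" "a ` C"] by (simp add: A_def)
  moreover have "card (a ` C) = Suc (card (unit_seq ` A))"
    using card_image[OF inj_on_subset[OF inj subset_UNIV], of C] by (simp add: C_def)
  ultimately show False by simp
qed

lemma basis_indiscernible:
  "infinite (range (\<lambda>c. emb (unit_seq c))) \<and> indiscernible_set LL NN (range (\<lambda>c. emb (unit_seq c)))"
proof
  have ne: "emb (unit_seq c) \<noteq> emb (unit_seq d)" if "c \<noteq> d" for c d
    using nrm_emb_diff[of "unit_seq c" "unit_seq d"] norm_unit_seq_diff[OF that] by auto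
  then have "inj (\<lambda>c. emb (unit_seq c))" by (metis injI)
  then show "infinite (range (\<lambda>c. emb (unit_seq c)))" by (simp add: finite_image_iff)
  show "indiscernible_set LL NN (range (\<lambda>c. emb (unit_seq c)))"
    by (rule indiscernible_equidistant[OF P.banach_space_axioms V_indiscernible, of _ "sqrt 2"])
       (auto simp: nrm_emb nrm_emb_diff intro!: norm_unit_seq_diff)
qed

end

lemma indiscernible_subspace_exists:
  fixes M :: "('a, 'f, 'p) banach_data"
  assumes M: "is_model K E T M" and inf: "infinite_dimensional K M (carrier M)"
    and T: "T \<subseteq> {\<phi>. sentence (banach_language K E) \<phi>}"
  shows "\<exists>(N :: (('a, 'f, 'p) large, 'f, 'p) banach_data) V I. is_model K E T N \<and>
    indiscernible_subspace K E N {} V \<and> infinite_dimensional \<real> N V \<and>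
    infinite I \<and> indiscernible_set (banach_language K E) (metric_structure N) I"
proof -
  have bM: "banach_structure K E M" using M by (simp add: is_model_def)
  interpret B: banach_space K M using bM by (rule banach_structure_imp_banach_space)
  \<comment> \<open>The real span of a set is contained in its span over \<open>K\<close>, so
    infinite dimension over \<open>K\<close> passes to the real scalars.\<close>
  have "infinite_dimensional \<real> M (carrier M)"
    using inf lin_span_real_subset[OF B.scalar_field, where X = M] unfolding infinite_dimensional_def by blast
  then have "\<exists>v :: nat \<Rightarrow> 'a. (\<forall>i. v i \<in> carrier M \<and> nrm M (v i) \<le> 1) \<and>
      (\<forall>i j. i \<noteq> j \<longrightarrow> 1 / 2 \<le> nrm M (v i \<ominus>\<^bsub>M\<^esub> v j))"
    by (rule B.separated_sequence) blast
  then obtain v :: "nat \<Rightarrow> 'a" where v: "\<forall>i. v i \<in> carrier M \<and> nrm M (v i) \<le> 1"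
      "\<forall>i j. i \<noteq> j \<longrightarrow> 1 / 2 \<le> nrm M (v i \<ominus>\<^bsub>M\<^esub> v j)"
    by (elim exE conjE) (rule that)
  interpret S: separated_space K E M v
    by unfold_locales (use bM v in auto)
  obtain F :: "('f bfun, 'p bpred) fm set filter" and U where FU: "ultrapower F K E M card" "\<forall>i. linear (U i)"
    "((\<lambda>i. nrm M (S.J (U i (unit_seq 0)))) \<longlongrightarrow> 1) F"
    "\<forall>\<phi> xs w. wf_fm (banach_language K E) \<phi> \<longrightarrow>
        ((\<lambda>i. S.fval \<phi> (\<lambda>t. U i (pad xs t)) - S.fval \<phi> (\<lambda>t. U i (reflect w (pad xs t)))) \<longlongrightarrow> 0) F"
    using S.limit_maps by (elim exE conjE) (rule that)
  interpret U: ultrapower F K E M card by (rule FU(1))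
  interpret I: invariant_maps F K E M card v U
    by (intro invariant_maps.intro invariant_maps_axioms.intro FU(1) S.separated_space_axioms FU(3)
        FU(2)[rule_format] FU(4)[rule_format])
  show ?thesis
    by (intro exI conjI; rule U.pow_model[OF M T] I.V_indiscernible I.V_infinite_dimensional
        I.basis_indiscernible[THEN conjunct1] I.basis_indiscernible[THEN conjunct2])
qed

section \<open>Orthonormal bases\<close>

text \<open>
  Ficken's characterization of inner product norms, for a single pair of vectors: the
  hypothesis makes the norm of \<open>a e + b f\<close> invariant under changes of sign and exchange of
  \<open>a\<close> and \<open>b\<close>, and the symmetry that exchanges \<open>e\<close> with the multiple of \<open>e + f\<close> of norm 1 then
  determines the norm of \<open>e + f\<close>.
\<close>

lemma (in seminorm) ficken_pair:
  assumes swap: "\<And>u w \<alpha> \<beta>. p u = p w \<Longrightarrow> p (\<alpha> *\<^sub>R u + \<beta> *\<^sub>R w) = p (\<beta> *\<^sub>R u + \<alpha> *\<^sub>R w)"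
    and e: "p e = 1" and f: "p f = 1" and orth: "p (e + f) = p (e - f)"
  shows "(p (e - f))\<^sup>2 = 2"
proof -
  define h where "h a b = p (a *\<^sub>R e + b *\<^sub>R f)" for a b
  have sym: "h a b = h b a" for a b unfolding h_def using swap[of e f a b] e f by simp
  \<comment> \<open>Exchange the coefficients of \<open>e + f\<close> and \<open>e - f\<close>,
    which have equal norms by hypothesis.\<close>
  have neg: "h a (- b) = h a b" for a b
  proof -
    have "((a + b) / 2) *\<^sub>R (e + f) + ((a - b) / 2) *\<^sub>R (e - f) = (((a + b) / 2 + (a - b) / 2)) *\<^sub>R e + ((a + b) / 2 - (a - b) / 2) *\<^sub>R f"
      "((a - b) / 2) *\<^sub>R (e + f) + ((a + b) / 2) *\<^sub>R (e - f) = (((a - b) / 2 + (a + b) / 2)) *\<^sub>R e + ((a - b) / 2 - (a + b) / 2) *\<^sub>R f"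
      by (simp_all only: scaleR_add_right scaleR_diff_right scaleR_add_left scaleR_diff_left) (simp_all add: algebra_simps)
    moreover have "(a + b) / 2 + (a - b) / 2 = a" "(a + b) / 2 - (a - b) / 2 = b"
      "(a - b) / 2 + (a + b) / 2 = a" "(a - b) / 2 - (a + b) / 2 = - b" by (simp_all add: field_simps)
    ultimately show ?thesis unfolding h_def using swap[OF orth, of "(a + b) / 2" "(a - b) / 2"] by simp
  qed
  have conv: "h (s * a + t * a') (s * b + t * b') \<le> s * h a b + t * h a' b'" if "0 \<le> s" "0 \<le> t" for s t a a' b b'
  proof -
    have "(s * a + t * a') *\<^sub>R e + (s * b + t * b') *\<^sub>R f = s *\<^sub>R (a *\<^sub>R e + b *\<^sub>R f) + t *\<^sub>R (a' *\<^sub>R e + b' *\<^sub>R f)"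
      by (simp add: algebra_simps)
    then show ?thesis
      unfolding h_def using triangle[of "s *\<^sub>R (a *\<^sub>R e + b *\<^sub>R f)" "t *\<^sub>R (a' *\<^sub>R e + b' *\<^sub>R f)"] that by (simp add: scale)
  qed
  have h0: "h 0 b = \<bar>b\<bar>" "h b 0 = \<bar>b\<bar>" for b by (simp_all add: h_def scale e f)
  \<comment> \<open>Convexity at the midpoint of \<open>(a, b)\<close> and \<open>(- a, b)\<close>,
    where \<open>h\<close> takes equal values.\<close>
  have le: "\<bar>b\<bar> \<le> h a b" for a b
    using conv[of "1 / 2" "1 / 2" a "- a" b b] neg[of b a] sym[of "- a" b] sym[of a b] h0(1)[of b] by (simp add: field_simps)
  define m where "m = p (e - f)"
  have hm: "h 1 1 = m" using orth by (simp add: h_def m_def)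
  have m1: "m \<ge> 1" using le[of 1 1] hm by simp
  \<comment> \<open>The vector \<open>c *\<^sub>R (e + f)\<close> has norm 1 and can be exchanged
    with \<open>e\<close>.\<close>
  define c where "c = 1 / m"
  have c: "0 < c" "c \<le> 1" "c * m = 1" using m1 by (auto simp: c_def)
  define d where "d = m - c"
  have d0: "0 \<le> d" using m1 c by (simp add: d_def)
  have hc: "h c c = 1"
  proof -
    have "c *\<^sub>R e + c *\<^sub>R f = c *\<^sub>R (e + f)" by (simp add: scaleR_add_right)
    then have "h c c = \<bar>c\<bar> * p (e + f)" by (simp only: h_def scale)
    then show ?thesis using c orth by (simp add: m_def[symmetric])
  qed
  \<comment> \<open>The coefficients -1 and \<open>m\<close> are chosen so that one side of the
    exchange is \<open>f\<close>; the other has coefficients \<open>d\<close> and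
    \<open>- c\<close>.\<close>
  have hd: "h d c = 1"
  proof -
    have "p e = p (c *\<^sub>R e + c *\<^sub>R f)" using hc e by (simp add: h_def)
    from swap[OF this, of "-1" m]
    have sw: "p ((-1) *\<^sub>R e + m *\<^sub>R (c *\<^sub>R e + c *\<^sub>R f)) = p (m *\<^sub>R e + (-1) *\<^sub>R (c *\<^sub>R e + c *\<^sub>R f))" .
    have A: "(-1) *\<^sub>R e + m *\<^sub>R (c *\<^sub>R e + c *\<^sub>R f) = f"
    proof -
      have "m *\<^sub>R (c *\<^sub>R e + c *\<^sub>R f) = (c * m) *\<^sub>R (e + f)" by (simp add: scaleR_add_right mult.commute)
      then show ?thesis using c by simp
    qed
    have B: "m *\<^sub>R e + (-1) *\<^sub>R (c *\<^sub>R e + c *\<^sub>R f) = d *\<^sub>R e + (- c) *\<^sub>R f" by (simp add: d_def algebra_simps)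
    have "h d (- c) = 1" unfolding h_def B[symmetric] sw[symmetric] A by (rule f)
    then show ?thesis by (simp add: neg)
  qed
  \<comment> \<open>Both \<open>h c c\<close> and \<open>h d c\<close> are 1, while
    \<open>h 0 c = c\<close>. If \<open>c\<close> and \<open>d\<close> differ, convexity along the
    line of second coordinate \<open>c\<close> forces \<open>c = 1\<close>.\<close>
  consider "d = c" | "c < d" | "d < c" by linarith
  then show ?thesis
  proof cases
    case 1
    then have "m = 2 * c" by (simp add: d_def)
    then have "m * m = 2 * (c * m)" by (metis mult.assoc mult.commute)
    then show ?thesis using c(3) unfolding m_def power2_eq_square by simp
  next
    case 2
    have "1 \<le> (c / d) * h d c + (1 - c / d) * h 0 c"
      using conv[of "c / d" "1 - c / d" d 0 c c] hc 2 c by (simp add: algebra_simps)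
    then have "1 - c / d \<le> (1 - c / d) * c" using hd h0 c by (simp add: algebra_simps)
    moreover have "1 - c / d > 0" using 2 c by simp
    ultimately have "1 \<le> c" by simp
    then have "c = 1" using c by simp
    then show ?thesis using 2 c by (simp add: d_def)
  next
    case 3
    have "1 \<le> (d / c) * h c c + (1 - d / c) * h 0 c"
      using conv[of "d / c" "1 - d / c" c 0 c c] hd 3 c d0 by (simp add: algebra_simps)
    then have "1 - d / c \<le> (1 - d / c) * c" using hc h0 c by (simp add: algebra_simps)
    moreover have "1 - d / c > 0" using 3 c by simp
    ultimately have "1 \<le> c" by simp
    then have "m = 1" using c by simp
    \<comment> \<open>The case \<open>m = 1\<close>, as for the maximum norm, is excluded by
      exchanging \<open>e\<close> with the vector \<open>e + f / 2\<close> of norm 1: the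
      coefficients 3 and -2 give \<open>e - f\<close>, of norm 1, and \<open>e + 3 / 2 f\<close>, of
      norm at least 3/2.\<close>
    have "h 1 (1 / 2) \<le> 1" using conv[of "1 / 2" "1 / 2" 1 1 0 1] h0 hm \<open>m = 1\<close> by simp
    moreover have "h 1 (1 / 2) \<ge> 1" using le[of 1 "1 / 2"] sym[of 1 "1 / 2"] le[of "1 / 2" 1] by simp
    ultimately have "p e = p (e + (1 / 2) *\<^sub>R f)" using e by (simp add: h_def)
    from swap[OF this, of 3 "-2"]
    have "p (3 *\<^sub>R e + (-2) *\<^sub>R (e + (1 / 2) *\<^sub>R f)) = p ((-2) *\<^sub>R e + 3 *\<^sub>R (e + (1 / 2) *\<^sub>R f))" .
    moreover have "3 *\<^sub>R e + (-2) *\<^sub>R (e + (1 / 2) *\<^sub>R f) = 1 *\<^sub>R e + (- 1) *\<^sub>R f"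
    proof -
      have "3 *\<^sub>R e + (-2) *\<^sub>R (e + (1 / 2) *\<^sub>R f) = (3 + (-2)) *\<^sub>R e + ((-2) * (1 / 2)) *\<^sub>R f"
        by (simp only: scaleR_add_left scaleR_add_right scaleR_scaleR add.assoc)
      then show ?thesis by simp
    qed
    moreover have "(-2) *\<^sub>R e + 3 *\<^sub>R (e + (1 / 2) *\<^sub>R f) = 1 *\<^sub>R e + (3 / 2) *\<^sub>R f"
    proof -
      have "(-2) *\<^sub>R e + 3 *\<^sub>R (e + (1 / 2) *\<^sub>R f) = (-2 + 3) *\<^sub>R e + (3 * (1 / 2)) *\<^sub>R f"
        by (simp only: scaleR_add_left scaleR_add_right scaleR_scaleR add.assoc)
      then show ?thesis by simp
    qed
    ultimately have "h 1 (- 1) = h 1 (3 / 2)" by (simp only: h_def)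
    then show ?thesis using le[of "3 / 2" 1] neg[of 1 1] hm \<open>m = 1\<close> by simp
  qed
qed

context
  fixes K :: "complex set" and E :: "('f, 'p) language" and N :: "('x, 'f, 'p) banach_data" and V :: "'x set"
  assumes N: "banach_space K N" and V: "indiscernible_subspace K E N {} V"
begin

interpretation banach_space K N by (rule N)

lemma V_submodule: "submodule V (scalars \<real>) N"
  using V by (simp add: indiscernible_subspace_def real_subspace_def)

lemma V_carrier: "V \<subseteq> carrier N"
  using module.submoduleE(1)[OF banach_space.axioms(1)[OF banach_space_real] V_submodule] .

text \<open>The pairs \<open>[y, z]\<close> and \<open>[z, y]\<close> are congruent, so the norm
  predicate with coefficients \<open>\<alpha>\<close> and \<open>\<beta>\<close> has the same value
  at both. This is Ficken's exchange condition.\<close>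

lemma indiscernible_swap:
  assumes y: "y \<in> V" "nrm N y \<le> 1" and z: "z \<in> V" "nrm N z \<le> 1" and yz: "nrm N y = nrm N z"
  shows "nrm N (complex_of_real \<alpha> \<odot>\<^bsub>N\<^esub> y \<oplus>\<^bsub>N\<^esub> complex_of_real \<beta> \<odot>\<^bsub>N\<^esub> z) =
    nrm N (complex_of_real \<alpha> \<odot>\<^bsub>N\<^esub> z \<oplus>\<^bsub>N\<^esub> complex_of_real \<beta> \<odot>\<^bsub>N\<^esub> y)"
proof -
  have c: "y \<in> carrier N" "z \<in> carrier N" using y z V_carrier by auto
  define \<phi> :: "('f bfun, 'p bpred) fm" where "\<phi> = FPred (NormP [complex_of_real \<alpha>, complex_of_real \<beta>]) [Var 0, Var 1]"
  have wf: "wf_fm (banach_language K E) \<phi>" "free_vars \<phi> \<subseteq> {..<2}" by (auto simp: \<phi>_def banach_language_def)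
  have val: "eval_fm (metric_structure N) (nth [a, b]) \<phi> = nrm N (complex_of_real \<alpha> \<odot>\<^bsub>N\<^esub> a \<oplus>\<^bsub>N\<^esub> complex_of_real \<beta> \<odot>\<^bsub>N\<^esub> b)"
    if "a \<in> carrier N" "b \<in> carrier N" for a b
  proof -
    have "{..<length [complex_of_real \<alpha>, complex_of_real \<beta>]} = {0, 1}" by auto
    then have "lin_comb N [complex_of_real \<alpha>, complex_of_real \<beta>] [a, b] = complex_of_real \<alpha> \<odot>\<^bsub>N\<^esub> a \<oplus>\<^bsub>N\<^esub> complex_of_real \<beta> \<odot>\<^bsub>N\<^esub> b"
      unfolding lin_comb_def using that by simp
    then show ?thesis by (simp add: \<phi>_def)
  qed
  have ns: "(\<forall>i\<le>2. P i) \<longleftrightarrow> P 0 \<and> P 1 \<and> P 2" for P :: "nat \<Rightarrow> bool"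
    by (auto simp: le_Suc_eq numeral_2_eq_2)
  have "congruent_tuples N [y, z] [z, y]"
    unfolding congruent_tuples_def Let_def
  proof (intro conjI)
    have l: "length [y, z] = 2" by simp
    show "\<forall>i\<le>length [y, z]. \<forall>j\<le>length [y, z]. nrm N (([y, z] @ [\<zero>\<^bsub>N\<^esub>]) ! i \<ominus>\<^bsub>N\<^esub> ([y, z] @ [\<zero>\<^bsub>N\<^esub>]) ! j) =
        nrm N (([z, y] @ [\<zero>\<^bsub>N\<^esub>]) ! i \<ominus>\<^bsub>N\<^esub> ([z, y] @ [\<zero>\<^bsub>N\<^esub>]) ! j)"
      unfolding l ns using c yz nrm_diff_commute[of y z] nrm_diff_commute[of "\<zero>\<^bsub>N\<^esub>" y] nrm_diff_commute[of "\<zero>\<^bsub>N\<^esub>" z]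
      by (simp add: numeral_2_eq_2)
  qed simp
  moreover have "[y, z] \<in> tuples 2 (V \<inter> unit_ball N)" "[z, y] \<in> tuples 2 (V \<inter> unit_ball N)"
    using y z c by (auto simp: tuples_def unit_ball_def)
  ultimately have "same_type (banach_language K E) (metric_structure N) {} [y, z] [z, y]"
    using V unfolding indiscernible_subspace_def by blast
  then have s: "\<forall>as\<in>lists {}. \<forall>\<phi>. wf_fm (banach_language K E) \<phi> \<longrightarrow> free_vars \<phi> \<subseteq> {..<length [y, z] + length as} \<longrightarrow>
      eval_fm (metric_structure N) (nth ([y, z] @ as)) \<phi> = eval_fm (metric_structure N) (nth ([z, y] @ as)) \<phi>"
    unfolding same_type_def by (rule conjunct2)
  have "eval_fm (metric_structure N) (nth ([y, z] @ [])) \<phi> = eval_fm (metric_structure N) (nth ([z, y] @ [])) \<phi>"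
    by (rule s[rule_format]) (use wf in auto)
  then show ?thesis using val c by simp
qed

text \<open>Ficken's argument applies to the seminorm that the pair induces on \<open>fseq\<close>
  through \<open>lin x\<close>, because the image of \<open>lin x\<close> lies in
  \<open>V\<close>.\<close>

lemma orthonormal_distance:
  assumes e: "e \<in> V" "nrm N e = 1" and f: "f \<in> V" "nrm N f = 1" and ip: "real_ip N e f = 0"
  shows "nrm N (e \<ominus>\<^bsub>N\<^esub> f) = sqrt 2"
proof -
  have ec: "e \<in> carrier N" and fc: "f \<in> carrier N" using e f V_carrier by auto
  define x where "x i = (if i = 0 then e else f)" for i :: nat
  have xV: "x i \<in> V" for i using e f by (simp add: x_def)
  then have xc: "x i \<in> carrier N" for i using V_carrier by auto
  note lins = lin_closed[of x, OF xc] lin_add[of x, OF xc] lin_diff[of x, OF xc] lin_scale[of x, OF xc] lin_unit[of x, OF xc]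
  interpret S: seminorm "\<lambda>a. nrm N (lin x a)" by (rule lin_seminorm[of x, OF xc])
  have linV: "lin x a \<in> V" for a
  proof (rule lin_mem_submodule[of x, OF xc V_submodule, of UNIV])
    have "a = (\<Sum>i | coord a i \<noteq> 0. coord a i *\<^sub>R unit_seq i)" by (rule fseq_expansion) auto
    also have "\<dots> \<in> span (range unit_seq)" by (intro span_sum span_scale span_base) auto
    finally show "a \<in> span (range unit_seq)" .
  qed (rule xV)
  have "(nrm N (lin x (unit_seq 0 - unit_seq 1)))\<^sup>2 = 2"
  proof (rule S.ficken_pair)
    fix u w :: fseq and \<alpha> \<beta> :: real
    assume uw: "nrm N (lin x u) = nrm N (lin x w)"
    show "nrm N (lin x (\<alpha> *\<^sub>R u + \<beta> *\<^sub>R w)) = nrm N (lin x (\<beta> *\<^sub>R u + \<alpha> *\<^sub>R w))"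
    proof (cases "nrm N (lin x u) = 0")
      case True
      have "nrm N (lin x (a *\<^sub>R u + b *\<^sub>R w)) = 0" for a b
        using S.triangle[of "a *\<^sub>R u" "b *\<^sub>R w"] S.p_nonneg[of "a *\<^sub>R u + b *\<^sub>R w"] True uw by (simp only: S.scale)
      then show ?thesis by simp
    next
      case False
      \<comment> \<open>Types concern tuples from the unit ball, so both vectors are scaled to norm
        1 before the exchange, and the factor is cancelled afterwards.\<close>
      define s where "s = 1 / nrm N (lin x u)"
      have s: "\<bar>s\<bar> * nrm N (lin x u) = 1" using False S.p_nonneg[of u] by (simp add: s_def)
      then have n: "nrm N (lin x (s *\<^sub>R u)) = 1" "nrm N (lin x (s *\<^sub>R w)) = 1" by (simp_all only: S.scale uw)
      have k: "complex_of_real a \<odot>\<^bsub>N\<^esub> lin x (s *\<^sub>R u') \<oplus>\<^bsub>N\<^esub> complex_of_real b \<odot>\<^bsub>N\<^esub> lin x (s *\<^sub>R w') = lin x (s *\<^sub>R (a *\<^sub>R u' + b *\<^sub>R w'))" for a b u' w'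
        by (simp only: lins(2)[symmetric] lins(4)[symmetric] scaleR_add_right scaleR_scaleR mult.commute)
      have "nrm N (lin x (s *\<^sub>R (\<alpha> *\<^sub>R u + \<beta> *\<^sub>R w))) = nrm N (lin x (s *\<^sub>R (\<alpha> *\<^sub>R w + \<beta> *\<^sub>R u)))"
        unfolding k[symmetric] by (rule indiscernible_swap) (use n linV in auto)
      then have "\<bar>s\<bar> * nrm N (lin x (\<alpha> *\<^sub>R u + \<beta> *\<^sub>R w)) = \<bar>s\<bar> * nrm N (lin x (\<beta> *\<^sub>R u + \<alpha> *\<^sub>R w))"
        by (simp only: S.scale add.commute)
      moreover have "\<bar>s\<bar> \<noteq> 0" using s by auto
      ultimately show ?thesis by simp
    qed
  next
    show "nrm N (lin x (unit_seq 0)) = 1" "nrm N (lin x (unit_seq 1)) = 1" using e f by (simp_all add: lins(5) x_def)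
    have "(nrm N (e \<oplus>\<^bsub>N\<^esub> f))\<^sup>2 = (nrm N (e \<ominus>\<^bsub>N\<^esub> f))\<^sup>2" using ip by (simp add: real_ip_def)
    then have "nrm N (e \<oplus>\<^bsub>N\<^esub> f) = nrm N (e \<ominus>\<^bsub>N\<^esub> f)"
      by (rule power2_eq_imp_eq) (simp_all add: nrm_nonneg ec fc)
    then show "nrm N (lin x (unit_seq 0 + unit_seq 1)) = nrm N (lin x (unit_seq 0 - unit_seq 1))"
      by (simp add: lins(2,3,5) x_def)
  qed
  then have "(nrm N (e \<ominus>\<^bsub>N\<^esub> f))\<^sup>2 = 2" by (simp add: lins(3,5) x_def)
  moreover have "nrm N (e \<ominus>\<^bsub>N\<^esub> f) \<ge> 0" by (simp add: nrm_nonneg ec fc)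
  ultimately show ?thesis by (metis real_sqrt_unique)
qed

text \<open>The span of a finite basis would be closed, hence equal to \<open>V\<close>, against the
  infinite dimension. Indiscernibility comes from the common distance \<open>sqrt 2\<close> between
  basis vectors.\<close>

lemma orthonormal_basis_indiscernible:
  assumes inf: "infinite_dimensional \<real> N V" and B: "orthonormal_basis N V B"
  shows "infinite B \<and> indiscernible_set (banach_language K E) (metric_structure N) B"
proof
  have BV: "B \<subseteq> V" and one: "\<And>e. e \<in> B \<Longrightarrow> nrm N e = 1" and orth: "\<And>e f. e \<in> B \<Longrightarrow> f \<in> B \<Longrightarrow> e \<noteq> f \<Longrightarrow> real_ip N e f = 0"
    and cl: "norm_topology N closure_of lin_span \<real> N B = V"
    using B by (auto simp: orthonormal_basis_def)
  have Bc: "B \<subseteq> carrier N" using BV V_carrier by auto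
  show "infinite B"
  proof
    assume fin: "finite B"
    have "V \<subseteq> lin_span \<real> N B"
    proof
      fix y assume y: "y \<in> V"
      then have yc: "y \<in> carrier N" using V_carrier by auto
      show "y \<in> lin_span \<real> N B"
      proof (rule finite_lin_span_closed[OF fin Bc yc])
        fix \<epsilon> :: real assume "\<epsilon> > 0"
        then obtain w where w: "w \<in> lin_span \<real> N B" "w \<in> met.mball y \<epsilon>"
          using y unfolding cl[symmetric] norm_topology_def met.metric_closure_of by blast
        then have "nrm N (y \<ominus>\<^bsub>N\<^esub> w) < \<epsilon>" by (metis met.in_mball ndist_eq)
        then show "\<exists>w\<in>lin_span \<real> N B. nrm N (y \<ominus>\<^bsub>N\<^esub> w) < \<epsilon>" using w by blast
      qed
    qed
    then show False using inf fin BV unfolding infinite_dimensional_def by blast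
  qed
  show "indiscernible_set (banach_language K E) (metric_structure N) B"
  proof (rule indiscernible_equidistant[OF N V BV one])
    show "nrm N (e \<ominus>\<^bsub>N\<^esub> f) = sqrt 2" if "e \<in> B" "f \<in> B" "e \<noteq> f" for e f
      using that BV one orth by (intro orthonormal_distance) auto
  qed
qed

end

text \<open>The statement on orthonormal bases concerns all models over an arbitrary type
  \<open>'c\<close>. The set in the last conjunct is the image of the unit sequences in the
  ultrapower, which is equidistant, so its existence does not rest on that of an orthonormal
  basis.\<close>

theorem corollary2p4:
  fixes K :: "complex set"
    and E :: "('f, 'p) language"
    and T :: "('f bfun, 'p bpred) fm set"
    and X\<^sub>0 :: "('b, 'f, 'p) banach_data"
    and M :: "('a, 'f, 'p) banach_data"
  assumes banach_theory: "banach_structure K E X\<^sub>0" "T = theory_of K E X\<^sub>0"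
    and infinite_dimensional_model: "is_model K E T M" "infinite_dimensional K M (carrier M)"
  shows
    "(\<exists>(N :: (('a, 'f, 'p) large, 'f, 'p) banach_data) V.
        is_model K E T N \<and>
        indiscernible_subspace K E N {} V \<and> infinite_dimensional \<real> N V) \<and>
     (\<forall>(N :: ('c, 'f, 'p) banach_data) V B.
        is_model K E T N \<longrightarrow>
        indiscernible_subspace K E N {} V \<longrightarrow> infinite_dimensional \<real> N V \<longrightarrow>
        orthonormal_basis N V B \<longrightarrow>
        infinite B \<and> indiscernible_set (banach_language K E) (metric_structure N) B) \<and>
     (\<exists>(N :: (('a, 'f, 'p) large, 'f, 'p) banach_data) I.
        is_model K E T N \<and>
        infinite I \<and> indiscernible_set (banach_language K E) (metric_structure N) I)"
proof -
  have T: "T \<subseteq> {\<phi>. sentence (banach_language K E) \<phi>}"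
    by (auto simp: banach_theory(2) theory_of_def complete_theory_def)
  obtain N :: "(('a, 'f, 'p) large, 'f, 'p) banach_data" and V I where N: "is_model K E T N"
    "indiscernible_subspace K E N {} V" "infinite_dimensional \<real> N V"
    "infinite I" "indiscernible_set (banach_language K E) (metric_structure N) I"
    using indiscernible_subspace_exists[OF infinite_dimensional_model T] by (elim exE conjE) (rule that)
  show ?thesis
  proof (intro conjI allI impI)
    fix N :: "('c, 'f, 'p) banach_data" and V B
    assume a: "is_model K E T N" "indiscernible_subspace K E N {} V" "infinite_dimensional \<real> N V" "orthonormal_basis N V B"
    have "banach_space K N" using a(1) by (simp add: is_model_def banach_structure_def)
    from orthonormal_basis_indiscernible[OF this a(2-4)]
    show "infinite B" "indiscernible_set (banach_language K E) (metric_structure N) B" by blast+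
  qed (use N in blast)+
qed

end
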